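(* Let $M$ be a complete hyperbolic complex manifold with Kobayashi distance $k_M$, and assume that $k_M\in C^1(M\times M\setminus \mathrm{Diag})$, where $\mathrm{Diag}=\{(z,z): z\in M\}$. Let $d\in[1,+\infty]$ and let $G(z,t)$ be a Herglotz vector field of order $d$ on $M$. Then there exists a unique evolution family $(\varphi_{s,t})_{0\le s\le t<+\infty}$ of order $d$ on $M$ such that for all $s\ge 0$ and all $z\in M$ $$\frac{\partial \varphi_{s,t}(z)}{\partial t}=G(\varphi_{s,t}(z),t)\quad \text{for a.e. } t\in[s,+\infty).$$
   Context: Complex manifolds are connected, Hausdorff and second countable. $TM$ is the complex tangent bundle of $M$, $\|\cdot\|$ is a fixed Hermitian metric along the fibers of $TM$, and $d_M(\cdot,\cdot)$ is the distance on $M$ induced by $\|\cdot\|$. $k_M$ denotes the Kobayashi (pseudo-)distance of $M$; $M$ is complete hyperbolic if $k_M$ is a complete distance. A weak holomorphic vector field of order $d\in[1,+\infty]$ on $M$ is a map $G:M\times[0,+\infty)\to TM$ with $G(z,t)\in T_zM$ such that: (1) for all $z\in M$, $t\mapsto G(z,t)$ is measurable; (2) for all $t\ge 0$, $z\mapsto G(z,t)$ is holomorphic; (3) for every compact set $K\subset M$ and every $T>0$ there is a function $C_{K,T}\in L^d([0,T],\mathbb{R}^+)$ with $\|G(z,t)\|\le C_{K,T}(t)$ for all $z\in K$ and almost every $t\in[0,T]$. Assuming $k_M\in C^1(M\times M\setminus\mathrm{Diag})$, a Herglotz vector field of order $d$ on $M$ is a weak holomorphic vector field $G$ of order $d$ such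 that $(dk_M)_{(z,w)}(G(z,t),G(w,t))\le 0$ for almost every $t\in[0,+\infty)$ and all $z,w\in M$ with $z\ne w$. An evolution family of order $d\in[1,+\infty]$ on $M$ is a family $(\varphi_{s,t})_{0\le s\le t<+\infty}$ of maps such that: (1) $\varphi_{s,s}=\mathrm{id}_M$ for all $s\ge0$; (2) $\varphi_{s,t}=\varphi_{u,t}\circ\varphi_{s,u}$ for all $0\le s\le u\le t<+\infty$; (3) $\varphi_{s,t}:M\to M$ is holomorphic for all $0\le s\le t<+\infty$; (4) for every $T>0$ and every compact set $K\subset M$ there is a function $c_{T,K}\in L^d([0,T],\mathbb{R}^+)$ such that $\sup_{z\in K}d_M(\varphi_{s,t}(z),\varphi_{s,t'}(z))\le \int_{t'}^{t}c_{T,K}(\xi)\,d\xi$ for all $0\le s\le t'\le t\le T$. *)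

theory Defs
  imports "HOL-Analysis.Analysis"
begin

section \<open>Holomorphic and \<open>C\<^sup>k\<close> maps between open subsets of vector spaces\<close>

text \<open>Real (Frechet) differentiability with a complex-linear derivative; \<open>*s\<close> is the
  scalar multiplication of \<open>complex ^ 'n\<close>.\<close>

definition cholomorphic_on :: "(complex ^ 'n \<Rightarrow> complex ^ 'k) \<Rightarrow> (complex ^ 'n) set \<Rightarrow> bool"
  where "cholomorphic_on f U \<longleftrightarrow>
    (\<forall>x\<in>U. \<exists>f'. (f has_derivative f') (at x) \<and> (\<forall>a v. f' (a *s v) = a *s f' v))"

text \<open>Real differentiability of class \<open>C\<^sup>k\<close> on an open set, by recursion on the directional
  derivatives.\<close>

primrec Ck_on :: "nat \<Rightarrow> ('a::euclidean_space \<Rightarrow> 'b::real_normed_vector) \<Rightarrow> 'a set \<Rightarrow> bool"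
  where
    "Ck_on 0 f U \<longleftrightarrow> continuous_on U f"
  | "Ck_on (Suc k) f U \<longleftrightarrow> (\<forall>x\<in>U. f differentiable (at x)) \<and>
       (\<forall>v. Ck_on k (\<lambda>x. frechet_derivative f (at x) v) U)"

definition Cinf_on :: "('a::euclidean_space \<Rightarrow> 'b::real_normed_vector) \<Rightarrow> 'a set \<Rightarrow> bool"
  where "Cinf_on f U \<longleftrightarrow> (\<forall>k. Ck_on k f U)"


section \<open>Complex manifolds\<close>

text \<open>A manifold is a whole type \<open>'m\<close> (Hausdorff and second countable by its type class) with a
  holomorphic atlas, which need not be maximal. A chart is a pair (domain, coordinate map).\<close>

type_synonym ('m, 'n) chart = "'m set \<times> ('m \<Rightarrow> complex ^ 'n)"

abbreviation chart_dom :: "('m, 'n) chart \<Rightarrow> 'm set"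
  where "chart_dom c \<equiv> fst c"

abbreviation chart_map :: "('m, 'n) chart \<Rightarrow> 'm \<Rightarrow> complex ^ 'n"
  where "chart_map c \<equiv> snd c"

definition chart_inv :: "('m, 'n) chart \<Rightarrow> complex ^ 'n \<Rightarrow> 'm"
  where "chart_inv c = inv_into (chart_dom c) (chart_map c)"

definition complex_manifold ::
    "('m::{t2_space, second_countable_topology}, 'n::finite) chart set \<Rightarrow> bool"
  where "complex_manifold A \<longleftrightarrow>
    connected (UNIV :: 'm set) \<and>
    (\<Union>c\<in>A. chart_dom c) = UNIV \<and>
    (\<forall>c\<in>A. open (chart_dom c) \<and> open (chart_map c ` chart_dom c) \<and>
       homeomorphism (chart_dom c) (chart_map c ` chart_dom c) (chart_map c) (chart_inv c)) \<and>
    (\<forall>c\<in>A. \<forall>c'\<in>A. cholomorphic_on (chart_map c' \<circ> chart_inv c)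
       (chart_map c ` (chart_dom c \<inter> chart_dom c')))"

definition holomorphic_self_map ::
    "('m::topological_space, 'n::finite) chart set \<Rightarrow> ('m \<Rightarrow> 'm) \<Rightarrow> bool"
  where "holomorphic_self_map A f \<longleftrightarrow>
    continuous_on UNIV f \<and>
    (\<forall>c\<in>A. \<forall>c'\<in>A. cholomorphic_on (chart_map c' \<circ> f \<circ> chart_inv c)
       (chart_map c ` (chart_dom c \<inter> f -` chart_dom c')))"

definition holomorphic_disc ::
    "('m::topological_space, 'n::finite) chart set \<Rightarrow> (complex \<Rightarrow> 'm) \<Rightarrow> bool"
  where "holomorphic_disc A f \<longleftrightarrow>
    continuous_on (ball 0 1) f \<and>
    (\<forall>c\<in>A. \<forall>i. (\<lambda>\<zeta>. chart_map c (f \<zeta>) $ i) holomorphic_on (ball 0 1 \<inter> f -` chart_dom c))"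


section \<open>The Kobayashi pseudodistance\<close>

definition poincare_dist :: "complex \<Rightarrow> complex \<Rightarrow> real"
  where "poincare_dist a b = artanh (cmod ((a - b) / (1 - cnj a * b)))"

text \<open>\<open>disc_chain A z L w\<close>: the analytic discs \<open>f\<close> with marked points \<open>a, b\<close> listed in \<open>L\<close> form a
  chain from \<open>z\<close> to \<open>w\<close>, each leading from \<open>f a\<close> to \<open>f b\<close>.\<close>

fun disc_chain :: "('m::topological_space, 'n::finite) chart set \<Rightarrow> 'm \<Rightarrow>
    ((complex \<Rightarrow> 'm) \<times> complex \<times> complex) list \<Rightarrow> 'm \<Rightarrow> bool"
  where
    "disc_chain A z [] w \<longleftrightarrow> z = w"
  | "disc_chain A z ((f, a, b) # L) w \<longleftrightarrow>
       holomorphic_disc A f \<and> a \<in> ball 0 1 \<and> b \<in> ball 0 1 \<and> f a = z \<and> disc_chain A (f b) L w"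

definition kobayashi :: "('m::topological_space, 'n::finite) chart set \<Rightarrow> 'm \<Rightarrow> 'm \<Rightarrow> real"
  where "kobayashi A z w =
    (INF L\<in>{L. disc_chain A z L w}. \<Sum>(f, a, b)\<leftarrow>L. poincare_dist a b)"

definition complete_hyperbolic :: "('m::topological_space, 'n::finite) chart set \<Rightarrow> bool"
  where "complete_hyperbolic A \<longleftrightarrow>
    Metric_space UNIV (kobayashi A) \<and> Metric_space.mcomplete UNIV (kobayashi A)"

definition C1_off_Diag ::
    "('m::topological_space, 'n::finite) chart set \<Rightarrow> ('m \<Rightarrow> 'm \<Rightarrow> real) \<Rightarrow> bool"
  where "C1_off_Diag A F \<longleftrightarrow>
    (\<forall>c\<in>A. \<forall>c'\<in>A. Ck_on 1 (\<lambda>(x, y). F (chart_inv c x) (chart_inv c' y))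
       {(x, y). x \<in> chart_map c ` chart_dom c \<and> y \<in> chart_map c' ` chart_dom c' \<and>
          chart_inv c x \<noteq> chart_inv c' y})"


section \<open>The complex tangent bundle\<close>

text \<open>A tangent vector at \<open>p\<close> is the family of its coordinate vectors in all charts around \<open>p\<close>,
  related by the Jacobians of the coordinate changes (and \<open>0\<close> at all other arguments, so that the
  representation is unique). Via real parts it is identified with a real tangent vector as usual:
  the coordinate vector in \<open>complex ^ 'n\<close> is read as an element of the underlying real vector
  space.\<close>

type_synonym ('m, 'n) tvec = "('m, 'n) chart \<Rightarrow> complex ^ 'n"

text \<open>The tangent vector at \<open>p\<close> with coordinate vector \<open>a\<close> in the chart \<open>c\<close>.\<close>

definition coord_vec ::
    "('m, 'n::finite) chart set \<Rightarrow> ('m, 'n) chart \<Rightarrow> 'm \<Rightarrow> complex ^ 'n \<Rightarrow> ('m, 'n) tvec"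
  where "coord_vec A c p a = (\<lambda>c'.
    if c' \<in> A \<and> p \<in> chart_dom c'
    then frechet_derivative (chart_map c' \<circ> chart_inv c) (at (chart_map c p)) a else 0)"

definition tangent_space :: "('m, 'n::finite) chart set \<Rightarrow> 'm \<Rightarrow> ('m, 'n) tvec set"
  where "tangent_space A p = {v. \<forall>c\<in>A. p \<in> chart_dom c \<longrightarrow> v = coord_vec A c p (v c)}"

text \<open>The differential at \<open>(z, w)\<close> of a function on \<open>M \<times> M\<close>. By the chain rule it does not depend
  on the chosen charts wherever \<open>F\<close> is differentiable.\<close>

definition chart_at :: "('m, 'n) chart set \<Rightarrow> 'm \<Rightarrow> ('m, 'n) chart"
  where "chart_at A p = (SOME c. c \<in> A \<and> p \<in> chart_dom c)"

definition differential2 :: "('m, 'n::finite) chart set \<Rightarrow> ('m \<Rightarrow> 'm \<Rightarrow> real) \<Rightarrow> 'm \<Rightarrow> 'm \<Rightarrow>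
    ('m, 'n) tvec \<Rightarrow> ('m, 'n) tvec \<Rightarrow> real"
  where "differential2 A F z w u v =
    (let c = chart_at A z; c' = chart_at A w in
       frechet_derivative (\<lambda>(x, y). F (chart_inv c x) (chart_inv c' y))
         (at (chart_map c z, chart_map c' w)) (u c, v c'))"

text \<open>The continuity requirement excludes accidental derivatives caused by values of \<open>chart_map c\<close>
  outside \<open>chart_dom c\<close>.\<close>

definition has_velocity :: "('m::topological_space, 'n::finite) chart set \<Rightarrow> (real \<Rightarrow> 'm) \<Rightarrow>
    ('m, 'n) tvec \<Rightarrow> real \<Rightarrow> real set \<Rightarrow> bool"
  where "has_velocity A \<gamma> v t S \<longleftrightarrow>
    continuous (at t within S) \<gamma> \<and>
    (\<forall>c\<in>A. \<gamma> t \<in> chart_dom c \<longrightarrow>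
       ((\<lambda>\<tau>. chart_map c (\<gamma> \<tau>)) has_vector_derivative v c) (at t within S))"

definition velocity ::
    "('m, 'n::finite) chart set \<Rightarrow> (real \<Rightarrow> 'm) \<Rightarrow> real \<Rightarrow> ('m, 'n) tvec"
  where "velocity A \<gamma> t = (\<lambda>c.
    if c \<in> A \<and> \<gamma> t \<in> chart_dom c then vector_derivative (\<lambda>\<tau>. chart_map c (\<gamma> \<tau>)) (at t) else 0)"


section \<open>Hermitian metrics and the induced distance\<close>

text \<open>\<open>h p\<close> only matters on \<open>tangent_space A p\<close>, whose vector space operations are pointwise.\<close>

definition hermitian_metric :: "('m, 'n::finite) chart set \<Rightarrow>
    ('m \<Rightarrow> ('m, 'n) tvec \<Rightarrow> ('m, 'n) tvec \<Rightarrow> complex) \<Rightarrow> bool"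
  where "hermitian_metric A h \<longleftrightarrow>
    (\<forall>p. \<forall>u\<in>tangent_space A p. \<forall>v\<in>tangent_space A p. \<forall>w\<in>tangent_space A p.
       h p (\<lambda>c. u c + v c) w = h p u w + h p v w) \<and>
    (\<forall>p a. \<forall>u\<in>tangent_space A p. \<forall>v\<in>tangent_space A p. h p (\<lambda>c. a *s u c) v = a * h p u v) \<and>
    (\<forall>p. \<forall>u\<in>tangent_space A p. \<forall>v\<in>tangent_space A p. h p v u = cnj (h p u v)) \<and>
    (\<forall>p. \<forall>u\<in>tangent_space A p. u \<noteq> (\<lambda>c. 0) \<longrightarrow> 0 < Re (h p u u)) \<and>
    (\<forall>c\<in>A. \<forall>a b. Cinf_on
       (\<lambda>x. h (chart_inv c x) (coord_vec A c (chart_inv c x) a) (coord_vec A c (chart_inv c x) b))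
       (chart_map c ` chart_dom c))"

definition hnorm ::
    "('m \<Rightarrow> ('m, 'n::finite) tvec \<Rightarrow> ('m, 'n) tvec \<Rightarrow> complex) \<Rightarrow> 'm \<Rightarrow> ('m, 'n) tvec \<Rightarrow> real"
  where "hnorm h p v = sqrt (Re (h p v v))"

definition piecewise_C1_curve ::
    "('m::topological_space, 'n::finite) chart set \<Rightarrow> (real \<Rightarrow> 'm) \<Rightarrow> bool"
  where "piecewise_C1_curve A \<gamma> \<longleftrightarrow>
    continuous_on {0..1} \<gamma> \<and>
    (\<forall>c\<in>A. \<forall>a b. 0 \<le> a \<and> a < b \<and> b \<le> 1 \<and> \<gamma> ` {a..b} \<subseteq> chart_dom c \<longrightarrow>
       (\<lambda>t. chart_map c (\<gamma> t)) piecewise_C1_differentiable_on {a..b})"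

text \<open>Lengths are in \<open>ennreal\<close>: the library's piecewise \<open>C\<^sup>1\<close> functions may have derivatives that
  are not integrable near a break point, and such curves then have length \<open>\<infinity>\<close>.\<close>

definition curve_length :: "('m, 'n::finite) chart set \<Rightarrow>
    ('m \<Rightarrow> ('m, 'n) tvec \<Rightarrow> ('m, 'n) tvec \<Rightarrow> complex) \<Rightarrow> (real \<Rightarrow> 'm) \<Rightarrow> ennreal"
  where "curve_length A h \<gamma> =
    (\<integral>\<^sup>+t\<in>{0..1}. ennreal (hnorm h (\<gamma> t) (velocity A \<gamma> t)) \<partial>lborel)"

definition metric_dist :: "('m::topological_space, 'n::finite) chart set \<Rightarrow>
    ('m \<Rightarrow> ('m, 'n) tvec \<Rightarrow> ('m, 'n) tvec \<Rightarrow> complex) \<Rightarrow> 'm \<Rightarrow> 'm \<Rightarrow> real"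
  where "metric_dist A h z w =
    enn2real (INF \<gamma>\<in>{\<gamma>. piecewise_C1_curve A \<gamma> \<and> \<gamma> 0 = z \<and> \<gamma> 1 = w}. curve_length A h \<gamma>)"


section \<open>Herglotz vector fields and evolution families\<close>

text \<open>\<open>Lp_nonneg d T\<close> is \<open>L\<^sup>d([0,T], \<real>\<^sup>+)\<close>.\<close>

definition Lp_nonneg :: "ennreal \<Rightarrow> real \<Rightarrow> (real \<Rightarrow> real) set"
  where "Lp_nonneg d T = {f.
    f \<in> borel_measurable (lebesgue_on {0..T}) \<and> (\<forall>t\<in>{0..T}. 0 \<le> f t) \<and>
    (if d = \<infinity> then \<exists>B. AE t in lebesgue_on {0..T}. f t \<le> B
     else integrable (lebesgue_on {0..T}) (\<lambda>t. f t powr enn2real d))}"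

definition weak_holomorphic_vector_field ::
    "('m::topological_space, 'n::finite) chart set \<Rightarrow>
     ('m \<Rightarrow> ('m, 'n) tvec \<Rightarrow> ('m, 'n) tvec \<Rightarrow> complex) \<Rightarrow> ennreal \<Rightarrow>
     ('m \<Rightarrow> real \<Rightarrow> ('m, 'n) tvec) \<Rightarrow> bool"
  where "weak_holomorphic_vector_field A h d G \<longleftrightarrow>
    (\<forall>z. \<forall>t\<ge>0. G z t \<in> tangent_space A z) \<and>
    (\<forall>z. \<forall>c\<in>A. z \<in> chart_dom c \<longrightarrow> (\<lambda>t. G z t c) \<in> borel_measurable (lebesgue_on {0..})) \<and>
    (\<forall>t\<ge>0. \<forall>c\<in>A. cholomorphic_on (\<lambda>x. G (chart_inv c x) t c) (chart_map c ` chart_dom c)) \<and>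
    (\<forall>K T. compact K \<and> 0 < T \<longrightarrow>
       (\<exists>C\<in>Lp_nonneg d T. \<forall>z\<in>K. AE t in lebesgue_on {0..T}. hnorm h z (G z t) \<le> C t))"

definition herglotz_vector_field ::
    "('m::topological_space, 'n::finite) chart set \<Rightarrow>
     ('m \<Rightarrow> ('m, 'n) tvec \<Rightarrow> ('m, 'n) tvec \<Rightarrow> complex) \<Rightarrow> ennreal \<Rightarrow>
     ('m \<Rightarrow> real \<Rightarrow> ('m, 'n) tvec) \<Rightarrow> bool"
  where "herglotz_vector_field A h d G \<longleftrightarrow>
    weak_holomorphic_vector_field A h d G \<and>
    (AE t in lebesgue_on {0..}. \<forall>z w. z \<noteq> w \<longrightarrow>
       differential2 A (kobayashi A) z w (G z t) (G w t) \<le> 0)"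

text \<open>Only the values \<open>\<phi> s t\<close> with \<open>0 \<le> s \<le> t\<close> belong to the family. The supremum is taken in
  \<open>ereal\<close> so that it is meaningful for every compact \<open>K\<close>, including the empty set.\<close>

definition evolution_family ::
    "('m::topological_space, 'n::finite) chart set \<Rightarrow>
     ('m \<Rightarrow> ('m, 'n) tvec \<Rightarrow> ('m, 'n) tvec \<Rightarrow> complex) \<Rightarrow> ennreal \<Rightarrow>
     (real \<Rightarrow> real \<Rightarrow> 'm \<Rightarrow> 'm) \<Rightarrow> bool"
  where "evolution_family A h d \<phi> \<longleftrightarrow>
    (\<forall>s\<ge>0. \<phi> s s = id) \<and>
    (\<forall>s u t. 0 \<le> s \<and> s \<le> u \<and> u \<le> t \<longrightarrow> \<phi> s t = \<phi> u t \<circ> \<phi> s u) \<and>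
    (\<forall>s t. 0 \<le> s \<and> s \<le> t \<longrightarrow> holomorphic_self_map A (\<phi> s t)) \<and>
    (\<forall>T K. 0 < T \<and> compact K \<longrightarrow>
       (\<exists>C\<in>Lp_nonneg d T. \<forall>s t' t. 0 \<le> s \<and> s \<le> t' \<and> t' \<le> t \<and> t \<le> T \<longrightarrow>
          (SUP z\<in>K. ereal (metric_dist A h (\<phi> s t z) (\<phi> s t' z)))
            \<le> ereal (LINT \<xi>:{t'..t}|lebesgue. C \<xi>)))"

definition solves_loewner_ODE ::
    "('m::topological_space, 'n::finite) chart set \<Rightarrow> ('m \<Rightarrow> real \<Rightarrow> ('m, 'n) tvec) \<Rightarrow>
     (real \<Rightarrow> real \<Rightarrow> 'm \<Rightarrow> 'm) \<Rightarrow> bool"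
  where "solves_loewner_ODE A G \<phi> \<longleftrightarrow>
    (\<forall>s\<ge>0. \<forall>z. AE t in lebesgue_on {s..}.
       has_velocity A (\<lambda>\<tau>. \<phi> s \<tau> z) (G (\<phi> s t z) t) t {s..})"

end

theory Submission
  imports Defs "HOL-Complex_Analysis.Complex_Analysis"
begin

text \<open>In a chart the equation is a Caratheodory differential equation with a holomorphic right-hand
  side; Picard iteration gives local solutions that depend holomorphically on the initial point. The
  Herglotz condition makes the Kobayashi distance of two solutions nonincreasing. Hence, for fixed times
  \<open>u \<le> v\<close>, the set of initial points whose solution exists on all of \<open>[u, v]\<close> is open, and it is also
  closed: a solution near one that exists on \<open>[u, v]\<close> is a Cauchy curve for the Kobayashi distance, so
  completeness lets it be continued. As \<open>M\<close> is connected and local solutions exist, every solution is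
  global, and no compactness of Kobayashi balls is needed. Conversely, a bound of the Hermitian distance as
  in an evolution family makes a curve absolutely continuous in charts, so that an almost everywhere
  solution solves the integral equation and is unique.\<close>

section \<open>Holomorphic maps of several variables\<close>

text \<open>Absolute continuity is never defined. A solution is a continuous curve that satisfies
  the integral equation in each chart over each time interval spent there, and such identities and
  estimates add up over adjacent intervals; global statements about a curve are therefore obtained
  by bisection in time from statements on short intervals. The Kobayashi distance is
  \<open>C1\<close> only off the diagonal, which is enough because two solutions that differ once
  differ always. Contraction and completeness speak of \<open>kobayashi A\<close> alone, so it must
  be shown to induce the topology of the manifold. The order \<open>d\<close> enters through
  compactness: by contraction the flow is jointly continuous, so trajectories that start in a
  compact set and run within \<open>[0, T]\<close> stay in a compact set, on which the field has a
  bound in \<open>L^d\<close>. For uniqueness, a derivative given almost everywhere does not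
  determine a curve, as the Cantor function shows; the distance bound in the definition of an
  evolution family is what rules this out.\<close>

lemma norm_vector_smult: "norm (a *s v) = norm a * norm (v :: complex ^ 'n)"
  by (simp add: norm_vec_def norm_mult L2_set_right_distrib)

lemma vector_smult_of_real: "of_real r *s (v :: complex ^ 'n) = r *\<^sub>R v"
  by (simp add: vec_eq_iff scaleR_conv_of_real[where 'a = complex])

lemma bounded_linear_vector_smult_left: "bounded_linear (\<lambda>a. a *s (v :: complex ^ 'n))"
  by (rule bounded_linear_intro[where K = "norm v"])
     (auto simp: vec_eq_iff algebra_simps scaleR_conv_of_real[where 'a = complex] norm_vector_smult)

text \<open>Derivatives at a point are unique, so the existential in \<open>cholomorphic_on\<close>
  is witnessed by the canonical \<open>frechet_derivative\<close>; all later estimates are about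
  this term.\<close>

lemma cholomorphic_on_frechet:
  assumes "cholomorphic_on f U" "x \<in> U"
  shows "(f has_derivative frechet_derivative f (at x)) (at x)"
    and "frechet_derivative f (at x) (a *s v) = a *s frechet_derivative f (at x) v"
proof -
  obtain f' where f': "(f has_derivative f') (at x)" "\<And>a v. f' (a *s v) = a *s f' v"
    using assms unfolding cholomorphic_on_def by blast
  then have "f' = frechet_derivative f (at x)"
    by (simp add: frechet_derivative_at)
  then show "(f has_derivative frechet_derivative f (at x)) (at x)"
    and "frechet_derivative f (at x) (a *s v) = a *s frechet_derivative f (at x) v"
    using f' by auto
qed

lemma cholomorphic_on_subset: "cholomorphic_on f U \<Longrightarrow> V \<subseteq> U \<Longrightarrow> cholomorphic_on f V"
  unfolding cholomorphic_on_def by blast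

lemma cholomorphic_on_imp_continuous_on:
  assumes "cholomorphic_on f U"
  shows "continuous_on U f"
  using cholomorphic_on_frechet(1)[OF assms]
  by (intro continuous_at_imp_continuous_on) (auto intro: has_derivative_continuous)

lemma cholomorphic_on_const: "cholomorphic_on (\<lambda>x. c) U"
  unfolding cholomorphic_on_def by (auto intro!: exI[of _ "\<lambda>x. 0"])

lemma cholomorphic_on_diff:
  assumes "cholomorphic_on f U" "cholomorphic_on g U"
  shows "cholomorphic_on (\<lambda>x. f x - g x) U"
  unfolding cholomorphic_on_def
proof
  fix x assume "x \<in> U"
  then obtain f' g' where "(f has_derivative f') (at x)" "\<And>a v. f' (a *s v) = a *s f' v"
    "(g has_derivative g') (at x)" "\<And>a v. g' (a *s v) = a *s g' v"
    using assms unfolding cholomorphic_on_def by meson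
  then show "\<exists>h'. ((\<lambda>x. f x - g x) has_derivative h') (at x) \<and> (\<forall>a v. h' (a *s v) = a *s h' v)"
    by (intro exI[of _ "\<lambda>v. f' v - g' v"]) (auto intro!: derivative_eq_intros simp: vector_ssub_ldistrib)
qed

lemma cholomorphic_on_add:
  assumes "cholomorphic_on f U" "cholomorphic_on g U"
  shows "cholomorphic_on (\<lambda>x. f x + g x) U"
  unfolding cholomorphic_on_def
proof
  fix x assume "x \<in> U"
  then obtain f' g' where "(f has_derivative f') (at x)" "\<And>a v. f' (a *s v) = a *s f' v"
    "(g has_derivative g') (at x)" "\<And>a v. g' (a *s v) = a *s g' v"
    using assms unfolding cholomorphic_on_def by meson
  then show "\<exists>h'. ((\<lambda>x. f x + g x) has_derivative h') (at x) \<and> (\<forall>a v. h' (a *s v) = a *s h' v)"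
    by (intro exI[of _ "\<lambda>v. f' v + g' v"]) (auto intro!: derivative_eq_intros simp: vector_add_ldistrib)
qed

lemma cholomorphic_on_ident: "cholomorphic_on (\<lambda>x. x) U"
  unfolding cholomorphic_on_def by (auto intro!: exI[of _ "\<lambda>x. x"] derivative_eq_intros)

lemma cholomorphic_on_compose:
  assumes "cholomorphic_on f U" "cholomorphic_on g V" "f ` U \<subseteq> V"
  shows "cholomorphic_on (\<lambda>x. g (f x)) U"
  unfolding cholomorphic_on_def
proof
  fix x assume x: "x \<in> U"
  obtain f' where f': "(f has_derivative f') (at x)" "\<And>a v. f' (a *s v) = a *s f' v"
    using assms(1) x unfolding cholomorphic_on_def by meson
  obtain g' where g': "(g has_derivative g') (at (f x))" "\<And>a v. g' (a *s v) = a *s g' v"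
    using assms(2,3) x unfolding cholomorphic_on_def by blast
  show "\<exists>h'. ((\<lambda>x. g (f x)) has_derivative h') (at x) \<and> (\<forall>a v. h' (a *s v) = a *s h' v)"
    using f' g' by (intro exI[of _ "\<lambda>v. g' (f' v)"]) (auto intro: has_derivative_compose)
qed

section \<open>Cauchy estimates on complex lines\<close>

text \<open>Restriction to the complex line through \<open>x\<close> in direction \<open>v\<close>.
  Complex linearity turns the derivative into multiplication by one number per coordinate, so the
  theory of one variable applies.\<close>

lemma cholomorphic_on_slice:
  assumes "cholomorphic_on f U" "x + a *s v \<in> U"
  shows "((\<lambda>a. f (x + a *s v) $ i) has_field_derivative frechet_derivative f (at (x + a *s v)) v $ i) (at a)"
proof -
  note D = cholomorphic_on_frechet[OF assms]
  have 1: "((\<lambda>a. x + a *s v) has_derivative (\<lambda>a. a *s v)) (at a)"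
    using bounded_linear_imp_has_derivative[OF bounded_linear_vector_smult_left[of v]]
    by (auto intro!: derivative_eq_intros)
  have "((\<lambda>a. f (x + a *s v)) has_derivative (\<lambda>b. frechet_derivative f (at (x + a *s v)) (b *s v))) (at a)"
    using has_derivative_compose[OF 1 D(1)] .
  then have "((\<lambda>a. f (x + a *s v) $ i) has_derivative (\<lambda>b. frechet_derivative f (at (x + a *s v)) (b *s v) $ i)) (at a)"
    by (rule bounded_linear.has_derivative[OF bounded_linear_vec_nth])
  then show ?thesis
    unfolding has_field_derivative_def by (simp add: D(2) mult.commute[of _ "frechet_derivative f (at (x + a *s v)) v $ i"])
qed

text \<open>Cauchy's inequality in one variable on the line through \<open>x\<close> in direction
  \<open>v\<close>, one coordinate at a time. The factor \<open>CARD('k)\<close> comes from bounding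
  the Euclidean norm by the sum over the coordinates, the factor 2 from the halved radius.\<close>

lemma cholomorphic_on_Cauchy_bound:
  fixes f :: "complex ^ 'n \<Rightarrow> complex ^ 'k"
  assumes r: "r > 0" and hol: "cholomorphic_on f (ball x r)"
    and B: "\<And>y. y \<in> ball x r \<Longrightarrow> norm (f y) \<le> B"
  shows "norm (frechet_derivative f (at x) v) \<le> 2 * real CARD('k) * B / r * norm v"
proof (cases "v = 0")
  case True
  have "bounded_linear (frechet_derivative f (at x))"
    using cholomorphic_on_frechet(1)[OF hol] r has_derivative_bounded_linear by force
  then show ?thesis using True by (simp add: linear_simps)
next
  case False
  \<comment> \<open>At this radius the closed disc in the line reaches distance \<open>r/2\<close>
    from \<open>x\<close>, hence stays inside the open ball.\<close>
  define \<rho> where "\<rho> = r / (2 * norm v)"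
  have \<rho>: "\<rho> > 0" using r False by (simp add: \<rho>_def)
  have in_ball: "x + a *s v \<in> ball x r" if "norm a \<le> \<rho>" for a
  proof -
    have "norm a * norm v \<le> \<rho> * norm v" using that by (simp add: mult_right_mono)
    also have "\<dots> < r" using r False by (simp add: \<rho>_def)
    finally show ?thesis by (simp add: dist_norm norm_vector_smult)
  qed
  have comp: "norm (frechet_derivative f (at x) v $ i) \<le> 2 * B / r * norm v" for i
  proof -
    let ?g = "\<lambda>a. f (x + a *s v) $ i"
    have d: "(?g has_field_derivative frechet_derivative f (at (x + a *s v)) v $ i) (at a)"
      if "norm a \<le> \<rho>" for a
      using cholomorphic_on_slice[OF hol in_ball[OF that]] .
    have "norm ((deriv ^^ 1) ?g 0) \<le> fact 1 * B / \<rho> ^ 1"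
    proof (rule Cauchy_inequality)
      show "?g holomorphic_on ball 0 \<rho>"
        by (rule holomorphic_onI, rule field_differentiable_at_within)
           (use d in \<open>force simp: field_differentiable_def\<close>)
      show "continuous_on (cball 0 \<rho>) ?g"
        by (rule continuous_at_imp_continuous_on) (use d DERIV_isCont in \<open>force\<close>)
      show "norm (?g a) \<le> B" if "norm (0 - a) = \<rho>" for a
        using B[OF in_ball, of a] that by (simp add: order_trans[OF Finite_Cartesian_Product.norm_nth_le])
    qed (use \<rho> in auto)
    moreover have "deriv ?g 0 = frechet_derivative f (at x) v $ i"
      using DERIV_imp_deriv[OF d[of 0]] \<rho> by simp
    ultimately show ?thesis
      using False by (simp add: \<rho>_def field_simps)
  qed
  have "norm (frechet_derivative f (at x) v) \<le> (\<Sum>i\<in>UNIV. norm (frechet_derivative f (at x) v $ i))"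
    unfolding norm_vec_def by (rule L2_set_le_sum) auto
  also have "\<dots> \<le> (\<Sum>i\<in>(UNIV :: 'k set). 2 * B / r * norm v)"
    by (intro sum_mono comp)
  finally show ?thesis by (simp add: algebra_simps)
qed

lemma onorm_cholomorphic_le:
  fixes f :: "complex ^ 'n \<Rightarrow> complex ^ 'k"
  assumes r: "r > 0" and hol: "cholomorphic_on f (ball x r)"
    and B: "\<And>y. y \<in> ball x r \<Longrightarrow> norm (f y) \<le> B"
  shows "onorm (frechet_derivative f (at x)) \<le> 2 * real CARD('k) * B / r"
  by (rule onorm_le) (use cholomorphic_on_Cauchy_bound[OF assms] in auto)

text \<open>Every point of the half ball is the centre of a ball of radius \<open>r/2\<close> inside
  the large one, so the Cauchy bound for the derivative is uniform there, and the mean value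
  inequality applies by convexity.\<close>

lemma cholomorphic_on_lipschitz:
  fixes f :: "complex ^ 'n \<Rightarrow> complex ^ 'k"
  assumes r: "r > 0" and hol: "cholomorphic_on f (ball x r)"
    and B: "\<And>y. y \<in> ball x r \<Longrightarrow> norm (f y) \<le> B"
    and yz: "y \<in> ball x (r/2)" "z \<in> ball x (r/2)"
  shows "norm (f y - f z) \<le> 4 * real CARD('k) * B / r * norm (y - z)"
proof (rule differentiable_bound[OF convex_ball[of x "r/2"] _ _ yz])
  fix w assume w: "w \<in> ball x (r/2)"
  have sub: "ball w (r/2) \<subseteq> ball x r"
  proof
    fix z assume "z \<in> ball w (r/2)"
    then show "z \<in> ball x r" using w dist_triangle[of x z w] by (simp add: dist_commute)
  qed
  show "(f has_derivative frechet_derivative f (at w)) (at w within ball x (r/2))"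
    using cholomorphic_on_frechet(1)[OF hol, of w] w r by (auto intro: has_derivative_at_withinI)
  have "onorm (frechet_derivative f (at w)) \<le> 2 * real CARD('k) * B / (r/2)"
    using sub r by (intro onorm_cholomorphic_le cholomorphic_on_subset[OF hol]) (auto intro: B)
  then show "onorm (frechet_derivative f (at w)) \<le> 4 * real CARD('k) * B / r"
    by (simp add: field_simps)
qed

text \<open>Second derivatives are avoided: as a function of \<open>z\<close>, the increment
  \<open>f (z + (y - x)) - f z\<close> is holomorphic, is small by the Lipschitz bound, and has at
  \<open>x\<close> the derivative to be estimated. Cauchy's inequality on the ball of radius
  \<open>r/4\<close> gives the factor 2 * 4 * 4 = 32.\<close>

lemma cholomorphic_on_deriv_lipschitz:
  fixes f :: "complex ^ 'n \<Rightarrow> complex ^ 'k"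
  assumes r: "r > 0" and hol: "cholomorphic_on f (ball x r)"
    and B: "\<And>y. y \<in> ball x r \<Longrightarrow> norm (f y) \<le> B"
    and y: "y \<in> ball x (r/4)"
  shows "norm (frechet_derivative f (at y) v - frechet_derivative f (at x) v)
    \<le> 32 * (real CARD('k))\<^sup>2 * B / r\<^sup>2 * norm (y - x) * norm v"
proof -
  let ?g = "\<lambda>z. f (z + (y - x)) - f z"
  let ?L = "4 * real CARD('k) * B / r * norm (y - x)"
  have shift: "z + (y - x) \<in> ball x (r/2)" "z \<in> ball x (r/2)" if "z \<in> ball x (r/4)" for z
  proof -
    have "norm ((x - z) + (x - y)) \<le> norm (x - z) + norm (x - y)" by (rule norm_triangle_ineq)
    then show "z + (y - x) \<in> ball x (r/2)" using that y by (simp add: dist_norm algebra_simps)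
    show "z \<in> ball x (r/2)" using that r by auto
  qed
  have half: "ball x (r/2) \<subseteq> ball x r" using r by auto
  have "cholomorphic_on (\<lambda>z. z + (y - x)) (ball x (r/4))"
    by (intro cholomorphic_on_add cholomorphic_on_ident cholomorphic_on_const)
  then have 1: "cholomorphic_on (\<lambda>z. f (z + (y - x))) (ball x (r/4))"
    by (rule cholomorphic_on_compose[OF _ hol]) (use shift half in blast)
  have "cholomorphic_on ?g (ball x (r/4))"
    by (intro cholomorphic_on_diff 1 cholomorphic_on_subset[OF hol]) (use shift half in blast)
  moreover have "norm (?g z) \<le> ?L" if "z \<in> ball x (r/4)" for z
    using cholomorphic_on_lipschitz[OF r hol B shift[OF that]] by simp
  ultimately have "norm (frechet_derivative ?g (at x) v) \<le> 2 * real CARD('k) * ?L / (r/4) * norm v"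
    using r by (intro cholomorphic_on_Cauchy_bound) auto
  moreover have "frechet_derivative ?g (at x) = (\<lambda>v. frechet_derivative f (at y) v - frechet_derivative f (at x) v)"
  proof (rule frechet_derivative_at[symmetric])
    have "((\<lambda>z. z + (y - x)) has_derivative (\<lambda>v. v)) (at x)" by (auto intro!: derivative_eq_intros)
    moreover have "(f has_derivative frechet_derivative f (at y)) (at (x + (y - x)))"
      using cholomorphic_on_frechet(1)[OF hol, of y] y r by auto
    ultimately have "((\<lambda>z. f (z + (y - x))) has_derivative frechet_derivative f (at y)) (at x)"
      by (rule has_derivative_compose)
    moreover have "(f has_derivative frechet_derivative f (at x)) (at x)"
      using cholomorphic_on_frechet(1)[OF hol, of x] r by auto
    ultimately show "(?g has_derivative (\<lambda>v. frechet_derivative f (at y) v - frechet_derivative f (at x) v)) (at x)"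
      by (rule has_derivative_diff)
  qed
  ultimately show ?thesis using r by (simp add: field_simps power2_eq_square)
qed

text \<open>A Lipschitz derivative leaves a quadratic remainder. The bound is proportional to
  \<open>B\<close>, which permits integration in time when \<open>B\<close> is the value of an
  integrable majorant.\<close>

lemma cholomorphic_on_taylor:
  fixes f :: "complex ^ 'n \<Rightarrow> complex ^ 'k"
  assumes r: "r > 0" and hol: "cholomorphic_on f (ball x r)"
    and B: "\<And>y. y \<in> ball x r \<Longrightarrow> norm (f y) \<le> B"
    and v: "norm v < r/4"
  shows "norm (f (x + v) - f x - frechet_derivative f (at x) v)
    \<le> 32 * (real CARD('k))\<^sup>2 * B / r\<^sup>2 * (norm v)\<^sup>2"
proof -
  let ?L = "32 * (real CARD('k))\<^sup>2 * B / r\<^sup>2 * norm v"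
  have "norm (f x) \<le> B" using B r by simp
  then have B0: "0 \<le> B" by (rule order_trans[OF norm_ge_zero])
  have S: "cball x (norm v) \<subseteq> ball x (r/4)" "ball x (r/4) \<subseteq> ball x r" using v r by auto
  have "norm (f (x + v) - f x - frechet_derivative f (at x) ((x + v) - x)) \<le> norm ((x + v) - x) * ?L"
  proof (rule differentiable_bound_linearization[where S = "cball x (norm v)"])
    show "x + t *\<^sub>R (x + v - x) \<in> cball x (norm v)" if "t \<in> {0..1}" for t
      using that by (simp add: dist_norm mult_left_le_one_le)
    show "(f has_derivative frechet_derivative f (at z)) (at z within cball x (norm v))"
      if "z \<in> cball x (norm v)" for z
      by (rule has_derivative_at_withinI, rule cholomorphic_on_frechet(1)[OF hol]) (use that S in blast)
    show "onorm (frechet_derivative f (at z) - frechet_derivative f (at x)) \<le> ?L"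
      if z: "z \<in> cball x (norm v)" for z
      unfolding fun_diff_def
    proof (rule onorm_le)
      fix w
      have "norm (frechet_derivative f (at z) w - frechet_derivative f (at x) w)
        \<le> 32 * (real CARD('k))\<^sup>2 * B / r\<^sup>2 * norm (z - x) * norm w"
        by (rule cholomorphic_on_deriv_lipschitz[OF r hol B]) (use z S in blast)+
      also have "\<dots> \<le> ?L * norm w"
        using z B0 by (intro mult_right_mono mult_left_mono) (auto simp: dist_norm norm_minus_commute)
      finally show "norm (frechet_derivative f (at z) w - frechet_derivative f (at x) w) \<le> ?L * norm w" .
    qed
  qed auto
  then show ?thesis by (simp add: power2_eq_square algebra_simps)
qed

text \<open>Continuity of \<open>f\<close> makes it bounded on a small ball, and there the Lipschitz
  bound for the derivative applies. Transition maps thus satisfy the hypothesis of the chain rule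
  for integral curves.\<close>

lemma cholomorphic_on_deriv_continuous:
  fixes f :: "complex ^ 'n \<Rightarrow> complex ^ 'k"
  assumes U: "open U" and hol: "cholomorphic_on f U"
  shows "continuous_on U (\<lambda>x. frechet_derivative f (at x) v)"
proof (rule continuous_at_imp_continuous_on, rule ballI)
  fix x assume x: "x \<in> U"
  obtain r0 where r0: "r0 > 0" "ball x r0 \<subseteq> U" using U x open_contains_ball by blast
  have "continuous (at x) f"
    using cholomorphic_on_frechet(1)[OF hol x] has_derivative_continuous by blast
  then obtain r1 where r1: "r1 > 0" "\<And>y. dist y x < r1 \<Longrightarrow> dist (f y) (f x) < 1"
    unfolding continuous_at_eps_delta using zero_less_one by blast
  define r where "r = min r0 r1"
  have r: "r > 0" using r0 r1 by (simp add: r_def)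
  have sub: "ball x r \<subseteq> U" using r0 by (auto simp: r_def)
  have B: "norm (f y) \<le> norm (f x) + 1" if "y \<in> ball x r" for y
  proof -
    have "dist (f y) (f x) < 1" using that r1(2)[of y] by (simp add: r_def dist_commute)
    then show ?thesis using norm_triangle_ineq2[of "f y" "f x"] by (simp add: dist_norm)
  qed
  define L where "L = 32 * (real CARD('k))\<^sup>2 * (norm (f x) + 1) / r\<^sup>2 * norm v"
  have L: "norm (frechet_derivative f (at y) v - frechet_derivative f (at x) v) \<le> L * norm (y - x)"
    if "y \<in> ball x (r/4)" for y
    using cholomorphic_on_deriv_lipschitz[OF r cholomorphic_on_subset[OF hol sub] B that, of v]
    by (simp add: L_def mult_ac)
  have "((\<lambda>y. frechet_derivative f (at y) v - frechet_derivative f (at x) v) \<longlongrightarrow> 0) (at x)"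
  proof (rule Lim_null_comparison)
    show "\<forall>\<^sub>F y in at x. norm (frechet_derivative f (at y) v - frechet_derivative f (at x) v) \<le> L * norm (y - x)"
      unfolding eventually_at using L r by (intro exI[of _ "r/4"]) (auto simp: dist_commute)
    show "((\<lambda>y. L * norm (y - x)) \<longlongrightarrow> 0) (at x)"
      by (rule tendsto_eq_intros refl | simp)+
  qed
  then show "isCont (\<lambda>x. frechet_derivative f (at x) v) x"
    unfolding continuous_at by (rule Lim_null[THEN iffD2])
qed

section \<open>Limits and integrals of holomorphic maps\<close>

text \<open>Weierstrass' theorem: Cauchy's inequality for \<open>F n - F m\<close> on balls around
  the points of a half ball makes the derivatives uniformly Cauchy, so limit and derivative may be
  interchanged. Complex linearity passes to the limit pointwise.\<close>

lemma cholomorphic_on_uniform_limit: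
  fixes F :: "nat \<Rightarrow> complex ^ 'n \<Rightarrow> complex ^ 'k"
  assumes U: "open U" and hol: "\<And>n. cholomorphic_on (F n) U" and lim: "uniform_limit U F f sequentially"
  shows "cholomorphic_on f U"
  unfolding cholomorphic_on_def
proof
  fix x assume x: "x \<in> U"
  obtain r where r: "r > 0" "ball x r \<subseteq> U" using U x open_contains_ball by blast
  let ?S = "ball x (r/2)"
  let ?D = "\<lambda>n z. frechet_derivative (F n) (at z)"
  \<comment> \<open>Cauchy's inequality with the bound \<open>2 * e\<close> and the radius
    \<open>r/2\<close> gives the factor 2 * 2 * 2 = 8.\<close>
  define K where "K = 8 * real CARD('k) / r"
  have K: "K > 0" using r by (simp add: K_def)
  have cauchy: "norm (?D n z v - ?D m z v) \<le> K * e * norm v"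
    if e: "e > 0" and nm: "\<And>y. y \<in> U \<Longrightarrow> dist (F n y) (f y) < e" "\<And>y. y \<in> U \<Longrightarrow> dist (F m y) (f y) < e"
      and z: "z \<in> ?S" for e n m z v
  proof -
    have sub: "ball z (r/2) \<subseteq> U"
    proof
      fix w assume "w \<in> ball z (r/2)"
      then have "dist x w < r" using z dist_triangle[of x w z] by (simp add: dist_commute)
      then show "w \<in> U" using r by auto
    qed
    have zU: "z \<in> U" using sub r by auto
    have "norm (frechet_derivative (\<lambda>y. F n y - F m y) (at z) v) \<le> 2 * real CARD('k) * (2 * e) / (r/2) * norm v"
    proof (rule cholomorphic_on_Cauchy_bound)
      show "cholomorphic_on (\<lambda>y. F n y - F m y) (ball z (r/2))"
        by (intro cholomorphic_on_diff cholomorphic_on_subset[OF hol sub])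
      show "norm (F n y - F m y) \<le> 2 * e" if "y \<in> ball z (r/2)" for y
        using nm[of y] that sub dist_triangle2[of "F n y" "F m y" "f y"] by (auto simp: dist_norm)
    qed (use r in auto)
    moreover have "frechet_derivative (\<lambda>y. F n y - F m y) (at z) = (\<lambda>v. ?D n z v - ?D m z v)"
      by (rule frechet_derivative_at[symmetric] has_derivative_diff cholomorphic_on_frechet(1)[OF hol zU])+
    ultimately show ?thesis by (simp add: K_def algebra_simps)
  qed
  have ev: "\<forall>\<^sub>F n in sequentially. \<forall>y\<in>U. dist (F n y) (f y) < e" if "e > 0" for e
    using lim that unfolding uniform_limit_iff by blast
  have "\<exists>l. (\<lambda>n. ?D n z v) \<longlonglongrightarrow> l" if z: "z \<in> ?S" for z v
  proof -
    have "Cauchy (\<lambda>n. ?D n z v)"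
    proof (rule metric_CauchyI)
      fix e :: real assume "e > 0"
      define e' where "e' = e / (K * (norm v + 1))"
      have e': "e' > 0" using \<open>e > 0\<close> K by (simp add: e'_def divide_pos_pos add_nonneg_pos)
      obtain N where N: "\<And>n y. n \<ge> N \<Longrightarrow> y \<in> U \<Longrightarrow> dist (F n y) (f y) < e'"
        using ev[OF e'] unfolding eventually_sequentially by blast
      have "dist (?D m z v) (?D n z v) < e" if "m \<ge> N" "n \<ge> N" for m n
      proof -
        have "dist (?D m z v) (?D n z v) \<le> K * e' * norm v"
          unfolding dist_norm by (rule cauchy[OF e' N[OF that(1)] N[OF that(2)] z])
        also have "\<dots> < K * e' * (norm v + 1)" using K e' by (intro mult_strict_left_mono) auto
        also have "\<dots> = e" unfolding e'_def using K norm_ge_zero[of v] by (simp add: field_simps add_nonneg_eq_0_iff)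
        finally show ?thesis .
      qed
      then show "\<exists>M. \<forall>m\<ge>M. \<forall>n\<ge>M. dist (?D m z v) (?D n z v) < e" by blast
    qed
    then show ?thesis using Cauchy_convergent convergent_def by blast
  qed
  then obtain g' where g': "\<And>z v. z \<in> ?S \<Longrightarrow> (\<lambda>n. ?D n z v) \<longlonglongrightarrow> g' z v" by metis
  have 1: "(F n has_derivative ?D n z) (at z within ?S)" if "z \<in> ?S" for n z
  proof -
    have "z \<in> U" using that r by auto
    then show ?thesis by (rule has_derivative_at_withinI[OF cholomorphic_on_frechet(1)[OF hol]])
  qed
  have 2: "\<forall>\<^sub>F n in sequentially. \<forall>z\<in>?S. \<forall>v. norm (?D n z v - g' z v) \<le> e * norm v" if "e > 0" for e
  proof -
    have e': "e / K > 0" using that K by simp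
    obtain N where N: "\<And>n y. n \<ge> N \<Longrightarrow> y \<in> U \<Longrightarrow> dist (F n y) (f y) < e / K"
      using ev[OF e'] unfolding eventually_sequentially by blast
    have "norm (?D n z v - g' z v) \<le> e * norm v" if n: "n \<ge> N" and z: "z \<in> ?S" for n z v
    proof (rule tendsto_upperbound)
      show "(\<lambda>m. norm (?D n z v - ?D m z v)) \<longlonglongrightarrow> norm (?D n z v - g' z v)"
        by (intro tendsto_norm tendsto_diff tendsto_const g'[OF z])
      have "norm (?D n z v - ?D m z v) \<le> e * norm v" if "m \<ge> N" for m
        using cauchy[OF e' N[OF n] N[OF that] z, of v] K by simp
      then show "\<forall>\<^sub>F m in sequentially. norm (?D n z v - ?D m z v) \<le> e * norm v"
        unfolding eventually_sequentially by blast
    qed auto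
    then show ?thesis unfolding eventually_sequentially by blast
  qed
  have xS: "x \<in> ?S" using r by simp
  have 3: "(\<lambda>n. F n x) \<longlonglongrightarrow> f x" using lim x by (rule tendsto_uniform_limitI)
  have "\<exists>g. \<forall>z\<in>?S. (\<lambda>n. F n z) \<longlonglongrightarrow> g z \<and> (g has_derivative g' z) (at z within ?S)"
    by (rule has_derivative_sequence[OF convex_ball 1 2 xS 3])
  then obtain g where g: "\<And>z. z \<in> ?S \<Longrightarrow> (\<lambda>n. F n z) \<longlonglongrightarrow> g z"
     "\<And>z. z \<in> ?S \<Longrightarrow> (g has_derivative g' z) (at z within ?S)" by blast
  have fg: "f z = g z" if "z \<in> ?S" for z
  proof -
    have "z \<in> U" using that r by auto
    then show ?thesis using LIMSEQ_unique[OF g(1)[OF that] tendsto_uniform_limitI[OF lim]] by simp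
  qed
  have "(g has_derivative g' x) (at x)" using g(2)[OF xS] at_within_open[OF xS] by simp
  then have "(f has_derivative g' x) (at x)"
    by (rule has_derivative_transform_within_open[OF _ open_ball xS]) (use fg in auto)
  moreover have "g' x (a *s v) = a *s g' x v" for a v
  proof (rule LIMSEQ_unique[OF g'[OF xS]])
    have "(\<lambda>n. a *s ?D n x v) \<longlonglongrightarrow> a *s g' x v"
      by (rule vec_tendstoI) (auto intro!: tendsto_intros tendsto_vec_nth g'[OF xS])
    then show "(\<lambda>n. ?D n x (a *s v)) \<longlonglongrightarrow> a *s g' x v"
      by (simp add: cholomorphic_on_frechet(2)[OF hol x])
  qed
  ultimately show "\<exists>f'. (f has_derivative f') (at x) \<and> (\<forall>a v. f' (a *s v) = a *s f' v)" by blast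
qed

text \<open>Rounding time down to a grid of mesh \<open>1/(n+1)\<close> makes \<open>X\<close>
  piecewise constant with countably many values, for which measurability follows from that of
  \<open>g\<close> at fixed points. Continuity of \<open>X\<close> and of \<open>g t\<close> gives
  the pointwise limit.\<close>

lemma caratheodory_measurable:
  fixes g :: "real \<Rightarrow> 'a::topological_space \<Rightarrow> 'b::metric_space"
  assumes X: "continuous_on {u..v} X" "X ` {u..v} \<subseteq> S"
    and meas: "\<And>x. x \<in> S \<Longrightarrow> (\<lambda>t. g t x) \<in> borel_measurable (lebesgue_on {u..v})"
    and cont: "\<And>t. t \<in> {u..v} \<Longrightarrow> continuous_on S (g t)"
  shows "(\<lambda>t. g t (X t)) \<in> borel_measurable (lebesgue_on {u..v})"
proof (cases "u \<le> v")
  case False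
  then show ?thesis by (intro borel_measurableI) (auto simp: space_restrict_space)
next
  case uv: True
  \<comment> \<open>Clamping to \<open>[u, v]\<close> keeps the grid points where \<open>X\<close>
    is continuous and has values in \<open>S\<close>.\<close>
  define p where "p n i = max u (min v (of_int i / (real n + 1)))" for n :: nat and i :: int
  have p: "p n i \<in> {u..v}" for n i using uv by (auto simp: p_def)
  define q where "q n t = p n \<lfloor>(real n + 1) * t\<rfloor>" for n :: nat and t :: real
  show ?thesis
  proof (rule borel_measurable_LIMSEQ_metric)
    show "(\<lambda>t. g t (X (q n t))) \<in> borel_measurable (lebesgue_on {u..v})" for n
      unfolding q_def
    proof (rule measurable_compose_countable[where f = "\<lambda>i t. g t (X (p n i))"])
      show "(\<lambda>t. g t (X (p n i))) \<in> borel_measurable (lebesgue_on {u..v})" for i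
        by (rule meas) (use X p in auto)
      have "(\<lambda>t. (real n + 1) * t) \<in> borel_measurable (lebesgue_on {u..v})"
        by (intro continuous_imp_measurable_on_sets_lebesgue continuous_intros) auto
      then show "(\<lambda>t. \<lfloor>(real n + 1) * t\<rfloor>) \<in> lebesgue_on {u..v} \<rightarrow>\<^sub>M count_space UNIV"
        by (rule measurable_compose[OF _ measurable_real_floor])
    qed
    fix t assume "t \<in> space (lebesgue_on {u..v})"
    then have t: "t \<in> {u..v}" by simp
    have "(\<lambda>n. q n t) \<longlonglongrightarrow> max u (min v t)"
      unfolding q_def p_def
    proof (intro tendsto_intros)
      show "(\<lambda>n. of_int \<lfloor>(real n + 1) * t\<rfloor> / (real n + 1)) \<longlonglongrightarrow> t"
      proof (rule LIM_zero_cancel, rule Lim_null_comparison)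
        show "\<forall>\<^sub>F n in sequentially. norm (of_int \<lfloor>(real n + 1) * t\<rfloor> / (real n + 1) - t) \<le> 1 / (real n + 1)"
        proof (rule always_eventually, rule allI)
          fix n
          have "of_int \<lfloor>(real n + 1) * t\<rfloor> / (real n + 1) - t = (of_int \<lfloor>(real n + 1) * t\<rfloor> - (real n + 1) * t) / (real n + 1)"
            by (simp add: field_simps)
          moreover have "\<bar>of_int \<lfloor>(real n + 1) * t\<rfloor> - (real n + 1) * t\<bar> \<le> 1" by linarith
          ultimately show "norm (of_int \<lfloor>(real n + 1) * t\<rfloor> / (real n + 1) - t) \<le> 1 / (real n + 1)"
            by (simp add: abs_divide divide_right_mono)
        qed
        show "(\<lambda>n. 1 / (real n + 1)) \<longlonglongrightarrow> 0"
          using LIMSEQ_inverse_real_of_nat by (simp add: inverse_eq_divide add.commute)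
      qed
    qed
    then have "(\<lambda>n. q n t) \<longlonglongrightarrow> t" using t by simp
    then have "(\<lambda>n. X (q n t)) \<longlonglongrightarrow> X t"
      by (rule continuous_on_tendsto_compose[OF X(1)]) (use t p in \<open>auto simp: q_def intro!: always_eventually\<close>)
    then show "(\<lambda>n. g t (X (q n t))) \<longlonglongrightarrow> g t (X t)"
      by (rule continuous_on_tendsto_compose[OF cont[OF t]]) (use X(2) t p in \<open>auto simp: q_def image_subset_iff intro!: always_eventually\<close>)
  qed
qed

text \<open>Differentiation under the integral: the Taylor remainder at time \<open>\<tau>\<close>
  is at most \<open>C \<tau>\<close> times a fixed multiple of \<open>(norm v)\<^sup>2\<close>, so
  its integral is again quadratic in \<open>v\<close>, and the integral of the derivatives is the
  derivative.\<close>

lemma cholomorphic_on_integral: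
  fixes F :: "real \<Rightarrow> complex ^ 'n \<Rightarrow> complex ^ 'k"
  assumes U: "open U" and hol: "\<And>\<tau>. \<tau> \<in> {u..t} \<Longrightarrow> cholomorphic_on (F \<tau>) U"
    and meas: "\<And>y. y \<in> U \<Longrightarrow> (\<lambda>\<tau>. F \<tau> y) \<in> borel_measurable (lebesgue_on {u..t})"
    and C: "C integrable_on {u..t}" "\<And>\<tau> y. \<tau> \<in> {u..t} \<Longrightarrow> y \<in> U \<Longrightarrow> norm (F \<tau> y) \<le> C \<tau>"
  shows "cholomorphic_on (\<lambda>y. integral {u..t} (\<lambda>\<tau>. F \<tau> y)) U"
  unfolding cholomorphic_on_def
proof
  fix x assume x: "x \<in> U"
  obtain r where r: "r > 0" "ball x r \<subseteq> U" using U x open_contains_ball by blast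
  define D where "D \<tau> = frechet_derivative (F \<tau>) (at x)" for \<tau>
  note hol' = cholomorphic_on_subset[OF hol r(2)]
  have C': "norm (F \<tau> y) \<le> C \<tau>" if "\<tau> \<in> {u..t}" "y \<in> ball x r" for \<tau> y using C r that by auto
  have Db: "norm (D \<tau> v) \<le> C \<tau> * (2 * real CARD('k) / r * norm v)" if "\<tau> \<in> {u..t}" for \<tau> v
    using cholomorphic_on_Cauchy_bound[OF r(1) hol'[OF that] C'[OF that], of v] by (simp add: D_def algebra_simps)
  define L where "L = 32 * (real CARD('k))\<^sup>2 / r\<^sup>2"
  have tay: "norm (F \<tau> (x + v) - F \<tau> x - D \<tau> v) \<le> C \<tau> * (L * (norm v)\<^sup>2)"
    if "\<tau> \<in> {u..t}" "norm v < r/4" for \<tau> v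
    using cholomorphic_on_taylor[OF r(1) hol'[OF that(1)] C'[OF that(1)] that(2)]
    by (simp add: D_def L_def algebra_simps)
  have lin: "linear (D \<tau>)" if "\<tau> \<in> {u..t}" for \<tau>
    using has_derivative_linear[OF cholomorphic_on_frechet(1)[OF hol[OF that] x]] by (simp add: D_def)
  have Fint: "(\<lambda>\<tau>. F \<tau> y) integrable_on {u..t}" if "y \<in> U" for y
    by (rule measurable_bounded_by_integrable_imp_integrable[OF meas[OF that] C(1)]) (use C that in auto)
  have Dint: "(\<lambda>\<tau>. D \<tau> v) integrable_on {u..t}" for v
  proof (rule measurable_bounded_by_integrable_imp_integrable)
    show "(\<lambda>\<tau>. C \<tau> * (2 * real CARD('k) / r * norm v)) integrable_on {u..t}"
      using C(1) by (rule integrable_on_mult_left)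
    \<comment> \<open>Step sizes tending to 0 for which \<open>h n *\<^sub>R v\<close> stays in the
      range of the Taylor estimate; \<open>norm v + 1\<close> covers \<open>v = 0\<close>. The
      derivative becomes measurable in time as a limit of difference quotients.\<close>
    define h where "h n = r / (4 * (norm v + 1)) / (real n + 1)" for n :: nat
    have h: "h n > 0" "norm (h n *\<^sub>R v) < r/4" for n
    proof -
      show "h n > 0" using r by (simp add: h_def add_nonneg_pos)
      have "norm (h n *\<^sub>R v) = (r/4) * (norm v / ((norm v + 1) * (real n + 1)))" using r by (simp add: h_def)
      also have "\<dots> < (r/4) * 1"
      proof (rule mult_strict_left_mono)
        have "norm v < norm v + 1" by simp
        also have "\<dots> \<le> (norm v + 1) * (real n + 1)" by (simp add: algebra_simps)
        finally show "norm v / ((norm v + 1) * (real n + 1)) < 1"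
          using norm_ge_zero[of v] by (simp add: divide_less_eq_1 add_nonneg_pos)
      qed (use r in auto)
      finally show "norm (h n *\<^sub>R v) < r/4" by simp
    qed
    have h0: "h \<longlonglongrightarrow> 0"
      unfolding h_def using tendsto_mult_right_zero[OF LIMSEQ_inverse_real_of_nat, of "r / (4 * (norm v + 1))"]
      by (simp add: divide_inverse add.commute)
    show "(\<lambda>\<tau>. D \<tau> v) \<in> borel_measurable (lebesgue_on {u..t})"
    proof (rule borel_measurable_LIMSEQ_metric[where f = "\<lambda>n \<tau>. (1 / h n) *\<^sub>R (F \<tau> (x + h n *\<^sub>R v) - F \<tau> x)"])
      fix n
      have "x + h n *\<^sub>R v \<in> U" using h(2)[of n] r by (auto simp: dist_norm intro!: subsetD[OF r(2)])
      then show "(\<lambda>\<tau>. (1 / h n) *\<^sub>R (F \<tau> (x + h n *\<^sub>R v) - F \<tau> x)) \<in> borel_measurable (lebesgue_on {u..t})"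
        by (intro borel_measurable_scaleR borel_measurable_diff meas x) auto
    next
      fix \<tau> assume "\<tau> \<in> space (lebesgue_on {u..t})"
      then have \<tau>: "\<tau> \<in> {u..t}" by simp
      show "(\<lambda>n. (1 / h n) *\<^sub>R (F \<tau> (x + h n *\<^sub>R v) - F \<tau> x)) \<longlonglongrightarrow> D \<tau> v"
      proof (rule LIM_zero_cancel, rule Lim_null_comparison)
        show "\<forall>\<^sub>F n in sequentially. norm ((1 / h n) *\<^sub>R (F \<tau> (x + h n *\<^sub>R v) - F \<tau> x) - D \<tau> v) \<le> h n * (C \<tau> * (L * (norm v)\<^sup>2))"
        proof (rule always_eventually, rule allI)
          fix n
          have "(1 / h n) *\<^sub>R (F \<tau> (x + h n *\<^sub>R v) - F \<tau> x) - D \<tau> v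
              = (1 / h n) *\<^sub>R (F \<tau> (x + h n *\<^sub>R v) - F \<tau> x - D \<tau> (h n *\<^sub>R v))"
            using h(1)[of n] by (simp add: linear_cmul[OF lin[OF \<tau>]] scaleR_diff_right)
          then have "norm ((1 / h n) *\<^sub>R (F \<tau> (x + h n *\<^sub>R v) - F \<tau> x) - D \<tau> v)
              = (1 / h n) * norm (F \<tau> (x + h n *\<^sub>R v) - F \<tau> x - D \<tau> (h n *\<^sub>R v))"
            using h(1)[of n] by simp
          also have "\<dots> \<le> (1 / h n) * (C \<tau> * (L * (norm (h n *\<^sub>R v))\<^sup>2))"
            using h(1)[of n] by (intro mult_left_mono tay \<tau> h) auto
          also have "\<dots> = h n * (C \<tau> * (L * (norm v)\<^sup>2))"
            using h(1)[of n] by (simp add: power2_eq_square)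
          finally show "norm ((1 / h n) *\<^sub>R (F \<tau> (x + h n *\<^sub>R v) - F \<tau> x) - D \<tau> v) \<le> h n * (C \<tau> * (L * (norm v)\<^sup>2))" .
        qed
        show "(\<lambda>n. h n * (C \<tau> * (L * (norm v)\<^sup>2))) \<longlonglongrightarrow> 0"
          by (rule tendsto_mult_left_zero[OF h0])
      qed
    qed
  qed (use Db in auto)
  let ?I = "\<lambda>y. integral {u..t} (\<lambda>\<tau>. F \<tau> y)" and ?J = "\<lambda>v. integral {u..t} (\<lambda>\<tau>. D \<tau> v)"
  have "linear ?J"
  proof (rule linearI)
    show "?J (v + w) = ?J v + ?J w" for v w
    proof -
      have "?J (v + w) = integral {u..t} (\<lambda>\<tau>. D \<tau> v + D \<tau> w)"
        by (intro integral_cong) (simp add: linear_add[OF lin])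
      then show ?thesis by (simp add: integral_add Dint)
    qed
    show "?J (a *\<^sub>R v) = a *\<^sub>R ?J v" for a v
    proof -
      have "?J (a *\<^sub>R v) = integral {u..t} (\<lambda>\<tau>. a *\<^sub>R D \<tau> v)"
        by (intro integral_cong) (simp add: linear_cmul[OF lin])
      then show ?thesis by simp
    qed
  qed
  then have blJ: "bounded_linear ?J" by (rule linear_conv_bounded_linear[THEN iffD1])
  have est: "norm (?I (x + v) - ?I x - ?J v) \<le> integral {u..t} C * (L * (norm v)\<^sup>2)" if v: "norm v < r/4" for v
  proof -
    have xv: "x + v \<in> U" using v r by (auto simp: dist_norm intro!: subsetD[OF r(2)])
    have "?I (x + v) - ?I x - ?J v = integral {u..t} (\<lambda>\<tau>. F \<tau> (x + v) - F \<tau> x - D \<tau> v)"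
      using Fint[OF xv] Fint[OF x] Dint by (simp add: integral_diff integrable_diff)
    also have "norm \<dots> \<le> integral {u..t} (\<lambda>\<tau>. C \<tau> * (L * (norm v)\<^sup>2))"
      by (intro integral_norm_bound_integral integrable_diff Fint xv x Dint integrable_on_mult_left C(1))
         (use tay v in auto)
    finally show ?thesis by simp
  qed
  have "(?I has_derivative ?J) (at x)"
    unfolding has_derivative_at2
  proof (intro conjI blJ)
    show "((\<lambda>y. (1 / norm (y - x)) *\<^sub>R (?I y - (?I x + ?J (y - x)))) \<longlongrightarrow> 0) (at x)"
    proof (rule Lim_null_comparison)
      show "\<forall>\<^sub>F y in at x. norm ((1 / norm (y - x)) *\<^sub>R (?I y - (?I x + ?J (y - x)))) \<le> integral {u..t} C * L * norm (y - x)"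
        unfolding eventually_at
      proof (intro exI[of _ "r/4"] conjI ballI impI)
        fix y assume y: "y \<noteq> x \<and> dist y x < r/4"
        have "norm (?I (x + (y - x)) - ?I x - ?J (y - x)) \<le> integral {u..t} C * (L * (norm (y - x))\<^sup>2)"
          by (rule est) (use y in \<open>simp add: dist_norm\<close>)
        then have "norm (?I y - (?I x + ?J (y - x))) \<le> (integral {u..t} C * L * norm (y - x)) * norm (y - x)"
          by (simp add: power2_eq_square diff_diff_eq mult_ac)
        then show "norm ((1 / norm (y - x)) *\<^sub>R (?I y - (?I x + ?J (y - x)))) \<le> integral {u..t} C * L * norm (y - x)"
          using y by (simp only: norm_scaleR) (simp add: divide_le_eq)
      qed (use r in auto)
      show "((\<lambda>y. integral {u..t} C * L * norm (y - x)) \<longlongrightarrow> 0) (at x)"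
        by (rule tendsto_eq_intros refl | simp)+
    qed
  qed
  moreover have "?J (a *s v) = a *s ?J v" for a v
  proof -
    have "bounded_linear (\<lambda>w. a *s (w :: complex ^ 'k))"
      by (rule linear_conv_bounded_linear[THEN iffD1], rule linearI)
         (auto simp: vec_eq_iff algebra_simps)
    then have "integral {u..t} (\<lambda>\<tau>. a *s D \<tau> v) = a *s ?J v"
      using integral_linear[OF Dint, of "\<lambda>w. a *s w" v] by (simp add: o_def)
    moreover have "?J (a *s v) = integral {u..t} (\<lambda>\<tau>. a *s D \<tau> v)"
      unfolding D_def by (intro integral_cong cholomorphic_on_frechet(2)[OF hol x])
    ultimately show ?thesis by simp
  qed
  ultimately show "\<exists>f'. (?I has_derivative f') (at x) \<and> (\<forall>a v. f' (a *s v) = a *s f' v)" by blast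
qed

section \<open>Caratheodory differential equations\<close>

text \<open>Bolzano's bisection for properties that are preserved when adjacent intervals are
  joined. It replaces explicit partitions throughout: the local hypothesis concerns all short
  intervals that contain \<open>x\<close>, wherever their end points lie, and \<open>x\<close> may
  be an end point.\<close>

lemma interval_local_to_global:
  fixes P :: "real \<Rightarrow> real \<Rightarrow> bool"
  assumes "a \<le> b"
    and trans: "\<And>c d e. a \<le> c \<Longrightarrow> c \<le> d \<Longrightarrow> d \<le> e \<Longrightarrow> e \<le> b \<Longrightarrow> P c d \<Longrightarrow> P d e \<Longrightarrow> P c e"
    and local: "\<And>x. a \<le> x \<Longrightarrow> x \<le> b \<Longrightarrow>
      \<exists>\<delta>>0. \<forall>c d. a \<le> c \<longrightarrow> c \<le> x \<longrightarrow> x \<le> d \<longrightarrow> d \<le> b \<longrightarrow> d - c < \<delta> \<longrightarrow> P c d"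
  shows "P a b"
proof -
  let ?P = "\<lambda>c d. a \<le> c \<longrightarrow> c \<le> d \<longrightarrow> d \<le> b \<longrightarrow> P c d"
  have "?P a b"
  proof (rule Bolzano[where P = ?P, OF \<open>a \<le> b\<close>])
    show "?P c e" if "?P c d" "?P d e" "c \<le> d" "d \<le> e" for c d e
    proof (intro impI)
      assume "a \<le> c" "c \<le> e" "e \<le> b"
      moreover have "P c d" "P d e" using that calculation by auto
      ultimately show "P c e" using trans[of c d e] that by auto
    qed
    show "\<exists>\<delta>>0. \<forall>c d. c \<le> x \<and> x \<le> d \<and> d - c < \<delta> \<longrightarrow> ?P c d" if "a \<le> x" "x \<le> b" for x
      using local[OF that] by meson
  qed
  then show ?thesis using \<open>a \<le> b\<close> by simp
qed

lemma integral_Icc_mono: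
  fixes f :: "real \<Rightarrow> real"
  assumes "f integrable_on {u..v}" "\<And>t. t \<in> {u..v} \<Longrightarrow> 0 \<le> f t" "u \<le> a" "b \<le> v"
  shows "integral {a..b} f \<le> integral {u..v} f"
  by (rule integral_subset_le) (use assms in \<open>auto intro: integrable_on_subinterval\<close>)

section \<open>Picard iteration and uniqueness\<close>

text \<open>The bound on the integral of \<open>C\<close> has two effects. Displacements are at most
  \<open>r/16\<close>, so iterates starting in the ball of radius \<open>r/4\<close> stay in that of
  radius \<open>r/2\<close>, where \<open>g t\<close> has the Lipschitz constant
  \<open>4 * CARD('n) * C t / r\<close>; and the integral of this constant is at most 1/4, so
  Picard's map is a contraction. Holomorphy in the initial point passes from the iterates to their
  uniform limit.\<close>

theorem caratheodory_flow:
  fixes g :: "real \<Rightarrow> complex ^ 'n \<Rightarrow> complex ^ 'n"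
  assumes r: "r > 0" and uv: "u \<le> v"
    and hol: "\<And>t. t \<in> {u..v} \<Longrightarrow> cholomorphic_on (g t) (ball x0 r)"
    and meas: "\<And>x. x \<in> ball x0 r \<Longrightarrow> (\<lambda>t. g t x) \<in> borel_measurable (lebesgue_on {u..v})"
    and C: "C integrable_on {u..v}" "\<And>t x. t \<in> {u..v} \<Longrightarrow> x \<in> ball x0 r \<Longrightarrow> norm (g t x) \<le> C t"
    and small: "integral {u..v} C \<le> r / (16 * real CARD('n))"
  obtains X where
    "\<And>x. x \<in> ball x0 (r/4) \<Longrightarrow> continuous_on {u..v} (X x)"
    "\<And>x t. x \<in> ball x0 (r/4) \<Longrightarrow> t \<in> {u..v} \<Longrightarrow> X x t \<in> ball x0 (r/2)"
    "\<And>x t. x \<in> ball x0 (r/4) \<Longrightarrow> t \<in> {u..v} \<Longrightarrow> ((\<lambda>\<tau>. g \<tau> (X x \<tau>)) has_integral (X x t - x)) {u..t}"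
    "\<And>t. t \<in> {u..v} \<Longrightarrow> cholomorphic_on (\<lambda>x. X x t) (ball x0 (r/4))"
proof -
  let ?N = "real CARD('n)"
  have N: "1 \<le> ?N" by (simp add: Suc_leI)
  have C0: "0 \<le> C t" if "t \<in> {u..v}" for t
    using C(2)[OF that, of x0] r norm_ge_zero order_trans by (metis centre_in_ball)
  have sub: "ball x0 (r/2) \<subseteq> ball x0 r" using r by auto
  define adm where "adm Y \<longleftrightarrow> continuous_on {u..v} Y \<and> Y ` {u..v} \<subseteq> ball x0 (r/2)" for Y :: "real \<Rightarrow> complex ^ 'n"
  have adm_in: "Y \<tau> \<in> ball x0 (r/2)" if "adm Y" "\<tau> \<in> {u..v}" for Y \<tau>
    using that unfolding adm_def by blast
  have Cut: "C integrable_on {u..t}" if "t \<in> {u..v}" for t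
    using integrable_on_subinterval[OF C(1), of u t] that by auto
  have Cle: "integral {u..t} C \<le> r / 16" if "t \<in> {u..v}" for t
  proof -
    have "integral {u..t} C \<le> integral {u..v} C" using that by (intro integral_Icc_mono C C0) auto
    also have "\<dots> \<le> r / (16 * ?N)" by (rule small)
    also have "\<dots> \<le> r / 16" using N r by (simp add: field_simps)
    finally show ?thesis .
  qed
  have adm_meas: "(\<lambda>\<tau>. g \<tau> (Y \<tau>)) \<in> borel_measurable (lebesgue_on {u..v})" if "adm Y" for Y
  proof (rule caratheodory_measurable[where S = "ball x0 (r/2)" and g = g and X = Y])
    show "continuous_on (ball x0 (r/2)) (g t)" if "t \<in> {u..v}" for t
      using cholomorphic_on_imp_continuous_on[OF hol[OF that]] continuous_on_subset sub by blast
  qed (use that meas sub in \<open>auto simp: adm_def\<close>)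
  have adm_bd: "norm (g \<tau> (Y \<tau>)) \<le> C \<tau>" if "adm Y" "\<tau> \<in> {u..v}" for Y \<tau>
    using C(2)[OF that(2)] sub adm_in[OF that] by blast
  have adm_int: "(\<lambda>\<tau>. g \<tau> (Y \<tau>)) integrable_on {u..t}" if "adm Y" "t \<in> {u..v}" for Y t
  proof -
    have "(\<lambda>\<tau>. g \<tau> (Y \<tau>)) integrable_on {u..v}"
      by (rule measurable_bounded_by_integrable_imp_integrable[OF adm_meas[OF that(1)] C(1)]) (use adm_bd[OF that(1)] in auto)
    then show ?thesis using that by (auto intro: integrable_on_subinterval)
  qed
  have con: "norm (integral {u..t} (\<lambda>\<tau>. g \<tau> (Y \<tau>)) - integral {u..t} (\<lambda>\<tau>. g \<tau> (Z \<tau>))) \<le> B / 4"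
    if Y: "adm Y" and Z: "adm Z" and t: "t \<in> {u..v}" and B: "\<And>\<tau>. \<tau> \<in> {u..v} \<Longrightarrow> norm (Y \<tau> - Z \<tau>) \<le> B" for Y Z t B
  proof -
    have B0: "0 \<le> B" using B[OF t] norm_ge_zero order_trans by blast
    have "integral {u..t} (\<lambda>\<tau>. g \<tau> (Y \<tau>)) - integral {u..t} (\<lambda>\<tau>. g \<tau> (Z \<tau>)) = integral {u..t} (\<lambda>\<tau>. g \<tau> (Y \<tau>) - g \<tau> (Z \<tau>))"
      using adm_int[OF Y t] adm_int[OF Z t] by (simp add: integral_diff)
    also have "norm \<dots> \<le> integral {u..t} (\<lambda>\<tau>. C \<tau> * (4 * ?N / r * B))"
    proof (intro integral_norm_bound_integral integrable_diff adm_int Y Z t integrable_on_mult_left Cut)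
      fix \<tau> assume "\<tau> \<in> {u..t}"
      then have \<tau>: "\<tau> \<in> {u..v}" using t by auto
      have "norm (g \<tau> (Y \<tau>) - g \<tau> (Z \<tau>)) \<le> 4 * ?N * C \<tau> / r * norm (Y \<tau> - Z \<tau>)"
        by (rule cholomorphic_on_lipschitz[OF r hol[OF \<tau>] C(2)[OF \<tau>]]) (assumption | rule adm_in[OF Y \<tau>] adm_in[OF Z \<tau>])+
      also have "\<dots> \<le> 4 * ?N * C \<tau> / r * B" using B[OF \<tau>] C0[OF \<tau>] r by (intro mult_left_mono) auto
      finally show "norm (g \<tau> (Y \<tau>) - g \<tau> (Z \<tau>)) \<le> C \<tau> * (4 * ?N / r * B)" by (simp add: algebra_simps)
    qed
    also have "\<dots> = integral {u..t} C * (4 * ?N / r * B)" by simp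
    also have "\<dots> \<le> (r / (16 * ?N)) * (4 * ?N / r * B)"
    proof (rule mult_right_mono)
      have "integral {u..t} C \<le> integral {u..v} C" using t by (intro integral_Icc_mono C C0) auto
      then show "integral {u..t} C \<le> r / (16 * ?N)" using small by linarith
    qed (use r B0 in auto)
    also have "\<dots> = B / 4" using r N by simp
    finally show ?thesis .
  qed
  define X where "X = rec_nat (\<lambda>x t. x) (\<lambda>n Y x t. x + integral {u..t} (\<lambda>\<tau>. g \<tau> (Y x \<tau>)))"
  have X0: "X 0 x t = x" and XS: "X (Suc n) x t = x + integral {u..t} (\<lambda>\<tau>. g \<tau> (X n x \<tau>))" for n x t
    by (simp_all add: X_def)
  have near: "z \<in> ball x0 (r/2)" if "x \<in> ball x0 (r/4)" "norm (z - x) \<le> r / 16" for x z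
    using that norm_triangle_ineq[of "x - x0" "z - x"] r by (simp add: dist_norm norm_minus_commute)
  have Xn: "continuous_on {u..v} (X n x) \<and> (\<forall>t\<in>{u..v}. norm (X n x t - x) \<le> r / 16)" if x: "x \<in> ball x0 (r/4)" for n x
  proof (induction n)
    case 0
    then show ?case using r by (simp add: X0)
  next
    case (Suc n)
    then have ad: "adm (X n x)" using near[OF x] by (auto simp: adm_def)
    have "norm (integral {u..t} (\<lambda>\<tau>. g \<tau> (X n x \<tau>))) \<le> r / 16" if t: "t \<in> {u..v}" for t
    proof -
      have "norm (integral {u..t} (\<lambda>\<tau>. g \<tau> (X n x \<tau>))) \<le> integral {u..t} C"
        by (rule integral_norm_bound_integral[OF adm_int[OF ad t] Cut[OF t]]) (use t adm_bd[OF ad] in auto)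
      then show ?thesis using Cle[OF t] by simp
    qed
    moreover have "continuous_on {u..v} (\<lambda>t. x + integral {u..t} (\<lambda>\<tau>. g \<tau> (X n x \<tau>)))"
      by (intro continuous_intros indefinite_integral_continuous_1 adm_int[OF ad]) (use uv in auto)
    ultimately show ?case by (simp add: XS cong: continuous_on_cong)
  qed
  have adX: "adm (X n x)" if "x \<in> ball x0 (r/4)" for n x
    using Xn[OF that] near[OF that] by (auto simp: adm_def)
  have step: "norm (X (Suc n) x t - X n x t) \<le> r * (1/4) ^ n" if x: "x \<in> ball x0 (r/4)" and t: "t \<in> {u..v}" for n x t
    using t
  proof (induction n arbitrary: t)
    case 0
    have "norm (X (Suc 0) x t - x) \<le> r / 16" using Xn[OF x, of "Suc 0"] 0 by blast
    then show ?case using r by (simp add: X0)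
  next
    case (Suc n)
    have "norm (X (Suc (Suc n)) x t - X (Suc n) x t) \<le> (r * (1/4) ^ n) / 4"
      using con[OF adX[OF x, of "Suc n"] adX[OF x, of n] Suc.prems Suc.IH] by (simp add: XS[of "Suc n" x t] XS[of n x t])
    then show ?case by simp
  qed
  \<comment> \<open>The series of increments is summed uniformly over initial points and times at
    once: uniformity in time gives continuity and the integral equation, uniformity in the initial
    point gives holomorphy.\<close>
  define A where "A = ball x0 (r/4) \<times> {u..v}"
  have "summable (\<lambda>n. r * (1/4 :: real) ^ n)" by (intro summable_mult summable_geometric) auto
  then have W: "uniform_limit A (\<lambda>n p. \<Sum>i<n. X (Suc i) (fst p) (snd p) - X i (fst p) (snd p))
      (\<lambda>p. \<Sum>i. X (Suc i) (fst p) (snd p) - X i (fst p) (snd p)) sequentially"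
    by (rule Weierstrass_m_test[rotated]) (use step in \<open>auto simp: A_def\<close>)
  define Z where "Z x t = x + (\<Sum>i. X (Suc i) x t - X i x t)" for x t
  have unif: "\<forall>\<^sub>F n in sequentially. \<forall>x\<in>ball x0 (r/4). \<forall>t\<in>{u..v}. dist (X n x t) (Z x t) < e" if e: "e > 0" for e
  proof -
    have tel: "(\<Sum>i<n. X (Suc i) x t - X i x t) = X n x t - x" for n x t
      by (subst sum_lessThan_telescope) (simp add: X0)
    have "\<forall>\<^sub>F n in sequentially. \<forall>p\<in>A. dist (\<Sum>i<n. X (Suc i) (fst p) (snd p) - X i (fst p) (snd p))
         (\<Sum>i. X (Suc i) (fst p) (snd p) - X i (fst p) (snd p)) < e"
      using W e unfolding uniform_limit_iff by blast
    then show ?thesis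
      by eventually_elim (auto simp: A_def tel Z_def dist_norm diff_diff_eq)
  qed
  have ulx: "uniform_limit {u..v} (\<lambda>n. X n x) (Z x) sequentially" if "x \<in> ball x0 (r/4)" for x
    unfolding uniform_limit_iff
  proof (intro allI impI)
    fix e :: real assume "e > 0"
    then show "\<forall>\<^sub>F n in sequentially. \<forall>s\<in>{u..v}. dist (X n x s) (Z x s) < e"
      by (rule eventually_mono[OF unif]) (use that in blast)
  qed
  have ult: "uniform_limit (ball x0 (r/4)) (\<lambda>n x. X n x t) (\<lambda>x. Z x t) sequentially" if "t \<in> {u..v}" for t
    unfolding uniform_limit_iff
  proof (intro allI impI)
    fix e :: real assume "e > 0"
    then show "\<forall>\<^sub>F n in sequentially. \<forall>x\<in>ball x0 (r/4). dist (X n x t) (Z x t) < e"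
      by (rule eventually_mono[OF unif]) (use that in blast)
  qed
  have Zc: "continuous_on {u..v} (Z x)" if "x \<in> ball x0 (r/4)" for x
    by (rule uniform_limit_theorem[OF _ ulx[OF that]]) (use Xn[OF that] in auto)
  have Znear: "norm (Z x t - x) \<le> r / 16" if x: "x \<in> ball x0 (r/4)" and t: "t \<in> {u..v}" for x t
  proof (rule tendsto_upperbound)
    show "(\<lambda>n. norm (X n x t - x)) \<longlonglongrightarrow> norm (Z x t - x)"
      by (intro tendsto_intros tendsto_uniform_limitI[OF ulx[OF x] t])
    show "\<forall>\<^sub>F n in sequentially. norm (X n x t - x) \<le> r / 16" using Xn[OF x] t by (intro always_eventually) blast
  qed auto
  have Zin: "Z x t \<in> ball x0 (r/2)" if "x \<in> ball x0 (r/4)" "t \<in> {u..v}" for x t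
    using near Znear that by blast
  have adZ: "adm (Z x)" if "x \<in> ball x0 (r/4)" for x
    using Zc Zin that by (auto simp: adm_def)
  have Zint: "Z x t - x = integral {u..t} (\<lambda>\<tau>. g \<tau> (Z x \<tau>))" if x: "x \<in> ball x0 (r/4)" and t: "t \<in> {u..v}" for x t
  proof -
    have "(\<lambda>n. X (Suc n) x t) \<longlonglongrightarrow> x + integral {u..t} (\<lambda>\<tau>. g \<tau> (Z x \<tau>))"
    proof (rule metric_LIMSEQ_I)
      fix e :: real assume e: "e > 0"
      obtain M where M: "\<And>n \<tau>. n \<ge> M \<Longrightarrow> \<tau> \<in> {u..v} \<Longrightarrow> dist (X n x \<tau>) (Z x \<tau>) < e"
        using unif[OF e] x unfolding eventually_sequentially by blast
      have "dist (X (Suc n) x t) (x + integral {u..t} (\<lambda>\<tau>. g \<tau> (Z x \<tau>))) < e" if "n \<ge> M" for n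
      proof -
        have "norm (integral {u..t} (\<lambda>\<tau>. g \<tau> (X n x \<tau>)) - integral {u..t} (\<lambda>\<tau>. g \<tau> (Z x \<tau>))) \<le> e / 4"
          by (rule con[OF adX[OF x] adZ[OF x] t]) (use M[OF that] in \<open>simp add: dist_norm less_imp_le\<close>)
        then show ?thesis using e by (simp add: XS dist_norm)
      qed
      then show "\<exists>M. \<forall>n\<ge>M. dist (X (Suc n) x t) (x + integral {u..t} (\<lambda>\<tau>. g \<tau> (Z x \<tau>))) < e" by blast
    qed
    moreover have "(\<lambda>n. X (Suc n) x t) \<longlonglongrightarrow> Z x t"
      by (rule LIMSEQ_Suc[OF tendsto_uniform_limitI[OF ulx[OF x] t]])
    ultimately show ?thesis using LIMSEQ_unique by fastforce
  qed
  have Xhol: "cholomorphic_on (\<lambda>x. X n x t) (ball x0 (r/4))" if t: "t \<in> {u..v}" for n t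
    using t
  proof (induction n arbitrary: t)
    case 0
    then show ?case by (simp add: X0 cholomorphic_on_ident)
  next
    case (Suc n)
    have "cholomorphic_on (\<lambda>x. integral {u..t} (\<lambda>\<tau>. g \<tau> (X n x \<tau>))) (ball x0 (r/4))"
    proof (rule cholomorphic_on_integral[OF open_ball _ _ Cut[OF Suc.prems]])
      fix \<tau> assume "\<tau> \<in> {u..t}"
      then have \<tau>: "\<tau> \<in> {u..v}" using Suc.prems by auto
      show "cholomorphic_on (\<lambda>x. g \<tau> (X n x \<tau>)) (ball x0 (r/4))"
        by (rule cholomorphic_on_compose[OF Suc.IH[OF \<tau>] hol[OF \<tau>]]) (use adm_in[OF adX \<tau>] sub in blast)
      show "norm (g \<tau> (X n y \<tau>)) \<le> C \<tau>" if "y \<in> ball x0 (r/4)" for y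
        using adm_bd[OF adX[OF that] \<tau>] .
    next
      fix y assume "y \<in> ball x0 (r/4)"
      then have "(\<lambda>\<tau>. g \<tau> (X n y \<tau>)) \<in> borel_measurable (lebesgue_on {u..v})" by (intro adm_meas adX)
      then show "(\<lambda>\<tau>. g \<tau> (X n y \<tau>)) \<in> borel_measurable (lebesgue_on {u..t})"
        by (rule measurable_restrict_mono) (use Suc.prems in auto)
    qed
    then show ?case by (simp add: XS cholomorphic_on_add cholomorphic_on_ident)
  qed
  show thesis
  proof (rule that[of Z])
    show "((\<lambda>\<tau>. g \<tau> (Z x \<tau>)) has_integral (Z x t - x)) {u..t}" if "x \<in> ball x0 (r/4)" "t \<in> {u..v}" for x t
      unfolding Zint[OF that] by (rule integrable_integral[OF adm_int[OF adZ[OF that(1)] that(2)]])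
    show "cholomorphic_on (\<lambda>x. Z x t) (ball x0 (r/4))" if "t \<in> {u..v}" for t
      by (rule cholomorphic_on_uniform_limit[OF open_ball Xhol[OF that] ult[OF that]])
  qed (use Zc Zin in auto)
qed

text \<open>At the time where \<open>norm (X t - Y t)\<close> is largest, with value
  \<open>M\<close>, integration from \<open>t0\<close> gives \<open>M \<le> M / 2\<close>. The
  common point may lie anywhere in the interval, so agreement spreads both forwards and backwards in
  time.\<close>

lemma caratheodory_unique:
  fixes X Y :: "real \<Rightarrow> 'a::euclidean_space"
  assumes L: "L integrable_on {u..v}" "\<And>t. t \<in> {u..v} \<Longrightarrow> 0 \<le> L t" "integral {u..v} L \<le> 1/2"
    and cont: "continuous_on {u..v} X" "continuous_on {u..v} Y"
    and lip: "\<And>t. t \<in> {u..v} \<Longrightarrow> norm (g t (X t) - g t (Y t)) \<le> L t * norm (X t - Y t)"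
    and X: "\<And>a b. u \<le> a \<Longrightarrow> a \<le> b \<Longrightarrow> b \<le> v \<Longrightarrow> ((\<lambda>\<tau>. g \<tau> (X \<tau>)) has_integral (X b - X a)) {a..b}"
    and Y: "\<And>a b. u \<le> a \<Longrightarrow> a \<le> b \<Longrightarrow> b \<le> v \<Longrightarrow> ((\<lambda>\<tau>. g \<tau> (Y \<tau>)) has_integral (Y b - Y a)) {a..b}"
    and t0: "t0 \<in> {u..v}" "X t0 = Y t0" and t: "t \<in> {u..v}"
  shows "X t = Y t"
proof -
  have *: "compact {u..v}" "{u..v} \<noteq> {}" "continuous_on {u..v} (\<lambda>t. norm (X t - Y t))"
    using t0 by (auto intro!: continuous_intros cont)
  obtain s where s: "s \<in> {u..v}" "\<And>t. t \<in> {u..v} \<Longrightarrow> norm (X t - Y t) \<le> norm (X s - Y s)"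
    using continuous_attains_sup[OF *] by blast
  let ?M = "norm (X s - Y s)"
  have half: "norm ((X b - Y b) - (X a - Y a)) \<le> ?M / 2" if ab: "u \<le> a" "a \<le> b" "b \<le> v" for a b
  proof -
    have *: "((\<lambda>\<tau>. g \<tau> (X \<tau>) - g \<tau> (Y \<tau>)) has_integral ((X b - X a) - (Y b - Y a))) {a..b}"
      by (intro has_integral_diff X Y ab)
    have Lab: "L integrable_on {a..b}" using integrable_on_subinterval[OF L(1)] ab by auto
    have "norm (integral {a..b} (\<lambda>\<tau>. g \<tau> (X \<tau>) - g \<tau> (Y \<tau>))) \<le> integral {a..b} (\<lambda>\<tau>. L \<tau> * ?M)"
    proof (rule integral_norm_bound_integral)
      show "(\<lambda>\<tau>. L \<tau> * ?M) integrable_on {a..b}" by (rule integrable_on_mult_left[OF Lab])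
      fix \<tau> assume "\<tau> \<in> {a..b}"
      then have \<tau>: "\<tau> \<in> {u..v}" using ab by auto
      show "norm (g \<tau> (X \<tau>) - g \<tau> (Y \<tau>)) \<le> L \<tau> * ?M"
        using lip[OF \<tau>] mult_left_mono[OF s(2)[OF \<tau>] L(2)[OF \<tau>]] by linarith
    qed (use * in auto)
    also have "\<dots> = integral {a..b} L * ?M" by simp
    also have "\<dots> \<le> 1/2 * ?M"
      using integral_Icc_mono[OF L(1,2), of a b] ab L(3) by (intro mult_right_mono) auto
    finally show ?thesis using integral_unique[OF *] by (simp add: algebra_simps)
  qed
  have "?M \<le> ?M / 2"
  proof (cases "t0 \<le> s")
    case True
    then show ?thesis using half[of t0 s] s t0 by auto
  next
    case False
    then show ?thesis using half[of s t0] s t0 by (auto simp: norm_minus_commute)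
  qed
  then have "norm (X t - Y t) \<le> 0" using s(2)[OF t] by linarith
  then show ?thesis by simp
qed

section \<open>The chain rule along integral curves\<close>

text \<open>\<open>Ck_on\<close> and the holomorphy lemmas provide continuity of the derivative only
  in each fixed direction; in finite dimension the basis directions control all others, which yields
  continuity in the operator norm. The tolerance is divided by the dimension because the errors in
  the basis directions are added.\<close>

lemma operator_continuity_from_directions:
  fixes D :: "'a::metric_space \<Rightarrow> 'c::euclidean_space \<Rightarrow> 'b::real_normed_vector"
  assumes U: "open U" "x \<in> U" and cont: "\<And>v. continuous_on U (\<lambda>y. D y v)"
    and lin: "\<And>y. y \<in> U \<Longrightarrow> linear (D y)" and e: "e > 0"
  obtains \<rho> where "\<rho> > 0" "ball x \<rho> \<subseteq> U" "\<And>y v. y \<in> ball x \<rho> \<Longrightarrow> norm (D y v - D x v) \<le> e * norm v"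
proof -
  let ?N = "real DIM('c)"
  have "\<forall>\<^sub>F y in nhds x. \<forall>i\<in>Basis. dist (D y i) (D x i) < e / ?N"
  proof (rule eventually_ball_finite)
    show "\<forall>i\<in>Basis. \<forall>\<^sub>F y in nhds x. dist (D y i) (D x i) < e / ?N"
    proof
      fix i :: 'c
      have "isCont (\<lambda>y. D y i) x" using cont U continuous_on_eq_continuous_at by blast
      then have "((\<lambda>y. D y i) \<longlongrightarrow> D x i) (nhds x)"
        by (simp add: continuous_at tendsto_nhds_iff)
      then show "\<forall>\<^sub>F y in nhds x. dist (D y i) (D x i) < e / ?N" using e by (intro tendstoD) auto
    qed
  qed auto
  moreover have "\<forall>\<^sub>F y in nhds x. y \<in> U" using U by (simp add: eventually_nhds_in_open)
  ultimately have "\<forall>\<^sub>F y in nhds x. y \<in> U \<and> (\<forall>i\<in>Basis. dist (D y i) (D x i) < e / ?N)"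
    by eventually_elim auto
  then obtain \<rho> where \<rho>: "\<rho> > 0" "\<And>y. dist y x < \<rho> \<Longrightarrow> y \<in> U \<and> (\<forall>i\<in>Basis. dist (D y i) (D x i) < e / ?N)"
    unfolding eventually_nhds_metric by blast
  show thesis
  proof (rule that[OF \<rho>(1)])
    show "ball x \<rho> \<subseteq> U" using \<rho>(2) by (auto simp: dist_commute)
    fix y v assume "y \<in> ball x \<rho>"
    then have y: "y \<in> U" "\<And>i. i \<in> Basis \<Longrightarrow> norm (D y i - D x i) \<le> e / ?N"
      using \<rho>(2)[of y] by (auto simp: dist_commute[of x y] dist_norm[symmetric] less_imp_le)
    have exp: "D z v = (\<Sum>i\<in>Basis. (v \<bullet> i) *\<^sub>R D z i)" if "z \<in> U" for z
    proof -
      have "D z v = D z (\<Sum>i\<in>Basis. (v \<bullet> i) *\<^sub>R i)" by (simp add: euclidean_representation)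
      also have "\<dots> = (\<Sum>i\<in>Basis. (v \<bullet> i) *\<^sub>R D z i)"
        by (simp add: linear_sum[OF lin[OF that]] linear_cmul[OF lin[OF that]])
      finally show ?thesis .
    qed
    have "norm (D y v - D x v) = norm (\<Sum>i\<in>Basis. (v \<bullet> i) *\<^sub>R (D y i - D x i))"
      by (simp add: exp[OF y(1)] exp[OF U(2)] sum_subtractf scaleR_diff_right)
    also have "\<dots> \<le> (\<Sum>i\<in>(Basis :: 'c set). norm v * (e / ?N))"
    proof (rule sum_norm_le)
      fix i :: 'c assume "i \<in> Basis"
      then show "norm ((v \<bullet> i) *\<^sub>R (D y i - D x i)) \<le> norm v * (e / ?N)"
        using mult_mono[OF Basis_le_norm[of i v] y(2)[of i]] by simp
    qed
    also have "\<dots> = e * norm v" by simp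
    finally show "norm (D y v - D x v) \<le> e * norm v" .
  qed
qed

text \<open>The chain rule for absolutely continuous curves, without absolute continuity: on a short interval
  around \<open>t\<close> both sides are compared with the derivative frozen at \<open>X t\<close>, and the error is
  \<open>\<epsilon> \<integral> \<bar>g\<bar>\<close>, which is additive in the interval.\<close>

lemma integral_chain_rule:
  fixes X :: "real \<Rightarrow> 'a::euclidean_space" and T :: "'a \<Rightarrow> 'b::euclidean_space"
  assumes ab: "a \<le> b" and g: "g absolutely_integrable_on {a..b}"
    and X: "\<And>c d. a \<le> c \<Longrightarrow> c \<le> d \<Longrightarrow> d \<le> b \<Longrightarrow> (g has_integral (X d - X c)) {c..d}"
    and U: "open U" "\<And>t. t \<in> {a..b} \<Longrightarrow> X t \<in> U"
    and DT: "\<And>x. x \<in> U \<Longrightarrow> (T has_derivative DT x) (at x)"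
    and cont: "\<And>v. continuous_on U (\<lambda>x. DT x v)"
  shows "((\<lambda>t. DT (X t) (g t)) has_integral (T (X b) - T (X a))) {a..b}"
proof -
  have gi: "g integrable_on {a..b}" and ngi: "(\<lambda>t. norm (g t)) integrable_on {a..b}"
    using g by (auto simp: absolutely_integrable_on_def)
  have lin: "linear (DT x)" if "x \<in> U" for x using DT[OF that] has_derivative_linear by blast
  have Xeq: "X t = X a + integral {a..t} g" if "t \<in> {a..b}" for t
    using integral_unique[OF X[of a t]] that by auto
  have Xc: "continuous_on {a..b} X"
    by (subst continuous_on_cong[OF refl Xeq]) (auto intro!: continuous_intros indefinite_integral_continuous_1 gi)
  define k where "k t = DT (X t) (g t)" for t
  \<comment> \<open>Written in a basis, the integrand is a sum of products of an integrable scalar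
    and a bounded continuous coefficient, hence absolutely integrable.\<close>
  have "(\<lambda>t. \<Sum>i\<in>Basis. (g t \<bullet> i) *\<^sub>R DT (X t) i) absolutely_integrable_on {a..b}"
  proof (intro absolutely_integrable_sum finite_Basis)
    fix i :: 'a
    have c: "continuous_on {a..b} (\<lambda>t. DT (X t) i)"
      using continuous_on_compose2[OF cont Xc] U(2) by blast
    show "(\<lambda>t. (g t \<bullet> i) *\<^sub>R DT (X t) i) absolutely_integrable_on {a..b}"
    proof (rule absolutely_integrable_bounded_measurable_product[where h = "\<lambda>y s. s *\<^sub>R y" and f = "\<lambda>t. DT (X t) i" and g = "\<lambda>t. g t \<bullet> i"])
      show "bilinear (\<lambda>(y::'b) (s::real). s *\<^sub>R y)"
        by (auto simp: bilinear_def scaleR_add_left scaleR_add_right intro!: linearI)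
      show "(\<lambda>t. DT (X t) i) \<in> borel_measurable (lebesgue_on {a..b})"
        by (intro continuous_imp_measurable_on_sets_lebesgue c) auto
      show "bounded ((\<lambda>t. DT (X t) i) ` {a..b})"
        by (intro compact_imp_bounded compact_continuous_image c) auto
      show "(\<lambda>t. g t \<bullet> i) absolutely_integrable_on {a..b}"
        using absolutely_integrable_linear[OF g bounded_linear_inner_left[of i]] by (simp add: o_def)
    qed auto
  qed
  moreover have "k t = (\<Sum>i\<in>Basis. (g t \<bullet> i) *\<^sub>R DT (X t) i)" if "t \<in> {a..b}" for t
  proof -
    have "k t = DT (X t) (\<Sum>i\<in>Basis. (g t \<bullet> i) *\<^sub>R i)" by (simp add: euclidean_representation k_def)
    then show ?thesis by (simp only: linear_sum[OF lin[OF U(2)[OF that]]] linear_cmul[OF lin[OF U(2)[OF that]]])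
  qed
  ultimately have kai: "k absolutely_integrable_on {a..b}"
    by (subst absolutely_integrable_spike_eq[of "{}"]) auto
  have ki: "k integrable_on {a..b}" using kai absolutely_integrable_on_def by blast
  have sub: "k integrable_on {c..d}" "g integrable_on {c..d}" "(\<lambda>t. norm (g t)) integrable_on {c..d}"
    if "a \<le> c" "d \<le> b" for c d
    using that integrable_on_subinterval[OF ki, of c d] integrable_on_subinterval[OF gi, of c d]
      integrable_on_subinterval[OF ngi, of c d] by auto
  \<comment> \<open>One \<open>e\<close> comes from linearising \<open>T\<close> at
    \<open>X x\<close>, the other from freezing the derivative inside the integral.\<close>
  have main: "norm (T (X b) - T (X a) - integral {a..b} k) \<le> 2 * e * integral {a..b} (\<lambda>t. norm (g t))" if e: "e > 0" for e
  proof (rule interval_local_to_global[OF ab, where P = "\<lambda>c d. norm (T (X d) - T (X c) - integral {c..d} k) \<le> 2 * e * integral {c..d} (\<lambda>t. norm (g t))"])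
    fix c d f
    assume *: "a \<le> c" "c \<le> d" "d \<le> f" "f \<le> b"
      and 1: "norm (T (X d) - T (X c) - integral {c..d} k) \<le> 2 * e * integral {c..d} (\<lambda>t. norm (g t))"
      and 2: "norm (T (X f) - T (X d) - integral {d..f} k) \<le> 2 * e * integral {d..f} (\<lambda>t. norm (g t))"
    have "integral {c..f} k = integral {c..d} k + integral {d..f} k"
      "integral {c..f} (\<lambda>t. norm (g t)) = integral {c..d} (\<lambda>t. norm (g t)) + integral {d..f} (\<lambda>t. norm (g t))"
      using * by (auto intro!: Henstock_Kurzweil_Integration.integral_combine[symmetric] sub)
    then show "norm (T (X f) - T (X c) - integral {c..f} k) \<le> 2 * e * integral {c..f} (\<lambda>t. norm (g t))"
      using 1 2 norm_triangle_ineq[of "T (X d) - T (X c) - integral {c..d} k" "T (X f) - T (X d) - integral {d..f} k"]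
      by (simp add: algebra_simps)
  next
    fix x assume x: "a \<le> x" "x \<le> b"
    then have XU: "X x \<in> U" using U(2) by auto
    obtain \<rho> where \<rho>: "\<rho> > 0" "ball (X x) \<rho> \<subseteq> U" "\<And>y v. y \<in> ball (X x) \<rho> \<Longrightarrow> norm (DT y v - DT (X x) v) \<le> e * norm v"
      using operator_continuity_from_directions[OF U(1) XU cont lin e] by blast
    obtain \<delta> where \<delta>: "\<delta> > 0" "\<And>t. t \<in> {a..b} \<Longrightarrow> dist t x < \<delta> \<Longrightarrow> dist (X t) (X x) < \<rho>"
      using Xc x \<rho>(1) unfolding continuous_on_iff by (metis atLeastAtMost_iff)
    show "\<exists>\<delta>>0. \<forall>c d. a \<le> c \<longrightarrow> c \<le> x \<longrightarrow> x \<le> d \<longrightarrow> d \<le> b \<longrightarrow> d - c < \<delta> \<longrightarrow>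
      norm (T (X d) - T (X c) - integral {c..d} k) \<le> 2 * e * integral {c..d} (\<lambda>t. norm (g t))"
    proof (intro exI[of _ \<delta>] conjI allI impI \<delta>(1))
      fix c d assume cd: "a \<le> c" "c \<le> x" "x \<le> d" "d \<le> b" "d - c < \<delta>"
      have near: "X t \<in> ball (X x) \<rho>" if "t \<in> {c..d}" for t
        using \<delta>(2)[of t] that cd by (auto simp: dist_real_def dist_commute)
      let ?I = "integral {c..d} (\<lambda>t. norm (g t))"
      note s = sub[OF cd(1,4)]
      have Xcd: "(g has_integral (X d - X c)) {c..d}" using X cd by auto
      have nX: "norm (X d - X c) \<le> ?I"
        using integral_norm_bound_integral[OF s(2,3)] integral_unique[OF Xcd] by simp
      have 1: "norm (T (X d) - T (X c) - DT (X x) (X d - X c)) \<le> norm (X d - X c) * e"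
      proof (rule differentiable_bound_linearization[where S = "ball (X x) \<rho>" and f' = DT])
        show "X c + t *\<^sub>R (X d - X c) \<in> ball (X x) \<rho>" if "t \<in> {0..1}" for t
        proof -
          have "(1 - t) *\<^sub>R X c + t *\<^sub>R X d \<in> ball (X x) \<rho>"
            using convexD[OF convex_ball, of "X c" "X x" \<rho> "X d" "1 - t" t] near cd that by auto
          then show ?thesis by (simp add: algebra_simps)
        qed
        show "(T has_derivative DT y) (at y within ball (X x) \<rho>)" if "y \<in> ball (X x) \<rho>" for y
          using DT that \<rho>(2) by (blast intro: has_derivative_at_withinI)
        show "onorm (DT y - DT (X x)) \<le> e" if "y \<in> ball (X x) \<rho>" for y
          unfolding fun_diff_def by (rule onorm_le) (rule \<rho>(3)[OF that])
      qed (use \<rho> in auto)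
      have bl: "bounded_linear (DT (X x))" using DT[OF XU] has_derivative_bounded_linear by blast
      have 2: "((\<lambda>t. DT (X x) (g t)) has_integral DT (X x) (X d - X c)) {c..d}"
        using has_integral_linear[OF Xcd bl] by (simp add: o_def)
      have "integral {c..d} (\<lambda>t. DT (X x) (g t) - k t) = DT (X x) (X d - X c) - integral {c..d} k"
        using 2 s(1) by (simp add: integral_diff has_integral_integrable integral_unique)
      moreover have "norm (integral {c..d} (\<lambda>t. DT (X x) (g t) - k t)) \<le> integral {c..d} (\<lambda>t. e * norm (g t))"
      proof (rule integral_norm_bound_integral)
        show "(\<lambda>t. DT (X x) (g t) - k t) integrable_on {c..d}"
          using 2 s(1) by (auto intro: integrable_diff)
        show "(\<lambda>t. e * norm (g t)) integrable_on {c..d}" using s(3) by (rule integrable_on_mult_right)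
        show "norm (DT (X x) (g t) - k t) \<le> e * norm (g t)" if "t \<in> {c..d}" for t
          using \<rho>(3)[OF near[OF that], of "g t"] by (simp add: k_def norm_minus_commute)
      qed
      ultimately have 3: "norm (DT (X x) (X d - X c) - integral {c..d} k) \<le> e * ?I" by simp
      have "norm (X d - X c) * e \<le> e * ?I" using nX e by (simp add: mult.commute)
      then show "norm (T (X d) - T (X c) - integral {c..d} k) \<le> 2 * e * ?I"
        using 1 3 norm_triangle_ineq[of "T (X d) - T (X c) - DT (X x) (X d - X c)" "DT (X x) (X d - X c) - integral {c..d} k"]
        by simp
    qed
  qed
  have "norm (T (X b) - T (X a) - integral {a..b} k) \<le> 0"
  proof (rule field_le_epsilon)
    fix e :: real assume e: "e > 0"
    let ?I = "integral {a..b} (\<lambda>t. norm (g t))"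
    have I: "0 \<le> ?I" by (rule integral_nonneg[OF ngi]) auto
    have "2 * (e / (2 * (?I + 1))) * ?I = e * (?I / (?I + 1))" using I by (simp add: divide_simps)
    also have "\<dots> \<le> e * 1" using I e by (intro mult_left_mono) auto
    finally show "norm (T (X b) - T (X a) - integral {a..b} k) \<le> 0 + e"
      using main[of "e / (2 * (?I + 1))"] e I by (simp add: add_nonneg_pos)
  qed
  then have "T (X b) - T (X a) = integral {a..b} k" by simp
  then show ?thesis using integrable_integral[OF ki] unfolding k_def by simp
qed

section \<open>Curves whose derivative vanishes almost everywhere\<close>

text \<open>Outer regularity of Lebesgue measure. The open set leaves room for a short interval
  around each exceptional time, as bisection requires.\<close>

lemma negligible_outer_open:
  assumes "negligible (N :: real set)" "e > 0"
  obtains V where "open V" "N \<subseteq> V" "V \<in> lmeasurable" "measure lebesgue V < e"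
proof -
  have N: "N \<in> sets lebesgue" using assms(1) by (simp add: negligible_imp_sets)
  obtain V where V: "open V" "N \<subseteq> V" "V - N \<in> lmeasurable" "emeasure lebesgue (V - N) < ennreal e"
    using sets_lebesgue_outer_open[OF N assms(2)] by blast
  have Vs: "V \<in> sets lebesgue" using V(1) by auto
  have "emeasure lebesgue (V - N) = emeasure lebesgue V"
    using assms(1) Vs by (simp add: emeasure_Diff_null_set negligible_iff_null_sets)
  then have lt: "emeasure lebesgue V < ennreal e" using V by simp
  then have "V \<in> lmeasurable" using Vs by (auto intro!: fmeasurableI simp: less_top[symmetric] order_less_trans[OF _ ennreal_less_top])
  then show thesis using that V lt by (metis assms(2) emeasure_eq_measure2 ennreal_less_iff measure_nonneg)
qed

text \<open>Near a point of the exceptional set the increment is controlled by \<open>m\<close>, which is cut off at height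
  \<open>n\<close> so that an open set of measure \<open>\<epsilon>/n\<close> around the exceptional set suffices.\<close>

lemma zero_derivative_ae_imp_constant:
  fixes H :: "real \<Rightarrow> 'a::euclidean_space"
  assumes ab: "a \<le> b" and m: "m integrable_on {a..b}" "\<And>t. t \<in> {a..b} \<Longrightarrow> 0 \<le> m t"
    and H: "\<And>c d. a \<le> c \<Longrightarrow> c \<le> d \<Longrightarrow> d \<le> b \<Longrightarrow> norm (H d - H c) \<le> integral {c..d} m"
    and N: "negligible N" "\<And>t. t \<in> {a..b} - N \<Longrightarrow> (H has_vector_derivative 0) (at t within {a..b})"
  shows "H b = H a"
proof -
  have "norm (H b - H a) \<le> 0"
  proof (rule field_le_epsilon)
    fix e :: real assume e: "e > 0"
    define mc where "mc n t = min (m t) (real n)" for n t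
    have "m absolutely_integrable_on {a..b}" using m nonnegative_absolutely_integrable_1 by blast
    then have mci: "mc n integrable_on {a..b}" for n
    proof -
      have "(\<lambda>t. real n) absolutely_integrable_on {a..b}" by auto
      then have "(\<lambda>t. min (m t) (real n)) absolutely_integrable_on {a..b}"
        by (rule absolutely_integrable_min_1[OF \<open>m absolutely_integrable_on {a..b}\<close>])
      then show ?thesis by (simp add: mc_def[abs_def] absolutely_integrable_on_def)
    qed
    have "(\<lambda>n. integral {a..b} (mc n)) \<longlonglongrightarrow> integral {a..b} m"
    proof (rule dominated_convergence(2)[OF mci m(1)])
      show "norm (mc n t) \<le> m t" if "t \<in> {a..b}" for n t using m(2)[OF that] by (simp add: mc_def)
      show "(\<lambda>n. mc n t) \<longlonglongrightarrow> m t" for t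
      proof (rule tendsto_eventually)
        obtain n0 where "m t \<le> real n0" using real_arch_simple by blast
        then show "\<forall>\<^sub>F n in sequentially. mc n t = m t"
          unfolding eventually_sequentially mc_def by (intro exI[of _ n0]) auto
      qed
    qed
    then obtain n where "dist (integral {a..b} (mc n)) (integral {a..b} m) < e/3"
      using e by (metis LIMSEQ_iff_nz order_refl dist_norm zero_less_divide_iff zero_less_numeral metric_LIMSEQ_D)
    then have n: "integral {a..b} m - integral {a..b} (mc n) < e/3" unfolding dist_real_def by linarith
    obtain V where V: "open V" "N \<subseteq> V" "V \<in> lmeasurable" "measure lebesgue V < e / (3 * (real n + 1))"
      using negligible_outer_open[OF N(1), of "e / (3 * (real n + 1))"] e by auto
    define e' where "e' = e / (3 * (b - a + 1))"
    have e': "e' > 0" using e ab by (simp add: e'_def)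
    \<comment> \<open>A majorant for the increments of \<open>H\<close>. On \<open>V\<close> it
      exceeds \<open>m\<close>, because \<open>m t - mc n t + n \<ge> m t\<close>; around times
      outside \<open>N\<close> the term \<open>e'\<close> bounds the difference quotients. Each of
      the three terms contributes at most \<open>e/3\<close> to the integral.\<close>
    define \<Phi> where "\<Phi> t = e' + (m t - mc n t) + real n * indicat_real V t" for t
    have iV: "indicat_real V integrable_on {c..d}" for c d
    proof -
      have "V \<inter> {c..d} \<in> lmeasurable" using V(3) by (intro fmeasurable_Int_fmeasurable) auto
      then show ?thesis by (simp add: integrable_on_indicator)
    qed
    have \<Phi>i: "\<Phi> integrable_on {c..d}" if "a \<le> c" "d \<le> b" for c d
      unfolding \<Phi>_def
      by (intro integrable_add integrable_diff integrable_on_mult_right iV)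
         (use that integrable_on_subinterval[OF m(1), of c d] integrable_on_subinterval[OF mci, of c d] in auto)
    have "norm (H b - H a) \<le> integral {a..b} \<Phi>"
    proof (rule interval_local_to_global[OF ab, where P = "\<lambda>c d. norm (H d - H c) \<le> integral {c..d} \<Phi>"])
      fix c d f assume *: "a \<le> c" "c \<le> d" "d \<le> f" "f \<le> b" "norm (H d - H c) \<le> integral {c..d} \<Phi>" "norm (H f - H d) \<le> integral {d..f} \<Phi>"
      have "integral {c..f} \<Phi> = integral {c..d} \<Phi> + integral {d..f} \<Phi>"
        using * by (intro Henstock_Kurzweil_Integration.integral_combine[symmetric] \<Phi>i) auto
      then show "norm (H f - H c) \<le> integral {c..f} \<Phi>"
        using * norm_triangle_ineq[of "H d - H c" "H f - H d"] by simp
    next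
      fix x assume x: "a \<le> x" "x \<le> b"
      show "\<exists>\<delta>>0. \<forall>c d. a \<le> c \<longrightarrow> c \<le> x \<longrightarrow> x \<le> d \<longrightarrow> d \<le> b \<longrightarrow> d - c < \<delta> \<longrightarrow> norm (H d - H c) \<le> integral {c..d} \<Phi>"
      proof (cases "x \<in> N")
        case True
        then obtain \<delta> where \<delta>: "\<delta> > 0" "ball x \<delta> \<subseteq> V" using V open_contains_ball by blast
        show ?thesis
        proof (intro exI[of _ \<delta>] conjI allI impI \<delta>(1))
          fix c d assume cd: "a \<le> c" "c \<le> x" "x \<le> d" "d \<le> b" "d - c < \<delta>"
          have "norm (H d - H c) \<le> integral {c..d} m" using H cd by auto
          also have "\<dots> \<le> integral {c..d} \<Phi>"
          proof (rule integral_le)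
            show "m integrable_on {c..d}" using integrable_on_subinterval[OF m(1), of c d] cd by auto
            show "\<Phi> integrable_on {c..d}" using \<Phi>i cd by auto
            fix t assume t: "t \<in> {c..d}"
            then have "t \<in> V" using \<delta>(2) cd by (auto simp: dist_real_def)
            then show "m t \<le> \<Phi> t" using e' by (simp add: \<Phi>_def mc_def)
          qed
          finally show "norm (H d - H c) \<le> integral {c..d} \<Phi>" .
        qed
      next
        case False
        then have "(H has_vector_derivative 0) (at x within {a..b})" using N(2) x by auto
        then obtain \<delta> where \<delta>: "\<delta> > 0" "\<And>y. y \<in> {a..b} \<Longrightarrow> norm (y - x) < \<delta> \<Longrightarrow> norm (H y - H x) \<le> e' * norm (y - x)"
          unfolding has_vector_derivative_def has_derivative_within_alt using e' by fastforce
        show ?thesis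
        proof (intro exI[of _ \<delta>] conjI allI impI \<delta>(1))
          fix c d assume cd: "a \<le> c" "c \<le> x" "x \<le> d" "d \<le> b" "d - c < \<delta>"
          have "norm (H d - H x) \<le> e' * (d - x)" "norm (H c - H x) \<le> e' * (x - c)"
            using \<delta>(2)[of d] \<delta>(2)[of c] cd by auto
          then have "norm (H d - H c) \<le> e' * (d - c)"
            using norm_triangle_ineq4[of "H d - H x" "H c - H x"] by (simp add: algebra_simps)
          also have "\<dots> = integral {c..d} (\<lambda>t. e')" using cd by simp
          also have "\<dots> \<le> integral {c..d} \<Phi>"
            by (rule integral_le) (use \<Phi>i cd in \<open>auto simp: \<Phi>_def mc_def min_def indicator_def\<close>)
          finally show "norm (H d - H c) \<le> integral {c..d} \<Phi>" .
        qed
      qed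
    qed
    also have "integral {a..b} \<Phi> = e' * (b - a) + (integral {a..b} m - integral {a..b} (mc n)) + real n * integral {a..b} (indicat_real V)"
    proof -
      have "integral {a..b} \<Phi> = integral {a..b} (\<lambda>t. e' + (m t - mc n t)) + integral {a..b} (\<lambda>t. real n * indicat_real V t)"
        unfolding \<Phi>_def by (intro integral_add integrable_add integrable_diff integrable_on_mult_right iV m mci) auto
      also have "integral {a..b} (\<lambda>t. e' + (m t - mc n t)) = integral {a..b} (\<lambda>t. e') + integral {a..b} (\<lambda>t. m t - mc n t)"
        by (intro integral_add integrable_diff m mci) auto
      also have "integral {a..b} (\<lambda>t. m t - mc n t) = integral {a..b} m - integral {a..b} (mc n)"
        by (intro integral_diff m mci)
      finally show ?thesis using ab by simp
    qed
    also have "\<dots> \<le> e/3 + e/3 + e/3"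
    proof (intro add_mono)
      show "e' * (b - a) \<le> e/3" using e ab by (simp add: e'_def field_simps)
      show "integral {a..b} m - integral {a..b} (mc n) \<le> e/3" using n by simp
      have "integral {a..b} (indicat_real V) = measure lebesgue (V \<inter> {a..b})"
        using V(3) by (simp add: integral_indicator fmeasurable_Int_fmeasurable Int_commute)
      also have "\<dots> \<le> measure lebesgue V" using V(3) by (intro measure_mono_fmeasurable) auto
      also have "\<dots> \<le> e / (3 * (real n + 1))" using V(4) by simp
      finally have "real n * integral {a..b} (indicat_real V) \<le> real n * (e / (3 * (real n + 1)))"
        by (rule mult_left_mono) simp
      also have "\<dots> \<le> e / 3" using e by (simp add: field_simps)
      finally show "real n * integral {a..b} (indicat_real V) \<le> e / 3" .
    qed
    finally show "norm (H b - H a) \<le> 0 + e" by simp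
  qed
  then show ?thesis by simp
qed

section \<open>Lebesgue's differentiation theorem on the line\<close>

text \<open>The underlying theorem averages over cubes with a corner at \<open>x\<close>; in
  dimension one these are the intervals to the right of \<open>x\<close>, whence the one-sided
  statement.\<close>

lemma indefinite_integral_right_derivative_ae:
  fixes f :: "real \<Rightarrow> 'b::euclidean_space"
  assumes f: "\<And>c d. f integrable_on {c..d}"
  obtains N where "negligible N"
    "\<And>x e. x \<notin> N \<Longrightarrow> e > 0 \<Longrightarrow> \<exists>\<delta>>0. \<forall>h. 0 < h \<and> h < \<delta> \<longrightarrow> norm (integral {x..x+h} f - h *\<^sub>R f x) \<le> e * h"
proof -
  obtain N where N: "negligible N" "\<And>x e. \<lbrakk>x \<notin> N; 0 < e\<rbrakk> \<Longrightarrow>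
      \<exists>d>0. \<forall>h. 0 < h \<and> h < d \<longrightarrow> norm(integral (cbox x (x + h *\<^sub>R One)) f /\<^sub>R h ^ DIM(real) - f x) < e"
    by (rule integrable_ccontinuous_explicit[of f]) (use f in auto)
  show thesis
  proof (rule that[OF N(1)])
    fix x and e :: real assume "x \<notin> N" "e > 0"
    then obtain \<delta> where \<delta>: "\<delta> > 0" "\<And>h. 0 < h \<Longrightarrow> h < \<delta> \<Longrightarrow> norm (integral {x..x+h} f /\<^sub>R h - f x) < e"
      using N(2)[of x e] by auto
    have "norm (integral {x..x+h} f - h *\<^sub>R f x) \<le> e * h" if "0 < h" "h < \<delta>" for h
    proof -
      have "norm (integral {x..x+h} f - h *\<^sub>R f x) = h * norm (integral {x..x+h} f /\<^sub>R h - f x)"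
      proof -
        have "integral {x..x+h} f - h *\<^sub>R f x = h *\<^sub>R (integral {x..x+h} f /\<^sub>R h - f x)"
          using that by (simp add: scaleR_diff_right)
        then show ?thesis using that by simp
      qed
      also have "\<dots> \<le> h * e" using \<delta>(2)[OF that] that by simp
      finally show ?thesis by (simp add: mult.commute)
    qed
    then show "\<exists>\<delta>>0. \<forall>h. 0 < h \<and> h < \<delta> \<longrightarrow> norm (integral {x..x+h} f - h *\<^sub>R f x) \<le> e * h"
      using \<delta>(1) by blast
  qed
qed

text \<open>Left derivatives come from the right-sided statement applied to the reflected integrand.
  The null set depends on \<open>f\<close> and the interval alone and is chosen before the primitive
  \<open>F\<close>.\<close>

theorem lebesgue_differentiation:
  fixes f :: "real \<Rightarrow> 'b::euclidean_space"
  assumes f: "f integrable_on {a..b}"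
  obtains N where "negligible N"
    "\<And>t F. t \<in> {a<..<b} - N \<Longrightarrow> (\<And>c d. a \<le> c \<Longrightarrow> c \<le> d \<Longrightarrow> d \<le> b \<Longrightarrow> (f has_integral (F d - F c)) {c..d}) \<Longrightarrow>
       (F has_vector_derivative f t) (at t)"
proof -
  \<comment> \<open>Extension by zero makes the function integrable on every interval; inside
    \<open>{a..b}\<close> its integrals are those of \<open>f\<close>, so derivatives at interior
    times are unaffected.\<close>
  define k where "k t = (if t \<in> {a..b} then f t else 0)" for t
  have "k integrable_on UNIV" unfolding k_def using f integrable_restrict_UNIV by blast
  then have ki: "k integrable_on {c..d}" for c d by (metis integrable_on_subcbox interval_cbox subset_UNIV)
  obtain N1 where N1: "negligible N1"
    "\<And>x e. x \<notin> N1 \<Longrightarrow> e > 0 \<Longrightarrow> \<exists>\<delta>>0. \<forall>h. 0 < h \<and> h < \<delta> \<longrightarrow> norm (integral {x..x+h} k - h *\<^sub>R k x) \<le> e * h"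
    using indefinite_integral_right_derivative_ae[of k] ki by blast
  have "(\<lambda>x. k (- x)) integrable_on {c..d}" for c d
    using ki[of "-d" "-c"] Henstock_Kurzweil_Integration.integrable_reflect_real[of k "-c" "-d"] by simp
  then obtain N2 where N2: "negligible N2"
    "\<And>x e. x \<notin> N2 \<Longrightarrow> e > 0 \<Longrightarrow> \<exists>\<delta>>0. \<forall>h. 0 < h \<and> h < \<delta> \<longrightarrow> norm (integral {x..x+h} (\<lambda>x. k (- x)) - h *\<^sub>R k (- x)) \<le> e * h"
    using indefinite_integral_right_derivative_ae[of "\<lambda>x. k (- x)"] by blast
  have N2': "negligible (uminus ` N2)"
    by (rule negligible_differentiable_image_negligible[OF _ N2(1)]) (auto intro: differentiable_on_minus differentiable_on_ident)
  show thesis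
  proof (rule that[of "N1 \<union> uminus ` N2"])
    show "negligible (N1 \<union> uminus ` N2)" using N1(1) N2' by (rule negligible_Un)
    fix t F assume t: "t \<in> {a<..<b} - (N1 \<union> uminus ` N2)"
      and F: "\<And>c d. a \<le> c \<Longrightarrow> c \<le> d \<Longrightarrow> d \<le> b \<Longrightarrow> (f has_integral (F d - F c)) {c..d}"
    have tN: "t \<notin> N1" "- t \<notin> N2" using t by (auto simp: image_iff)
    have kt: "k t = f t" using t by (simp add: k_def)
    have kF: "integral {c..d} k = F d - F c" if "a \<le> c" "c \<le> d" "d \<le> b" for c d
    proof -
      have "integral {c..d} k = integral {c..d} f" by (rule integral_cong) (use that in \<open>auto simp: k_def\<close>)
      then show ?thesis using integral_unique[OF F[OF that]] by simp
    qed
    show "(F has_vector_derivative f t) (at t)"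
      unfolding has_vector_derivative_def has_derivative_within_alt
    proof (intro conjI allI impI)
      show "bounded_linear (\<lambda>x. x *\<^sub>R f t)" by (rule bounded_linear_scaleR_left)
      fix e :: real assume e: "e > 0"
      obtain \<delta>1 where \<delta>1: "\<delta>1 > 0" "\<And>h. 0 < h \<Longrightarrow> h < \<delta>1 \<Longrightarrow> norm (integral {t..t+h} k - h *\<^sub>R k t) \<le> e * h"
        using N1(2)[OF tN(1) e] by blast
      obtain \<delta>2 where \<delta>2: "\<delta>2 > 0" "\<And>h. 0 < h \<Longrightarrow> h < \<delta>2 \<Longrightarrow> norm (integral {-t..-t+h} (\<lambda>x. k (- x)) - h *\<^sub>R k t) \<le> e * h"
        using N2(2)[OF tN(2) e] by auto
      define \<delta> where "\<delta> = min (min \<delta>1 \<delta>2) (min (t - a) (b - t))"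
      have "norm (F y - F t - (y - t) *\<^sub>R f t) \<le> e * norm (y - t)" if y: "norm (y - t) < \<delta>" for y
      proof (cases y t rule: linorder_cases)
        case less
        have "integral {-t..-y} (\<lambda>x. k (- x)) = integral {y..t} k"
          by (rule Henstock_Kurzweil_Integration.integral_reflect_real)
        then have "integral {-t..-t+(t-y)} (\<lambda>x. k (- x)) = F t - F y"
          using kF[of y t] y less t by (simp add: \<delta>_def)
        then have "norm ((F t - F y) - (t - y) *\<^sub>R f t) \<le> e * (t - y)"
          using \<delta>2(2)[of "t - y"] y less kt by (simp add: \<delta>_def)
        moreover have "F y - F t - (y - t) *\<^sub>R f t = - ((F t - F y) - (t - y) *\<^sub>R f t)" by (simp add: algebra_simps)
        ultimately show ?thesis using less by (metis abs_of_neg diff_less_0_iff_less minus_diff_eq norm_minus_cancel real_norm_def)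
      next
        case equal
        then show ?thesis by simp
      next
        case greater
        have "integral {t..t+(y-t)} k = F y - F t" using kF[of t y] y greater t by (simp add: \<delta>_def)
        then show ?thesis using \<delta>1(2)[of "y - t"] y greater kt by (simp add: \<delta>_def)
      qed
      moreover have "\<delta> > 0" using \<delta>1(1) \<delta>2(1) t by (simp add: \<delta>_def)
      ultimately show "\<exists>d>0. \<forall>y\<in>UNIV. norm (y - t) < d \<longrightarrow> norm (F y - F t - (y - t) *\<^sub>R f t) \<le> e * norm (y - t)" by blast
    qed
  qed
qed

section \<open>Charts and tangent vectors\<close>

abbreviation chart_img :: "('m, 'n) chart \<Rightarrow> (complex ^ 'n) set"
  where "chart_img c \<equiv> chart_map c ` chart_dom c"

abbreviation transition_deriv ::
    "('m, 'n::finite) chart \<Rightarrow> ('m, 'n) chart \<Rightarrow> 'm \<Rightarrow> complex ^ 'n \<Rightarrow> complex ^ 'n"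
  where "transition_deriv c c' p \<equiv> frechet_derivative (chart_map c' \<circ> chart_inv c) (at (chart_map c p))"

definition cdiff_between ::
    "('m, 'n::finite) chart \<Rightarrow> ('m, 'n) chart \<Rightarrow> ('m \<Rightarrow> 'm) \<Rightarrow> 'm \<Rightarrow> bool"
  where "cdiff_between c c' f p \<longleftrightarrow>
    (\<exists>D. ((chart_map c' \<circ> f \<circ> chart_inv c) has_derivative D) (at (chart_map c p)) \<and> (\<forall>a v. D (a *s v) = a *s D v))"

text \<open>\<open>holomorphic_self_map\<close> is a global notion, but a local flow is known to be
  holomorphic only near one point. This pointwise form can be composed along a trajectory and is
  reassembled in \<open>holomorphic_self_mapI\<close>. Continuity at \<open>p\<close> is demanded
  because \<open>chart_map c' \<circ> f\<close> has arbitrary values where \<open>f\<close> leaves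
  \<open>chart_dom c'\<close>.\<close>

definition cdiff_at ::
    "('m::topological_space, 'n::finite) chart set \<Rightarrow> ('m \<Rightarrow> 'm) \<Rightarrow> 'm \<Rightarrow> bool"
  where "cdiff_at A f p \<longleftrightarrow> (f \<longlongrightarrow> f p) (nhds p) \<and>
    (\<forall>c\<in>A. \<forall>c'\<in>A. p \<in> chart_dom c \<longrightarrow> f p \<in> chart_dom c' \<longrightarrow> cdiff_between c c' f p)"

locale complex_mfd =
  fixes A :: "('m::{t2_space, second_countable_topology}, 'n::finite) chart set"
  assumes mfd: "complex_manifold A"
begin

lemma connected_mfd: "connected (UNIV :: 'm set)"
  using mfd unfolding complex_manifold_def by blast

lemma chart_exists: obtains c where "c \<in> A" "p \<in> chart_dom c"
  using mfd unfolding complex_manifold_def by blast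

lemma chart_at_in: "chart_at A p \<in> A" and chart_at_dom: "p \<in> chart_dom (chart_at A p)"
proof -
  have "\<exists>c. c \<in> A \<and> p \<in> chart_dom c" using chart_exists by metis
  then have "chart_at A p \<in> A \<and> p \<in> chart_dom (chart_at A p)"
    unfolding chart_at_def by (rule someI_ex)
  then show "chart_at A p \<in> A" "p \<in> chart_dom (chart_at A p)" by auto
qed

lemma open_chart_dom: "c \<in> A \<Longrightarrow> open (chart_dom c)"
  and open_chart_img: "c \<in> A \<Longrightarrow> open (chart_img c)"
  and chart_homeo: "c \<in> A \<Longrightarrow> homeomorphism (chart_dom c) (chart_img c) (chart_map c) (chart_inv c)"
  using mfd unfolding complex_manifold_def by blast+

lemma chart_inv_map: "c \<in> A \<Longrightarrow> p \<in> chart_dom c \<Longrightarrow> chart_inv c (chart_map c p) = p"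
  using chart_homeo[of c] by (auto simp: homeomorphism_def)

lemma chart_map_inv: "c \<in> A \<Longrightarrow> x \<in> chart_img c \<Longrightarrow> chart_map c (chart_inv c x) = x"
  using chart_homeo[of c] by (auto simp: homeomorphism_def)

lemma chart_inv_in: "c \<in> A \<Longrightarrow> x \<in> chart_img c \<Longrightarrow> chart_inv c x \<in> chart_dom c"
  by (auto simp: chart_inv_map)

lemma continuous_chart_map: "c \<in> A \<Longrightarrow> continuous_on (chart_dom c) (chart_map c)"
  and continuous_chart_inv: "c \<in> A \<Longrightarrow> continuous_on (chart_img c) (chart_inv c)"
  using chart_homeo by (auto simp: homeomorphism_def)

lemma tendsto_chart_map:
  assumes "c \<in> A" "(f \<longlongrightarrow> p) F" "p \<in> chart_dom c"
  shows "((\<lambda>x. chart_map c (f x)) \<longlongrightarrow> chart_map c p) F"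
proof -
  have "isCont (chart_map c) p"
    using continuous_chart_map open_chart_dom assms continuous_on_eq_continuous_at by blast
  then show ?thesis using assms(2) isCont_tendsto_compose by blast
qed

lemma tendsto_chart_inv:
  assumes "c \<in> A" "(f \<longlongrightarrow> x) F" "x \<in> chart_img c"
  shows "((\<lambda>y. chart_inv c (f y)) \<longlongrightarrow> chart_inv c x) F"
proof -
  have "isCont (chart_inv c) x"
    using continuous_chart_inv open_chart_img assms continuous_on_eq_continuous_at by blast
  then show ?thesis using assms(2) isCont_tendsto_compose by blast
qed

lemma chart_image_eq: "c \<in> A \<Longrightarrow> chart_map c ` (chart_dom c \<inter> W) = chart_img c \<inter> chart_inv c -` W"
  by (auto simp: chart_inv_map)

lemma open_chart_image: "c \<in> A \<Longrightarrow> open W \<Longrightarrow> open (chart_map c ` (chart_dom c \<inter> W))"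
  unfolding chart_image_eq
  by (rule continuous_open_preimage[OF continuous_chart_inv open_chart_img])

lemma chart_cball:
  assumes "c \<in> A" "p \<in> chart_dom c" "open W" "p \<in> W"
  obtains r where "r > 0" "cball (chart_map c p) r \<subseteq> chart_img c" "chart_inv c ` cball (chart_map c p) r \<subseteq> W"
proof -
  have "open (chart_map c ` (chart_dom c \<inter> W))" "chart_map c p \<in> chart_map c ` (chart_dom c \<inter> W)"
    using open_chart_image assms by auto
  then obtain r where "r > 0" "cball (chart_map c p) r \<subseteq> chart_map c ` (chart_dom c \<inter> W)"
    using open_contains_cball by blast
  then show thesis using that[of r] by (auto simp: chart_image_eq[OF assms(1)])
qed

lemma open_chart_preimage: "c \<in> A \<Longrightarrow> open S \<Longrightarrow> open (chart_dom c \<inter> chart_map c -` S)"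
  by (rule continuous_open_preimage[OF continuous_chart_map open_chart_dom])

lemma holomorphic_transition:
  "c \<in> A \<Longrightarrow> c' \<in> A \<Longrightarrow> cholomorphic_on (chart_map c' \<circ> chart_inv c) (chart_map c ` (chart_dom c \<inter> chart_dom c'))"
  using mfd unfolding complex_manifold_def by blast

lemma transition_has_derivative:
  "c \<in> A \<Longrightarrow> c' \<in> A \<Longrightarrow> p \<in> chart_dom c \<Longrightarrow> p \<in> chart_dom c' \<Longrightarrow>
    ((chart_map c' \<circ> chart_inv c) has_derivative transition_deriv c c' p) (at (chart_map c p))"
  by (rule cholomorphic_on_frechet(1)[OF holomorphic_transition]) auto

lemma transition_deriv_smult:
  "c \<in> A \<Longrightarrow> c' \<in> A \<Longrightarrow> p \<in> chart_dom c \<Longrightarrow> p \<in> chart_dom c' \<Longrightarrow>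
    transition_deriv c c' p (a *s v) = a *s transition_deriv c c' p v"
  by (rule cholomorphic_on_frechet(2)[OF holomorphic_transition]) auto

lemma linear_transition_deriv:
  "c \<in> A \<Longrightarrow> c' \<in> A \<Longrightarrow> p \<in> chart_dom c \<Longrightarrow> p \<in> chart_dom c' \<Longrightarrow> linear (transition_deriv c c' p)"
  by (rule has_derivative_linear[OF transition_has_derivative])

text \<open>The cocycle identity of the Jacobians: it makes the family
  \<open>coord_vec A c p a\<close> consistent, hence an element of
  \<open>tangent_space A p\<close>.\<close>

lemma transition_deriv_comp:
  assumes A: "c \<in> A" "c' \<in> A" "c'' \<in> A" and p: "p \<in> chart_dom c" "p \<in> chart_dom c'" "p \<in> chart_dom c''"
  shows "transition_deriv c' c'' p (transition_deriv c c' p v) = transition_deriv c c'' p v"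
proof -
  have 1: "((chart_map c'' \<circ> chart_inv c') has_derivative transition_deriv c' c'' p) (at ((chart_map c' \<circ> chart_inv c) (chart_map c p)))"
    using transition_has_derivative[OF A(2,3) p(2,3)] by (simp add: chart_inv_map A p)
  have 2: "((\<lambda>x. (chart_map c'' \<circ> chart_inv c') ((chart_map c' \<circ> chart_inv c) x)) has_derivative
      (\<lambda>v. transition_deriv c' c'' p (transition_deriv c c' p v))) (at (chart_map c p))"
    by (rule has_derivative_compose[OF transition_has_derivative[OF A(1,2) p(1,2)] 1])
  have "((chart_map c'' \<circ> chart_inv c) has_derivative
      (\<lambda>v. transition_deriv c' c'' p (transition_deriv c c' p v))) (at (chart_map c p))"
  proof (rule has_derivative_transform_within_open[OF 2 open_chart_image[OF A(1) open_chart_dom[OF A(2)]]])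
    show "chart_map c p \<in> chart_map c ` (chart_dom c \<inter> chart_dom c')" using p by auto
    fix x assume "x \<in> chart_map c ` (chart_dom c \<inter> chart_dom c')"
    then show "(chart_map c'' \<circ> chart_inv c') ((chart_map c' \<circ> chart_inv c) x) = (chart_map c'' \<circ> chart_inv c) x"
      by (auto simp: chart_inv_map A)
  qed
  then have "(\<lambda>v. transition_deriv c' c'' p (transition_deriv c c' p v)) = transition_deriv c c'' p"
    by (rule frechet_derivative_at)
  then show ?thesis by metis
qed

lemma transition_deriv_self:
  assumes "c \<in> A" "p \<in> chart_dom c"
  shows "transition_deriv c c p v = v"
proof -
  have "((chart_map c \<circ> chart_inv c) has_derivative (\<lambda>v. v)) (at (chart_map c p))"
    by (rule has_derivative_transform_within_open[OF has_derivative_ident open_chart_img])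
       (use assms in \<open>auto simp: chart_inv_map\<close>)
  then show ?thesis using frechet_derivative_at by metis
qed

lemma coord_vec_apply:
  "c' \<in> A \<Longrightarrow> p \<in> chart_dom c' \<Longrightarrow> coord_vec A c p a c' = transition_deriv c c' p a"
  by (simp add: coord_vec_def)

lemma coord_vec_self: "c \<in> A \<Longrightarrow> p \<in> chart_dom c \<Longrightarrow> coord_vec A c p a c = a"
  by (simp add: coord_vec_def transition_deriv_self)

lemma coord_vec_in_tangent_space:
  assumes "c \<in> A" "p \<in> chart_dom c"
  shows "coord_vec A c p a \<in> tangent_space A p"
  unfolding tangent_space_def
proof (safe, rule ext)
  fix c' c'' assume c': "c' \<in> A" "p \<in> chart_dom c'"
  show "coord_vec A c p a c'' = coord_vec A c' p (coord_vec A c p a c') c''"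
    by (cases "c'' \<in> A \<and> p \<in> chart_dom c''")
       (use assms c' in \<open>auto simp: coord_vec_apply transition_deriv_comp coord_vec_def\<close>)
qed

lemma tangent_coord_vec:
  "v \<in> tangent_space A p \<Longrightarrow> c \<in> A \<Longrightarrow> p \<in> chart_dom c \<Longrightarrow> coord_vec A c p (v c) = v"
  unfolding tangent_space_def by auto

lemma tangent_change_chart:
  assumes "v \<in> tangent_space A p" "c \<in> A" "p \<in> chart_dom c" "c' \<in> A" "p \<in> chart_dom c'"
  shows "transition_deriv c c' p (v c) = v c'"
  using tangent_coord_vec[OF assms(1-3)] coord_vec_apply[OF assms(4,5), of c "v c"] by simp

text \<open>Continuity at \<open>t\<close> keeps the curve in both chart domains near
  \<open>t\<close>; there the second coordinate curve is the transition map applied to the first,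
  and the meaningless values of \<open>chart_map\<close> outside its domain cannot
  intervene.\<close>

lemma curve_change_chart:
  assumes c: "c \<in> A" "\<gamma> t \<in> chart_dom c" and c': "c' \<in> A" "\<gamma> t \<in> chart_dom c'"
    and t: "t \<in> S" and cont: "continuous (at t within S) \<gamma>"
    and d: "((\<lambda>\<tau>. chart_map c (\<gamma> \<tau>)) has_vector_derivative v) (at t within S)"
  shows "((\<lambda>\<tau>. chart_map c' (\<gamma> \<tau>)) has_vector_derivative transition_deriv c c' (\<gamma> t) v) (at t within S)"
proof -
  have "((\<lambda>\<tau>. (chart_map c' \<circ> chart_inv c) (chart_map c (\<gamma> \<tau>))) has_derivative
      (\<lambda>h. transition_deriv c c' (\<gamma> t) (h *\<^sub>R v))) (at t within S)"
    by (rule has_derivative_compose[OF d[unfolded has_vector_derivative_def] transition_has_derivative[OF c(1) c'(1) c(2) c'(2)]])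
  moreover have "\<forall>\<^sub>F \<tau> in at t within S. \<gamma> \<tau> \<in> chart_dom c \<inter> chart_dom c'"
    using cont unfolding continuous_within
    by (rule topological_tendstoD) (use open_chart_dom[of c] open_chart_dom[of c'] c c' in auto)
  then have "\<forall>\<^sub>F \<tau> in at t within S. (chart_map c' \<circ> chart_inv c) (chart_map c (\<gamma> \<tau>)) = chart_map c' (\<gamma> \<tau>)"
    by eventually_elim (auto simp: chart_inv_map c)
  ultimately have "((\<lambda>\<tau>. chart_map c' (\<gamma> \<tau>)) has_derivative (\<lambda>h. transition_deriv c c' (\<gamma> t) (h *\<^sub>R v))) (at t within S)"
    by (rule has_derivative_transform_eventually) (use c t in \<open>auto simp: chart_inv_map\<close>)
  then show ?thesis
    unfolding has_vector_derivative_def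
    by (simp add: linear_cmul[OF linear_transition_deriv[OF c(1) c'(1) c(2) c'(2)]])
qed

lemma has_velocity_chartI:
  assumes c: "c \<in> A" "\<gamma> t \<in> chart_dom c" and t: "t \<in> S" and cont: "continuous (at t within S) \<gamma>"
    and v: "v \<in> tangent_space A (\<gamma> t)"
    and d: "((\<lambda>\<tau>. chart_map c (\<gamma> \<tau>)) has_vector_derivative v c) (at t within S)"
  shows "has_velocity A \<gamma> v t S"
  unfolding has_velocity_def
proof (intro conjI ballI impI cont)
  fix c' assume c': "c' \<in> A" "\<gamma> t \<in> chart_dom c'"
  show "((\<lambda>\<tau>. chart_map c' (\<gamma> \<tau>)) has_vector_derivative v c') (at t within S)"
    using curve_change_chart[OF c c' t cont d] tangent_change_chart[OF v c c'] by simp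
qed

section \<open>Complex differentiability at a point\<close>

lemma cdiff_between_compose:
  assumes c: "c \<in> A" "p \<in> chart_dom c" and c': "c' \<in> A" "f p \<in> chart_dom c'" and c'': "c'' \<in> A"
    and f: "(f \<longlongrightarrow> f p) (nhds p)" "cdiff_between c c' f p" and g: "cdiff_between c' c'' g (f p)"
  shows "cdiff_between c c'' (g \<circ> f) p"
proof -
  obtain D where D: "((chart_map c' \<circ> f \<circ> chart_inv c) has_derivative D) (at (chart_map c p))" "\<And>a v. D (a *s v) = a *s D v"
    using f(2) unfolding cdiff_between_def by blast
  obtain E where E: "((chart_map c'' \<circ> g \<circ> chart_inv c') has_derivative E) (at (chart_map c' (f p)))" "\<And>a v. E (a *s v) = a *s E v"
    using g unfolding cdiff_between_def by blast
  have E': "((chart_map c'' \<circ> g \<circ> chart_inv c') has_derivative E) (at ((chart_map c' \<circ> f \<circ> chart_inv c) (chart_map c p)))"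
    using E(1) by (simp add: chart_inv_map c)
  have *: "((\<lambda>x. (chart_map c'' \<circ> g \<circ> chart_inv c') ((chart_map c' \<circ> f \<circ> chart_inv c) x)) has_derivative (\<lambda>v. E (D v))) (at (chart_map c p))"
    by (rule has_derivative_compose[OF D(1) E'])
  have "\<forall>\<^sub>F q in nhds p. f q \<in> chart_dom c'"
    using f(1) c' open_chart_dom by (simp add: topological_tendstoD)
  then obtain W where W: "open W" "p \<in> W" "\<And>q. q \<in> W \<Longrightarrow> f q \<in> chart_dom c'"
    unfolding eventually_nhds by blast
  have "((chart_map c'' \<circ> (g \<circ> f) \<circ> chart_inv c) has_derivative (\<lambda>v. E (D v))) (at (chart_map c p))"
  proof (rule has_derivative_transform_within_open[OF * open_chart_image[OF c(1) W(1)]])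
    show "chart_map c p \<in> chart_map c ` (chart_dom c \<inter> W)" using c W by auto
    fix x assume "x \<in> chart_map c ` (chart_dom c \<inter> W)"
    then show "(chart_map c'' \<circ> g \<circ> chart_inv c') ((chart_map c' \<circ> f \<circ> chart_inv c) x) = (chart_map c'' \<circ> (g \<circ> f) \<circ> chart_inv c) x"
      using W(3) by (auto simp: chart_inv_map c c')
  qed
  then show ?thesis unfolding cdiff_between_def using D(2) E(2) by (intro exI[of _ "\<lambda>v. E (D v)"]) auto
qed

lemma cdiff_between_id:
  assumes c: "c \<in> A" "p \<in> chart_dom c" and c': "c' \<in> A" "p \<in> chart_dom c'"
  shows "cdiff_between c c' id p"
  unfolding cdiff_between_def
  using transition_has_derivative[OF c(1) c'(1) c(2) c'(2)] transition_deriv_smult[OF c(1) c'(1) c(2) c'(2)]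
  by (auto simp: o_assoc[symmetric])

text \<open>One pair of charts suffices: composing with the identity on both sides, read in two
  different charts, reaches every other pair.\<close>

lemma cdiff_atI:
  assumes f: "(f \<longlongrightarrow> f p) (nhds p)" and c: "c \<in> A" "p \<in> chart_dom c" and c': "c' \<in> A" "f p \<in> chart_dom c'"
    and d: "cdiff_between c c' f p"
  shows "cdiff_at A f p"
  unfolding cdiff_at_def
proof (intro conjI ballI impI f)
  fix e e' assume e: "e \<in> A" "e' \<in> A" "p \<in> chart_dom e" "f p \<in> chart_dom e'"
  have id: "(id \<longlongrightarrow> id p) (nhds p)" by (simp add: filterlim_ident id_def)
  have 1: "cdiff_between e c' (f \<circ> id) p"
    by (rule cdiff_between_compose[OF e(1,3) c(1) _ c'(1) id]) (use c e d cdiff_between_id in auto)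
  have "cdiff_between e e' (id \<circ> f) p"
    by (rule cdiff_between_compose[OF e(1,3) c' e(2) f]) (use 1 cdiff_between_id[OF c' e(2,4)] in auto)
  then show "cdiff_between e e' f p" by simp
qed

lemma cdiff_at_compose:
  assumes "cdiff_at A f p" "cdiff_at A g (f p)"
  shows "cdiff_at A (g \<circ> f) p"
proof -
  have lim: "(f \<longlongrightarrow> f p) (nhds p)" "(g \<longlongrightarrow> g (f p)) (nhds (f p))" using assms unfolding cdiff_at_def by auto
  show ?thesis
  proof (rule cdiff_atI[where c = "chart_at A p" and c' = "chart_at A (g (f p))"])
    show "((g \<circ> f) \<longlongrightarrow> (g \<circ> f) p) (nhds p)"
      using filterlim_compose[OF lim(2,1)] by (simp add: o_def)
    show "cdiff_between (chart_at A p) (chart_at A (g (f p))) (g \<circ> f) p"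
      by (rule cdiff_between_compose[where c' = "chart_at A (f p)"])
         (use assms chart_at_in chart_at_dom in \<open>auto simp: cdiff_at_def\<close>)
  qed (auto simp: chart_at_in chart_at_dom)
qed

lemma cdiff_at_cong:
  assumes f: "cdiff_at A f p" and W: "open W" "p \<in> W" "\<And>q. q \<in> W \<Longrightarrow> f q = g q"
  shows "cdiff_at A g p"
  unfolding cdiff_at_def
proof (intro conjI ballI impI)
  have "\<forall>\<^sub>F q in nhds p. f q = g q" using W eventually_nhds by blast
  then show "(g \<longlongrightarrow> g p) (nhds p)"
    using f W tendsto_cong[of f g] unfolding cdiff_at_def by force
  fix c c' assume c: "c \<in> A" "c' \<in> A" "p \<in> chart_dom c" "g p \<in> chart_dom c'"
  then have "cdiff_between c c' f p" using f W unfolding cdiff_at_def by auto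
  then obtain D where D: "((chart_map c' \<circ> f \<circ> chart_inv c) has_derivative D) (at (chart_map c p))" "\<And>a v. D (a *s v) = a *s D v"
    unfolding cdiff_between_def by blast
  have "((chart_map c' \<circ> g \<circ> chart_inv c) has_derivative D) (at (chart_map c p))"
    by (rule has_derivative_transform_within_open[OF D(1) open_chart_image[OF c(1) W(1)]])
       (use W c in \<open>auto simp: chart_inv_map\<close>)
  then show "cdiff_between c c' g p" unfolding cdiff_between_def using D(2) by blast
qed

lemma holomorphic_self_mapI:
  assumes "\<And>p. cdiff_at A f p"
  shows "holomorphic_self_map A f"
  unfolding holomorphic_self_map_def
proof (intro conjI ballI)
  show "continuous_on UNIV f"
    using assms unfolding cdiff_at_def
    by (auto simp: continuous_on_eq_continuous_at continuous_at tendsto_nhds_iff)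
  fix c c' assume c: "c \<in> A" "c' \<in> A"
  show "cholomorphic_on (chart_map c' \<circ> f \<circ> chart_inv c) (chart_map c ` (chart_dom c \<inter> f -` chart_dom c'))"
    unfolding cholomorphic_on_def
  proof
    fix x assume "x \<in> chart_map c ` (chart_dom c \<inter> f -` chart_dom c')"
    then obtain p where p: "p \<in> chart_dom c" "f p \<in> chart_dom c'" "x = chart_map c p" by auto
    then have "cdiff_between c c' f p" using assms c unfolding cdiff_at_def by blast
    then show "\<exists>D. (chart_map c' \<circ> f \<circ> chart_inv c has_derivative D) (at x) \<and> (\<forall>a v. D (a *s v) = a *s D v)"
      unfolding cdiff_between_def p(3) .
  qed
qed

text \<open>\<open>differential2\<close> uses charts picked by \<open>SOME\<close>, separately at
  each point, whereas the chain rule along a curve requires charts that stay fixed for a while. Off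
  the diagonal \<open>F\<close> is differentiable, and the derivatives of the coordinate changes on
  both factors are absorbed by the change of tangent coordinates.\<close>

lemma differential2_in_charts:
  assumes C1: "C1_off_Diag A F" and zw: "z \<noteq> w"
    and c: "c \<in> A" "z \<in> chart_dom c" and c': "c' \<in> A" "w \<in> chart_dom c'"
    and u: "u \<in> tangent_space A z" and v: "v \<in> tangent_space A w"
  shows "differential2 A F z w u v =
    frechet_derivative (\<lambda>(x, y). F (chart_inv c x) (chart_inv c' y)) (at (chart_map c z, chart_map c' w)) (u c, v c')"
proof -
  define e e' where "e = chart_at A z" and "e' = chart_at A w"
  have e: "e \<in> A" "z \<in> chart_dom e" and e': "e' \<in> A" "w \<in> chart_dom e'"
    by (simp_all add: e_def e'_def chart_at_in chart_at_dom)
  let ?F = "\<lambda>c c' (x, y). F (chart_inv c x) (chart_inv c' y)"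
  let ?D = "frechet_derivative (?F c c') (at (chart_map c z, chart_map c' w))"
  have "Ck_on 1 (?F c c') {(x, y). x \<in> chart_img c \<and> y \<in> chart_img c' \<and> chart_inv c x \<noteq> chart_inv c' y}"
    using C1 c c' unfolding C1_off_Diag_def by blast
  then have "?F c c' differentiable at (chart_map c z, chart_map c' w)"
    using c c' zw by (auto simp: chart_inv_map)
  then have D: "(?F c c' has_derivative ?D) (at (chart_map c z, chart_map c' w))"
    using frechet_derivative_works by blast
  have "((\<lambda>p. ((chart_map c \<circ> chart_inv e) (fst p), (chart_map c' \<circ> chart_inv e') (snd p))) has_derivative
      (\<lambda>q. (transition_deriv e c z (fst q), transition_deriv e' c' w (snd q)))) (at (chart_map e z, chart_map e' w))"
  proof (rule has_derivative_Pair)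
    show "((\<lambda>p. (chart_map c \<circ> chart_inv e) (fst p)) has_derivative (\<lambda>q. transition_deriv e c z (fst q))) (at (chart_map e z, chart_map e' w))"
      by (rule has_derivative_compose[OF has_derivative_fst[OF has_derivative_ident]])
         (use transition_has_derivative[OF e(1) c(1) e(2) c(2)] in \<open>simp del: o_apply\<close>)
    show "((\<lambda>p. (chart_map c' \<circ> chart_inv e') (snd p)) has_derivative (\<lambda>q. transition_deriv e' c' w (snd q))) (at (chart_map e z, chart_map e' w))"
      by (rule has_derivative_compose[OF has_derivative_snd[OF has_derivative_ident]])
         (use transition_has_derivative[OF e'(1) c'(1) e'(2) c'(2)] in \<open>simp del: o_apply\<close>)
  qed
  then have *: "((\<lambda>p. ?F c c' ((chart_map c \<circ> chart_inv e) (fst p), (chart_map c' \<circ> chart_inv e') (snd p))) has_derivative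
      (\<lambda>q. ?D (transition_deriv e c z (fst q), transition_deriv e' c' w (snd q)))) (at (chart_map e z, chart_map e' w))"
    by (rule has_derivative_compose) (use D in \<open>simp add: chart_inv_map e e'\<close>)
  have "(?F e e' has_derivative (\<lambda>q. ?D (transition_deriv e c z (fst q), transition_deriv e' c' w (snd q)))) (at (chart_map e z, chart_map e' w))"
  proof (rule has_derivative_transform_within_open[OF *])
    show "open (chart_map e ` (chart_dom e \<inter> chart_dom c) \<times> chart_map e' ` (chart_dom e' \<inter> chart_dom c'))"
      by (intro open_Times open_chart_image open_chart_dom c c' e e')
    show "(chart_map e z, chart_map e' w) \<in> chart_map e ` (chart_dom e \<inter> chart_dom c) \<times> chart_map e' ` (chart_dom e' \<inter> chart_dom c')"
      using c c' e e' by auto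
  qed (auto simp: chart_inv_map e e' c c')
  then have eq: "(\<lambda>q. ?D (transition_deriv e c z (fst q), transition_deriv e' c' w (snd q))) = frechet_derivative (?F e e') (at (chart_map e z, chart_map e' w))"
    by (rule frechet_derivative_at)
  have "frechet_derivative (?F e e') (at (chart_map e z, chart_map e' w)) (u e, v e') =
      ?D (transition_deriv e c z (u e), transition_deriv e' c' w (v e'))"
    using fun_cong[OF eq, of "(u e, v e')"] by (simp only: fst_conv snd_conv)
  also have "\<dots> = ?D (u c, v c')"
    using tangent_change_chart[OF u e c] tangent_change_chart[OF v e' c'] by simp
  finally show ?thesis by (simp add: differential2_def Let_def e_def e'_def)
qed

end

section \<open>The Hermitian distance\<close>

text \<open>The set where \<open>P\<close> holds and its complement are both open. Connectedness of
  the manifold enters in this form three times: for finiteness of the Hermitian distance, for the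
  existence of chains of discs, and for global existence.\<close>

lemma connected_UNIV_propagate:
  assumes "connected (UNIV :: 'a::topological_space set)" "P a"
    and loc: "\<And>x. \<exists>U. open U \<and> x \<in> U \<and> (\<forall>y\<in>U. P x \<longleftrightarrow> P y)"
  shows "P (b :: 'a)"
proof -
  have "open {x. P x}" "open {x. \<not> P x}"
    unfolding open_subopen[of "{x. P x}"] open_subopen[of "{x. \<not> P x}"] using loc by fast+
  then have "{x. P x} = {} \<or> {x. \<not> P x} = {}"
    using connectedD[OF assms(1), of "{x. P x}" "{x. \<not> P x}"] by blast
  then show ?thesis using assms(2) by blast
qed

text \<open>If the right-hand side is finite, \<open>f\<close> is Lebesgue integrable and the two
  integrals agree; otherwise nothing is to be shown. It links the gauge integral of the fundamental
  theorem of calculus with the length of a curve, which lies in \<open>ennreal\<close>.\<close>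

lemma norm_integral_le_nn_integral:
  fixes f :: "real \<Rightarrow> 'a::euclidean_space"
  assumes meas: "f \<in> borel_measurable borel" and I: "(f has_integral I) UNIV"
  shows "ennreal (norm I) \<le> (\<integral>\<^sup>+x. ennreal (norm (f x)) \<partial>lborel)"
proof (cases "(\<integral>\<^sup>+x. ennreal (norm (f x)) \<partial>lborel) < \<infinity>")
  case True
  then have int: "integrable lborel f" using meas by (intro integrableI_bounded) auto
  have "I = integral\<^sup>L lborel f"
    using has_integral_unique[OF I has_integral_integral_lborel[OF int]] .
  then show ?thesis using integral_norm_bound_ennreal[OF int] by simp
next
  case False
  then show ?thesis by (simp add: not_less top_unique)
qed

lemma ennreal_le_add_INF:
  fixes f :: "'a \<Rightarrow> ennreal"
  assumes "\<And>i. i \<in> I \<Longrightarrow> a \<le> b + f i"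
  shows "a \<le> b + (INF i\<in>I. f i)"
proof (rule ennreal_le_epsilon)
  fix e :: real assume e: "0 < e" and "b + (INF i\<in>I. f i) < top"
  then have "(INF i\<in>I. f i) < top" using ennreal_add_less_top by blast
  then have fin: "(INF i\<in>I. f i) \<noteq> \<infinity>" by (simp only: less_top infinity_ennreal_def not_False_eq_True)
  have "(INF i\<in>I. f i) + 0 < (INF i\<in>I. f i) + ennreal e"
    unfolding ennreal_add_left_cancel_less using e fin by simp
  then have "(INF i\<in>I. f i) < (INF i\<in>I. f i) + ennreal e" by (simp only: add_0_right)
  then obtain i where i: "i \<in> I" "f i < (INF i\<in>I. f i) + ennreal e" unfolding INF_less_iff by blast
  have "a \<le> b + f i" by (rule assms[OF i(1)])
  also have "\<dots> \<le> b + ((INF i\<in>I. f i) + ennreal e)" using i(2) by (intro add_left_mono) simp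
  finally show "a \<le> b + (INF i\<in>I. f i) + ennreal e" by (simp add: add.assoc)
qed

locale hermitian_mfd = complex_mfd A
  for A :: "('m::{t2_space, second_countable_topology}, 'n::finite) chart set" +
  fixes h :: "'m \<Rightarrow> ('m, 'n) tvec \<Rightarrow> ('m, 'n) tvec \<Rightarrow> complex"
  assumes herm: "hermitian_metric A h"
begin

section \<open>The Hermitian norm in a chart\<close>

definition chart_norm :: "('m, 'n) chart \<Rightarrow> complex ^ 'n \<Rightarrow> complex ^ 'n \<Rightarrow> real"
  where "chart_norm c x v = hnorm h (chart_inv c x) (coord_vec A c (chart_inv c x) v)"

lemma coord_vec_add:
  assumes "c \<in> A" "p \<in> chart_dom c"
  shows "coord_vec A c p (a + b) = (\<lambda>c'. coord_vec A c p a c' + coord_vec A c p b c')"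
  unfolding coord_vec_def using linear_add[OF linear_transition_deriv] assms by (intro ext) auto

lemma coord_vec_smult:
  assumes "c \<in> A" "p \<in> chart_dom c"
  shows "coord_vec A c p (s *s a) = (\<lambda>c'. s *s coord_vec A c p a c')"
  unfolding coord_vec_def using transition_deriv_smult assms by (intro ext) auto

lemma
  assumes c: "c \<in> A" "p \<in> chart_dom c"
  shows herm_add: "h p (coord_vec A c p (a + b)) (coord_vec A c p w) =
      h p (coord_vec A c p a) (coord_vec A c p w) + h p (coord_vec A c p b) (coord_vec A c p w)"
    and herm_smult: "h p (coord_vec A c p (s *s a)) (coord_vec A c p w) = s * h p (coord_vec A c p a) (coord_vec A c p w)"
    and herm_cnj: "h p (coord_vec A c p b) (coord_vec A c p a) = cnj (h p (coord_vec A c p a) (coord_vec A c p b))"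
  unfolding coord_vec_add[OF c] coord_vec_smult[OF c]
  using herm coord_vec_in_tangent_space[OF c] unfolding hermitian_metric_def by blast+

lemma herm_sum:
  assumes c: "c \<in> A" "p \<in> chart_dom c" and "finite I"
  shows "h p (coord_vec A c p (\<Sum>i\<in>I. f i)) (coord_vec A c p w) = (\<Sum>i\<in>I. h p (coord_vec A c p (f i)) (coord_vec A c p w))"
  using assms(3)
proof (induction I rule: finite_induct)
  case empty
  show ?case using herm_smult[OF c, of 0 0 w] by simp
qed (simp add: herm_add[OF c])

text \<open>\<open>hermitian_metric\<close> provides regularity only for pairs of constant
  coordinate vectors. The expansion by the coefficient matrix separates the point from the vector,
  so that the norm becomes jointly continuous.\<close>

lemma herm_expand:
  assumes c: "c \<in> A" "p \<in> chart_dom c"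
  shows "h p (coord_vec A c p v) (coord_vec A c p v) =
    (\<Sum>i\<in>UNIV. \<Sum>j\<in>UNIV. v $ i * (cnj (v $ j) * h p (coord_vec A c p (axis i 1)) (coord_vec A c p (axis j 1))))"
proof -
  have first: "h p (coord_vec A c p v) (coord_vec A c p w) = (\<Sum>i\<in>UNIV. v $ i * h p (coord_vec A c p (axis i 1)) (coord_vec A c p w))" for v w
    by (subst basis_expansion[of v, symmetric]) (simp add: herm_sum[OF c] herm_smult[OF c])
  have "h p (coord_vec A c p a) (coord_vec A c p v) = (\<Sum>j\<in>UNIV. cnj (v $ j) * h p (coord_vec A c p a) (coord_vec A c p (axis j 1)))" for a
    by (subst herm_cnj[OF c, of a v], subst first) (simp add: herm_cnj[OF c, of a, symmetric])
  then show ?thesis by (subst first) (simp add: sum_distrib_left)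
qed

lemma chart_norm_scaleR:
  assumes c: "c \<in> A" "x \<in> chart_img c"
  shows "chart_norm c x (s *\<^sub>R v) = \<bar>s\<bar> * chart_norm c x v"
proof -
  let ?p = "chart_inv c x"
  have p: "?p \<in> chart_dom c" using chart_inv_in c by blast
  have "h ?p (coord_vec A c ?p (of_real s *s v)) (coord_vec A c ?p (of_real s *s v)) = of_real (s\<^sup>2) * h ?p (coord_vec A c ?p v) (coord_vec A c ?p v)"
    by (simp add: herm_expand[OF c(1) p] sum_distrib_left power2_eq_square mult_ac)
  then show ?thesis
    by (simp add: chart_norm_def hnorm_def vector_smult_of_real real_sqrt_mult)
qed

lemma continuous_on_chart_norm:
  assumes c: "c \<in> A"
  shows "continuous_on (chart_img c \<times> UNIV) (\<lambda>(x, v). chart_norm c x v)"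
proof -
  let ?H = "\<lambda>i j x. h (chart_inv c x) (coord_vec A c (chart_inv c x) (axis i 1)) (coord_vec A c (chart_inv c x) (axis j 1))"
  have H: "continuous_on (chart_img c) (?H i j)" for i j
  proof -
    have "Cinf_on (?H i j) (chart_img c)" using herm c unfolding hermitian_metric_def by blast
    then have "Ck_on 0 (?H i j) (chart_img c)" unfolding Cinf_on_def by blast
    then show ?thesis by simp
  qed
  have "continuous_on (chart_img c \<times> UNIV)
     (\<lambda>z. sqrt (Re (\<Sum>i\<in>UNIV. \<Sum>j\<in>UNIV. snd z $ i * (cnj (snd z $ j) * ?H i j (fst z)))))"
    by (intro continuous_intros continuous_on_compose2[OF H]) auto
  then show ?thesis
    by (rule continuous_on_eq) (auto simp: chart_norm_def hnorm_def herm_expand[OF c] chart_inv_map c)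
qed

lemma chart_norm_pos:
  assumes c: "c \<in> A" "x \<in> chart_img c" and v: "v \<noteq> 0"
  shows "chart_norm c x v > 0"
proof -
  have p: "chart_inv c x \<in> chart_dom c" using chart_inv_in c by blast
  have "coord_vec A c (chart_inv c x) v \<noteq> (\<lambda>c. 0)"
    using coord_vec_self[OF c(1) p, of v] v by (metis)
  then have "0 < Re (h (chart_inv c x) (coord_vec A c (chart_inv c x) v) (coord_vec A c (chart_inv c x) v))"
    using herm coord_vec_in_tangent_space[OF c(1) p] unfolding hermitian_metric_def by blast
  then show ?thesis by (simp add: chart_norm_def hnorm_def)
qed

text \<open>Extrema of the continuous norm on the compact set \<open>K \<times> sphere 0 1\<close>,
  extended by homogeneity. Definiteness of the metric makes the lower constant positive.\<close>

lemma chart_norm_bounds: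
  assumes c: "c \<in> A" and K: "compact K" "K \<subseteq> chart_img c"
  obtains m M where "m > 0" "M > 0" "\<And>x v. x \<in> K \<Longrightarrow> m * norm v \<le> chart_norm c x v"
    "\<And>x v. x \<in> K \<Longrightarrow> chart_norm c x v \<le> M * norm v"
proof (cases "K = {}")
  case True
  then show thesis using that[of 1 1] by auto
next
  case False
  let ?S = "K \<times> sphere (0 :: complex ^ 'n) 1"
  have "(axis undefined 1 :: complex ^ 'n) \<in> sphere 0 1" by simp
  then have S: "compact ?S" "?S \<noteq> {}" using K False by (auto intro: compact_Times)
  have cont: "continuous_on ?S (\<lambda>(x, v). chart_norm c x v)"
    by (rule continuous_on_subset[OF continuous_on_chart_norm[OF c]]) (use K in auto)
  obtain a where a: "a \<in> ?S" "\<And>z. z \<in> ?S \<Longrightarrow> (\<lambda>(x, v). chart_norm c x v) a \<le> (\<lambda>(x, v). chart_norm c x v) z"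
    using continuous_attains_inf[OF S cont] by blast
  obtain b where b: "b \<in> ?S" "\<And>z. z \<in> ?S \<Longrightarrow> (\<lambda>(x, v). chart_norm c x v) z \<le> (\<lambda>(x, v). chart_norm c x v) b"
    using continuous_attains_sup[OF S cont] by blast
  let ?m = "(\<lambda>(x, v). chart_norm c x v) a" and ?M = "(\<lambda>(x, v). chart_norm c x v) b"
  have pos: "?m > 0" "?M > 0" using a(1) b(1) K(2) by (auto intro!: chart_norm_pos[OF c])
  have bd: "?m * norm v \<le> chart_norm c x v \<and> chart_norm c x v \<le> ?M * norm v" if x: "x \<in> K" for x v
  proof (cases "v = 0")
    case True
    then show ?thesis using chart_norm_scaleR[OF c, of x 0 v] x K by auto
  next
    case False
    define w where "w = (1 / norm v) *\<^sub>R v"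
    have w: "(x, w) \<in> ?S" using x False by (simp add: w_def)
    have "chart_norm c x (norm v *\<^sub>R w) = norm v * chart_norm c x w"
      using chart_norm_scaleR[OF c, of x "norm v" w] x K by auto
    then have "chart_norm c x v = norm v * chart_norm c x w" using False by (simp add: w_def)
    then show ?thesis
      using a(2)[OF w] b(2)[OF w] by (auto simp: mult.commute[of _ "norm v"] intro!: mult_left_mono)
  qed
  show thesis by (rule that[OF pos]) (use bd in auto)
qed

section \<open>Speed and length of piecewise C1 curves\<close>

definition speed :: "(real \<Rightarrow> 'm) \<Rightarrow> real \<Rightarrow> real"
  where "speed \<gamma> t = hnorm h (\<gamma> t) (velocity A \<gamma> t)"

text \<open>At these times \<open>velocity\<close> is a genuine tangent vector and not a default
  value of \<open>vector_derivative\<close>. One chart decides this for all charts, by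
  \<open>curve_change_chart\<close>.\<close>

definition regular_at :: "(real \<Rightarrow> 'm) \<Rightarrow> real \<Rightarrow> bool"
  where "regular_at \<gamma> t \<longleftrightarrow> isCont \<gamma> t \<and>
    (\<exists>c\<in>A. \<gamma> t \<in> chart_dom c \<and> (\<lambda>\<tau>. chart_map c (\<gamma> \<tau>)) differentiable at t)"

lemma velocity_in_chart:
  assumes c: "c \<in> A" "\<gamma> t \<in> chart_dom c" and cont: "isCont \<gamma> t"
    and d: "((\<lambda>\<tau>. chart_map c (\<gamma> \<tau>)) has_vector_derivative v) (at t)"
  shows "velocity A \<gamma> t = coord_vec A c (\<gamma> t) v"
proof
  fix c'
  show "velocity A \<gamma> t c' = coord_vec A c (\<gamma> t) v c'"
    using vector_derivative_at[OF curve_change_chart[of c \<gamma> t c' UNIV v]] c cont d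
    by (auto simp: velocity_def coord_vec_def)
qed

lemma speed_in_chart:
  assumes "c \<in> A" "\<gamma> t \<in> chart_dom c" "isCont \<gamma> t"
    "((\<lambda>\<tau>. chart_map c (\<gamma> \<tau>)) has_vector_derivative v) (at t)"
  shows "speed \<gamma> t = chart_norm c (chart_map c (\<gamma> t)) v"
  using velocity_in_chart[of c \<gamma> t v, OF assms] assms by (simp add: speed_def chart_norm_def chart_inv_map)

text \<open>Used with \<open>\<alpha> = 2\<close> for concatenation and
  \<open>\<alpha> = - 1\<close> for reversal. Agreement is asked for on an open set \<open>W\<close>
  only, since a concatenated curve has a separate formula on each half.\<close>

lemma affine_reparametrization:
  assumes \<gamma>: "regular_at \<gamma> (\<alpha> * t + \<beta>)"
    and W: "open W" "t \<in> W" "\<And>\<tau>. \<tau> \<in> W \<Longrightarrow> \<eta> \<tau> = \<gamma> (\<alpha> * \<tau> + \<beta>)"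
  shows "speed \<eta> t = \<bar>\<alpha>\<bar> * speed \<gamma> (\<alpha> * t + \<beta>)"
proof -
  obtain c where c: "c \<in> A" "\<gamma> (\<alpha> * t + \<beta>) \<in> chart_dom c" "(\<lambda>\<tau>. chart_map c (\<gamma> \<tau>)) differentiable at (\<alpha> * t + \<beta>)"
    and cont: "isCont \<gamma> (\<alpha> * t + \<beta>)" using \<gamma> unfolding regular_at_def by blast
  obtain v where v: "((\<lambda>\<tau>. chart_map c (\<gamma> \<tau>)) has_vector_derivative v) (at (\<alpha> * t + \<beta>))"
    using c(3) vector_derivative_works by blast
  have "((\<lambda>\<tau>. \<alpha> * \<tau> + \<beta>) has_vector_derivative \<alpha>) (at t)" by (auto intro!: derivative_eq_intros simp: has_vector_derivative_def)
  from vector_diff_chain_at[OF this v]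
  have "((\<lambda>\<tau>. chart_map c (\<gamma> (\<alpha> * \<tau> + \<beta>))) has_vector_derivative \<alpha> *\<^sub>R v) (at t)" by (simp add: o_def)
  then have d: "((\<lambda>\<tau>. chart_map c (\<eta> \<tau>)) has_vector_derivative \<alpha> *\<^sub>R v) (at t)"
    by (rule has_vector_derivative_transform_within_open[OF _ W(1,2)]) (simp add: W(3))
  have "isCont (\<lambda>\<tau>. \<gamma> (\<alpha> * \<tau> + \<beta>)) t"
    by (rule isCont_o2[where f = "\<lambda>\<tau>. \<alpha> * \<tau> + \<beta>" and g = \<gamma>, OF _ cont]) (intro continuous_intros)
  note ic = this
  have ev: "\<forall>\<^sub>F \<tau> in nhds t. \<gamma> (\<alpha> * \<tau> + \<beta>) = \<eta> \<tau>"
    unfolding eventually_nhds using W by (intro exI[of _ W]) auto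
  have "isCont \<eta> t" by (rule isCont_cong[THEN iffD1, OF ev ic])
  have "speed \<eta> t = chart_norm c (chart_map c (\<eta> t)) (\<alpha> *\<^sub>R v)"
    by (rule speed_in_chart[OF c(1) _ \<open>isCont \<eta> t\<close> d]) (use W c in auto)
  also have "\<dots> = \<bar>\<alpha>\<bar> * chart_norm c (chart_map c (\<eta> t)) v"
    by (rule chart_norm_scaleR[OF c(1)]) (use W c in auto)
  also have "chart_norm c (chart_map c (\<eta> t)) v = speed \<gamma> (\<alpha> * t + \<beta>)"
    using speed_in_chart[OF c(1,2) cont v] W by simp
  finally show ?thesis .
qed

text \<open>The definition speaks only about parts of the curve inside one chart. Bisection collects
  the finitely many break points of these parts; on the remaining open set the speed is continuous,
  hence measurable.\<close>

lemma piecewise_C1_curve_regular: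
  assumes \<gamma>: "piecewise_C1_curve A \<gamma>"
  obtains S where "finite S" "continuous_on ({0<..<1} - S) (speed \<gamma>)" "\<And>t. t \<in> {0<..<1} - S \<Longrightarrow> regular_at \<gamma> t"
proof -
  have cont: "continuous_on {0..1} \<gamma>" using \<gamma> unfolding piecewise_C1_curve_def by blast
  have isC: "isCont \<gamma> t" if "t \<in> {0<..<1}" for t
    using continuous_on_interior[OF cont, of t] that by simp
  let ?P = "\<lambda>a b. \<exists>S. finite S \<and> continuous_on ({a<..<b} - S) (speed \<gamma>) \<and> (\<forall>t\<in>{a<..<b} - S. regular_at \<gamma> t)"
  have "?P 0 1"
  proof (rule interval_local_to_global[where P = ?P])
    fix c d e :: real
    assume *: "c \<le> d" "d \<le> e" and "?P c d" "?P d e"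
    then obtain S T where S: "finite S" "continuous_on ({c<..<d} - S) (speed \<gamma>)" "\<And>t. t \<in> {c<..<d} - S \<Longrightarrow> regular_at \<gamma> t"
      and T: "finite T" "continuous_on ({d<..<e} - T) (speed \<gamma>)" "\<And>t. t \<in> {d<..<e} - T \<Longrightarrow> regular_at \<gamma> t" by blast
    have "continuous_on (({c<..<d} - S) \<union> ({d<..<e} - T)) (speed \<gamma>)"
      by (rule continuous_on_open_Un) (use S T in \<open>auto intro!: open_Diff finite_imp_closed\<close>)
    then have "continuous_on ({c<..<e} - (insert d (S \<union> T))) (speed \<gamma>)"
      by (rule continuous_on_subset) auto
    moreover have "regular_at \<gamma> t" if "t \<in> {c<..<e} - (insert d (S \<union> T))" for t
      using that S(3)[of t] T(3)[of t] by force
    ultimately show "?P c e" using S(1) T(1) by (intro exI[of _ "insert d (S \<union> T)"]) auto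
  next
    fix x :: real assume x: "0 \<le> x" "x \<le> 1"
    obtain c where c: "c \<in> A" "\<gamma> x \<in> chart_dom c" using chart_exists by blast
    have "\<exists>\<delta>>0. \<forall>t\<in>{0..1}. dist t x < \<delta> \<longrightarrow> \<gamma> t \<in> chart_dom c"
      using topological_tendstoD[OF continuous_on_def[THEN iffD1, OF cont, rule_format, of x] open_chart_dom[OF c(1)] c(2)] x c(2)
      unfolding eventually_at by auto
    then obtain \<delta> where \<delta>: "\<delta> > 0" "\<And>t. t \<in> {0..1} \<Longrightarrow> dist t x < \<delta> \<Longrightarrow> \<gamma> t \<in> chart_dom c" by blast
    show "\<exists>\<delta>>0. \<forall>a b. 0 \<le> a \<longrightarrow> a \<le> x \<longrightarrow> x \<le> b \<longrightarrow> b \<le> 1 \<longrightarrow> b - a < \<delta> \<longrightarrow> ?P a b"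
    proof (intro exI[of _ \<delta>] conjI allI impI \<delta>(1))
      fix a b assume ab: "0 \<le> a" "a \<le> x" "x \<le> b" "b \<le> 1" "b - a < \<delta>"
      show "?P a b"
      proof (cases "a < b")
        case False
        then show ?thesis by (intro exI[of _ "{}"]) auto
      next
        case True
        have dom: "\<gamma> t \<in> chart_dom c" if "t \<in> {a..b}" for t
          using \<delta>(2)[of t] that ab by (auto simp: dist_real_def)
        have "(\<lambda>t. chart_map c (\<gamma> t)) piecewise_C1_differentiable_on {a..b}"
          using \<gamma> c ab True dom unfolding piecewise_C1_curve_def by blast
        then obtain S where S: "finite S" "(\<lambda>t. chart_map c (\<gamma> t)) C1_differentiable_on ({a..b} - S)"
          unfolding piecewise_C1_differentiable_on_def by blast
        then obtain D where D: "\<And>t. t \<in> {a..b} - S \<Longrightarrow> ((\<lambda>t. chart_map c (\<gamma> t)) has_vector_derivative D t) (at t)"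
            "continuous_on ({a..b} - S) D"
          unfolding C1_differentiable_on_def by blast
        have eq: "chart_norm c (chart_map c (\<gamma> t)) (D t) = speed \<gamma> t" if "t \<in> {a<..<b} - S" for t
          by (rule speed_in_chart[symmetric]) (use that c dom isC ab D in auto)
        have "continuous_on ({a<..<b} - S) (\<lambda>t. (chart_map c (\<gamma> t), D t))"
        proof (intro continuous_on_Pair)
          show "continuous_on ({a<..<b} - S) (\<lambda>t. chart_map c (\<gamma> t))"
            by (intro continuous_at_imp_continuous_on ballI, rule has_vector_derivative_continuous[OF D(1)]) auto
          show "continuous_on ({a<..<b} - S) D" by (rule continuous_on_subset[OF D(2)]) auto
        qed
        from continuous_on_compose2[OF continuous_on_chart_norm[OF c(1)] this]
        have "continuous_on ({a<..<b} - S) (\<lambda>t. chart_norm c (chart_map c (\<gamma> t)) (D t))"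
          using dom by force
        then have "continuous_on ({a<..<b} - S) (speed \<gamma>)"
          by (rule continuous_on_eq) (rule eq)
        moreover have "regular_at \<gamma> t" if "t \<in> {a<..<b} - S" for t
          unfolding regular_at_def using that c dom[of t] isC[of t] ab D(1)[of t]
          by (auto simp: differentiableI_vector)
        ultimately show ?thesis using S(1) by blast
      qed
    qed
  qed simp
  then show thesis using that by blast
qed

text \<open>End points and break points form a null set. With the exceptional set of
  \<open>piecewise_C1_curve_regular\<close> as \<open>S\<close> the new integrand is Borel
  measurable, so that linearity and substitution apply to the length.\<close>

lemma curve_length_eq:
  assumes S: "finite S"
  shows "curve_length A h \<gamma> = (\<integral>\<^sup>+t. ennreal (speed \<gamma> t * indicator ({0<..<1} - S) t) \<partial>lborel)"
proof -
  have "AE t in lborel. t \<notin> insert 0 (insert 1 S)"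
    by (rule AE_not_in) (use S in \<open>auto intro!: finite_imp_null_set_lborel\<close>)
  then have "AE t in lborel. ennreal (hnorm h (\<gamma> t) (velocity A \<gamma> t)) * indicator {0..1} t = ennreal (speed \<gamma> t * indicator ({0<..<1} - S) t)"
    by eventually_elim (auto simp: speed_def indicator_def)
  then show ?thesis unfolding curve_length_def by (rule nn_integral_cong_AE)
qed

text \<open>Each half runs at double speed over half the time, so an affine substitution returns the
  two lengths. For the triangle inequality an upper bound of the total length is enough.\<close>

lemma curve_join:
  assumes \<gamma>: "piecewise_C1_curve A \<gamma>" and \<eta>: "piecewise_C1_curve A \<eta>" and eq: "\<gamma> 1 = \<eta> 0"
  shows "piecewise_C1_curve A (\<gamma> +++ \<eta>)"
    and "curve_length A h (\<gamma> +++ \<eta>) \<le> curve_length A h \<gamma> + curve_length A h \<eta>"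
proof -
  have c1: "continuous_on {0..1} \<gamma>" "continuous_on {0..1} \<eta>" using \<gamma> \<eta> unfolding piecewise_C1_curve_def by auto
  show "piecewise_C1_curve A (\<gamma> +++ \<eta>)"
    unfolding piecewise_C1_curve_def
  proof (intro conjI ballI allI impI)
    show "continuous_on {0..1} (\<gamma> +++ \<eta>)"
      by (rule continuous_on_joinpaths[OF c1]) (simp add: eq pathfinish_def pathstart_def)
    fix c a b assume c: "c \<in> A" and *: "0 \<le> a \<and> a < b \<and> b \<le> 1 \<and> (\<gamma> +++ \<eta>) ` {a..b} \<subseteq> chart_dom c"
    let ?f = "\<lambda>t. chart_map c (\<gamma> (2 * t))" and ?g = "\<lambda>t. chart_map c (\<eta> (2 * t - 1))"
    have in1: "\<gamma> (2 * t) \<in> chart_dom c" if "t \<in> {a..b}" "t \<le> 1/2" for t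
    proof -
      have "(\<gamma> +++ \<eta>) t \<in> chart_dom c" using * that by blast
      then show ?thesis using that by (simp add: joinpaths_def)
    qed
    have in2: "\<eta> (2 * t - 1) \<in> chart_dom c" if "t \<in> {a..b}" "t \<ge> 1/2" for t
    proof (cases "t = 1/2")
      case True
      then have e: "2 * t - 1 = 0" by simp
      have "\<eta> 0 \<in> chart_dom c" using in1[OF that(1)[unfolded True]] eq by simp
      then show ?thesis by (simp only: e)
    next
      case False
      have "(\<gamma> +++ \<eta>) t \<in> chart_dom c" using * that by blast
      then show ?thesis using that False by (simp add: joinpaths_def)
    qed
    have f: "?f piecewise_C1_differentiable_on {a'..b'}" if ab: "a \<le> a'" "a' < b'" "b' \<le> b" "b' \<le> 1/2" for a' b'
    proof -
      have "(\<lambda>t. chart_map c (\<gamma> t)) piecewise_C1_differentiable_on {2 * a'..2 * b'}"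
      proof -
        have "\<gamma> ` {2 * a'..2 * b'} \<subseteq> chart_dom c"
          using in1[of "t / 2" for t] ab by (force simp: image_subset_iff)
        then show ?thesis using \<gamma> c ab * unfolding piecewise_C1_curve_def by auto
      qed
      then have "(\<lambda>t. chart_map c (\<gamma> t)) piecewise_C1_differentiable_on (\<lambda>x. 2 * x + 0) ` {a'..b'}"
        by (rule piecewise_C1_differentiable_on_subset) auto
      from piecewise_C1_differentiable_affine[OF this] show ?thesis by (simp add: o_def)
    qed
    have g: "?g piecewise_C1_differentiable_on {a'..b'}" if ab: "a \<le> a'" "a' < b'" "b' \<le> b" "1/2 \<le> a'" for a' b'
    proof -
      have "(\<lambda>t. chart_map c (\<eta> t)) piecewise_C1_differentiable_on {2 * a' - 1..2 * b' - 1}"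
      proof -
        have "\<eta> ` {2 * a' - 1..2 * b' - 1} \<subseteq> chart_dom c"
        proof (rule image_subsetI)
          fix t assume "t \<in> {2 * a' - 1..2 * b' - 1}"
          then show "\<eta> t \<in> chart_dom c" using in2[of "(t + 1) / 2"] ab by (auto simp: field_simps)
        qed
        then show ?thesis using \<eta> c ab * unfolding piecewise_C1_curve_def by auto
      qed
      then have "(\<lambda>t. chart_map c (\<eta> t)) piecewise_C1_differentiable_on (\<lambda>x. 2 * x + (-1)) ` {a'..b'}"
        by (rule piecewise_C1_differentiable_on_subset) auto
      from piecewise_C1_differentiable_affine[OF this] show ?thesis by (simp add: o_def)
    qed
    have eqf: "(\<lambda>t. chart_map c ((\<gamma> +++ \<eta>) t)) = (\<lambda>t. if t \<le> 1/2 then ?f t else ?g t)"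
      by (auto simp: joinpaths_def)
    show "(\<lambda>t. chart_map c ((\<gamma> +++ \<eta>) t)) piecewise_C1_differentiable_on {a..b}"
    proof -
      \<comment> \<open>Derivatives in \<open>C1_differentiable_on\<close> are two-sided, but the
        two functions agree only on \<open>{a..b}\<close>; the end points are therefore added to the
        break points.\<close>
      have cong: "k piecewise_C1_differentiable_on {a..b}" if l: "l piecewise_C1_differentiable_on {a..b}" and kl: "\<And>t. t \<in> {a..b} \<Longrightarrow> k t = l t" for k l :: "real \<Rightarrow> complex ^ 'n"
        unfolding piecewise_C1_differentiable_on_def
      proof
        show "continuous_on {a..b} k" using l kl unfolding piecewise_C1_differentiable_on_def by (metis continuous_on_cong)
        obtain S where S: "finite S" "l C1_differentiable_on ({a..b} - S)" using l unfolding piecewise_C1_differentiable_on_def by blast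
        then obtain D where D: "\<And>t. t \<in> {a..b} - S \<Longrightarrow> (l has_vector_derivative D t) (at t)" "continuous_on ({a..b} - S) D"
          unfolding C1_differentiable_on_def by blast
        have "(k has_vector_derivative D t) (at t)" if "t \<in> {a..b} - (insert a (insert b S))" for t
          by (rule has_vector_derivative_transform_within_open[of l _ _ "{a<..<b}"]) (use D(1) that kl in auto)
        then have "k C1_differentiable_on ({a..b} - insert a (insert b S))"
          unfolding C1_differentiable_on_def using D(2) by (intro exI[of _ D]) (auto intro: continuous_on_subset)
        then show "\<exists>S. finite S \<and> k C1_differentiable_on {a..b} - S" using S(1) by (intro exI[of _ "insert a (insert b S)"]) auto
      qed
      consider "b \<le> 1/2" | "1/2 \<le> a" | "a < 1/2" "1/2 < b" by linarith
      then show ?thesis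
      proof cases
        case 1
        then show ?thesis unfolding eqf by (intro cong[OF f]) (use * in auto)
      next
        case 2
        have "(if t \<le> 1/2 then ?f t else ?g t) = ?g t" if "t \<in> {a..b}" for t
        proof (cases "t \<le> 1/2")
          case True
          then have t: "t = 1/2" using 2 that by auto
          show ?thesis by (simp add: t eq)
        qed simp
        then show ?thesis unfolding eqf by (intro cong[OF g]) (use * 2 in auto)
      next
        case 3
        then show ?thesis unfolding eqf
          by (intro piecewise_C1_differentiable_cases f g) (use * eq in auto)
      qed
    qed
  qed
  obtain S where S: "finite S" "continuous_on ({0<..<1} - S) (speed \<gamma>)" "\<And>t. t \<in> {0<..<1} - S \<Longrightarrow> regular_at \<gamma> t"
    using piecewise_C1_curve_regular[OF \<gamma>] by blast
  obtain T where T: "finite T" "continuous_on ({0<..<1} - T) (speed \<eta>)" "\<And>t. t \<in> {0<..<1} - T \<Longrightarrow> regular_at \<eta> t"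
    using piecewise_C1_curve_regular[OF \<eta>] by blast
  \<comment> \<open>The break points of both curves, carried to the two halves of the unit interval,
    together with the joining time.\<close>
  define R where "R = insert (1/2) ((\<lambda>t. t / 2) ` S \<union> (\<lambda>t. (t + 1) / 2) ` T)"
  have R: "finite R" using S(1) T(1) by (simp add: R_def)
  let ?F = "\<lambda>t. speed \<gamma> t * indicator ({0<..<1} - S) t" and ?G = "\<lambda>t. speed \<eta> t * indicator ({0<..<1} - T) t"
  have meas: "?F \<in> borel_measurable borel" "?G \<in> borel_measurable borel"
  proof -
    have "{0<..<1} - S \<in> sets borel" "{0<..<1} - T \<in> sets borel" by (intro sets.Diff borel_open borel_closed finite_imp_closed open_greaterThanLessThan S(1) T(1))+
    then show "?F \<in> borel_measurable borel" "?G \<in> borel_measurable borel"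
      using borel_measurable_continuous_on_indicator[OF _ S(2)] borel_measurable_continuous_on_indicator[OF _ T(2)]
      by (simp_all add: mult.commute)
  qed
  have pw: "ennreal (speed (\<gamma> +++ \<eta>) t * indicator ({0<..<1} - R) t) \<le> 2 * ennreal (?F (0 + 2 * t)) + 2 * ennreal (?G (- 1 + 2 * t))" for t
  proof (cases "t \<in> {0<..<1} - R")
    case True
    show ?thesis
    proof (cases "t < 1/2")
      case t: True
      have "2 * t \<notin> S"
      proof
        assume "2 * t \<in> S"
        then have "(2 * t) / 2 \<in> R" unfolding R_def by blast
        then show False using True by simp
      qed
      then have s: "2 * t \<in> {0<..<1} - S" using True t by auto
      have "speed (\<gamma> +++ \<eta>) t = \<bar>2\<bar> * speed \<gamma> (2 * t + 0)"
        by (rule affine_reparametrization[where W = "{..<1/2}"]) (use S(3)[OF s] t in \<open>auto simp: joinpaths_def\<close>)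
      then have "ennreal (speed (\<gamma> +++ \<eta>) t * indicator ({0<..<1} - R) t) = 2 * ennreal (?F (0 + 2 * t))"
        using True s by (simp add: ennreal_mult')
      then show ?thesis by simp
    next
      case False
      then have t: "t > 1/2" using True by (auto simp: R_def)
      have "2 * t - 1 \<notin> T"
      proof
        assume "2 * t - 1 \<in> T"
        then have "(2 * t - 1 + 1) / 2 \<in> R" unfolding R_def by blast
        then show False using True by simp
      qed
      then have s: "2 * t - 1 \<in> {0<..<1} - T" using True t by auto
      have "speed (\<gamma> +++ \<eta>) t = \<bar>2\<bar> * speed \<eta> (2 * t + (- 1))"
        by (rule affine_reparametrization[where W = "{1/2<..}"]) (use T(3)[OF s] t in \<open>auto simp: joinpaths_def\<close>)
      then have "ennreal (speed (\<gamma> +++ \<eta>) t * indicator ({0<..<1} - R) t) = 2 * ennreal (?G (- 1 + 2 * t))"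
        using True s by (simp add: ennreal_mult' add.commute)
      then show ?thesis by simp
    qed
  qed simp
  have "curve_length A h (\<gamma> +++ \<eta>) \<le> (\<integral>\<^sup>+t. 2 * ennreal (?F (0 + 2 * t)) + 2 * ennreal (?G (- 1 + 2 * t)) \<partial>lborel)"
    unfolding curve_length_eq[OF R] by (rule nn_integral_mono) (rule pw)
  also have "\<dots> = 2 * (\<integral>\<^sup>+t. ennreal (?F (0 + 2 * t)) \<partial>lborel) + 2 * (\<integral>\<^sup>+t. ennreal (?G (- 1 + 2 * t)) \<partial>lborel)"
    using measurable_compose[OF _ meas(1), of "\<lambda>t. 0 + 2 * t" lborel] measurable_compose[OF _ meas(2), of "\<lambda>t. - 1 + 2 * t" lborel]
    by (subst nn_integral_add) (auto simp: nn_integral_cmult)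
  also have "\<dots> = (\<integral>\<^sup>+t. ennreal (?F t) \<partial>lborel) + (\<integral>\<^sup>+t. ennreal (?G t) \<partial>lborel)"
    using nn_integral_real_affine[of "\<lambda>t. ennreal (?F t)" 2 0] nn_integral_real_affine[of "\<lambda>t. ennreal (?G t)" 2 "- 1"] meas by simp
  also have "\<dots> = curve_length A h \<gamma> + curve_length A h \<eta>"
    by (simp only: curve_length_eq[OF S(1), of \<gamma>] curve_length_eq[OF T(1), of \<eta>])
  finally show "curve_length A h (\<gamma> +++ \<eta>) \<le> curve_length A h \<gamma> + curve_length A h \<eta>" .
qed

lemma curve_reverse:
  assumes \<gamma>: "piecewise_C1_curve A \<gamma>"
  shows "piecewise_C1_curve A (\<lambda>t. \<gamma> (1 - t))"
    and "curve_length A h (\<lambda>t. \<gamma> (1 - t)) = curve_length A h \<gamma>"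
proof -
  have c1: "continuous_on {0..1} \<gamma>" using \<gamma> unfolding piecewise_C1_curve_def by auto
  show "piecewise_C1_curve A (\<lambda>t. \<gamma> (1 - t))"
    unfolding piecewise_C1_curve_def
  proof (intro conjI ballI allI impI)
    show "continuous_on {0..1} (\<lambda>t. \<gamma> (1 - t))"
      by (rule continuous_on_compose2[OF c1]) (auto intro!: continuous_intros)
    fix c a b assume c: "c \<in> A" and *: "0 \<le> a \<and> a < b \<and> b \<le> 1 \<and> (\<lambda>t. \<gamma> (1 - t)) ` {a..b} \<subseteq> chart_dom c"
    have "\<gamma> t \<in> chart_dom c" if "t \<in> {1 - b..1 - a}" for t
    proof -
      have "1 - t \<in> {a..b}" using that by auto
      then have "\<gamma> (1 - (1 - t)) \<in> chart_dom c" using * by blast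
      then show ?thesis by simp
    qed
    then have "\<gamma> ` {1 - b..1 - a} \<subseteq> chart_dom c" by blast
    then have "(\<lambda>t. chart_map c (\<gamma> t)) piecewise_C1_differentiable_on {1 - b..1 - a}"
      using \<gamma> c * unfolding piecewise_C1_curve_def by auto
    then have "(\<lambda>t. chart_map c (\<gamma> t)) piecewise_C1_differentiable_on (\<lambda>x. (- 1) * x + 1) ` {a..b}"
      by (rule piecewise_C1_differentiable_on_subset) auto
    from piecewise_C1_differentiable_affine[OF this]
    show "(\<lambda>t. chart_map c (\<gamma> (1 - t))) piecewise_C1_differentiable_on {a..b}" by (simp add: o_def)
  qed
  obtain S where S: "finite S" "continuous_on ({0<..<1} - S) (speed \<gamma>)" "\<And>t. t \<in> {0<..<1} - S \<Longrightarrow> regular_at \<gamma> t"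
    using piecewise_C1_curve_regular[OF \<gamma>] by blast
  have R: "finite ((\<lambda>t. 1 - t) ` S)" using S(1) by simp
  let ?F = "\<lambda>t. speed \<gamma> t * indicator ({0<..<1} - S) t"
  have "{0<..<1} - S \<in> sets borel" using S(1) by (intro sets.Diff borel_open borel_closed finite_imp_closed open_greaterThanLessThan)
  then have meas: "?F \<in> borel_measurable borel"
    using borel_measurable_continuous_on_indicator[OF _ S(2)] by (simp add: mult.commute)
  have pw: "speed (\<lambda>t. \<gamma> (1 - t)) t * indicator ({0<..<1} - (\<lambda>t. 1 - t) ` S) t = ?F (1 + (- 1) * t)" for t
  proof (cases "t \<in> {0<..<1} \<and> 1 - t \<notin> S")
    case True
    then have s: "1 - t \<in> {0<..<1} - S" by auto
    have "speed (\<lambda>t. \<gamma> (1 - t)) t = \<bar>- 1\<bar> * speed \<gamma> ((- 1) * t + 1)"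
      by (rule affine_reparametrization[where W = UNIV]) (use S(3)[OF s] in auto)
    moreover have "t \<notin> (\<lambda>t. 1 - t) ` S" using True by force
    ultimately show ?thesis using True by simp
  next
    case False
    then have "t \<notin> {0<..<1} - (\<lambda>t. 1 - t) ` S" by (auto simp: image_iff) (metis diff_diff_eq2 add_diff_cancel_left')
    then show ?thesis using False by (auto simp: indicator_def)
  qed
  show "curve_length A h (\<lambda>t. \<gamma> (1 - t)) = curve_length A h \<gamma>"
  proof -
    have "curve_length A h (\<lambda>t. \<gamma> (1 - t)) = (\<integral>\<^sup>+t. ennreal (?F (1 + (- 1) * t)) \<partial>lborel)"
      unfolding curve_length_eq[OF R] pw ..
    also have "\<dots> = (\<integral>\<^sup>+t. ennreal (?F t) \<partial>lborel)"
      using nn_integral_real_affine[of "\<lambda>t. ennreal (?F t)" "- 1" 1] meas by simp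
    finally show ?thesis unfolding curve_length_eq[OF S(1)] .
  qed
qed

section \<open>The distance as an infimum of lengths\<close>

text \<open>\<open>metric_dist\<close> is \<open>enn2real\<close> of this infimum. In
  \<open>ennreal\<close> the triangle inequality holds before finiteness is known, and finiteness is
  then derived from it.\<close>

definition cost :: "'m \<Rightarrow> 'm \<Rightarrow> ennreal"
  where "cost z w = (INF \<gamma>\<in>{\<gamma>. piecewise_C1_curve A \<gamma> \<and> \<gamma> 0 = z \<and> \<gamma> 1 = w}. curve_length A h \<gamma>)"

lemma metric_dist_cost: "metric_dist A h z w = enn2real (cost z w)"
  by (simp add: metric_dist_def cost_def)

lemma cost_le: "piecewise_C1_curve A \<gamma> \<Longrightarrow> \<gamma> 0 = z \<Longrightarrow> \<gamma> 1 = w \<Longrightarrow> cost z w \<le> curve_length A h \<gamma>"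
  unfolding cost_def by (rule INF_lower) auto

lemma cost_triangle: "cost z w \<le> cost z u + cost u w"
proof -
  have "cost z w \<le> curve_length A h \<gamma> + curve_length A h \<eta>"
    if "piecewise_C1_curve A \<gamma>" "\<gamma> 0 = z" "\<gamma> 1 = u" "piecewise_C1_curve A \<eta>" "\<eta> 0 = u" "\<eta> 1 = w" for \<gamma> \<eta>
  proof -
    have "cost z w \<le> curve_length A h (\<gamma> +++ \<eta>)"
      using that curve_join(1)[of \<gamma> \<eta>] by (intro cost_le) (auto simp: joinpaths_def)
    also have "\<dots> \<le> curve_length A h \<gamma> + curve_length A h \<eta>" using that by (intro curve_join) auto
    finally show ?thesis .
  qed
  note 1 = this
  have 2: "cost z w \<le> cost u w + curve_length A h \<gamma>" if \<gamma>: "piecewise_C1_curve A \<gamma>" "\<gamma> 0 = z" "\<gamma> 1 = u" for \<gamma>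
    unfolding cost_def[of u w] add.commute[of _ "curve_length A h \<gamma>"]
    by (rule ennreal_le_add_INF) (use 1[OF \<gamma>] in auto)
  have "cost z w \<le> cost u w + cost z u"
    unfolding cost_def[of z u] by (rule ennreal_le_add_INF) (use 2 in auto)
  then show ?thesis by (simp add: add.commute)
qed

lemma cost_commute: "cost z w = cost w z"
proof -
  have "cost z w \<le> cost w z" for z w
    unfolding cost_def[of w z]
  proof (rule INF_greatest)
    fix \<gamma> assume "\<gamma> \<in> {\<gamma>. piecewise_C1_curve A \<gamma> \<and> \<gamma> 0 = w \<and> \<gamma> 1 = z}"
    then show "cost z w \<le> curve_length A h \<gamma>"
      using cost_le[OF curve_reverse(1), of \<gamma> z w] curve_reverse(2)[of \<gamma>] by simp
  qed
  then show ?thesis by (meson antisym)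
qed

text \<open>The curve is a straight segment in the coordinates of \<open>c\<close>, but it must be
  shown to be \<open>C1\<close> in every other chart as well, which uses continuity of the
  derivatives of the transition maps. In \<open>c\<close> its coordinate velocity is the constant
  \<open>y - x\<close>.\<close>

lemma cost_segment:
  assumes c: "c \<in> A" and xy: "x \<in> cball a r" "y \<in> cball a r" "cball a r \<subseteq> chart_img c"
    and M: "\<And>z v. z \<in> cball a r \<Longrightarrow> chart_norm c z v \<le> M * norm v"
  shows "cost (chart_inv c x) (chart_inv c y) \<le> ennreal (M * norm (y - x))"
proof -
  define \<sigma> where "\<sigma> t = x + t *\<^sub>R (y - x)" for t :: real
  define \<gamma> where "\<gamma> t = chart_inv c (\<sigma> t)" for t
  have in_ball: "\<sigma> t \<in> cball a r" if "t \<in> {0..1}" for t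
  proof -
    have "(1 - t) *\<^sub>R x + t *\<^sub>R y \<in> cball a r"
      using convexD[OF convex_cball, of x a r y "1 - t" t] xy that by auto
    then show ?thesis by (simp add: \<sigma>_def algebra_simps)
  qed
  then have img: "\<sigma> t \<in> chart_img c" if "t \<in> {0..1}" for t using xy(3) that by blast
  have d\<sigma>: "(\<sigma> has_vector_derivative (y - x)) (at t)" for t
    unfolding \<sigma>_def by (auto intro!: derivative_eq_intros simp: has_vector_derivative_def)
  have c\<sigma>: "isCont \<sigma> t" for t using d\<sigma> has_vector_derivative_continuous by blast
  have cont: "isCont \<gamma> t" if "t \<in> {0..1}" for t
    using tendsto_chart_inv[OF c c\<sigma>[of t, unfolded continuous_at] img[OF that]]
    by (simp add: \<gamma>_def[abs_def] continuous_at)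
  have dom: "\<gamma> t \<in> chart_dom c" if "t \<in> {0..1}" for t
    using chart_inv_in[OF c img[OF that]] by (simp add: \<gamma>_def)
  have d: "((\<lambda>\<tau>. chart_map c' (\<gamma> \<tau>)) has_vector_derivative transition_deriv c c' (\<gamma> t) (y - x)) (at t)"
    if t: "t \<in> {0..1}" and c': "c' \<in> A" "\<gamma> t \<in> chart_dom c'" for t c'
  proof (rule curve_change_chart[OF c dom[OF t] c' _ cont[OF t]])
    have "open (\<sigma> -` chart_img c)"
      using c\<sigma> by (intro open_vimage open_chart_img c) (auto simp: continuous_on_eq_continuous_at)
    then show "((\<lambda>\<tau>. chart_map c (\<gamma> \<tau>)) has_vector_derivative y - x) (at t)"
      by (rule has_vector_derivative_transform_within_open[OF d\<sigma>])
         (use img[OF t] in \<open>auto simp: \<gamma>_def chart_inv_map c\<close>)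
  qed simp
  have "piecewise_C1_curve A \<gamma>"
    unfolding piecewise_C1_curve_def
  proof (intro conjI ballI allI impI)
    show "continuous_on {0..1} \<gamma>" using cont by (intro continuous_at_imp_continuous_on) auto
    fix c' s t assume c': "c' \<in> A" and *: "0 \<le> s \<and> s < t \<and> t \<le> 1 \<and> \<gamma> ` {s..t} \<subseteq> chart_dom c'"
    have dom': "\<gamma> \<tau> \<in> chart_dom c'" "\<gamma> \<tau> \<in> chart_dom c" "\<tau> \<in> {0..1}" if "\<tau> \<in> {s..t}" for \<tau>
      using * dom[of \<tau>] that by auto
    have "(\<lambda>\<tau>. chart_map c' (\<gamma> \<tau>)) C1_differentiable_on {s..t}"
      unfolding C1_differentiable_on_def
    proof (intro exI conjI ballI)
      fix \<tau> assume \<tau>: "\<tau> \<in> {s..t}"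
      show "((\<lambda>\<tau>. chart_map c' (\<gamma> \<tau>)) has_vector_derivative transition_deriv c c' (\<gamma> \<tau>) (y - x)) (at \<tau>)"
        using d[OF dom'(3)[OF \<tau>] c' dom'(1)[OF \<tau>]] .
    next
      have "continuous_on {s..t} (\<lambda>\<tau>. frechet_derivative (chart_map c' \<circ> chart_inv c) (at (\<sigma> \<tau>)) (y - x))"
      proof (rule continuous_on_compose2[OF cholomorphic_on_deriv_continuous])
        show "open (chart_map c ` (chart_dom c \<inter> chart_dom c'))" by (intro open_chart_image open_chart_dom c c')
        show "cholomorphic_on (chart_map c' \<circ> chart_inv c) (chart_map c ` (chart_dom c \<inter> chart_dom c'))"
          by (rule holomorphic_transition[OF c c'])
        show "continuous_on {s..t} \<sigma>" using c\<sigma> by (intro continuous_at_imp_continuous_on) auto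
        show "\<sigma> ` {s..t} \<subseteq> chart_map c ` (chart_dom c \<inter> chart_dom c')"
          unfolding chart_image_eq[OF c] using dom' img by (auto simp: \<gamma>_def)
      qed
      then show "continuous_on {s..t} (\<lambda>\<tau>. transition_deriv c c' (\<gamma> \<tau>) (y - x))"
        by (rule continuous_on_eq) (use img dom'(3) in \<open>simp add: \<gamma>_def chart_map_inv[OF c]\<close>)
    qed
    then show "(\<lambda>\<tau>. chart_map c' (\<gamma> \<tau>)) piecewise_C1_differentiable_on {s..t}"
      unfolding piecewise_C1_differentiable_on_def using C1_differentiable_imp_continuous_on
      by (auto intro!: exI[of _ "{}"])
  qed
  then have "cost (chart_inv c x) (chart_inv c y) \<le> curve_length A h \<gamma>"
    by (rule cost_le) (simp_all add: \<gamma>_def \<sigma>_def)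
  also have "\<dots> \<le> (\<integral>\<^sup>+(t::real). ennreal (M * norm (y - x)) * indicator {0..1} t \<partial>lborel)"
    unfolding curve_length_def
  proof (rule nn_integral_mono)
    fix t :: real
    show "ennreal (hnorm h (\<gamma> t) (velocity A \<gamma> t)) * indicator {0..1} t \<le> ennreal (M * norm (y - x)) * indicator {0..1} t"
    proof (cases "t \<in> {0..1}")
      case True
      have "hnorm h (\<gamma> t) (velocity A \<gamma> t) = chart_norm c (chart_map c (\<gamma> t)) (y - x)"
        using speed_in_chart[OF c dom[OF True] cont[OF True]] d[OF True c dom[OF True]]
        by (simp add: speed_def transition_deriv_self[OF c dom[OF True]])
      also have "\<dots> \<le> M * norm (y - x)"
        using M[OF in_ball[OF True]] img[OF True] by (simp add: \<gamma>_def chart_map_inv[OF c])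
      finally show ?thesis by (simp add: ennreal_leI mult_right_mono)
    qed simp
  qed
  also have "\<dots> = ennreal (M * norm (y - x))" by (simp add: nn_integral_cmult_indicator)
  finally show ?thesis .
qed

text \<open>Segments join nearby points at finite cost, and connectedness with the triangle
  inequality does the rest. An infinite cost would be turned into distance 0 by
  \<open>enn2real\<close>.\<close>

lemma cost_finite: "cost z w < \<infinity>"
proof (rule connected_UNIV_propagate[OF connected_mfd, where P = "\<lambda>w. cost z w < \<infinity>"])
  have near: "\<exists>U. open U \<and> p \<in> U \<and> (\<forall>q\<in>U. cost p q < \<infinity>)" for p
  proof -
    obtain c where c: "c \<in> A" "p \<in> chart_dom c" using chart_exists by blast
    obtain r where r: "r > 0" "cball (chart_map c p) r \<subseteq> chart_img c"
      using chart_cball[OF c open_UNIV] by auto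
    obtain M where M: "\<And>x v. x \<in> cball (chart_map c p) r \<Longrightarrow> chart_norm c x v \<le> M * norm v"
      using chart_norm_bounds[OF c(1) compact_cball r(2)] by metis
    let ?U = "chart_dom c \<inter> chart_map c -` ball (chart_map c p) r"
    have "cost p q < \<infinity>" if "q \<in> ?U" for q
    proof -
      have "cost (chart_inv c (chart_map c p)) (chart_inv c (chart_map c q)) \<le> ennreal (M * norm (chart_map c q - chart_map c p))"
        by (rule cost_segment[OF c(1) _ _ r(2) M]) (use that r in auto)
      then show ?thesis using that c by (auto simp: chart_inv_map intro: order_le_less_trans)
    qed
    then show ?thesis using open_chart_preimage[OF c(1) open_ball] c r by (intro exI[of _ ?U]) auto
  qed
  then show "cost z z < \<infinity>" by blast
  fix p
  obtain U where U: "open U" "p \<in> U" "\<And>q. q \<in> U \<Longrightarrow> cost p q < \<infinity>" using near[of p] by blast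
  have "cost z p < \<infinity> \<longleftrightarrow> cost z q < \<infinity>" if "q \<in> U" for q
  proof
    have "cost p q < \<infinity>" "cost q p < \<infinity>" using U(3)[OF that] by (simp_all add: cost_commute)
    then show "cost z p < \<infinity> \<Longrightarrow> cost z q < \<infinity>" "cost z q < \<infinity> \<Longrightarrow> cost z p < \<infinity>"
      using order_le_less_trans[OF cost_triangle[of z q p]] order_le_less_trans[OF cost_triangle[of z p q]]
      by (simp_all add: ennreal_add_less_top)
  qed
  then show "\<exists>U. open U \<and> p \<in> U \<and> (\<forall>q\<in>U. (cost z p < \<infinity>) = (cost z q < \<infinity>))"
    using U(1,2) by (intro exI[of _ U]) simp
qed

lemma ennreal_metric_dist: "ennreal (metric_dist A h z w) = cost z w"
  using cost_finite[of z w] by (simp add: metric_dist_cost)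

lemma metric_dist_nonneg: "0 \<le> metric_dist A h z w"
  by (simp add: metric_dist_cost)

lemma metric_dist_commute: "metric_dist A h z w = metric_dist A h w z"
  by (simp add: metric_dist_cost cost_commute)

lemma metric_dist_triangle: "metric_dist A h z w \<le> metric_dist A h z u + metric_dist A h u w"
proof -
  have "ennreal (metric_dist A h z w) \<le> ennreal (metric_dist A h z u + metric_dist A h u w)"
    using cost_triangle[of z w u] by (simp add: ennreal_metric_dist metric_dist_nonneg)
  then show ?thesis using metric_dist_nonneg by (simp del: ennreal_plus)
qed

lemma metric_dist_segment:
  assumes "c \<in> A" "x \<in> cball a r" "y \<in> cball a r" "cball a r \<subseteq> chart_img c"
    and M: "\<And>z v. z \<in> cball a r \<Longrightarrow> chart_norm c z v \<le> M * norm v" "M \<ge> 0"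
  shows "metric_dist A h (chart_inv c x) (chart_inv c y) \<le> M * norm (y - x)"
  using cost_segment[OF assms(1-5)] M(2) by (simp add: ennreal_metric_dist[symmetric])

section \<open>Lower bounds for lengths and distances\<close>

text \<open>The fundamental theorem of calculus bounds the coordinate displacement by the integral
  of the coordinate speed, and \<open>m\<close> converts this into Hermitian speed. The curve is
  followed up to time \<open>b\<close> only, because it may leave the chart later.\<close>

lemma curve_length_ge_in_chart:
  assumes \<gamma>: "piecewise_C1_curve A \<gamma>" and c: "c \<in> A" and b: "0 < b" "b \<le> 1"
    and K: "\<And>t. t \<in> {0..b} \<Longrightarrow> \<gamma> t \<in> chart_dom c \<and> chart_map c (\<gamma> t) \<in> K"
    and m: "m \<ge> 0" "\<And>x v. x \<in> K \<Longrightarrow> m * norm v \<le> chart_norm c x v"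
  shows "ennreal (m * norm (chart_map c (\<gamma> b) - chart_map c (\<gamma> 0))) \<le> curve_length A h \<gamma>"
proof -
  let ?f = "\<lambda>t. chart_map c (\<gamma> t)"
  have c1: "continuous_on {0..1} \<gamma>" using \<gamma> unfolding piecewise_C1_curve_def by auto
  have "\<gamma> ` {0..b} \<subseteq> chart_dom c" using K by blast
  then have "?f piecewise_C1_differentiable_on {0..b}"
    using \<gamma> c b unfolding piecewise_C1_curve_def by auto
  then obtain S where S: "finite S" "?f C1_differentiable_on ({0..b} - S)" "continuous_on {0..b} ?f"
    unfolding piecewise_C1_differentiable_on_def by blast
  then obtain D where D: "\<And>t. t \<in> {0..b} - S \<Longrightarrow> (?f has_vector_derivative D t) (at t)" "continuous_on ({0..b} - S) D"
    unfolding C1_differentiable_on_def by blast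
  define T where "T = {0<..<b} - S"
  define k where "k t = indicat_real T t *\<^sub>R D t" for t
  have T: "T \<in> sets borel" unfolding T_def using S(1) by (intro sets.Diff borel_open borel_closed finite_imp_closed open_greaterThanLessThan)
  have "(k has_integral (?f b - ?f 0)) {0..b}"
    by (rule fundamental_theorem_of_calculus_interior_strong[OF S(1) _ _ S(3)]) (use b D(1) in \<open>auto simp: k_def T_def\<close>)
  then have kI: "(k has_integral (?f b - ?f 0)) UNIV"
    by (rule has_integral_on_superset) (auto simp: k_def T_def)
  have km: "k \<in> borel_measurable borel"
    unfolding k_def by (rule borel_measurable_continuous_on_indicator[OF T]) (rule continuous_on_subset[OF D(2)], auto simp: T_def)
  have "ennreal (m * norm (?f b - ?f 0)) = ennreal m * ennreal (norm (?f b - ?f 0))" using m by (simp add: ennreal_mult)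
  also have "\<dots> \<le> ennreal m * (\<integral>\<^sup>+t. ennreal (norm (k t)) \<partial>lborel)"
    by (intro mult_left_mono norm_integral_le_nn_integral km kI) auto
  also have "\<dots> = (\<integral>\<^sup>+t. ennreal m * ennreal (norm (k t)) \<partial>lborel)"
    using km by (subst nn_integral_cmult) auto
  also have "\<dots> \<le> curve_length A h \<gamma>"
    unfolding curve_length_def
  proof (rule nn_integral_mono)
    fix t
    show "ennreal m * ennreal (norm (k t)) \<le> ennreal (hnorm h (\<gamma> t) (velocity A \<gamma> t)) * indicator {0..1} t"
    proof (cases "t \<in> T")
      case True
      then have t: "t \<in> {0<..<b}" "t \<notin> S" by (auto simp: T_def)
      have "isCont \<gamma> t" using continuous_on_interior[OF c1, of t] t b by simp
      then have "hnorm h (\<gamma> t) (velocity A \<gamma> t) = chart_norm c (?f t) (D t)"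
        using speed_in_chart[OF c, of \<gamma> t "D t"] K[of t] D(1)[of t] t by (simp add: speed_def)
      moreover have "m * norm (D t) \<le> chart_norm c (?f t) (D t)" by (rule m(2)) (use K t in auto)
      ultimately have "m * norm (D t) \<le> hnorm h (\<gamma> t) (velocity A \<gamma> t)" by simp
      then show ?thesis using True t b m by (simp add: k_def ennreal_mult[symmetric] ennreal_leI)
    qed (simp add: k_def)
  qed
  finally show ?thesis .
qed

text \<open>A curve from \<open>q\<close> to a point outside the coordinate ball must run through
  the ball up to its boundary, and before the first exit time its length is bounded below in the
  chart. With the opposite estimate for segments this compares the Hermitian distance locally with
  the Euclidean one.\<close>

lemma metric_dist_lower_bound:
  assumes c: "c \<in> A" "q \<in> chart_dom c" and r: "r > 0" "cball (chart_map c q) r \<subseteq> chart_img c"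
    and m: "m \<ge> 0" "\<And>x v. x \<in> cball (chart_map c q) r \<Longrightarrow> m * norm v \<le> chart_norm c x v"
    and q': "q' \<notin> chart_inv c ` ball (chart_map c q) r"
  shows "m * r \<le> metric_dist A h q q'"
proof -
  let ?V = "chart_dom c \<inter> chart_map c -` ball (chart_map c q) r"
  have V: "open ?V" by (rule open_chart_preimage[OF c(1) open_ball])
  have q'V: "q' \<notin> ?V" using q' chart_inv_map[OF c(1)] by (metis IntE image_eqI vimageE)
  have "ennreal (m * r) \<le> cost q q'"
    unfolding cost_def
  proof (rule INF_greatest)
    fix \<gamma> assume "\<gamma> \<in> {\<gamma>. piecewise_C1_curve A \<gamma> \<and> \<gamma> 0 = q \<and> \<gamma> 1 = q'}"
    then have \<gamma>: "piecewise_C1_curve A \<gamma>" "\<gamma> 0 = q" "\<gamma> 1 = q'" by auto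
    have c1: "continuous_on {0..1} \<gamma>" using \<gamma>(1) unfolding piecewise_C1_curve_def by auto
    let ?I = "{0..1} \<inter> \<gamma> -` (- ?V)"
    have "closed ?I" by (rule continuous_closed_preimage[OF c1 _ closed_Compl[OF V]]) simp
    then have I: "compact ?I" by (simp add: compact_eq_bounded_closed bounded_Int)
    have "1 \<in> ?I" using \<gamma> q'V by auto
    then obtain t1 where t1: "t1 \<in> ?I" "\<And>t. t \<in> ?I \<Longrightarrow> t1 \<le> t"
      using compact_attains_inf[OF I] by blast
    have "\<gamma> 0 \<in> ?V" using c r \<gamma> by auto
    then have "t1 \<noteq> 0" using t1(1) by auto
    then have t1': "0 < t1" "t1 \<le> 1" using t1(1) by auto
    have inV: "\<gamma> t \<in> ?V" if "0 \<le> t" "t < t1" for t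
    proof (rule ccontr)
      assume "\<gamma> t \<notin> ?V"
      then have "t \<in> ?I" using that t1' by auto
      then show False using t1(2) that by fastforce
    qed
    \<comment> \<open>At the exit time the curve may already be outside the chart, so coordinates
      are read at earlier times only. Any radius \<open>r' < r\<close> is reached there, and
      \<open>r'\<close> tends to \<open>r\<close> afterwards.\<close>
    have le: "m * r' \<le> enn2real (curve_length A h \<gamma>)" if r': "0 < r'" "r' < r" and fin: "curve_length A h \<gamma> < \<infinity>" for r'
    proof -
      have "\<exists>t. 0 < t \<and> t < t1 \<and> r' \<le> dist (chart_map c (\<gamma> t)) (chart_map c q)"
      proof (rule ccontr)
        assume "\<not> ?thesis"
        then have small: "dist (chart_map c (\<gamma> t)) (chart_map c q) < r'" if "0 < t" "t < t1" for t
          using that by force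
        \<comment> \<open>If the curve stayed within coordinate distance \<open>r'\<close> until the
          exit time, its limit would lie in this compact, hence closed, set and therefore still in
          \<open>?V\<close>.\<close>
        let ?Q = "chart_inv c ` cball (chart_map c q) r'"
        have sub: "cball (chart_map c q) r' \<subseteq> ball (chart_map c q) r" using r' by auto
        have "compact ?Q"
          by (intro compact_continuous_image continuous_on_subset[OF continuous_chart_inv[OF c(1)]])
             (use order_trans[OF sub ball_subset_cball] r(2) in \<open>blast intro: compact_cball\<close>)+
        then have Q: "closed ?Q" by (rule compact_imp_closed)
        have "(\<gamma> \<longlongrightarrow> \<gamma> t1) (at t1 within {0<..<t1})"
          using continuous_on_subset[OF c1, of "{0..t1}"] t1' unfolding continuous_on_def
          by (auto intro: tendsto_within_subset[of _ _ _ "{0..t1}"])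
        moreover have "\<forall>\<^sub>F t in at t1 within {0<..<t1}. \<gamma> t \<in> ?Q"
          unfolding eventually_at
        proof (intro exI[of _ 1] conjI ballI impI)
          fix t assume t: "t \<in> {0<..<t1}"
          then have "chart_map c (\<gamma> t) \<in> cball (chart_map c q) r'" using small[of t] by (simp add: dist_commute)
          moreover have "chart_inv c (chart_map c (\<gamma> t)) = \<gamma> t" using inV[of t] t c by (intro chart_inv_map) auto
          ultimately show "\<gamma> t \<in> ?Q" by (metis image_eqI)
        qed simp
        moreover have "at t1 within {0<..<t1} \<noteq> bot"
          using t1' by (simp add: at_within_eq_bot_iff)
        ultimately have "\<gamma> t1 \<in> ?Q" using Lim_in_closed_set[OF Q] by blast
        then obtain x where x: "x \<in> cball (chart_map c q) r'" "\<gamma> t1 = chart_inv c x" by auto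
        then have xb: "x \<in> ball (chart_map c q) r" using sub by blast
        then have "x \<in> chart_img c" using r(2) ball_subset_cball by blast
        then have "\<gamma> t1 \<in> ?V" using xb x(2) chart_inv_in[OF c(1)] chart_map_inv[OF c(1)] by auto
        then show False using t1(1) by auto
      qed
      then obtain t where t: "0 < t" "t < t1" "r' \<le> dist (chart_map c (\<gamma> t)) (chart_map c q)" by blast
      have "ennreal (m * norm (chart_map c (\<gamma> t) - chart_map c (\<gamma> 0))) \<le> curve_length A h \<gamma>"
      proof (rule curve_length_ge_in_chart[OF \<gamma>(1) c(1) t(1), where K = "cball (chart_map c q) r"])
        show "\<gamma> s \<in> chart_dom c \<and> chart_map c (\<gamma> s) \<in> cball (chart_map c q) r" if "s \<in> {0..t}" for s
          using inV[of s] that t by auto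
      qed (use t t1' m in auto)
      then have "m * norm (chart_map c (\<gamma> t) - chart_map c (\<gamma> 0)) \<le> enn2real (curve_length A h \<gamma>)"
        using fin m by (metis enn2real_ennreal enn2real_mono infinity_ennreal_def mult_nonneg_nonneg norm_ge_zero)
      moreover have "m * r' \<le> m * norm (chart_map c (\<gamma> t) - chart_map c (\<gamma> 0))"
        using t(3) m by (intro mult_left_mono) (simp_all add: \<gamma> dist_norm)
      ultimately show ?thesis by simp
    qed
    show "ennreal (m * r) \<le> curve_length A h \<gamma>"
    proof (cases "curve_length A h \<gamma> < \<infinity>")
      case True
      have "m * r \<le> enn2real (curve_length A h \<gamma>)"
      proof (rule tendsto_upperbound)
        show "((\<lambda>r'. m * r') \<longlongrightarrow> m * r) (at_left r)" by (intro tendsto_intros)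
        show "\<forall>\<^sub>F r' in at_left r. m * r' \<le> enn2real (curve_length A h \<gamma>)"
          unfolding eventually_at_left_field using le r True by (intro exI[of _ 0]) auto
      qed simp
      then show ?thesis using True by (metis ennreal_enn2real ennreal_leI infinity_ennreal_def)
    next
      case False
      then show ?thesis by (simp add: not_less top_unique)
    qed
  qed
  then show ?thesis by (simp add: ennreal_metric_dist[symmetric] metric_dist_nonneg)
qed

end

section \<open>The Kobayashi distance\<close>

lemma artanh_mono:
  fixes x y :: real
  assumes "0 \<le> x" "x \<le> y" "y < 1"
  shows "artanh x \<le> artanh y"
proof -
  have "(1 + x) / (1 - x) \<le> (1 + y) / (1 - y)"
    using assms by (intro frac_le) auto
  then show ?thesis using assms by (simp add: artanh_def)
qed

lemma poincare_dist_Moebius: "poincare_dist a b = artanh (cmod (Moebius_function 0 a b))"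
  by (simp add: poincare_dist_def Moebius_function_simple norm_divide norm_minus_commute)

lemma poincare_dist_nonneg:
  assumes "a \<in> ball 0 1" "b \<in> ball 0 1"
  shows "0 \<le> poincare_dist a b"
  using artanh_mono[of 0 "cmod (Moebius_function 0 a b)"] Moebius_function_norm_lt_1[of a b 0] assms
  by (simp add: poincare_dist_Moebius)

lemma Moebius_inverse:
  assumes "norm a < 1" "norm z < 1"
  shows "Moebius_function 0 a (Moebius_function 0 (- a) z) = z"
  by (rule Moebius_function_compose) (use assms in auto)

text \<open>The witness is the closed hyperbolic disc around \<open>a\<close> with \<open>b\<close> on its boundary.\<close>

lemma hyperbolic_disc_connected:
  assumes ab: "a \<in> ball 0 1" "b \<in> ball 0 1"
  obtains Z where "connected Z" "Z \<subseteq> ball 0 1" "a \<in> Z" "b \<in> Z" "\<And>\<zeta>. \<zeta> \<in> Z \<Longrightarrow> poincare_dist a \<zeta> \<le> poincare_dist a b"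
proof -
  let ?s = "cmod (Moebius_function 0 a b)"
  have s: "?s < 1" using Moebius_function_norm_lt_1[of a b 0] ab by simp
  have sub: "cball 0 ?s \<subseteq> ball (0::complex) 1" using s by auto
  let ?Z = "Moebius_function 0 (- a) ` cball 0 ?s"
  show thesis
  proof (rule that[of ?Z])
    have "Moebius_function 0 (- a) holomorphic_on ball 0 1"
      using Moebius_function_holomorphic[of "- a" 0] ab by simp
    then have "continuous_on (cball 0 ?s) (Moebius_function 0 (- a))"
      using holomorphic_on_imp_continuous_on continuous_on_subset sub by blast
    then show "connected ?Z" by (rule connected_continuous_image) (rule convex_connected[OF convex_cball])
    show "?Z \<subseteq> ball 0 1"
    proof (rule image_subsetI)
      fix z :: complex assume "z \<in> cball 0 ?s"
      then have "norm z < 1" using s by auto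
      then show "Moebius_function 0 (- a) z \<in> ball 0 1" using Moebius_function_norm_lt_1[of "- a" z 0] ab by simp
    qed
    have "Moebius_function 0 (- a) 0 = a" by (simp add: Moebius_function_of_zero)
    then show "a \<in> ?Z" by (metis centre_in_cball image_eqI norm_ge_zero)
    have "Moebius_function 0 (- a) (Moebius_function 0 a b) = b"
      using Moebius_inverse[of "- a" b] ab by simp
    then show "b \<in> ?Z" by (metis dist_0_norm image_eqI mem_cball order_refl)
    fix \<zeta> assume "\<zeta> \<in> ?Z"
    then obtain z where z: "norm z \<le> ?s" "\<zeta> = Moebius_function 0 (- a) z" by auto
    then have "Moebius_function 0 a \<zeta> = z" using Moebius_inverse[of a z] ab s by simp
    then show "poincare_dist a \<zeta> \<le> poincare_dist a b"
      using z s by (simp add: poincare_dist_Moebius artanh_mono)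
  qed
qed

abbreviation chain_length :: "((complex \<Rightarrow> 'm) \<times> complex \<times> complex) list \<Rightarrow> real"
  where "chain_length L \<equiv> \<Sum>(f, a, b)\<leftarrow>L. poincare_dist a b"

lemma chain_length_nonneg: "disc_chain A z L w \<Longrightarrow> 0 \<le> chain_length L"
  by (induction A z L w rule: disc_chain.induct) (auto simp: poincare_dist_nonneg add_nonneg_nonneg)

lemma disc_chain_append: "disc_chain A z L u \<Longrightarrow> disc_chain A u L' w \<Longrightarrow> disc_chain A z (L @ L') w"
  by (induction A z L u rule: disc_chain.induct) auto

lemma kobayashi_le: "disc_chain A z L w \<Longrightarrow> kobayashi A z w \<le> chain_length L"
  unfolding kobayashi_def
  by (rule cINF_lower) (auto intro!: bdd_belowI2[of _ 0] chain_length_nonneg)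

locale complete_hyperbolic_mfd = complex_mfd A
  for A :: "('m::{t2_space, second_countable_topology}, 'n::finite) chart set" +
  assumes hyp: "complete_hyperbolic A"
begin

sublocale K: Metric_space UNIV "kobayashi A"
  using hyp unfolding complete_hyperbolic_def by blast

section \<open>Discs in charts and chains of discs\<close>

text \<open>The affine disc centred at \<open>p\<close> in the direction of \<open>q\<close>, scaled
  so that the unit disc fills the radius \<open>r\<close>; then \<open>q\<close> is the image of a
  real point, the coordinate distance divided by \<open>r\<close>.\<close>

lemma disc_in_chart:
  assumes c: "c \<in> A" "p \<in> chart_dom c" and r: "r > 0" "ball (chart_map c p) r \<subseteq> chart_img c"
    and q: "q \<in> chart_dom c" "chart_map c q \<in> ball (chart_map c p) r" "q \<noteq> p"
  obtains f b where "holomorphic_disc A f" "b \<in> ball 0 1" "f 0 = p" "f b = q"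
    "poincare_dist 0 b = artanh (dist (chart_map c p) (chart_map c q) / r)"
proof -
  let ?x = "chart_map c p"
  define u where "u = chart_map c q - ?x"
  have u: "u \<noteq> 0" using q c chart_inv_map by (metis right_minus_eq u_def)
  have nu: "norm u < r" using q by (simp add: u_def dist_norm norm_minus_commute)
  define w where "w = (r / norm u) *\<^sub>R u"
  have nw: "norm w = r" using u r by (simp add: w_def)
  have in_ball: "?x + \<zeta> *s w \<in> ball ?x r" if "norm \<zeta> < 1" for \<zeta>
    using that r by (simp add: dist_norm norm_vector_smult nw)
  define f where "f \<zeta> = chart_inv c (?x + \<zeta> *s w)" for \<zeta>
  define b where "b = complex_of_real (norm u / r)"
  have bw: "b *s w = u"
    unfolding b_def vector_smult_of_real using u r by (simp add: w_def)
  have cf: "continuous_on (ball 0 1) f"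
    unfolding f_def
  proof (rule continuous_on_compose2[OF continuous_chart_inv[OF c(1)]])
    show "continuous_on (ball 0 1) (\<lambda>\<zeta>. ?x + \<zeta> *s w)"
      by (intro continuous_intros linear_continuous_on bounded_linear_vector_smult_left)
    show "(\<lambda>\<zeta>. ?x + \<zeta> *s w) ` ball 0 1 \<subseteq> chart_img c"
      using in_ball r(2) by auto
  qed
  show thesis
  proof (rule that[of f b])
    show "holomorphic_disc A f"
      unfolding holomorphic_disc_def
    proof (intro conjI cf ballI allI)
      fix c' i assume c': "c' \<in> A"
      show "(\<lambda>\<zeta>. chart_map c' (f \<zeta>) $ i) holomorphic_on (ball 0 1 \<inter> f -` chart_dom c')"
      proof (rule holomorphic_onI, rule field_differentiable_at_within)
        fix \<zeta> assume \<zeta>: "\<zeta> \<in> ball 0 1 \<inter> f -` chart_dom c'"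
        have "?x + \<zeta> *s w \<in> chart_map c ` (chart_dom c \<inter> chart_dom c')"
          unfolding chart_image_eq[OF c(1)] using \<zeta> in_ball[of \<zeta>] r(2) by (auto simp: f_def)
        from cholomorphic_on_slice[OF holomorphic_transition[OF c(1) c'] this, of i]
        show "(\<lambda>\<zeta>. chart_map c' (f \<zeta>) $ i) field_differentiable at \<zeta>"
          unfolding field_differentiable_def f_def by (auto simp: o_def)
      qed
    qed
    show "b \<in> ball 0 1" using nu r by (simp add: b_def norm_divide)
    show "f 0 = p" using c by (simp add: f_def chart_inv_map)
    show "f b = q" using c q by (simp add: f_def bw u_def chart_inv_map)
    show "poincare_dist 0 b = artanh (dist ?x (chart_map c q) / r)"
      using r by (simp add: poincare_dist_def b_def u_def dist_norm norm_minus_commute norm_divide)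
  qed
qed

lemma kobayashi_le_in_chart:
  assumes c: "c \<in> A" "p \<in> chart_dom c" and r: "r > 0" "ball (chart_map c p) r \<subseteq> chart_img c"
    and q: "q \<in> chart_dom c" "chart_map c q \<in> ball (chart_map c p) r"
  shows "kobayashi A p q \<le> artanh (dist (chart_map c p) (chart_map c q) / r)"
proof (cases "q = p")
  case True
  then show ?thesis by simp
next
  case False
  obtain f b where f: "holomorphic_disc A f" "b \<in> ball 0 1" "f 0 = p" "f b = q"
    "poincare_dist 0 b = artanh (dist (chart_map c p) (chart_map c q) / r)"
    using disc_in_chart[OF c r q False] by blast
  then show ?thesis using kobayashi_le[of A p "[(f, 0, b)]" q] by simp
qed

text \<open>A single affine disc bounds \<open>kobayashi A p\<close> near \<open>p\<close> by a
  continuous function that vanishes at \<open>p\<close>; this is the source of its continuity for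
  the manifold topology.\<close>

lemma kobayashi_small:
  assumes e: "e > 0"
  obtains U where "open U" "p \<in> U" "\<And>q. q \<in> U \<Longrightarrow> kobayashi A p q < e"
proof -
  obtain c where c: "c \<in> A" "p \<in> chart_dom c" using chart_exists by blast
  obtain r where r: "r > 0" "cball (chart_map c p) r \<subseteq> chart_img c" using chart_cball[OF c open_UNIV] by auto
  then have rb: "ball (chart_map c p) r \<subseteq> chart_img c" using ball_subset_cball by blast
  \<comment> \<open>Chosen so that \<open>artanh\<close> returns \<open>e/2\<close>, strictly below
    \<open>e\<close>.\<close>
  let ?s = "tanh (e/2)"
  have s: "0 < ?s" "?s < 1" using e by (simp_all add: tanh_real_lt_1)
  let ?U = "chart_dom c \<inter> chart_map c -` ball (chart_map c p) (r * ?s)"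
  show thesis
  proof (rule that[of ?U])
    show "open ?U" by (rule open_chart_preimage[OF c(1) open_ball])
    show "p \<in> ?U" using c r s by simp
    fix q assume q: "q \<in> ?U"
    have "r * ?s \<le> r" using r s by simp
    then have "kobayashi A p q \<le> artanh (dist (chart_map c p) (chart_map c q) / r)"
      using q by (intro kobayashi_le_in_chart[OF c r(1) rb]) auto
    also have "\<dots> \<le> artanh ?s"
      using q r s by (intro artanh_mono) (auto simp: field_simps)
    also have "\<dots> = e/2" by (simp add: artanh_tanh_real)
    finally show "kobayashi A p q < e" using e by simp
  qed
qed

text \<open>The infimum in \<open>kobayashi\<close> is meaningful only over a nonempty set of
  chains. Exchanging the marked points reverses a disc, which makes reachability symmetric between
  neighbouring points.\<close>

lemma disc_chain_exists: "\<exists>L. disc_chain A z L w"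
proof (rule connected_UNIV_propagate[OF connected_mfd, where P = "\<lambda>w. \<exists>L. disc_chain A z L w"])
  show "\<exists>L. disc_chain A z L z" by (rule exI[of _ "[]"]) simp
  fix p
  obtain c where c: "c \<in> A" "p \<in> chart_dom c" using chart_exists by blast
  obtain r where r: "r > 0" "cball (chart_map c p) r \<subseteq> chart_img c" using chart_cball[OF c open_UNIV] by auto
  then have rb: "ball (chart_map c p) r \<subseteq> chart_img c" using ball_subset_cball by blast
  let ?U = "chart_dom c \<inter> chart_map c -` ball (chart_map c p) r"
  have "(\<exists>L. disc_chain A z L p) \<longleftrightarrow> (\<exists>L. disc_chain A z L q)" if q: "q \<in> ?U" for q
  proof (cases "q = p")
    case False
    obtain f b where f: "holomorphic_disc A f" "b \<in> ball 0 1" "f 0 = p" "f b = q"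
      using disc_in_chart[OF c r(1) rb _ _ False] q by blast
    then have "disc_chain A p [(f, 0, b)] q" "disc_chain A q [(f, b, 0)] p" by simp_all
    then show ?thesis using disc_chain_append by blast
  qed simp
  then show "\<exists>U. open U \<and> p \<in> U \<and> (\<forall>q\<in>U. (\<exists>L. disc_chain A z L p) = (\<exists>L. disc_chain A z L q))"
    using c r by (intro exI[of _ ?U]) (auto intro: open_chart_preimage)
qed

section \<open>The topology of the Kobayashi distance\<close>

text \<open>From each disc of the chain a hyperbolic disc is kept, all of whose points are reached
  at no greater cost; consecutive pieces share a point. The resulting connected set plays the part
  of a path, so a chain cannot jump over a separating set.\<close>

lemma disc_chain_connected:
  assumes "disc_chain A z L w"
  shows "\<exists>S. connected S \<and> z \<in> S \<and> w \<in> S \<and> (\<forall>y\<in>S. \<exists>L'. disc_chain A z L' y \<and> chain_length L' \<le> chain_length L)"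
  using assms
proof (induction L arbitrary: z)
  case Nil
  then show ?case by (intro exI[of _ "{w}"]) (auto intro!: exI[of _ "[]"])
next
  case (Cons d L)
  obtain f a b where d: "d = (f, a, b)" by (cases d)
  have f: "holomorphic_disc A f" "a \<in> ball 0 1" "b \<in> ball 0 1" "f a = z" "disc_chain A (f b) L w"
    using Cons.prems by (auto simp: d)
  obtain S where S: "connected S" "f b \<in> S" "w \<in> S"
      "\<And>y. y \<in> S \<Longrightarrow> \<exists>L'. disc_chain A (f b) L' y \<and> chain_length L' \<le> chain_length L"
    using Cons.IH[OF f(5)] by blast
  obtain Z where Z: "connected Z" "Z \<subseteq> ball 0 1" "a \<in> Z" "b \<in> Z" "\<And>\<zeta>. \<zeta> \<in> Z \<Longrightarrow> poincare_dist a \<zeta> \<le> poincare_dist a b"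
    using hyperbolic_disc_connected[OF f(2,3)] by blast
  have "connected (f ` Z)"
    using f(1) Z(1,2) unfolding holomorphic_disc_def
    by (intro connected_continuous_image) (auto intro: continuous_on_subset)
  then have "connected (f ` Z \<union> S)" using S(1,2) Z(4) by (intro connected_Un) auto
  moreover have "\<exists>L'. disc_chain A z L' y \<and> chain_length L' \<le> chain_length (d # L)" if "y \<in> f ` Z \<union> S" for y
    using that
  proof
    assume "y \<in> f ` Z"
    then obtain \<zeta> where \<zeta>: "\<zeta> \<in> Z" "y = f \<zeta>" by blast
    have "disc_chain A z [(f, a, \<zeta>)] y" using f \<zeta> Z(2) by auto
    moreover have "chain_length [(f, a, \<zeta>)] \<le> chain_length (d # L)"
      using Z(5)[OF \<zeta>(1)] chain_length_nonneg[OF f(5)] by (simp add: d)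
    ultimately show ?thesis by blast
  next
    assume "y \<in> S"
    then obtain L' where L': "disc_chain A (f b) L' y" "chain_length L' \<le> chain_length L" using S(4) by blast
    have "disc_chain A z ((f, a, b) # L') y" using f L' by simp
    moreover have "chain_length ((f, a, b) # L') \<le> chain_length (d # L)" using L'(2) by (simp add: d)
    ultimately show ?thesis by blast
  qed
  ultimately show ?case using S(3) Z(3) f(4) by (intro exI[of _ "f ` Z \<union> S"]) auto
qed

lemma tendsto_kobayashi:
  assumes "(f \<longlongrightarrow> p) F" "(g \<longlongrightarrow> q) F"
  shows "((\<lambda>x. kobayashi A (f x) (g x)) \<longlongrightarrow> kobayashi A p q) F"
proof (rule tendstoI)
  fix e :: real assume e: "e > 0"
  obtain U where U: "open U" "p \<in> U" "\<And>y. y \<in> U \<Longrightarrow> kobayashi A p y < e/2" using kobayashi_small[OF half_gt_zero[OF e], of p] by blast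
  obtain V where V: "open V" "q \<in> V" "\<And>y. y \<in> V \<Longrightarrow> kobayashi A q y < e/2" using kobayashi_small[OF half_gt_zero[OF e], of q] by blast
  have "\<forall>\<^sub>F x in F. f x \<in> U" "\<forall>\<^sub>F x in F. g x \<in> V"
    using assms U(1,2) V(1,2) by (auto intro: topological_tendstoD)
  then show "\<forall>\<^sub>F x in F. dist (kobayashi A (f x) (g x)) (kobayashi A p q) < e"
  proof eventually_elim
    case (elim x)
    note b = U(3)[OF elim(1)] V(3)[OF elim(2)]
    have "kobayashi A (f x) (g x) \<le> kobayashi A (f x) p + kobayashi A p q + kobayashi A q (g x)"
      using K.triangle[of "f x" p "g x"] K.triangle[of p q "g x"] by simp
    moreover have "kobayashi A p q \<le> kobayashi A p (f x) + kobayashi A (f x) (g x) + kobayashi A (g x) q"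
      using K.triangle[of p "f x" q] K.triangle[of "f x" "g x" q] by simp
    ultimately show ?case using b K.commute[of p "f x"] K.commute[of q "g x"] by (simp add: dist_real_def abs_if)
  qed
qed

text \<open>Barth's argument: a chain of discs from \<open>p\<close> that leaves a compact coordinate ball crosses the
  boundary sphere, at a point whose distance from \<open>p\<close> is at most the length of the chain.\<close>

lemma kobayashi_nbhd:
  assumes W: "open W" "p \<in> W"
  obtains e where "e > 0" "\<And>q. kobayashi A p q < e \<Longrightarrow> q \<in> W"
proof -
  obtain c where c: "c \<in> A" "p \<in> chart_dom c" using chart_exists by blast
  obtain r where r: "r > 0" "cball (chart_map c p) r \<subseteq> chart_img c" "chart_inv c ` cball (chart_map c p) r \<subseteq> W"
    using chart_cball[OF c W] by auto
  let ?x = "chart_map c p"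
  let ?O = "chart_dom c \<inter> chart_map c -` ball ?x r"
  let ?Q = "chart_inv c ` cball ?x r" and ?T = "chart_inv c ` sphere ?x r"
  have cinv: "continuous_on (cball ?x r) (chart_inv c)"
    by (rule continuous_on_subset[OF continuous_chart_inv[OF c(1)] r(2)])
  have Q: "closed ?Q"
    by (rule compact_imp_closed[OF compact_continuous_image[OF cinv compact_cball]])
  have T: "compact ?T"
    by (rule compact_continuous_image[OF continuous_on_subset[OF cinv sphere_cball]]) simp
  have O: "open ?O" by (rule open_chart_preimage[OF c(1) open_ball])
  have sub: "sphere ?x r \<subseteq> chart_img c" using r(2) sphere_cball by blast
  have OQ: "?O \<subseteq> ?Q"
  proof
    fix q assume "q \<in> ?O"
    then have "chart_inv c (chart_map c q) = q" "chart_map c q \<in> cball ?x r" using c by (auto simp: chart_inv_map)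
    then show "q \<in> ?Q" by (metis image_eqI)
  qed
  have QO: "q \<in> ?O" if q: "q \<in> ?Q" "q \<notin> ?T" for q
  proof -
    obtain y where y: "y \<in> cball ?x r" "q = chart_inv c y" using q(1) by blast
    then have "y \<notin> sphere ?x r" using q(2) by blast
    then have "y \<in> ball ?x r" using y by auto
    moreover have "y \<in> chart_img c" using y(1) r(2) by blast
    ultimately show ?thesis using y(2) chart_map_inv[OF c(1), of y] chart_inv_in[OF c(1), of y] by auto
  qed
  \<comment> \<open>Hyperbolicity enters here: \<open>kobayashi A\<close> separates points, so by
    compactness it has a positive minimum on the coordinate sphere.\<close>
  have pos: "kobayashi A p y > 0" if y: "y \<in> ?T" for y
  proof -
    obtain x where x: "x \<in> sphere ?x r" "y = chart_inv c x" using y by blast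
    then have "chart_map c y = x" using chart_map_inv[OF c(1)] sub by blast
    then have "y \<noteq> p" using x r by auto
    then show ?thesis by (metis K.mdist_pos_less UNIV_I)
  qed
  have "\<exists>e>0. \<forall>y\<in>?T. e \<le> kobayashi A p y"
  proof (cases "?T = {}")
    case True
    then show ?thesis by (intro exI[of _ 1]) auto
  next
    case False
    have "continuous_on ?T (kobayashi A p)"
      unfolding continuous_on_def by (auto intro!: tendsto_kobayashi tendsto_ident_at)
    then obtain y where "y \<in> ?T" "\<forall>z\<in>?T. kobayashi A p y \<le> kobayashi A p z"
      using continuous_attains_inf[OF T False] by blast
    then show ?thesis using pos by blast
  qed
  then obtain e where e: "e > 0" "\<And>y. y \<in> ?T \<Longrightarrow> e \<le> kobayashi A p y" by blast
  show thesis
  proof (rule that[OF e(1)])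
    fix q assume q: "kobayashi A p q < e"
    have "{L. disc_chain A p L q} \<noteq> {}" using disc_chain_exists by blast
    then obtain L where L: "disc_chain A p L q" "chain_length L < e"
      using q cInf_lessD[of "(\<lambda>L. chain_length L) ` {L. disc_chain A p L q}" e] unfolding kobayashi_def by auto
    obtain S where S: "connected S" "p \<in> S" "q \<in> S"
      "\<And>y. y \<in> S \<Longrightarrow> \<exists>L'. disc_chain A p L' y \<and> chain_length L' \<le> chain_length L"
      using disc_chain_connected[OF L(1)] by blast
    have ST: "S \<inter> ?T = {}"
    proof (rule ccontr)
      assume "S \<inter> ?T \<noteq> {}"
      then obtain y where y: "y \<in> S" "y \<in> ?T" by blast
      then obtain L' where "disc_chain A p L' y" "chain_length L' \<le> chain_length L" using S(4) by blast
      then show False using kobayashi_le[of A p L' y] L(2) e(2)[OF y(2)] by linarith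
    qed
    have cover: "S \<subseteq> ?O \<union> - ?Q" using QO ST by blast
    have disj: "?O \<inter> (- ?Q) \<inter> S = {}" using OQ by blast
    have "open (- ?Q)" using Q by (rule open_Compl)
    moreover have "p \<in> ?O" using c r by simp
    ultimately have "(- ?Q) \<inter> S = {}"
      using connectedD[OF S(1) O _ disj cover] S(2) by blast
    then show "q \<in> W" using S(3) r(3) by blast
  qed
qed

text \<open>Continuity of \<open>kobayashi A\<close> gives one direction,
  \<open>kobayashi_nbhd\<close> the other. With it, convergence in the manifold can be tested by the
  distance.\<close>

lemma tendsto_iff_kobayashi: "(f \<longlongrightarrow> p) F \<longleftrightarrow> ((\<lambda>x. kobayashi A p (f x)) \<longlongrightarrow> 0) F"
proof
  assume "(f \<longlongrightarrow> p) F"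
  then show "((\<lambda>x. kobayashi A p (f x)) \<longlongrightarrow> 0) F"
    using tendsto_kobayashi[OF tendsto_const, of f p F p] by simp
next
  assume *: "((\<lambda>x. kobayashi A p (f x)) \<longlongrightarrow> 0) F"
  show "(f \<longlongrightarrow> p) F"
  proof (rule topological_tendstoI)
    fix W assume W: "open W" "p \<in> W"
    obtain e where e: "e > 0" "\<And>q. kobayashi A p q < e \<Longrightarrow> q \<in> W" using kobayashi_nbhd[OF W] by blast
    have "\<forall>\<^sub>F x in F. kobayashi A p (f x) < e" using * e(1) by (rule order_tendstoD)
    then show "\<forall>\<^sub>F x in F. f x \<in> W" by eventually_elim (rule e(2))
  qed
qed

text \<open>Completeness is formulated in the metric topology \<open>K.mtopology\<close>; the limit
  found there is transferred to the topology of the type.\<close>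

lemma kobayashi_Cauchy_convergent:
  assumes "\<And>e. e > 0 \<Longrightarrow> \<exists>N. \<forall>m\<ge>N. \<forall>n\<ge>N. kobayashi A (\<sigma> m) (\<sigma> n) < e"
  obtains q where "\<sigma> \<longlonglongrightarrow> q"
proof -
  have "K.MCauchy \<sigma>" unfolding K.MCauchy_def using assms by fastforce
  then obtain q where "limitin K.mtopology \<sigma> q sequentially"
    using hyp unfolding complete_hyperbolic_def K.mcomplete_def by blast
  then have "\<And>e. e > 0 \<Longrightarrow> \<exists>N. \<forall>n\<ge>N. kobayashi A (\<sigma> n) q < e"
    unfolding K.limit_metric_sequentially by blast
  then have "(\<lambda>n. kobayashi A q (\<sigma> n)) \<longlonglongrightarrow> 0"
    by (intro metric_LIMSEQ_I) (simp add: K.commute)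
  then show thesis using that tendsto_iff_kobayashi by blast
qed

end

section \<open>Solutions on the manifold\<close>

text \<open>The definitions speak of \<open>AE\<close>, the theory of the gauge integral of
  \<open>negligible\<close>; this is the passage between them.\<close>

lemma AE_lebesgue_on_iff_negligible:
  assumes S: "S \<in> sets lebesgue"
  shows "(AE t in lebesgue_on S. P t) \<longleftrightarrow> negligible {t \<in> S. \<not> P t}"
proof -
  have "(AE t in lebesgue_on S. P t) \<longleftrightarrow> (AE t in lebesgue. t \<in> S \<longrightarrow> P t)"
    using S by (subst AE_restrict_space_iff) auto
  also have "\<dots> \<longleftrightarrow> negligible {t \<in> S. \<not> P t}"
  proof
    assume "AE t in lebesgue. t \<in> S \<longrightarrow> P t"
    then obtain N where N: "N \<in> null_sets lebesgue" "{t \<in> space lebesgue. \<not> (t \<in> S \<longrightarrow> P t)} \<subseteq> N"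
      unfolding eventually_ae_filter by blast
    have "negligible N" unfolding negligible_iff_null_sets by (rule N(1))
    then show "negligible {t \<in> S. \<not> P t}"
      by (rule negligible_subset) (use N(2) in simp)
  next
    assume "negligible {t \<in> S. \<not> P t}"
    then have "{t \<in> S. \<not> P t} \<in> null_sets lebesgue" unfolding negligible_iff_null_sets .
    then show "AE t in lebesgue. t \<in> S \<longrightarrow> P t"
      by (rule AE_I') simp
  qed
  finally show ?thesis .
qed

text \<open>On a bounded interval \<open>L^d\<close> is contained in \<open>L^1\<close>, since a
  nonnegative number is at most 1 plus its power of exponent \<open>d \<ge> 1\<close>; for
  \<open>d = \<infinity>\<close> boundedness suffices.\<close>

lemma Lp_nonneg_integrable:
  assumes C: "C \<in> Lp_nonneg d T" and d: "1 \<le> d"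
  shows "C integrable_on {0..T}" "integrable (lebesgue_on {0..T}) C"
proof -
  have meas: "C \<in> borel_measurable (lebesgue_on {0..T})" and nn: "\<And>t. t \<in> {0..T} \<Longrightarrow> 0 \<le> C t"
    using C by (auto simp: Lp_nonneg_def)
  interpret finite_measure "lebesgue_on {0..T}" by (rule finite_measure_lebesgue_on) auto
  show int: "integrable (lebesgue_on {0..T}) C"
  proof (cases "d = \<infinity>")
    case True
    then obtain B where "AE t in lebesgue_on {0..T}. C t \<le> B" using C by (auto simp: Lp_nonneg_def)
    moreover have "AE t in lebesgue_on {0..T}. 0 \<le> C t" using nn by (intro AE_I2) auto
    ultimately have "AE t in lebesgue_on {0..T}. norm (C t) \<le> B" by eventually_elim auto
    then show ?thesis by (rule integrable_const_bound[OF _ meas])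
  next
    case False
    let ?p = "enn2real d"
    have p: "1 \<le> ?p" using d False by (metis enn2real_1 enn2real_mono infinity_ennreal_def less_top)
    have "integrable (lebesgue_on {0..T}) (\<lambda>t. C t powr ?p)" using C False by (auto simp: Lp_nonneg_def)
    then have "integrable (lebesgue_on {0..T}) (\<lambda>t. 1 + C t powr ?p)" by auto
    then show ?thesis
    proof (rule Bochner_Integration.integrable_bound[OF _ meas])
      have "C t \<le> 1 + C t powr ?p" if "0 \<le> C t" for t
      proof (cases "C t \<le> 1")
        case False
        then have "C t powr 1 \<le> C t powr ?p" using p by (intro powr_mono) auto
        then show ?thesis using False by simp
      qed (auto intro: order_trans[of _ 1])
      then show "AE t in lebesgue_on {0..T}. norm (C t) \<le> norm (1 + C t powr ?p)"
        using nn by (intro AE_I2) auto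
    qed
  qed
  then show "C integrable_on {0..T}" by (rule integrable_on_lebesgue_on) auto
qed

lemma Lp_nonneg_cmult:
  assumes C: "C \<in> Lp_nonneg d T" and B: "0 \<le> B"
  shows "(\<lambda>t. B * C t) \<in> Lp_nonneg d T"
proof -
  have meas: "C \<in> borel_measurable (lebesgue_on {0..T})" and nn: "\<And>t. t \<in> {0..T} \<Longrightarrow> 0 \<le> C t"
    using C by (auto simp: Lp_nonneg_def)
  have "\<exists>B'. AE t in lebesgue_on {0..T}. B * C t \<le> B'" if di: "d = \<infinity>"
  proof -
    obtain B' where "AE t in lebesgue_on {0..T}. C t \<le> B'" using C di by (auto simp: Lp_nonneg_def)
    then have "AE t in lebesgue_on {0..T}. B * C t \<le> B * B'" by eventually_elim (simp add: B mult_left_mono)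
    then show ?thesis by blast
  qed
  moreover have "integrable (lebesgue_on {0..T}) (\<lambda>t. (B * C t) powr enn2real d)" if "d \<noteq> \<infinity>"
  proof -
    have "integrable (lebesgue_on {0..T}) (\<lambda>t. B powr enn2real d * C t powr enn2real d)"
      using C that by (auto simp: Lp_nonneg_def)
    then show ?thesis
      by (subst Bochner_Integration.integrable_cong[OF refl]) (use nn B in \<open>auto simp: powr_mult\<close>)
  qed
  ultimately show ?thesis using meas nn B by (auto simp: Lp_nonneg_def)
qed

lemma absolutely_integrable_Pair:
  fixes f :: "real \<Rightarrow> 'a::euclidean_space" and g :: "real \<Rightarrow> 'b::euclidean_space"
  assumes "f absolutely_integrable_on S" "g absolutely_integrable_on S"
  shows "(\<lambda>t. (f t, g t)) absolutely_integrable_on S"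
proof -
  have "(\<lambda>t. (f t, 0 :: 'b)) absolutely_integrable_on S" "(\<lambda>t. (0 :: 'a, g t)) absolutely_integrable_on S"
    using absolutely_integrable_linear[OF assms(1), of "\<lambda>v. (v, 0 :: 'b)"]
      absolutely_integrable_linear[OF assms(2), of "\<lambda>v. (0 :: 'a, v)"]
    by (auto simp: o_def bounded_linear_Pair bounded_linear_ident bounded_linear_zero)
  from set_integral_add(1)[OF this] show ?thesis by simp
qed

lemma has_integral_Pair_real:
  fixes f :: "real \<Rightarrow> 'a::euclidean_space" and g :: "real \<Rightarrow> 'b::euclidean_space"
  assumes "(f has_integral i) S" "(g has_integral j) S"
  shows "((\<lambda>t. (f t, g t)) has_integral (i, j)) S"
proof -
  have "((\<lambda>t. (f t, 0 :: 'b)) has_integral (i, 0)) S" "((\<lambda>t. (0 :: 'a, g t)) has_integral (0, j)) S"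
    using has_integral_linear[OF assms(1), of "\<lambda>v. (v, 0 :: 'b)"]
      has_integral_linear[OF assms(2), of "\<lambda>v. (0 :: 'a, v)"]
    by (auto simp: o_def bounded_linear_Pair bounded_linear_ident bounded_linear_zero)
  from has_integral_add[OF this] show ?thesis by simp
qed

locale herglotz_mfd = hermitian_mfd A h + complete_hyperbolic_mfd A
  for A :: "('m::{t2_space, second_countable_topology}, 'n::finite) chart set"
    and h :: "'m \<Rightarrow> ('m, 'n) tvec \<Rightarrow> ('m, 'n) tvec \<Rightarrow> complex" +
  fixes d :: ennreal and G :: "'m \<Rightarrow> real \<Rightarrow> ('m, 'n) tvec"
  assumes C1: "C1_off_Diag A (kobayashi A)"
    and d: "1 \<le> d"
    and G: "herglotz_vector_field A h d G"
begin

section \<open>The field in charts: measurability and bounds\<close>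

lemma G_weak: "weak_holomorphic_vector_field A h d G"
  using G unfolding herglotz_vector_field_def by (rule conjunct1)

lemmas G_weak_conjuncts = G_weak[unfolded weak_holomorphic_vector_field_def,
    THEN conjunct1] G_weak[unfolded weak_holomorphic_vector_field_def, THEN conjunct2]

lemma G_tangent: "0 \<le> t \<Longrightarrow> G z t \<in> tangent_space A z"
  using G_weak_conjuncts(1) by simp

lemma G_measurable:
  assumes "c \<in> A" "z \<in> chart_dom c" "0 \<le> u"
  shows "(\<lambda>t. G z t c) \<in> borel_measurable (lebesgue_on {u..v})"
proof -
  have "(\<lambda>t. G z t c) \<in> borel_measurable (lebesgue_on {0..})"
    using G_weak_conjuncts(2)[THEN conjunct1, rule_format, OF assms(1,2)] .
  then show ?thesis by (rule measurable_restrict_mono) (use assms in auto)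
qed

lemma G_holomorphic: "0 \<le> t \<Longrightarrow> c \<in> A \<Longrightarrow> cholomorphic_on (\<lambda>x. G (chart_inv c x) t c) (chart_img c)"
  by (rule G_weak_conjuncts(2)[THEN conjunct2, THEN conjunct1, rule_format])

lemma G_continuous:
  assumes "0 \<le> t" "c \<in> A"
  shows "continuous_on (chart_dom c) (\<lambda>z. G z t c)"
proof -
  have "continuous_on (chart_dom c) (\<lambda>z. G (chart_inv c (chart_map c z)) t c)"
    by (rule continuous_on_compose2[OF cholomorphic_on_imp_continuous_on[OF G_holomorphic[OF assms]] continuous_chart_map[OF assms(2)]]) auto
  then show ?thesis by (rule continuous_on_eq) (simp add: chart_inv_map[OF assms(2)])
qed

lemma hnorm_G_in_chart:
  assumes "0 \<le> t" "c \<in> A" "z \<in> chart_dom c"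
  shows "hnorm h z (G z t) = chart_norm c (chart_map c z) (G z t c)"
  using tangent_coord_vec[OF G_tangent[OF assms(1)] assms(2,3)]
  by (simp add: chart_norm_def chart_inv_map[OF assms(2,3)])

lemma continuous_hnorm_G:
  assumes t: "0 \<le> t"
  shows "continuous_on UNIV (\<lambda>z. hnorm h z (G z t))"
proof (rule continuous_at_imp_continuous_on, rule ballI)
  fix p
  obtain c where c: "c \<in> A" "p \<in> chart_dom c" using chart_exists by blast
  have "continuous_on (chart_dom c) (\<lambda>z. (\<lambda>(x, v). chart_norm c x v) (chart_map c z, G z t c))"
    by (rule continuous_on_compose2[OF continuous_on_chart_norm[OF c(1)]])
       (auto intro!: continuous_on_Pair continuous_chart_map G_continuous c t)
  then have "continuous_on (chart_dom c) (\<lambda>z. hnorm h z (G z t))"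
    by (rule continuous_on_eq) (simp add: hnorm_G_in_chart[OF t c(1)])
  then show "isCont (\<lambda>z. hnorm h z (G z t)) p"
    using c open_chart_dom continuous_on_eq_continuous_at by blast
qed

text \<open>The exceptional null sets for the points of a countable dense subset of \<open>K\<close> suffice.\<close>

lemma field_bound:
  assumes K: "compact K" and T: "0 < T"
  obtains C N where "C \<in> Lp_nonneg d T" "negligible N"
    "\<And>t z. t \<in> {0..T} - N \<Longrightarrow> z \<in> K \<Longrightarrow> hnorm h z (G z t) \<le> C t"
proof -
  obtain C where C: "C \<in> Lp_nonneg d T" "\<And>z. z \<in> K \<Longrightarrow> AE t in lebesgue_on {0..T}. hnorm h z (G z t) \<le> C t"
  proof -
    have "\<exists>C\<in>Lp_nonneg d T. \<forall>z\<in>K. AE t in lebesgue_on {0..T}. hnorm h z (G z t) \<le> C t"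
      by (rule G_weak_conjuncts(2)[THEN conjunct2, THEN conjunct2, rule_format, OF conjI[OF K T]])
    then show ?thesis using that by blast
  qed
  obtain B :: "'m set set" where B: "countable B" "topological_basis B" using ex_countable_basis by blast
  define D where "D = (\<lambda>b. SOME z. z \<in> b \<inter> K) ` {b \<in> B. b \<inter> K \<noteq> {}}"
  have D: "countable D" unfolding D_def using B(1) by (intro countable_image) auto
  have sel: "(SOME z. z \<in> b \<inter> K) \<in> b \<inter> K" if "b \<inter> K \<noteq> {}" for b
    using that by (intro someI_ex[of "\<lambda>z. z \<in> b \<inter> K"]) blast
  have DK: "D \<subseteq> K" unfolding D_def using sel by blast
  have "AE t in lebesgue_on {0..T}. \<forall>z\<in>D. hnorm h z (G z t) \<le> C t"
    using D C(2) DK by (subst AE_ball_countable) auto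
  then have N: "negligible {t \<in> {0..T}. \<not> (\<forall>z\<in>D. hnorm h z (G z t) \<le> C t)}"
    by (subst (asm) AE_lebesgue_on_iff_negligible) auto
  show thesis
  proof (rule that[OF C(1) N])
    fix t z assume t: "t \<in> {0..T} - {t \<in> {0..T}. \<not> (\<forall>z\<in>D. hnorm h z (G z t) \<le> C t)}" and z: "z \<in> K"
    show "hnorm h z (G z t) \<le> C t"
    proof (rule ccontr)
      \<comment> \<open>For fixed \<open>t\<close>, violation of the bound is an open condition on
        the point, so a violation in \<open>K\<close> would already occur in
        \<open>D\<close>.\<close>
      let ?W = "{w. C t < hnorm h w (G w t)}"
      assume "\<not> ?thesis"
      then have "z \<in> ?W" by simp
      moreover have "open ?W" by (rule open_Collect_less) (use continuous_hnorm_G t in auto)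
      ultimately obtain b where b: "b \<in> B" "z \<in> b" "b \<subseteq> ?W" using topological_basisE[OF B(2)] by blast
      then have ne: "b \<inter> K \<noteq> {}" using z by blast
      let ?w = "SOME z. z \<in> b \<inter> K"
      have "?w \<in> D" unfolding D_def using b ne by blast
      then have "hnorm h ?w (G ?w t) \<le> C t" using t by blast
      moreover have "?w \<in> ?W" using sel[OF ne] b by blast
      ultimately show False by simp
    qed
  qed
qed

text \<open>Picard iteration is carried out with a majorant valid at every time, whereas the field
  is bounded by an \<open>L^d\<close> function only almost everywhere. On the exceptional null set
  some bound of the field over the compact set \<open>K\<close> at that time takes its place, which
  leaves integrability unchanged.\<close>

lemma field_bound_in_chart:
  assumes c: "c \<in> A" and K: "compact K" "K \<subseteq> chart_img c" and T: "0 < T"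
  obtains C where "C integrable_on {0..T}" "\<And>t x. t \<in> {0..T} \<Longrightarrow> x \<in> K \<Longrightarrow> norm (G (chart_inv c x) t c) \<le> C t"
    "\<And>t. t \<in> {0..T} \<Longrightarrow> 0 \<le> C t"
proof -
  have "compact (chart_inv c ` K)"
    by (rule compact_continuous_image[OF continuous_on_subset[OF continuous_chart_inv[OF c] K(2)] K(1)])
  then obtain C N where C: "C \<in> Lp_nonneg d T" "negligible N"
    "\<And>t z. t \<in> {0..T} - N \<Longrightarrow> z \<in> chart_inv c ` K \<Longrightarrow> hnorm h z (G z t) \<le> C t"
    using field_bound[OF _ T] by blast
  obtain m M where m: "m > 0" "\<And>x v. x \<in> K \<Longrightarrow> m * norm v \<le> chart_norm c x v"
    using chart_norm_bounds[OF c K] by metis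
  have "\<exists>B. \<forall>x\<in>K. norm (G (chart_inv c x) t c) \<le> B" if "0 \<le> t" for t
  proof -
    have "continuous_on K (\<lambda>x. G (chart_inv c x) t c)"
      by (rule continuous_on_subset[OF cholomorphic_on_imp_continuous_on[OF G_holomorphic[OF that c]] K(2)])
    then have "bounded ((\<lambda>x. G (chart_inv c x) t c) ` K)"
      using K(1) compact_continuous_image compact_imp_bounded by blast
    then show ?thesis unfolding bounded_iff by auto
  qed
  then obtain B where B: "\<And>t x. 0 \<le> t \<Longrightarrow> x \<in> K \<Longrightarrow> norm (G (chart_inv c x) t c) \<le> B t" by metis
  define C' where "C' t = (if t \<in> N then \<bar>B t\<bar> else C t / m)" for t
  show thesis
  proof (rule that[of C'])
    have "(\<lambda>t. C t * (1 / m)) integrable_on {0..T}"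
      by (rule integrable_on_mult_left[OF Lp_nonneg_integrable(1)[OF C(1) d]])
    then show "C' integrable_on {0..T}"
      by (rule integrable_spike[OF _ C(2)]) (auto simp: C'_def)
    show "0 \<le> C' t" if "t \<in> {0..T}" for t using C(1) m that by (auto simp: C'_def Lp_nonneg_def)
    fix t x assume t: "t \<in> {0..T}" and x: "x \<in> K"
    show "norm (G (chart_inv c x) t c) \<le> C' t"
    proof (cases "t \<in> N")
      case True
      then show ?thesis using B[of t x] t x by (simp add: C'_def)
    next
      case False
      have xi: "x \<in> chart_img c" using x K by blast
      have "m * norm (G (chart_inv c x) t c) \<le> chart_norm c x (G (chart_inv c x) t c)" by (rule m(2)[OF x])
      also have "\<dots> = hnorm h (chart_inv c x) (G (chart_inv c x) t)"
        using hnorm_G_in_chart[of t c "chart_inv c x"] t c chart_inv_in[OF c xi] by (simp add: chart_map_inv[OF c xi])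
      also have "\<dots> \<le> C t" using C(3)[of t "chart_inv c x"] t x False by blast
      finally show ?thesis using m(1) False by (simp add: C'_def field_simps)
    qed
  qed
qed

lemma field_along_path_integrable:
  assumes c: "c \<in> A" and x: "continuous_on {a..b} x" "x ` {a..b} \<subseteq> chart_dom c" and a: "0 \<le> a"
  shows "(\<lambda>\<tau>. G (x \<tau>) \<tau> c) absolutely_integrable_on {a..b}"
proof (cases "a \<le> b")
  case False
  then show ?thesis by simp
next
  case True
  have cx: "continuous_on {a..b} (\<lambda>\<tau>. chart_map c (x \<tau>))"
    by (rule continuous_on_compose2[OF continuous_chart_map[OF c] x])
  have K: "compact ((\<lambda>\<tau>. chart_map c (x \<tau>)) ` {a..b})" "(\<lambda>\<tau>. chart_map c (x \<tau>)) ` {a..b} \<subseteq> chart_img c"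
    using x(2) by (auto intro!: compact_continuous_image cx)
  \<comment> \<open>\<open>field_bound_in_chart\<close> asks for a positive final time, and
    \<open>b\<close> may be 0.\<close>
  have b1: "0 < b + 1" using a True by simp
  obtain C where C: "C integrable_on {0..b+1}"
    "\<And>t y. t \<in> {0..b+1} \<Longrightarrow> y \<in> (\<lambda>\<tau>. chart_map c (x \<tau>)) ` {a..b} \<Longrightarrow> norm (G (chart_inv c y) t c) \<le> C t"
    "\<And>t. t \<in> {0..b+1} \<Longrightarrow> 0 \<le> C t"
    by (rule field_bound_in_chart[OF c K b1]) (rule that, auto)
  show ?thesis
  proof (rule measurable_bounded_by_integrable_imp_absolutely_integrable)
    show "(\<lambda>\<tau>. G (x \<tau>) \<tau> c) \<in> borel_measurable (lebesgue_on {a..b})"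
      by (rule caratheodory_measurable[where g = "\<lambda>\<tau> z. G z \<tau> c" and X = x, OF x])
         (use G_measurable G_continuous c a in auto)
    show "C integrable_on {a..b}" using integrable_on_subinterval[OF C(1), of a b] a by auto
    fix t assume t: "t \<in> {a..b}"
    have "norm (G (chart_inv c (chart_map c (x t))) t c) \<le> C t" using t a by (intro C(2)) auto
    moreover have "chart_inv c (chart_map c (x t)) = x t" using x(2) t by (intro chart_inv_map[OF c]) auto
    ultimately show "norm (G (x t) t c) \<le> C t" by simp
  qed auto
qed

section \<open>Solutions of the integral equation\<close>

text \<open>The differential equation in integral form. Asking for it in all charts over all
  subintervals spent there makes the notion restrict and concatenate without a choice of
  subdivision.\<close>

definition sol :: "real \<Rightarrow> real \<Rightarrow> (real \<Rightarrow> 'm) \<Rightarrow> bool"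
  where "sol a b x \<longleftrightarrow> continuous_on {a..b} x \<and>
    (\<forall>c\<in>A. \<forall>s t. a \<le> s \<longrightarrow> s \<le> t \<longrightarrow> t \<le> b \<longrightarrow> x ` {s..t} \<subseteq> chart_dom c \<longrightarrow>
       ((\<lambda>\<tau>. G (x \<tau>) \<tau> c) has_integral (chart_map c (x t) - chart_map c (x s))) {s..t})"

lemma sol_continuous: "sol a b x \<Longrightarrow> continuous_on {a..b} x"
  unfolding sol_def by blast

lemma sol_integral:
  "sol a b x \<Longrightarrow> c \<in> A \<Longrightarrow> a \<le> s \<Longrightarrow> s \<le> t \<Longrightarrow> t \<le> b \<Longrightarrow> x ` {s..t} \<subseteq> chart_dom c \<Longrightarrow>
    ((\<lambda>\<tau>. G (x \<tau>) \<tau> c) has_integral (chart_map c (x t) - chart_map c (x s))) {s..t}"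
  unfolding sol_def by blast

lemma sol_subinterval:
  assumes "sol a b x" "a \<le> s" "t \<le> b"
  shows "sol s t x"
  unfolding sol_def
proof (intro conjI ballI allI impI)
  show "continuous_on {s..t} x" using sol_continuous[OF assms(1)] by (rule continuous_on_subset) (use assms in auto)
qed (rule sol_integral[OF assms(1)], use assms in auto)

lemma sol_refl: "sol a a x"
  unfolding sol_def
proof (intro conjI ballI allI impI)
  fix c s t assume "a \<le> s" "s \<le> t" "t \<le> a"
  then have "s = a" "t = a" by auto
  then show "((\<lambda>\<tau>. G (x \<tau>) \<tau> c) has_integral (chart_map c (x t) - chart_map c (x s))) {s..t}"
    by (auto intro: has_integral_refl)
qed simp

lemma sol_cong:
  assumes "sol a b x" "\<And>t. t \<in> {a..b} \<Longrightarrow> y t = x t"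
  shows "sol a b y"
  unfolding sol_def
proof (intro conjI ballI allI impI)
  show "continuous_on {a..b} y" using sol_continuous[OF assms(1)] by (rule continuous_on_eq) (simp add: assms(2))
  fix c s t assume c: "c \<in> A" and *: "a \<le> s" "s \<le> t" "t \<le> b" "y ` {s..t} \<subseteq> chart_dom c"
  have eq: "y \<tau> = x \<tau>" if "\<tau> \<in> {s..t}" for \<tau> using * assms(2) that by auto
  then have "x ` {s..t} \<subseteq> chart_dom c" using *(4) by (metis image_cong)
  from sol_integral[OF assms(1) c *(1-3) this]
  show "((\<lambda>\<tau>. G (y \<tau>) \<tau> c) has_integral (chart_map c (y t) - chart_map c (y s))) {s..t}"
    using eq[of s] eq[of t] * by (subst has_integral_cong[where g = "\<lambda>\<tau>. G (x \<tau>) \<tau> c"]) (auto simp: eq)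
qed

lemma sol_join:
  assumes x: "sol a b x" and y: "sol b c y" and eq: "x b = y b" and abc: "a \<le> b" "b \<le> c"
  shows "sol a c (\<lambda>t. if t \<le> b then x t else y t)" (is "sol a c ?z")
proof -
  have x': "sol a b ?z" by (rule sol_cong[OF x]) auto
  have y': "sol b c ?z" by (rule sol_cong[OF y]) (use eq in auto)
  show ?thesis
    unfolding sol_def
  proof (intro conjI ballI allI impI)
    have "continuous_on ({a..b} \<union> {b..c}) ?z"
      by (rule continuous_on_closed_Un) (use sol_continuous[OF x'] sol_continuous[OF y'] in auto)
    moreover have "{a..b} \<union> {b..c} = {a..c}" using abc by auto
    ultimately show "continuous_on {a..c} ?z" by simp
    fix e s t assume e: "e \<in> A" and *: "a \<le> s" "s \<le> t" "t \<le> c" "?z ` {s..t} \<subseteq> chart_dom e"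
    consider "t \<le> b" | "b \<le> s" | "s < b" "b < t" by linarith
    then show "((\<lambda>\<tau>. G (?z \<tau>) \<tau> e) has_integral (chart_map e (?z t) - chart_map e (?z s))) {s..t}"
    proof cases
      case 1
      then show ?thesis using sol_integral[OF x' e] * by blast
    next
      case 2
      then show ?thesis using sol_integral[OF y' e] * by blast
    next
      case 3
      have "?z ` {s..b} \<subseteq> chart_dom e" "?z ` {b..t} \<subseteq> chart_dom e"
        using *(4) 3 by (meson atLeastatMost_subset_iff image_mono less_imp_le order_refl order_trans)+
      then have "((\<lambda>\<tau>. G (?z \<tau>) \<tau> e) has_integral (chart_map e (?z b) - chart_map e (?z s))) {s..b}"
        "((\<lambda>\<tau>. G (?z \<tau>) \<tau> e) has_integral (chart_map e (?z t) - chart_map e (?z b))) {b..t}"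
        using sol_integral[OF x' e, of s b] sol_integral[OF y' e, of b t] * 3 by (meson less_imp_le order_refl)+
      from has_integral_combine[OF _ _ this] show ?thesis using 3 by simp
    qed
  qed
qed

text \<open>One chart is enough: the chain rule for the transition map carries the integral equation
  to any other chart, where the Jacobian turns the coordinates of the field into the new
  ones.\<close>

lemma sol_chartI:
  assumes c: "c \<in> A" and a: "0 \<le> a" and x: "continuous_on {a..b} x" "x ` {a..b} \<subseteq> chart_dom c"
    and int: "\<And>s t. a \<le> s \<Longrightarrow> s \<le> t \<Longrightarrow> t \<le> b \<Longrightarrow>
      ((\<lambda>\<tau>. G (x \<tau>) \<tau> c) has_integral (chart_map c (x t) - chart_map c (x s))) {s..t}"
  shows "sol a b x"
  unfolding sol_def
proof (intro conjI ballI allI impI x)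
  fix c' s t assume c': "c' \<in> A" and *: "a \<le> s" "s \<le> t" "t \<le> b" "x ` {s..t} \<subseteq> chart_dom c'"
  let ?T = "chart_map c' \<circ> chart_inv c" and ?U = "chart_map c ` (chart_dom c \<inter> chart_dom c')"
  have dom: "x \<tau> \<in> chart_dom c" "x \<tau> \<in> chart_dom c'" if "\<tau> \<in> {s..t}" for \<tau>
    using that * x(2) by (auto simp: image_subset_iff)
  have "((\<lambda>\<tau>. frechet_derivative ?T (at (chart_map c (x \<tau>))) (G (x \<tau>) \<tau> c)) has_integral
      (?T (chart_map c (x t)) - ?T (chart_map c (x s)))) {s..t}"
  proof (rule integral_chain_rule[OF *(2), where X = "\<lambda>\<tau>. chart_map c (x \<tau>)" and DT = "\<lambda>y. frechet_derivative ?T (at y)"])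
    show "(\<lambda>\<tau>. G (x \<tau>) \<tau> c) absolutely_integrable_on {s..t}"
      by (rule field_along_path_integrable[OF c]) (use a * dom x in \<open>auto intro: continuous_on_subset\<close>)
    show "open ?U" by (intro open_chart_image open_chart_dom c c')
    show "(?T has_derivative frechet_derivative ?T (at y)) (at y)" if "y \<in> ?U" for y
      by (rule cholomorphic_on_frechet(1)[OF holomorphic_transition[OF c c'] that])
    show "continuous_on ?U (\<lambda>y. frechet_derivative ?T (at y) v)" for v
      by (intro cholomorphic_on_deriv_continuous open_chart_image open_chart_dom holomorphic_transition c c')
  qed (use int * dom in auto)
  then have "((\<lambda>\<tau>. frechet_derivative ?T (at (chart_map c (x \<tau>))) (G (x \<tau>) \<tau> c)) has_integral
      (chart_map c' (x t) - chart_map c' (x s))) {s..t}"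
    using dom * by (simp add: chart_inv_map[OF c])
  then show "((\<lambda>\<tau>. G (x \<tau>) \<tau> c') has_integral (chart_map c' (x t) - chart_map c' (x s))) {s..t}"
  proof (rule has_integral_eq[rotated])
    fix \<tau> assume \<tau>: "\<tau> \<in> {s..t}"
    show "frechet_derivative ?T (at (chart_map c (x \<tau>))) (G (x \<tau>) \<tau> c) = G (x \<tau>) \<tau> c'"
      by (rule tangent_change_chart[OF G_tangent c _ c']) (use dom[OF \<tau>] \<tau> a * in auto)
  qed
qed

section \<open>Local flows\<close>

text \<open>Continuity of the indefinite integral at \<open>\<tau>\<close>. The window extends to
  both sides of \<open>\<tau>\<close>, because bisection in time provides intervals that merely
  contain \<open>\<tau>\<close>; intersecting it with \<open>0 \<le> u\<close> covers
  \<open>\<tau> = 0\<close>.\<close>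

lemma integral_small_near:
  fixes C :: "real \<Rightarrow> real"
  assumes C: "C integrable_on {0..T}" and \<tau>: "0 \<le> \<tau>" "\<tau> < T" and e: "e > 0"
  obtains \<delta> where "\<delta> > 0" "\<tau> + \<delta> \<le> T"
    "\<And>u v. 0 \<le> u \<Longrightarrow> u \<le> v \<Longrightarrow> \<tau> - \<delta> \<le> u \<Longrightarrow> v \<le> \<tau> + \<delta> \<Longrightarrow> integral {u..v} C \<le> e"
proof -
  let ?I = "\<lambda>t. integral {0..t} C"
  have "continuous_on {0..T} ?I" by (rule indefinite_integral_continuous_1[OF C])
  then obtain \<delta>0 where \<delta>0: "\<delta>0 > 0" "\<And>t. t \<in> {0..T} \<Longrightarrow> dist t \<tau> < \<delta>0 \<Longrightarrow> dist (?I t) (?I \<tau>) < e/2"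
    using \<tau> e half_gt_zero[OF e] unfolding continuous_on_iff by (metis atLeastAtMost_iff less_imp_le)
  define \<delta> where "\<delta> = min (\<delta>0 / 2) (T - \<tau>)"
  show thesis
  proof (rule that[of \<delta>])
    show "\<delta> > 0" "\<tau> + \<delta> \<le> T" using \<delta>0 \<tau> by (auto simp: \<delta>_def)
    fix u v assume uv: "0 \<le> u" "u \<le> v" "\<tau> - \<delta> \<le> u" "v \<le> \<tau> + \<delta>"
    then have vT: "v \<le> T" using \<delta>0 by (auto simp: \<delta>_def)
    have "integral {0..v} C = integral {0..u} C + integral {u..v} C"
      using uv vT integrable_on_subinterval[OF C, of 0 v]
      by (intro Henstock_Kurzweil_Integration.integral_combine[symmetric]) auto
    moreover have "\<delta> < \<delta>0" using \<delta>0(1) by (simp add: \<delta>_def)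
    then have "dist u \<tau> < \<delta>0" "dist v \<tau> < \<delta>0" using uv by (auto simp: dist_real_def)
    then have "dist (?I u) (?I \<tau>) < e/2" "dist (?I v) (?I \<tau>) < e/2"
      using uv vT \<delta>0(2)[of u] \<delta>0(2)[of v] by simp_all
    ultimately show "integral {u..v} C \<le> e" unfolding dist_real_def by linarith
  qed
qed

text \<open>\<open>\<delta>\<close> and \<open>U\<close> depend on \<open>\<tau>\<close>,
  \<open>p\<close> and \<open>W\<close> but not on the initial time \<open>u\<close>. Bisection in
  time requires this uniformity, since trajectories are started at the left end of an arbitrary
  short interval. \<open>W\<close> confines the trajectories and later shows that they move
  little.\<close>

lemma local_flow_within:
  assumes \<tau>: "0 \<le> \<tau>" and W: "open W" "p \<in> W"
  obtains \<delta> U where "\<delta> > 0" "open U" "p \<in> U"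
    "\<And>u v. 0 \<le> u \<Longrightarrow> u \<le> v \<Longrightarrow> \<tau> - \<delta> \<le> u \<Longrightarrow> v \<le> \<tau> + \<delta> \<Longrightarrow>
      \<exists>\<Phi>. (\<forall>q\<in>U. sol u v (\<Phi> q) \<and> \<Phi> q u = q \<and> cdiff_at A (\<lambda>q. \<Phi> q v) q \<and> \<Phi> q ` {u..v} \<subseteq> W)"
proof -
  obtain c where c: "c \<in> A" "p \<in> chart_dom c" using chart_exists by blast
  obtain r where r: "r > 0" "cball (chart_map c p) r \<subseteq> chart_img c" "chart_inv c ` cball (chart_map c p) r \<subseteq> W"
    using chart_cball[OF c W] by blast
  let ?x0 = "chart_map c p"
  have rb: "ball ?x0 r \<subseteq> chart_img c" using r(2) ball_subset_cball by blast
  have \<tau>1: "0 < \<tau> + 1" "\<tau> < \<tau> + 1" using \<tau> by auto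
  obtain C where C: "C integrable_on {0..\<tau>+1}"
    "\<And>t x. t \<in> {0..\<tau>+1} \<Longrightarrow> x \<in> cball ?x0 r \<Longrightarrow> norm (G (chart_inv c x) t c) \<le> C t"
    "\<And>t. t \<in> {0..\<tau>+1} \<Longrightarrow> 0 \<le> C t"
    by (rule field_bound_in_chart[OF c(1) compact_cball r(2) \<tau>1(1)]) (rule that, auto)
  have e: "r / (16 * real CARD('n)) > 0" using r by simp
  obtain \<delta> where \<delta>: "\<delta> > 0" "\<tau> + \<delta> \<le> \<tau> + 1"
    "\<And>u v. 0 \<le> u \<Longrightarrow> u \<le> v \<Longrightarrow> \<tau> - \<delta> \<le> u \<Longrightarrow> v \<le> \<tau> + \<delta> \<Longrightarrow> integral {u..v} C \<le> r / (16 * real CARD('n))"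
    by (rule integral_small_near[OF C(1) \<tau> \<tau>1(2) e]) (rule that, auto)
  define U where "U = chart_dom c \<inter> chart_map c -` ball ?x0 (r/4)"
  have U: "open U" unfolding U_def by (rule open_chart_preimage[OF c(1) open_ball])
  show thesis
  proof (rule that[OF \<delta>(1) U])
    show "p \<in> U" using c r by (simp add: U_def)
    fix u v assume uv: "0 \<le> u" "u \<le> v" "\<tau> - \<delta> \<le> u" "v \<le> \<tau> + \<delta>"
    have sub: "{u..v} \<subseteq> {0..\<tau>+1}" using uv \<delta>(2) by auto
    let ?g = "\<lambda>t x. G (chart_inv c x) t c"
    have C': "C integrable_on {u..v}" using integrable_on_subinterval[OF C(1) sub] .
    obtain X where X: "\<And>x. x \<in> ball ?x0 (r/4) \<Longrightarrow> continuous_on {u..v} (X x)"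
      "\<And>x t. x \<in> ball ?x0 (r/4) \<Longrightarrow> t \<in> {u..v} \<Longrightarrow> X x t \<in> ball ?x0 (r/2)"
      "\<And>x t. x \<in> ball ?x0 (r/4) \<Longrightarrow> t \<in> {u..v} \<Longrightarrow> ((\<lambda>\<tau>. ?g \<tau> (X x \<tau>)) has_integral (X x t - x)) {u..t}"
      "\<And>t. t \<in> {u..v} \<Longrightarrow> cholomorphic_on (\<lambda>x. X x t) (ball ?x0 (r/4))"
    proof (rule caratheodory_flow[where g = ?g, OF r(1) uv(2) _ _ C' _ \<delta>(3)[OF uv]])
      show "cholomorphic_on (?g t) (ball ?x0 r)" if "t \<in> {u..v}" for t
        by (rule cholomorphic_on_subset[OF G_holomorphic[OF _ c(1)] rb]) (use that uv in auto)
      show "(\<lambda>t. ?g t x) \<in> borel_measurable (lebesgue_on {u..v})" if "x \<in> ball ?x0 r" for x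
        by (rule G_measurable[OF c(1) chart_inv_in[OF c(1)] uv(1)]) (use that rb in blast)
      show "norm (?g t x) \<le> C t" if "t \<in> {u..v}" "x \<in> ball ?x0 r" for t x
        by (rule C(2)) (use that sub in auto)
    qed blast
    have half: "ball ?x0 (r/2) \<subseteq> chart_img c" using rb r(1) by auto
    have img: "X x t \<in> chart_img c" if "x \<in> ball ?x0 (r/4)" "t \<in> {u..v}" for x t
      using X(2)[OF that] half by blast
    define \<Phi> where "\<Phi> q t = chart_inv c (X (chart_map c q) t)" for q t
    have qU: "chart_map c q \<in> ball ?x0 (r/4)" "q \<in> chart_dom c" if "q \<in> U" for q using that by (auto simp: U_def)
    have cX: "chart_map c (\<Phi> q t) = X (chart_map c q) t" "\<Phi> q t \<in> chart_dom c" if "q \<in> U" "t \<in> {u..v}" for q t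
      using chart_map_inv[OF c(1) img[OF qU(1)[OF that(1)] that(2)]] chart_inv_in[OF c(1) img[OF qU(1)[OF that(1)] that(2)]]
      by (simp_all add: \<Phi>_def)
    have "sol u v (\<Phi> q) \<and> \<Phi> q u = q \<and> cdiff_at A (\<lambda>q. \<Phi> q v) q \<and> \<Phi> q ` {u..v} \<subseteq> W" if q: "q \<in> U" for q
    proof (intro conjI)
      show "\<Phi> q ` {u..v} \<subseteq> W"
      proof (rule image_subsetI)
        fix t assume "t \<in> {u..v}"
        then have "X (chart_map c q) t \<in> ball ?x0 (r/2)" by (rule X(2)[OF qU(1)[OF q]])
        then have "X (chart_map c q) t \<in> cball ?x0 r" using r(1) by auto
        then show "\<Phi> q t \<in> W" using r(3) by (auto simp: \<Phi>_def)
      qed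
      let ?xq = "chart_map c q"
      have "X ?xq u - ?xq = 0"
        by (rule has_integral_unique[OF X(3)[OF qU(1)[OF q]]]) (use uv in \<open>auto intro: has_integral_refl\<close>)
      then show "\<Phi> q u = q" using qU(2)[OF q] by (simp add: \<Phi>_def chart_inv_map[OF c(1)])
      show "sol u v (\<Phi> q)"
      proof (rule sol_chartI[OF c(1) uv(1)])
        show "continuous_on {u..v} (\<Phi> q)"
          unfolding \<Phi>_def
          by (rule continuous_on_compose2[OF continuous_chart_inv[OF c(1)] X(1)[OF qU(1)[OF q]]])
             (use img[OF qU(1)[OF q]] in auto)
        show "\<Phi> q ` {u..v} \<subseteq> chart_dom c" using cX(2)[OF q] by auto
        fix s t assume st: "u \<le> s" "s \<le> t" "t \<le> v"
        let ?f = "\<lambda>\<tau>. ?g \<tau> (X ?xq \<tau>)"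
        have 1: "(?f has_integral (X ?xq s - ?xq)) {u..s}" "(?f has_integral (X ?xq t - ?xq)) {u..t}"
          using X(3)[OF qU(1)[OF q]] st by auto
        have "?f integrable_on {s..t}" using integrable_on_subinterval[OF has_integral_integrable[OF 1(2)], of s t] st by auto
        then have 2: "(?f has_integral integral {s..t} ?f) {s..t}" by (rule integrable_integral)
        have "X ?xq t - ?xq = (X ?xq s - ?xq) + integral {s..t} ?f"
          by (rule has_integral_unique[OF 1(2) has_integral_combine[OF st(1,2) 1(1) 2]])
        then have "(?f has_integral (X ?xq t - X ?xq s)) {s..t}" using 2 by (simp add: algebra_simps)
        then show "((\<lambda>\<tau>. G (\<Phi> q \<tau>) \<tau> c) has_integral (chart_map c (\<Phi> q t) - chart_map c (\<Phi> q s))) {s..t}"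
          using cX(1)[OF q, of s] cX(1)[OF q, of t] st by (simp add: \<Phi>_def)
      qed
      have v: "v \<in> {u..v}" using uv by simp
      show "cdiff_at A (\<lambda>q. \<Phi> q v) q"
      proof (rule cdiff_atI[where f = "\<lambda>q. \<Phi> q v" and p = q, OF _ c(1) qU(2)[OF q] c(1) cX(2)[OF q v]])
        have "isCont (\<lambda>x. X x v) ?xq"
          using cholomorphic_on_frechet(1)[OF X(4)[OF v] qU(1)[OF q]] has_derivative_continuous by blast
        then have "((\<lambda>q. X (chart_map c q) v) \<longlongrightarrow> X ?xq v) (nhds q)"
          by (rule isCont_tendsto_compose) (rule tendsto_chart_map[OF c(1) _ qU(2)[OF q]], simp add: filterlim_ident)
        then show "((\<lambda>q. \<Phi> q v) \<longlongrightarrow> \<Phi> q v) (nhds q)"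
          unfolding \<Phi>_def by (rule tendsto_chart_inv[OF c(1) _ img[OF qU(1)[OF q] v]])
        show "cdiff_between c c (\<lambda>q. \<Phi> q v) q"
          unfolding cdiff_between_def
        proof (intro exI conjI allI)
          show "((chart_map c \<circ> (\<lambda>q. \<Phi> q v) \<circ> chart_inv c) has_derivative frechet_derivative (\<lambda>x. X x v) (at ?xq)) (at ?xq)"
          proof (rule has_derivative_transform_within_open[OF cholomorphic_on_frechet(1)[OF X(4)[OF v] qU(1)[OF q]] open_ball qU(1)[OF q]])
            fix y assume y: "y \<in> ball ?x0 (r/4)"
            then have "y \<in> chart_img c" using rb r(1) by (auto intro: subsetD[OF rb])
            then show "X y v = (chart_map c \<circ> (\<lambda>q. \<Phi> q v) \<circ> chart_inv c) y"
              using chart_map_inv[OF c(1), of y] chart_map_inv[OF c(1) img[OF y v]] by (simp add: \<Phi>_def)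
          qed
          show "frechet_derivative (\<lambda>x. X x v) (at ?xq) (a *s w) = a *s frechet_derivative (\<lambda>x. X x v) (at ?xq) w" for a w
            by (rule cholomorphic_on_frechet(2)[OF X(4)[OF v] qU(1)[OF q]])
        qed
      qed
    qed
    then show "\<exists>\<Phi>. (\<forall>q\<in>U. sol u v (\<Phi> q) \<and> \<Phi> q u = q \<and> cdiff_at A (\<lambda>q. \<Phi> q v) q \<and> \<Phi> q ` {u..v} \<subseteq> W)" by blast
  qed
qed

lemma local_flow:
  assumes \<tau>: "0 \<le> \<tau>"
  obtains \<delta> U where "\<delta> > 0" "open U" "p \<in> U"
    "\<And>u v. 0 \<le> u \<Longrightarrow> u \<le> v \<Longrightarrow> \<tau> - \<delta> \<le> u \<Longrightarrow> v \<le> \<tau> + \<delta> \<Longrightarrow>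
      \<exists>\<Phi>. (\<forall>q\<in>U. sol u v (\<Phi> q) \<and> \<Phi> q u = q \<and> cdiff_at A (\<lambda>q. \<Phi> q v) q)"
proof (rule local_flow_within[OF \<tau> open_UNIV UNIV_I])
  fix \<delta> U
  assume *: "\<delta> > 0" "open U" "p \<in> U" "\<And>u v. 0 \<le> u \<Longrightarrow> u \<le> v \<Longrightarrow> \<tau> - \<delta> \<le> u \<Longrightarrow> v \<le> \<tau> + \<delta> \<Longrightarrow>
      \<exists>\<Phi>. (\<forall>q\<in>U. sol u v (\<Phi> q) \<and> \<Phi> q u = q \<and> cdiff_at A (\<lambda>q. \<Phi> q v) q \<and> \<Phi> q ` {u..v} \<subseteq> UNIV)"
  show thesis by (rule that[OF *(1-3)]) (use *(4) in simp)
qed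

lemma continuous_path_nbhd:
  fixes x :: "real \<Rightarrow> 'm"
  assumes "continuous_on {a..b} x" "\<tau> \<in> {a..b}" "open W" "x \<tau> \<in> W"
  obtains \<delta> where "\<delta> > 0" "\<And>t. t \<in> {a..b} \<Longrightarrow> \<bar>t - \<tau>\<bar> < \<delta> \<Longrightarrow> x t \<in> W"
proof -
  have "\<forall>\<^sub>F t in at \<tau> within {a..b}. x t \<in> W"
    using assms unfolding continuous_on_def by (auto intro: topological_tendstoD)
  then obtain \<delta> where "\<delta> > 0" "\<And>t. t \<in> {a..b} \<Longrightarrow> t \<noteq> \<tau> \<Longrightarrow> dist t \<tau> < \<delta> \<Longrightarrow> x t \<in> W"
    unfolding eventually_at by blast
  then show thesis using that[of \<delta>] assms(4) by (metis dist_real_def)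
qed

section \<open>Uniqueness and contraction\<close>

text \<open>For a short time both curves stay in one coordinate ball, where the field is Lipschitz
  with an integrable constant. The neighbourhood of \<open>\<tau>\<close> extends to both sides, so
  agreement spreads forwards and backwards in time.\<close>

lemma sol_unique_near:
  assumes x: "sol a b x" and y: "sol a b y" and a: "0 \<le> a" and \<tau>: "\<tau> \<in> {a..b}" and eq: "x \<tau> = y \<tau>"
  obtains \<delta> where "\<delta> > 0" "\<And>t. t \<in> {a..b} \<Longrightarrow> \<bar>t - \<tau>\<bar> < \<delta> \<Longrightarrow> x t = y t"
proof -
  obtain c where c: "c \<in> A" "x \<tau> \<in> chart_dom c" using chart_exists by blast
  obtain r where r: "r > 0" "cball (chart_map c (x \<tau>)) r \<subseteq> chart_img c" using chart_cball[OF c open_UNIV] by auto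
  let ?x0 = "chart_map c (x \<tau>)" and ?N = "real CARD('n)"
  have rb: "ball ?x0 r \<subseteq> chart_img c" using r(2) ball_subset_cball by blast
  have \<tau>0: "0 \<le> \<tau>" "\<tau> < b + 1" and b1: "0 < b + 1" using \<tau> a by auto
  obtain C where C: "C integrable_on {0..b+1}"
    "\<And>t x. t \<in> {0..b+1} \<Longrightarrow> x \<in> cball ?x0 r \<Longrightarrow> norm (G (chart_inv c x) t c) \<le> C t"
    "\<And>t. t \<in> {0..b+1} \<Longrightarrow> 0 \<le> C t"
    by (rule field_bound_in_chart[OF c(1) compact_cball r(2) b1]) (rule that, auto)
  \<comment> \<open>Multiplied by \<open>4 * CARD('n) / r\<close> from the Lipschitz constant, this
    gives the bound 1/2 required by \<open>caratheodory_unique\<close>.\<close>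
  have e: "r / (8 * ?N) > 0" using r by simp
  obtain \<delta>1 where \<delta>1: "\<delta>1 > 0" "\<tau> + \<delta>1 \<le> b + 1"
    "\<And>u v. 0 \<le> u \<Longrightarrow> u \<le> v \<Longrightarrow> \<tau> - \<delta>1 \<le> u \<Longrightarrow> v \<le> \<tau> + \<delta>1 \<Longrightarrow> integral {u..v} C \<le> r / (8 * ?N)"
    by (rule integral_small_near[OF C(1) \<tau>0 e]) (rule that, auto)
  let ?W = "chart_dom c \<inter> chart_map c -` ball ?x0 (r/2)"
  have W: "open ?W" "x \<tau> \<in> ?W" using open_chart_preimage[OF c(1) open_ball] c r by auto
  have yW: "y \<tau> \<in> ?W" using W(2) by (simp only: eq[symmetric])
  obtain \<delta>2 where \<delta>2: "\<delta>2 > 0" "\<And>t. t \<in> {a..b} \<Longrightarrow> \<bar>t - \<tau>\<bar> < \<delta>2 \<Longrightarrow> x t \<in> ?W"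
    by (rule continuous_path_nbhd[OF sol_continuous[OF x] \<tau> W]) (rule that, auto)
  obtain \<delta>3 where \<delta>3: "\<delta>3 > 0" "\<And>t. t \<in> {a..b} \<Longrightarrow> \<bar>t - \<tau>\<bar> < \<delta>3 \<Longrightarrow> y t \<in> ?W"
    by (rule continuous_path_nbhd[OF sol_continuous[OF y] \<tau> W(1) yW]) (rule that, auto)
  define \<delta> where "\<delta> = min \<delta>1 (min \<delta>2 \<delta>3) / 2"
  have \<delta>: "\<delta> > 0" "\<delta> < \<delta>1" "\<delta> < \<delta>2" "\<delta> < \<delta>3" using \<delta>1(1) \<delta>2(1) \<delta>3(1) by (auto simp: \<delta>_def)
  define u v where "u = max a (\<tau> - \<delta>)" and "v = min b (\<tau> + \<delta>)"
  have uv: "a \<le> u" "u \<le> \<tau>" "\<tau> \<le> v" "v \<le> b" "\<tau> - \<delta> \<le> u" "v \<le> \<tau> + \<delta>" using \<tau> \<delta>(1) by (auto simp: u_def v_def)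
  have xW: "x t \<in> ?W" "y t \<in> ?W" if "t \<in> {u..v}" for t
    using \<delta>2(2)[of t] \<delta>3(2)[of t] that uv \<delta> by auto
  have sub: "t \<in> {0..b+1}" if "t \<in> {u..v}" for t using that uv a by auto
  have eqt: "x t = y t" if t: "t \<in> {u..v}" for t
  proof -
    have "chart_map c (x t) = chart_map c (y t)"
    proof (rule caratheodory_unique[where X = "\<lambda>t. chart_map c (x t)" and Y = "\<lambda>t. chart_map c (y t)" and
          g = "\<lambda>t z. G (chart_inv c z) t c" and L = "\<lambda>t. C t * (4 * ?N / r)" and u = u and v = v and ?t0.0 = \<tau>])
      have Cuv: "C integrable_on {u..v}" using integrable_on_subinterval[OF C(1), of u v] sub by blast
      show "(\<lambda>t. C t * (4 * ?N / r)) integrable_on {u..v}" by (rule integrable_on_mult_left[OF Cuv])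
      show "0 \<le> C t * (4 * ?N / r)" if "t \<in> {u..v}" for t using C(3)[OF sub[OF that]] r by simp
      have "integral {u..v} C * (4 * ?N / r) \<le> (r / (8 * ?N)) * (4 * ?N / r)"
        using \<delta>1(3)[of u v] uv a \<delta> r by (intro mult_right_mono) auto
      then show "integral {u..v} (\<lambda>t. C t * (4 * ?N / r)) \<le> 1/2" using r by simp
      have xs: "sol u v x" "sol u v y" using x y uv by (auto intro: sol_subinterval)
      show "continuous_on {u..v} (\<lambda>t. chart_map c (x t))" "continuous_on {u..v} (\<lambda>t. chart_map c (y t))"
        using xW by (auto intro!: continuous_on_compose2[OF continuous_chart_map[OF c(1)]] sol_continuous xs)
      show "norm (G (chart_inv c (chart_map c (x t))) t c - G (chart_inv c (chart_map c (y t))) t c)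
          \<le> C t * (4 * ?N / r) * norm (chart_map c (x t) - chart_map c (y t))" if t: "t \<in> {u..v}" for t
      proof -
        have "norm (G (chart_inv c (chart_map c (x t))) t c - G (chart_inv c (chart_map c (y t))) t c)
          \<le> 4 * ?N * C t / r * norm (chart_map c (x t) - chart_map c (y t))"
        proof (rule cholomorphic_on_lipschitz[OF r(1), where f = "\<lambda>z. G (chart_inv c z) t c" and x = ?x0])
          show "cholomorphic_on (\<lambda>z. G (chart_inv c z) t c) (ball ?x0 r)"
            by (rule cholomorphic_on_subset[OF G_holomorphic[OF _ c(1)] rb]) (use sub[OF t] in auto)
          show "norm (G (chart_inv c z) t c) \<le> C t" if "z \<in> ball ?x0 r" for z
            by (rule C(2)[OF sub[OF t]]) (use that in auto)
        qed (use xW[OF t] in auto)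
        then show ?thesis by (simp add: mult_ac)
      qed
      have key: "((\<lambda>\<tau>. G (chart_inv c (chart_map c (z \<tau>))) \<tau> c) has_integral chart_map c (z t) - chart_map c (z s)) {s..t}"
        if z: "sol u v z" "\<And>t. t \<in> {u..v} \<Longrightarrow> z t \<in> ?W" and st: "u \<le> s" "s \<le> t" "t \<le> v" for z s t
      proof (rule has_integral_eq[OF _ sol_integral[OF z(1) c(1) st]])
        show "z ` {s..t} \<subseteq> chart_dom c" using z(2) st by auto
        show "G (z \<tau>) \<tau> c = G (chart_inv c (chart_map c (z \<tau>))) \<tau> c" if "\<tau> \<in> {s..t}" for \<tau>
          using z(2)[of \<tau>] that st by (simp add: chart_inv_map[OF c(1)])
      qed
      show "((\<lambda>\<tau>. G (chart_inv c (chart_map c (x \<tau>))) \<tau> c) has_integral chart_map c (x t) - chart_map c (x s)) {s..t}"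
        "((\<lambda>\<tau>. G (chart_inv c (chart_map c (y \<tau>))) \<tau> c) has_integral chart_map c (y t) - chart_map c (y s)) {s..t}"
        if "u \<le> s" "s \<le> t" "t \<le> v" for s t
        using key[OF xs(1) _ that] key[OF xs(2) _ that] xW by blast+
    qed (use uv t eq in auto)
    then show ?thesis using xW[OF t] chart_inv_map[OF c(1)] by (metis IntE)
  qed
  show thesis
  proof (rule that[OF \<delta>(1)])
    fix t assume "t \<in> {a..b}" "\<bar>t - \<tau>\<bar> < \<delta>"
    then show "x t = y t" by (intro eqt) (auto simp: u_def v_def)
  qed
qed

text \<open>As an equivalence the statement is transitive in time. Locally it holds by uniqueness
  where the curves agree and by the Hausdorff property where they differ. Read from \<open>b\<close>
  to \<open>a\<close>, it says that solutions with distinct initial points never meet.\<close>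

lemma sol_agree_iff:
  assumes x: "sol a b x" and y: "sol a b y" and a: "0 \<le> a" "a \<le> b"
  shows "x a = y a \<longleftrightarrow> x b = y b"
proof (rule interval_local_to_global[OF a(2), where P = "\<lambda>s t. x s = y s \<longleftrightarrow> x t = y t"])
  fix r s t assume "x r = y r \<longleftrightarrow> x s = y s" "x s = y s \<longleftrightarrow> x t = y t"
  then show "x r = y r \<longleftrightarrow> x t = y t" by blast
next
  fix \<tau> assume "a \<le> \<tau>" "\<tau> \<le> b"
  then have \<tau>: "\<tau> \<in> {a..b}" by simp
  have "\<exists>\<delta>>0. \<forall>t\<in>{a..b}. \<bar>t - \<tau>\<bar> < \<delta> \<longrightarrow> (x t = y t \<longleftrightarrow> x \<tau> = y \<tau>)"
  proof (cases "x \<tau> = y \<tau>")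
    case True
    obtain \<delta> where "\<delta> > 0" "\<And>t. t \<in> {a..b} \<Longrightarrow> \<bar>t - \<tau>\<bar> < \<delta> \<Longrightarrow> x t = y t"
      using sol_unique_near[OF x y a(1) \<tau> True] by blast
    then show ?thesis using True by (intro exI[of _ \<delta>]) simp
  next
    case False
    obtain V W where VW: "open V" "open W" "x \<tau> \<in> V" "y \<tau> \<in> W" "V \<inter> W = {}" using hausdorff[OF False] by blast
    obtain \<delta>1 where \<delta>1: "\<delta>1 > 0" "\<And>t. t \<in> {a..b} \<Longrightarrow> \<bar>t - \<tau>\<bar> < \<delta>1 \<Longrightarrow> x t \<in> V"
      by (rule continuous_path_nbhd[OF sol_continuous[OF x] \<tau> VW(1,3)]) (rule that, auto)
    obtain \<delta>2 where \<delta>2: "\<delta>2 > 0" "\<And>t. t \<in> {a..b} \<Longrightarrow> \<bar>t - \<tau>\<bar> < \<delta>2 \<Longrightarrow> y t \<in> W"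
      by (rule continuous_path_nbhd[OF sol_continuous[OF y] \<tau> VW(2,4)]) (rule that, auto)
    have "x t \<noteq> y t" if "t \<in> {a..b}" "\<bar>t - \<tau>\<bar> < min \<delta>1 \<delta>2" for t
      using \<delta>1(2)[of t] \<delta>2(2)[of t] that VW(5) by auto
    then show ?thesis using False \<delta>1(1) \<delta>2(1) by (intro exI[of _ "min \<delta>1 \<delta>2"]) auto
  qed
  then obtain \<delta> where \<delta>: "\<delta> > 0" "\<And>t. t \<in> {a..b} \<Longrightarrow> \<bar>t - \<tau>\<bar> < \<delta> \<Longrightarrow> x t = y t \<longleftrightarrow> x \<tau> = y \<tau>" by blast
  show "\<exists>\<delta>>0. \<forall>s t. a \<le> s \<longrightarrow> s \<le> \<tau> \<longrightarrow> \<tau> \<le> t \<longrightarrow> t \<le> b \<longrightarrow> t - s < \<delta> \<longrightarrow> (x s = y s) = (x t = y t)"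
  proof (intro exI[of _ \<delta>] conjI allI impI \<delta>(1))
    fix s t assume "a \<le> s" "s \<le> \<tau>" "\<tau> \<le> t" "t \<le> b" "t - s < \<delta>"
    then show "(x s = y s) = (x t = y t)" using \<delta>(2)[of s] \<delta>(2)[of t] by auto
  qed
qed

lemma sol_unique:
  assumes "sol a b x" "sol a b y" "0 \<le> a" "x a = y a" "t \<in> {a..b}"
  shows "x t = y t"
proof -
  have at: "a \<le> t" "t \<le> b" using assms(5) by auto
  show ?thesis
    using sol_agree_iff[OF sol_subinterval[OF assms(1) order_refl at(2)] sol_subinterval[OF assms(2) order_refl at(2)] assms(3) at(1)] assms(4)
    by blast
qed

text \<open>Two solutions either coincide or never meet. In the second case the pair stays where the
  Kobayashi distance is \<open>C1\<close>, and the chain rule writes its increment as the integral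
  of the differential evaluated on the field, which the Herglotz condition makes nonpositive for
  almost every time.\<close>

lemma sol_contraction:
  assumes x: "sol a b x" and y: "sol a b y" and a: "0 \<le> a" "a \<le> b"
  shows "kobayashi A (x b) (y b) \<le> kobayashi A (x a) (y a)"
proof (cases "x a = y a")
  case True
  then have "x b = y b" using sol_agree_iff[OF x y a] by blast
  then show ?thesis by (simp add: True)
next
  case False
  have ne: "x t \<noteq> y t" if "t \<in> {a..b}" for t
  proof -
    have at: "a \<le> t" "t \<le> b" using that by auto
    show ?thesis
      using sol_agree_iff[OF sol_subinterval[OF x order_refl at(2)] sol_subinterval[OF y order_refl at(2)] a(1) at(1)] False
      by blast
  qed
  \<comment> \<open>One null set of times serves for all pairs of points, so the condition may be
    evaluated at the two moving points.\<close>
  define H where "H = {t \<in> {0..}. \<not> (\<forall>z w. z \<noteq> w \<longrightarrow> differential2 A (kobayashi A) z w (G z t) (G w t) \<le> 0)}"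
  have "AE t in lebesgue_on {0..}. \<forall>z w. z \<noteq> w \<longrightarrow> differential2 A (kobayashi A) z w (G z t) (G w t) \<le> 0"
    using G unfolding herglotz_vector_field_def by (rule conjunct2)
  then have H: "negligible H" unfolding H_def by (subst (asm) AE_lebesgue_on_iff_negligible) auto
  show ?thesis
  proof (rule interval_local_to_global[OF a(2), where P = "\<lambda>s t. kobayashi A (x t) (y t) \<le> kobayashi A (x s) (y s)"])
    fix \<tau> assume "a \<le> \<tau>" "\<tau> \<le> b"
    then have \<tau>: "\<tau> \<in> {a..b}" by simp
    obtain c where c: "c \<in> A" "x \<tau> \<in> chart_dom c" using chart_exists by blast
    obtain c' where c': "c' \<in> A" "y \<tau> \<in> chart_dom c'" using chart_exists by blast
    obtain \<delta>1 where \<delta>1: "\<delta>1 > 0" "\<And>t. t \<in> {a..b} \<Longrightarrow> \<bar>t - \<tau>\<bar> < \<delta>1 \<Longrightarrow> x t \<in> chart_dom c"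
      by (rule continuous_path_nbhd[OF sol_continuous[OF x] \<tau> open_chart_dom[OF c(1)] c(2)]) (rule that, auto)
    obtain \<delta>2 where \<delta>2: "\<delta>2 > 0" "\<And>t. t \<in> {a..b} \<Longrightarrow> \<bar>t - \<tau>\<bar> < \<delta>2 \<Longrightarrow> y t \<in> chart_dom c'"
      by (rule continuous_path_nbhd[OF sol_continuous[OF y] \<tau> open_chart_dom[OF c'(1)] c'(2)]) (rule that, auto)
    define F where "F = (\<lambda>(x, y). kobayashi A (chart_inv c x) (chart_inv c' y))"
    define U where "U = {(x, y). x \<in> chart_img c \<and> y \<in> chart_img c' \<and> chart_inv c x \<noteq> chart_inv c' y}"
    have Ck: "Ck_on 1 F U" using C1 c c' unfolding C1_off_Diag_def F_def U_def by blast
    have "open U"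
    proof -
      have "continuous_on (chart_img c \<times> chart_img c') (\<lambda>z. (chart_inv c (fst z), chart_inv c' (snd z)))"
        by (intro continuous_on_Pair continuous_on_compose2[OF continuous_chart_inv[OF c(1)]]
            continuous_on_compose2[OF continuous_chart_inv[OF c'(1)]] continuous_intros) auto
      then have "open ((chart_img c \<times> chart_img c') \<inter> (\<lambda>z. (chart_inv c (fst z), chart_inv c' (snd z))) -` {z. \<exists>x y. z = (x, y) \<and> x \<noteq> y})"
        by (rule continuous_open_preimage[OF _ open_Times[OF open_chart_img[OF c(1)] open_chart_img[OF c'(1)]] open_diagonal_complement])
      moreover have "U = (chart_img c \<times> chart_img c') \<inter> (\<lambda>z. (chart_inv c (fst z), chart_inv c' (snd z))) -` {z. \<exists>x y. z = (x, y) \<and> x \<noteq> y}"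
        by (auto simp: U_def)
      ultimately show ?thesis by simp
    qed
    show "\<exists>\<delta>>0. \<forall>s t. a \<le> s \<longrightarrow> s \<le> \<tau> \<longrightarrow> \<tau> \<le> t \<longrightarrow> t \<le> b \<longrightarrow> t - s < \<delta> \<longrightarrow>
       kobayashi A (x t) (y t) \<le> kobayashi A (x s) (y s)"
    proof (intro exI[of _ "min \<delta>1 \<delta>2"] conjI allI impI)
      show "min \<delta>1 \<delta>2 > 0" using \<delta>1(1) \<delta>2(1) by simp
      fix s t assume st: "a \<le> s" "s \<le> \<tau>" "\<tau> \<le> t" "t \<le> b" "t - s < min \<delta>1 \<delta>2"
      then have st': "s \<le> t" by simp
      have dx: "x \<sigma> \<in> chart_dom c" "y \<sigma> \<in> chart_dom c'" if "\<sigma> \<in> {s..t}" for \<sigma>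
        using \<delta>1(2)[of \<sigma>] \<delta>2(2)[of \<sigma>] that st by auto
      let ?X = "\<lambda>\<sigma>. (chart_map c (x \<sigma>), chart_map c' (y \<sigma>))" and ?g = "\<lambda>\<sigma>. (G (x \<sigma>) \<sigma> c, G (y \<sigma>) \<sigma> c')"
      have int: "((\<lambda>\<sigma>. frechet_derivative F (at (?X \<sigma>)) (?g \<sigma>)) has_integral (F (?X t) - F (?X s))) {s..t}"
      proof (rule integral_chain_rule[OF st' _ _ \<open>open U\<close>, where X = ?X and DT = "\<lambda>z. frechet_derivative F (at z)"])
        have sx: "sol s t x" "sol s t y" using x y st by (auto intro: sol_subinterval)
        show "?g absolutely_integrable_on {s..t}"
          by (intro absolutely_integrable_Pair field_along_path_integrable c c' sol_continuous sx)
             (use dx st a in auto)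
        show "(?g has_integral (?X t' - ?X s')) {s'..t'}" if "s \<le> s'" "s' \<le> t'" "t' \<le> t" for s' t'
        proof -
          have "x ` {s'..t'} \<subseteq> chart_dom c" "y ` {s'..t'} \<subseteq> chart_dom c'" using dx that by auto
          then have "((\<lambda>\<sigma>. G (x \<sigma>) \<sigma> c) has_integral (chart_map c (x t') - chart_map c (x s'))) {s'..t'}"
            "((\<lambda>\<sigma>. G (y \<sigma>) \<sigma> c') has_integral (chart_map c' (y t') - chart_map c' (y s'))) {s'..t'}"
            using sol_integral[OF sx(1) c(1) that] sol_integral[OF sx(2) c'(1) that] by auto
          from has_integral_Pair_real[OF this] show ?thesis by simp
        qed
        show "?X \<sigma> \<in> U" if "\<sigma> \<in> {s..t}" for \<sigma>
          using dx[OF that] ne[of \<sigma>] that st c c' by (auto simp: U_def chart_inv_map)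
        show "(F has_derivative frechet_derivative F (at z)) (at z)" if "z \<in> U" for z
          using Ck that frechet_derivative_works by (auto simp del: split_paired_All)
        show "continuous_on U (\<lambda>z. frechet_derivative F (at z) v)" for v
          by (cases v) (use Ck in simp)
      qed
      have nonpos: "frechet_derivative F (at (?X \<sigma>)) (?g \<sigma>) \<le> 0" if \<sigma>: "\<sigma> \<in> {s..t} - H" for \<sigma>
      proof -
        have \<sigma>0: "0 \<le> \<sigma>" using \<sigma> a st by auto
        have d: "x \<sigma> \<in> chart_dom c" "y \<sigma> \<in> chart_dom c'" "x \<sigma> \<noteq> y \<sigma>" using dx[of \<sigma>] \<sigma> ne[of \<sigma>] st by auto
        have "frechet_derivative F (at (?X \<sigma>)) (?g \<sigma>) = differential2 A (kobayashi A) (x \<sigma>) (y \<sigma>) (G (x \<sigma>) \<sigma>) (G (y \<sigma>) \<sigma>)"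
          unfolding F_def
          by (rule differential2_in_charts[symmetric, OF C1 d(3) c(1) d(1) c'(1) d(2) G_tangent[OF \<sigma>0] G_tangent[OF \<sigma>0]])
        then show ?thesis using \<sigma> \<sigma>0 d(3) by (auto simp: H_def)
      qed
      have "((\<lambda>\<sigma>. if \<sigma> \<in> H then 0 else frechet_derivative F (at (?X \<sigma>)) (?g \<sigma>)) has_integral (F (?X t) - F (?X s))) {s..t}"
        by (rule has_integral_spike[OF H _ int]) auto
      then have "F (?X t) - F (?X s) \<le> 0"
        by (rule has_integral_le[OF _ has_integral_0]) (use nonpos in auto)
      then show "kobayashi A (x t) (y t) \<le> kobayashi A (x s) (y s)"
        using dx[of s] dx[of t] st' by (simp add: F_def chart_inv_map c c')
    qed
  qed auto
qed

section \<open>Global existence\<close>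

definition survives :: "real \<Rightarrow> real \<Rightarrow> 'm \<Rightarrow> bool"
  where "survives u v p \<longleftrightarrow> (\<exists>x. sol u v x \<and> x u = p)"

text \<open>Joining intervals requires control of the end point: solutions that start near
  \<open>x s\<close> must end as near to \<open>x t\<close> as prescribed, so that they fall into
  the neighbourhood found for the next interval. On short intervals contraction provides this
  control.\<close>

lemma survives_open:
  assumes uv: "0 \<le> u" "u \<le> v" and p: "survives u v p"
  obtains V where "open V" "p \<in> V" "\<And>q. q \<in> V \<Longrightarrow> survives u v q"
proof -
  obtain x where x: "sol u v x" "x u = p" using p unfolding survives_def by blast
  let ?P = "\<lambda>s t. \<forall>e>0. \<exists>V. open V \<and> x s \<in> V \<and> (\<forall>q\<in>V. \<exists>y. sol s t y \<and> y s = q \<and> kobayashi A (x t) (y t) < e)"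
  have "?P u v"
  proof (rule interval_local_to_global[OF uv(2), where P = ?P])
    fix r s t assume *: "u \<le> r" "r \<le> s" "s \<le> t" "t \<le> v" and 1: "?P r s" and 2: "?P s t"
    show "?P r t"
    proof (intro allI impI)
      fix e :: real assume e: "e > 0"
      obtain V where V: "open V" "x s \<in> V" "\<And>q. q \<in> V \<Longrightarrow> \<exists>y. sol s t y \<and> y s = q \<and> kobayashi A (x t) (y t) < e"
        using 2[THEN spec, THEN mp, OF e] by blast
      obtain e' where e': "e' > 0" "\<And>q. kobayashi A (x s) q < e' \<Longrightarrow> q \<in> V" by (rule kobayashi_nbhd[OF V(1,2)]) (rule that, auto)
      obtain W where W: "open W" "x r \<in> W" "\<And>q. q \<in> W \<Longrightarrow> \<exists>y. sol r s y \<and> y r = q \<and> kobayashi A (x s) (y s) < e'"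
        using 1[THEN spec, THEN mp, OF e'(1)] by blast
      have "\<exists>y. sol r t y \<and> y r = q \<and> kobayashi A (x t) (y t) < e" if "q \<in> W" for q
      proof -
        obtain y where y: "sol r s y" "y r = q" "kobayashi A (x s) (y s) < e'" using W(3)[OF \<open>q \<in> W\<close>] by blast
        obtain z where z: "sol s t z" "z s = y s" "kobayashi A (x t) (z t) < e"
          using V(3)[OF e'(2)[OF y(3)]] by blast
        have "sol r t (\<lambda>\<tau>. if \<tau> \<le> s then y \<tau> else z \<tau>)" using sol_join[OF y(1) z(1)] z(2) * by simp
        then show ?thesis using y z * by (intro exI[of _ "\<lambda>\<tau>. if \<tau> \<le> s then y \<tau> else z \<tau>"]) auto
      qed
      then show "\<exists>V. open V \<and> x r \<in> V \<and> (\<forall>q\<in>V. \<exists>y. sol r t y \<and> y r = q \<and> kobayashi A (x t) (y t) < e)"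
        using W(1,2) by blast
    qed
  next
    fix \<tau> assume \<tau>: "u \<le> \<tau>" "\<tau> \<le> v"
    obtain \<delta> U where \<delta>: "\<delta> > 0" "open U" "x \<tau> \<in> U"
      "\<And>u v. 0 \<le> u \<Longrightarrow> u \<le> v \<Longrightarrow> \<tau> - \<delta> \<le> u \<Longrightarrow> v \<le> \<tau> + \<delta> \<Longrightarrow>
        \<exists>\<Phi>. (\<forall>q\<in>U. sol u v (\<Phi> q) \<and> \<Phi> q u = q \<and> cdiff_at A (\<lambda>q. \<Phi> q v) q)"
      by (rule local_flow[of \<tau> "x \<tau>", OF order_trans[OF uv(1) \<tau>(1)]]) (rule that, auto)
    have \<tau>uv: "\<tau> \<in> {u..v}" using \<tau> by simp
    obtain \<delta>2 where \<delta>2: "\<delta>2 > 0" "\<And>t. t \<in> {u..v} \<Longrightarrow> \<bar>t - \<tau>\<bar> < \<delta>2 \<Longrightarrow> x t \<in> U"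
      by (rule continuous_path_nbhd[OF sol_continuous[OF x(1)] \<tau>uv \<delta>(2,3)]) (rule that, auto)
    show "\<exists>\<delta>>0. \<forall>s t. u \<le> s \<longrightarrow> s \<le> \<tau> \<longrightarrow> \<tau> \<le> t \<longrightarrow> t \<le> v \<longrightarrow> t - s < \<delta> \<longrightarrow> ?P s t"
    proof (intro exI[of _ "min \<delta> \<delta>2"] conjI allI impI)
      show "min \<delta> \<delta>2 > 0" using \<delta>(1) \<delta>2(1) by simp
      fix s t and e :: real assume st: "u \<le> s" "s \<le> \<tau>" "\<tau> \<le> t" "t \<le> v" "t - s < min \<delta> \<delta>2" and e: "e > 0"
      obtain \<Phi> where \<Phi>: "\<And>q. q \<in> U \<Longrightarrow> sol s t (\<Phi> q) \<and> \<Phi> q s = q" using \<delta>(4)[of s t] st uv by auto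
      obtain V where V: "open V" "x s \<in> V" "\<And>q. q \<in> V \<Longrightarrow> kobayashi A (x s) q < e" by (rule kobayashi_small[OF e]) (rule that, auto)
      have "kobayashi A (x t) (\<Phi> q t) < e" if "q \<in> U \<inter> V" for q
        using sol_contraction[of s t x "\<Phi> q"] \<Phi>[of q] V(3)[of q] that sol_subinterval[OF x(1), of s t] st uv by auto
      then have "\<forall>q\<in>U \<inter> V. \<exists>y. sol s t y \<and> y s = q \<and> kobayashi A (x t) (y t) < e" using \<Phi> by blast
      moreover have "x s \<in> U" using \<delta>2(2)[of s] st by auto
      ultimately show "\<exists>V. open V \<and> x s \<in> V \<and> (\<forall>q\<in>V. \<exists>y. sol s t y \<and> y s = q \<and> kobayashi A (x t) (y t) < e)"
        using V(1,2) \<delta>(2) by (intro exI[of _ "U \<inter> V"]) auto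
    qed
  qed
  from this[THEN spec, THEN mp, OF zero_less_one]
  obtain V where "open V" "x u \<in> V" "\<forall>q\<in>V. \<exists>y. sol u v y \<and> y u = q \<and> kobayashi A (x v) (y v) < 1"
    by blast
  then show thesis using that[of V] x(2) unfolding survives_def by blast
qed

text \<open>Nearby global solutions make the solution from \<open>p\<close> a Cauchy curve for the Kobayashi distance up to
  the supremum of its life time; completeness provides a limit, from which it can be continued.\<close>

lemma survives_closed:
  assumes uv: "0 \<le> u" "u \<le> v" and p: "\<And>V. open V \<Longrightarrow> p \<in> V \<Longrightarrow> \<exists>q\<in>V. survives u v q"
  shows "survives u v p"
proof -
  define S where "S = {t \<in> {u..v}. survives u t p}"
  have uS: "u \<in> S" using uv sol_refl[of u "\<lambda>_. p"] by (auto simp: S_def survives_def)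
  have bdd: "bdd_above S" by (rule bdd_aboveI[of _ v]) (auto simp: S_def)
  define \<tau> where "\<tau> = Sup S"
  have \<tau>1: "u \<le> \<tau>" unfolding \<tau>_def by (rule cSup_upper[OF uS bdd])
  have \<tau>2: "\<tau> \<le> v" unfolding \<tau>_def by (rule cSup_least) (use uS in \<open>auto simp: S_def\<close>)
  note \<tau> = \<tau>1 \<tau>2
  \<comment> \<open>Times that tend to \<open>\<tau>\<close> and are strictly smaller unless
    \<open>\<tau> = u\<close>: a solution exists up to each of them, while existence up to the
    supremum is not known yet.\<close>
  define T where "T n = \<tau> - (\<tau> - u) / (real n + 1)" for n :: nat
  have Tu: "u \<le> T n" "T n \<le> \<tau>" for n
  proof -
    have "(\<tau> - u) / (real n + 1) \<le> (\<tau> - u) / 1" using \<tau> by (intro divide_left_mono) auto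
    then show "u \<le> T n" "T n \<le> \<tau>" using \<tau>1 by (auto simp: T_def)
  qed
  have Tlim: "T \<longlonglongrightarrow> \<tau>"
  proof -
    have "(\<lambda>n. \<tau> - (\<tau> - u) * (1 / (real n + 1))) \<longlonglongrightarrow> \<tau> - (\<tau> - u) * 0"
      using LIMSEQ_inverse_real_of_nat by (intro tendsto_intros) (simp add: inverse_eq_divide add.commute)
    then show ?thesis by (simp add: T_def[abs_def])
  qed
  have "survives u (T n) p" for n
  proof (cases "\<tau> = u")
    case True
    then show ?thesis using uS by (simp add: T_def S_def)
  next
    case False
    then have "T n < \<tau>" using \<tau> by (simp add: T_def add_nonneg_pos)
    then obtain s where s: "s \<in> S" "T n < s" using less_cSup_iff[OF _ bdd] uS unfolding \<tau>_def by blast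
    then obtain x where "sol u s x" "x u = p" unfolding S_def survives_def by blast
    then show ?thesis unfolding survives_def using sol_subinterval[of u s x u "T n"] s(2) by auto
  qed
  then obtain x where x: "\<And>n. sol u (T n) (x n)" "\<And>n. x n u = p" unfolding survives_def by metis
  define \<sigma> where "\<sigma> n = x n (T n)" for n
  obtain q where q: "\<sigma> \<longlonglongrightarrow> q"
  proof (rule kobayashi_Cauchy_convergent)
    fix e :: real assume e: "e > 0"
    then have e4: "e/4 > 0" by simp
    \<comment> \<open>The route from \<open>\<sigma> m\<close> through \<open>y (T m)\<close>,
      \<open>y \<tau>\<close> and \<open>y (T n)\<close> to \<open>\<sigma> n\<close> has four legs,
      each of length below \<open>e/4\<close>.\<close>
    obtain V where V: "open V" "p \<in> V" "\<And>q. q \<in> V \<Longrightarrow> kobayashi A p q < e/4" by (rule kobayashi_small[OF e4]) (rule that, auto)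
    obtain p' where p': "p' \<in> V" "survives u v p'" using p[OF V(1,2)] by blast
    then obtain y where y: "sol u v y" "y u = p'" unfolding survives_def by blast
    have near: "kobayashi A (\<sigma> n) (y (T n)) < e/4" for n
      using sol_contraction[OF x(1)[of n] sol_subinterval[OF y(1), of u "T n"] uv(1)] Tu[of n] \<tau> x(2) y(2) V(3)[OF p'(1)]
      by (simp add: \<sigma>_def)
    have "(\<lambda>n. y (T n)) \<longlonglongrightarrow> y \<tau>"
      by (rule continuous_on_tendsto_compose[OF sol_continuous[OF y(1)] Tlim])
         (use \<tau> Tu order_trans[OF Tu(2) \<tau>(2)] in \<open>auto intro!: always_eventually\<close>)
    then have "(\<lambda>n. kobayashi A (y \<tau>) (y (T n))) \<longlonglongrightarrow> 0" unfolding tendsto_iff_kobayashi .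
    then have "\<forall>\<^sub>F n in sequentially. kobayashi A (y \<tau>) (y (T n)) < e/4" using e4 by (rule order_tendstoD)
    then obtain M where M: "\<And>n. n \<ge> M \<Longrightarrow> kobayashi A (y \<tau>) (y (T n)) < e/4" unfolding eventually_sequentially by blast
    have "kobayashi A (\<sigma> m) (\<sigma> n) < e" if "m \<ge> M" "n \<ge> M" for m n
    proof -
      have "kobayashi A (\<sigma> m) (\<sigma> n) \<le> kobayashi A (\<sigma> m) (y (T m)) + kobayashi A (y (T m)) (y \<tau>) + kobayashi A (y \<tau>) (y (T n)) + kobayashi A (y (T n)) (\<sigma> n)"
        using K.triangle[of "\<sigma> m" "y (T m)" "\<sigma> n"] K.triangle[of "y (T m)" "y \<tau>" "\<sigma> n"] K.triangle[of "y \<tau>" "y (T n)" "\<sigma> n"] by simp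
      then show ?thesis using near[of m] near[of n] M[OF that(1)] M[OF that(2)]
        by (simp add: K.commute[of "y (T m)" "y \<tau>"] K.commute[of "y (T n)" "\<sigma> n"])
    qed
    then show "\<exists>N. \<forall>m\<ge>N. \<forall>n\<ge>N. kobayashi A (\<sigma> m) (\<sigma> n) < e" by blast
  qed
  obtain \<delta> U where \<delta>: "\<delta> > 0" "open U" "q \<in> U"
    "\<And>u v. 0 \<le> u \<Longrightarrow> u \<le> v \<Longrightarrow> \<tau> - \<delta> \<le> u \<Longrightarrow> v \<le> \<tau> + \<delta> \<Longrightarrow>
        \<exists>\<Phi>. (\<forall>q\<in>U. sol u v (\<Phi> q) \<and> \<Phi> q u = q \<and> cdiff_at A (\<lambda>q. \<Phi> q v) q)"
    by (rule local_flow[of \<tau> q, OF order_trans[OF uv(1) \<tau>(1)]]) (rule that, auto)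
  have "\<forall>\<^sub>F n in sequentially. \<sigma> n \<in> U" "\<forall>\<^sub>F n in sequentially. \<tau> - \<delta> < T n"
    using topological_tendstoD[OF q \<delta>(2,3)] order_tendstoD(1)[OF Tlim, of "\<tau> - \<delta>"] \<delta>(1) by auto
  then have "\<forall>\<^sub>F n in sequentially. \<sigma> n \<in> U \<and> \<tau> - \<delta> < T n" by eventually_elim auto
  then obtain n where n: "\<sigma> n \<in> U" "\<tau> - \<delta> < T n" unfolding eventually_sequentially by blast
  \<comment> \<open>The continued solution reaches \<open>?w\<close>, so \<open>?w\<close> belongs
    to \<open>S\<close> and cannot exceed the supremum; as \<open>\<delta> > 0\<close>, this forces
    \<open>?w = v\<close>.\<close>
  let ?w = "min v (\<tau> + \<delta>)"
  have Tw: "T n \<le> ?w" using Tu[of n] \<tau> \<delta>(1) by simp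
  then obtain y where y: "sol (T n) ?w y" "y (T n) = \<sigma> n" using \<delta>(4)[of "T n" ?w] n Tu[of n] uv by auto
  have "sol u ?w (\<lambda>t. if t \<le> T n then x n t else y t)"
    using sol_join[OF x(1)[of n] y(1)] y(2) Tu[of n] Tw by (simp add: \<sigma>_def)
  then have sw: "survives u ?w p" unfolding survives_def using x(2)[of n] Tu[of n]
    by (intro exI[of _ "\<lambda>t. if t \<le> T n then x n t else y t"]) auto
  moreover have "u \<le> ?w" using uv \<tau> \<delta>(1) by simp
  ultimately have "?w \<in> S" by (simp add: S_def)
  then have "?w \<le> \<tau>" unfolding \<tau>_def by (rule cSup_upper[OF _ bdd])
  then have "?w = v" using \<delta>(1) by auto
  then show ?thesis using sw by simp
qed

text \<open>A local flow supplies one survivor for each short interval, but the admissible length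
  depends on the point. For a fixed interval the set of survivors is open and closed, so one
  survivor makes all points survive; only then can intervals be joined for arbitrary initial
  points.\<close>

theorem global_existence:
  assumes uv: "0 \<le> u" "u \<le> v"
  shows "survives u v p"
proof -
  have all: "survives s t q" if p0: "survives s t p0" and st: "0 \<le> s" "s \<le> t" for s t p0 q
  proof (rule connected_UNIV_propagate[OF connected_mfd, where P = "survives s t", OF p0])
    fix x
    show "\<exists>U. open U \<and> x \<in> U \<and> (\<forall>y\<in>U. survives s t x = survives s t y)"
    proof (cases "survives s t x")
      case True
      then show ?thesis using survives_open[OF st True] by metis
    next
      case False
      then show ?thesis using survives_closed[OF st, of x] by blast
    qed
  qed
  have "\<forall>p. survives u v p"
  proof (rule interval_local_to_global[OF uv(2), where P = "\<lambda>s t. \<forall>p. survives s t p"])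
    fix r s t assume *: "u \<le> r" "r \<le> s" "s \<le> t" "t \<le> v" "\<forall>p. survives r s p" "\<forall>p. survives s t p"
    show "\<forall>p. survives r t p"
    proof
      fix p
      obtain x where x: "sol r s x" "x r = p" using *(5) unfolding survives_def by blast
      obtain y where y: "sol s t y" "y s = x s" using *(6) unfolding survives_def by blast
      have "sol r t (\<lambda>\<tau>. if \<tau> \<le> s then x \<tau> else y \<tau>)" using sol_join[OF x(1) y(1)] y(2) * by simp
      then show "survives r t p" unfolding survives_def using x *
        by (intro exI[of _ "\<lambda>\<tau>. if \<tau> \<le> s then x \<tau> else y \<tau>"]) auto
    qed
  next
    fix \<tau> assume \<tau>: "u \<le> \<tau>" "\<tau> \<le> v"
    obtain \<delta> U where \<delta>: "\<delta> > 0" "open U" "p \<in> U"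
      "\<And>u v. 0 \<le> u \<Longrightarrow> u \<le> v \<Longrightarrow> \<tau> - \<delta> \<le> u \<Longrightarrow> v \<le> \<tau> + \<delta> \<Longrightarrow>
        \<exists>\<Phi>. (\<forall>q\<in>U. sol u v (\<Phi> q) \<and> \<Phi> q u = q \<and> cdiff_at A (\<lambda>q. \<Phi> q v) q)"
      by (rule local_flow[of \<tau> p, OF order_trans[OF uv(1) \<tau>(1)]]) (rule that, auto)
    show "\<exists>\<delta>>0. \<forall>s t. u \<le> s \<longrightarrow> s \<le> \<tau> \<longrightarrow> \<tau> \<le> t \<longrightarrow> t \<le> v \<longrightarrow> t - s < \<delta> \<longrightarrow> (\<forall>p. survives s t p)"
    proof (intro exI[of _ \<delta>] conjI allI impI \<delta>(1))
      fix s t q assume st: "u \<le> s" "s \<le> \<tau>" "\<tau> \<le> t" "t \<le> v" "t - s < \<delta>"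
      have "survives s t p" unfolding survives_def using \<delta>(4)[of s t] \<delta>(3) st uv by auto
      then show "survives s t q" by (rule all) (use st uv in auto)
    qed
  qed
  then show ?thesis by blast
qed

section \<open>The evolution family\<close>

text \<open>A curve is chosen anew for each \<open>t\<close>; for \<open>0 \<le> s \<le> t\<close>
  uniqueness makes the value independent of the choice, which is the content of
  \<open>flow_eq\<close>.\<close>

definition flow :: "real \<Rightarrow> real \<Rightarrow> 'm \<Rightarrow> 'm"
  where "flow s t z = (SOME x. sol s t x \<and> x s = z) t"

lemma flow_eq:
  assumes st: "0 \<le> s" "s \<le> t" and x: "sol s t x"
  shows "flow s t (x s) = x t"
proof -
  have "\<exists>y. sol s t y \<and> y s = x s" using x by blast
  then have *: "sol s t (SOME y. sol s t y \<and> y s = x s) \<and> (SOME y. sol s t y \<and> y s = x s) s = x s"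
    by (rule someI_ex)
  show ?thesis
    unfolding flow_def by (rule sol_unique[OF conjunct1[OF *] x st(1) conjunct2[OF *]]) (use st in simp)
qed

lemma flow_refl: "0 \<le> s \<Longrightarrow> flow s s z = z"
  by (rule flow_eq[OF _ order_refl sol_refl, of s "\<lambda>_. z"])

lemma flow_sol:
  assumes st: "0 \<le> s" "s \<le> t"
  shows "sol s t (\<lambda>\<tau>. flow s \<tau> z)"
proof -
  obtain x where x: "sol s t x" "x s = z" using global_existence[OF st] unfolding survives_def by blast
  show ?thesis
  proof (rule sol_cong[OF x(1)])
    fix \<tau> assume "\<tau> \<in> {s..t}"
    then show "flow s \<tau> z = x \<tau>" using flow_eq[OF st(1) _ sol_subinterval[OF x(1) order_refl]] x(2) by auto
  qed
qed

lemma flow_semigroup: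
  assumes "0 \<le> s" "s \<le> u" "u \<le> t"
  shows "flow s t z = flow u t (flow s u z)"
proof -
  have "sol u t (\<lambda>\<tau>. flow s \<tau> z)"
    by (rule sol_subinterval[OF flow_sol[of s t z]]) (use assms in auto)
  then show ?thesis using flow_eq[of u t "\<lambda>\<tau>. flow s \<tau> z"] assms by simp
qed

lemma flow_contraction:
  assumes "0 \<le> s" "s \<le> t"
  shows "kobayashi A (flow s t z) (flow s t w) \<le> kobayashi A z w"
  using sol_contraction[OF flow_sol[OF assms, of z] flow_sol[OF assms, of w] assms]
  unfolding flow_refl[OF assms(1)] .

text \<open>Bisection along the trajectory of \<open>p\<close>: on a short interval the flow
  coincides near the current point with a local flow, and differentiability at the points of the
  trajectory composes by the semigroup law.\<close>

lemma flow_cdiff: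
  assumes st: "0 \<le> s" "s \<le> t"
  shows "cdiff_at A (flow s t) p"
proof -
  let ?x = "\<lambda>\<tau>. flow s \<tau> p"
  have "cdiff_at A (flow s t) (?x s)"
  proof (rule interval_local_to_global[OF st(2), where P = "\<lambda>a b. cdiff_at A (flow a b) (?x a)"])
    fix a b c assume *: "s \<le> a" "a \<le> b" "b \<le> c" "c \<le> t" "cdiff_at A (flow a b) (?x a)" "cdiff_at A (flow b c) (?x b)"
    have "flow a b (?x a) = ?x b" using flow_semigroup[of s a b p] * st by simp
    then have "cdiff_at A (flow b c \<circ> flow a b) (?x a)" using cdiff_at_compose[OF *(5)] *(6) by simp
    moreover have "flow b c \<circ> flow a b = flow a c" using flow_semigroup[of a b c] * st by auto
    ultimately show "cdiff_at A (flow a c) (?x a)" by simp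
  next
    fix \<tau> assume \<tau>: "s \<le> \<tau>" "\<tau> \<le> t"
    obtain \<delta> U where \<delta>: "\<delta> > 0" "open U" "?x \<tau> \<in> U"
      "\<And>u v. 0 \<le> u \<Longrightarrow> u \<le> v \<Longrightarrow> \<tau> - \<delta> \<le> u \<Longrightarrow> v \<le> \<tau> + \<delta> \<Longrightarrow>
        \<exists>\<Phi>. (\<forall>q\<in>U. sol u v (\<Phi> q) \<and> \<Phi> q u = q \<and> cdiff_at A (\<lambda>q. \<Phi> q v) q)"
      by (rule local_flow[of \<tau> "?x \<tau>", OF order_trans[OF st(1) \<tau>(1)]]) (rule that, auto)
    have \<tau>st: "\<tau> \<in> {s..t}" using \<tau> by simp
    obtain \<delta>2 where \<delta>2: "\<delta>2 > 0" "\<And>a. a \<in> {s..t} \<Longrightarrow> \<bar>a - \<tau>\<bar> < \<delta>2 \<Longrightarrow> ?x a \<in> U"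
      by (rule continuous_path_nbhd[OF sol_continuous[OF flow_sol[OF st]] \<tau>st \<delta>(2,3)]) (rule that, auto)
    show "\<exists>\<delta>>0. \<forall>a b. s \<le> a \<longrightarrow> a \<le> \<tau> \<longrightarrow> \<tau> \<le> b \<longrightarrow> b \<le> t \<longrightarrow> b - a < \<delta> \<longrightarrow> cdiff_at A (flow a b) (?x a)"
    proof (intro exI[of _ "min \<delta> \<delta>2"] conjI allI impI)
      show "min \<delta> \<delta>2 > 0" using \<delta>(1) \<delta>2(1) by simp
      fix a b assume ab: "s \<le> a" "a \<le> \<tau>" "\<tau> \<le> b" "b \<le> t" "b - a < min \<delta> \<delta>2"
      have xU: "?x a \<in> U" using \<delta>2(2)[of a] ab by auto
      have a0: "0 \<le> a" "a \<le> b" using ab st by auto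
      have "\<exists>\<Phi>. (\<forall>q\<in>U. sol a b (\<Phi> q) \<and> \<Phi> q a = q \<and> cdiff_at A (\<lambda>q. \<Phi> q b) q)"
        by (rule \<delta>(4)[OF a0]) (use ab in auto)
      then obtain \<Phi> where \<Phi>: "\<And>q. q \<in> U \<Longrightarrow> sol a b (\<Phi> q) \<and> \<Phi> q a = q \<and> cdiff_at A (\<lambda>q. \<Phi> q b) q" by blast
      show "cdiff_at A (flow a b) (?x a)"
      proof (rule cdiff_at_cong[OF _ \<delta>(2) xU])
        show "cdiff_at A (\<lambda>q. \<Phi> q b) (?x a)" using \<Phi>[OF xU] by blast
        show "\<Phi> q b = flow a b q" if "q \<in> U" for q
          using flow_eq[OF a0, of "\<Phi> q"] \<Phi>[OF that] by simp
      qed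
    qed
  qed
  then show ?thesis using flow_refl[OF st(1)] by simp
qed

section \<open>The differential equation almost everywhere\<close>

text \<open>Lebesgue's theorem is applied in one chart per short interval. Only interior times are
  considered, where the derivative is two-sided; the time at which two intervals are joined goes
  into the null set.\<close>

lemma sol_velocity_ae:
  assumes a: "0 \<le> a" "a \<le> b" and x: "sol a b x"
  shows "negligible {t \<in> {a<..<b}. \<not> has_velocity A x (G (x t) t) t UNIV}"
proof (rule interval_local_to_global[OF a(2), where P = "\<lambda>s t. negligible {\<tau> \<in> {s<..<t}. \<not> has_velocity A x (G (x \<tau>) \<tau>) \<tau> UNIV}"])
  fix r s t
  assume 1: "negligible {\<tau> \<in> {r<..<s}. \<not> has_velocity A x (G (x \<tau>) \<tau>) \<tau> UNIV}"
    "negligible {\<tau> \<in> {s<..<t}. \<not> has_velocity A x (G (x \<tau>) \<tau>) \<tau> UNIV}"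
  have "negligible ({\<tau> \<in> {r<..<s}. \<not> has_velocity A x (G (x \<tau>) \<tau>) \<tau> UNIV} \<union>
    {\<tau> \<in> {s<..<t}. \<not> has_velocity A x (G (x \<tau>) \<tau>) \<tau> UNIV} \<union> {s})"
    by (intro negligible_Un 1) simp
  then show "negligible {\<tau> \<in> {r<..<t}. \<not> has_velocity A x (G (x \<tau>) \<tau>) \<tau> UNIV}"
    by (rule negligible_subset) (auto simp: not_less)
next
  fix \<tau> assume "a \<le> \<tau>" "\<tau> \<le> b"
  then have \<tau>: "\<tau> \<in> {a..b}" by simp
  obtain c where c: "c \<in> A" "x \<tau> \<in> chart_dom c" using chart_exists by blast
  obtain \<delta> where \<delta>: "\<delta> > 0" "\<And>t. t \<in> {a..b} \<Longrightarrow> \<bar>t - \<tau>\<bar> < \<delta> \<Longrightarrow> x t \<in> chart_dom c"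
    by (rule continuous_path_nbhd[OF sol_continuous[OF x] \<tau> open_chart_dom[OF c(1)] c(2)]) (rule that, auto)
  show "\<exists>\<delta>>0. \<forall>s t. a \<le> s \<longrightarrow> s \<le> \<tau> \<longrightarrow> \<tau> \<le> t \<longrightarrow> t \<le> b \<longrightarrow> t - s < \<delta> \<longrightarrow>
      negligible {\<tau> \<in> {s<..<t}. \<not> has_velocity A x (G (x \<tau>) \<tau>) \<tau> UNIV}"
  proof (intro exI[of _ \<delta>] conjI allI impI \<delta>(1))
    fix s t assume st: "a \<le> s" "s \<le> \<tau>" "\<tau> \<le> t" "t \<le> b" "t - s < \<delta>"
    have dom: "x \<sigma> \<in> chart_dom c" if "\<sigma> \<in> {s..t}" for \<sigma> using \<delta>(2)[of \<sigma>] that st by auto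
    have int: "((\<lambda>\<tau>. G (x \<tau>) \<tau> c) has_integral (chart_map c (x t') - chart_map c (x s'))) {s'..t'}"
      if "s \<le> s'" "s' \<le> t'" "t' \<le> t" for s' t'
      by (rule sol_integral[OF x c(1)]) (use that st dom in auto)
    have "s \<le> t" using st by simp
    then have "(\<lambda>\<tau>. G (x \<tau>) \<tau> c) integrable_on {s..t}" using int[of s t] by auto
    then obtain N where N: "negligible N"
      "\<And>t' F. t' \<in> {s<..<t} - N \<Longrightarrow> (\<And>c' d. s \<le> c' \<Longrightarrow> c' \<le> d \<Longrightarrow> d \<le> t \<Longrightarrow> ((\<lambda>\<tau>. G (x \<tau>) \<tau> c) has_integral (F d - F c')) {c'..d}) \<Longrightarrow>
       (F has_vector_derivative G (x t') t' c) (at t')"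
      by (rule lebesgue_differentiation) (rule that, auto)
    have "has_velocity A x (G (x \<sigma>) \<sigma>) \<sigma> UNIV" if \<sigma>: "\<sigma> \<in> {s<..<t} - N" for \<sigma>
    proof (rule has_velocity_chartI[OF c(1)])
      show "x \<sigma> \<in> chart_dom c" using dom \<sigma> by auto
      show "continuous (at \<sigma>) x"
        using continuous_on_interior[OF sol_continuous[OF x], of \<sigma>] \<sigma> st by simp
      show "G (x \<sigma>) \<sigma> \<in> tangent_space A (x \<sigma>)" by (rule G_tangent) (use \<sigma> st a in auto)
      show "((\<lambda>\<tau>. chart_map c (x \<tau>)) has_vector_derivative G (x \<sigma>) \<sigma> c) (at \<sigma>)"
        by (rule N(2)[OF \<sigma>]) (rule int)
    qed simp
    then show "negligible {\<tau> \<in> {s<..<t}. \<not> has_velocity A x (G (x \<tau>) \<tau>) \<tau> UNIV}"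
      by (intro negligible_subset[OF N(1)]) auto
  qed
qed

lemma has_velocity_UNIV_iff:
  assumes "s < t"
  shows "has_velocity A \<gamma> v t {s..} \<longleftrightarrow> has_velocity A \<gamma> v t UNIV"
proof -
  have "at t within {s..} = at t" by (rule at_within_interior) (use assms in simp)
  then show ?thesis by (simp add: has_velocity_def)
qed

lemma flow_solves_ODE: "solves_loewner_ODE A G flow"
  unfolding solves_loewner_ODE_def
proof (intro allI impI)
  fix s :: real and z assume s: "0 \<le> s"
  let ?B = "\<lambda>t. {\<tau> \<in> {s<..<t}. \<not> has_velocity A (\<lambda>\<tau>. flow s \<tau> z) (G (flow s \<tau> z) \<tau>) \<tau> UNIV}"
  have "negligible (?B (s + real n))" for n
    by (rule sol_velocity_ae) (use s flow_sol in auto)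
  then have "negligible (\<Union>(range (\<lambda>n. ?B (s + real n))))"
    by (intro negligible_countable_Union) auto
  \<comment> \<open>At the initial time \<open>s\<close> the derivative within \<open>{s..}\<close>
    is one-sided; this single time is put into the null set.\<close>
  then have "negligible (\<Union>(range (\<lambda>n. ?B (s + real n))) \<union> {s})" by (intro negligible_Un) auto
  then have "negligible {t \<in> {s..}. \<not> has_velocity A (\<lambda>\<tau>. flow s \<tau> z) (G (flow s t z) t) t {s..}}"
  proof (rule negligible_subset, intro subsetI)
    fix t assume t: "t \<in> {t \<in> {s..}. \<not> has_velocity A (\<lambda>\<tau>. flow s \<tau> z) (G (flow s t z) t) t {s..}}"
    obtain n where n: "t - s < real n" using reals_Archimedean2 by blast
    show "t \<in> \<Union>(range (\<lambda>n. ?B (s + real n))) \<union> {s}"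
    proof (cases "t = s")
      case False
      then have "t \<in> ?B (s + real n)" using t n has_velocity_UNIV_iff[of s t] by auto
      then show ?thesis by blast
    qed simp
  qed
  then show "AE t in lebesgue_on {s..}. has_velocity A (\<lambda>\<tau>. flow s \<tau> z) (G (flow s t z) t) t {s..}"
    by (subst AE_lebesgue_on_iff_negligible) auto
qed

section \<open>Joint continuity of the flow and the distance bound\<close>

text \<open>Local trajectories from \<open>p\<close> are confined to a small set, whatever their
  initial time in the window. This supplies the continuity of the flow in its initial time.\<close>

lemma flow_small_move:
  assumes \<tau>: "0 \<le> \<tau>" and e: "e > 0"
  obtains \<delta> where "\<delta> > 0"
    "\<And>s t. 0 \<le> s \<Longrightarrow> s \<le> t \<Longrightarrow> \<tau> - \<delta> \<le> s \<Longrightarrow> t \<le> \<tau> + \<delta> \<Longrightarrow> kobayashi A p (flow s t p) < e"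
proof -
  obtain W where W: "open W" "p \<in> W" "\<And>q. q \<in> W \<Longrightarrow> kobayashi A p q < e"
    by (rule kobayashi_small[OF e]) (rule that, auto)
  obtain \<delta> U where \<delta>: "\<delta> > 0" "open U" "p \<in> U"
    "\<And>u v. 0 \<le> u \<Longrightarrow> u \<le> v \<Longrightarrow> \<tau> - \<delta> \<le> u \<Longrightarrow> v \<le> \<tau> + \<delta> \<Longrightarrow>
      \<exists>\<Phi>. (\<forall>q\<in>U. sol u v (\<Phi> q) \<and> \<Phi> q u = q \<and> cdiff_at A (\<lambda>q. \<Phi> q v) q \<and> \<Phi> q ` {u..v} \<subseteq> W)"
    by (rule local_flow_within[OF \<tau> W(1,2)]) (rule that, auto)
  show thesis
  proof (rule that[OF \<delta>(1)])
    fix s t assume st: "0 \<le> s" "s \<le> t" "\<tau> - \<delta> \<le> s" "t \<le> \<tau> + \<delta>"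
    obtain \<Phi> where \<Phi>: "sol s t (\<Phi> p)" "\<Phi> p s = p" "\<Phi> p ` {s..t} \<subseteq> W" using \<delta>(4)[OF st] \<delta>(3) by blast
    have "flow s t p = \<Phi> p t" using flow_eq[OF st(1,2) \<Phi>(1)] \<Phi>(2) by simp
    moreover have "\<Phi> p t \<in> W" by (rule subsetD[OF \<Phi>(3)]) (use st(2) in simp)
    ultimately show "kobayashi A p (flow s t p) < e" using W(3) by simp
  qed
qed

text \<open>The solution that starts earlier has moved little from \<open>p\<close> when the other
  one starts, and contraction preserves this gap until time \<open>r\<close>; if
  \<open>r < s0\<close>, the second solution has not started and both points are near
  \<open>p\<close>. \<open>max s0 r\<close> replaces \<open>r\<close> because
  \<open>flow s0 r\<close> is meaningful only for \<open>r \<ge> s0\<close>.\<close>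

lemma flow_change_start:
  assumes s: "0 \<le> s" "s \<le> r" and s0: "0 \<le> s0"
    and e: "\<And>a b. 0 \<le> a \<Longrightarrow> a \<le> b \<Longrightarrow> s0 - \<delta> \<le> a \<Longrightarrow> b \<le> s0 + \<delta> \<Longrightarrow> kobayashi A p (flow a b p) < e"
    and near: "\<bar>s - s0\<bar> \<le> \<delta>"
  shows "kobayashi A (flow s r p) (flow s0 (max s0 r) p) < e"
proof -
  consider "s \<le> s0" "s0 \<le> r" | "r < s0" | "s0 < s" using s by linarith
  then show ?thesis
  proof cases
    case 1
    have "kobayashi A (flow s0 r (flow s s0 p)) (flow s0 r p) \<le> kobayashi A (flow s s0 p) p"
      by (rule flow_contraction) (use 1 s0 in auto)
    also have "\<dots> < e" using e[of s s0] 1 s near by (simp add: K.commute)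
    finally show ?thesis using flow_semigroup[of s s0 r p] 1 s by simp
  next
    case 2
    then show ?thesis using e[of s r] s near flow_refl[OF s0] by (simp add: K.commute)
  next
    case 3
    have "kobayashi A (flow s r p) (flow s r (flow s0 s p)) \<le> kobayashi A p (flow s0 s p)"
      by (rule flow_contraction) (use s in auto)
    also have "\<dots> < e" using e[of s0 s] 3 s0 near by simp
    finally show ?thesis using flow_semigroup[of s0 s r p] 3 s s0 by simp
  qed
qed

text \<open>The flow is jointly continuous in both times and the point. Changes of initial time,
  final time and point are estimated separately, each by \<open>e/3\<close>; the first and the last
  use contraction, the second is continuity of one solution.\<close>

lemma flow_image_compact:
  assumes K: "compact K"
  obtains L where "compact L" "\<And>s t z. 0 \<le> s \<Longrightarrow> s \<le> t \<Longrightarrow> t \<le> T \<Longrightarrow> z \<in> K \<Longrightarrow> flow s t z \<in> L"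
proof -
  \<comment> \<open>\<open>max s t\<close> extends the flow from \<open>s \<le> t\<close> to the
    full square, which makes the parameter set a product of compact sets.\<close>
  let ?\<Psi> = "\<lambda>(s, t, z). flow s (max s t) z"
  let ?D = "{0..T} \<times> {0..T} \<times> K"
  have "continuous_on ?D ?\<Psi>"
    unfolding continuous_on_def
  proof
    fix w assume w: "w \<in> ?D"
    obtain s0 t0 p where w_eq: "w = (s0, t0, p)" by (cases w)
    have s0: "0 \<le> s0" and t0: "0 \<le> t0" "s0 \<le> T" "t0 \<le> T" and p: "p \<in> K" using w by (auto simp: w_eq)
    have proj: "((\<lambda>v. fst v) \<longlongrightarrow> s0) (at w within ?D)" "((\<lambda>v. fst (snd v)) \<longlongrightarrow> t0) (at w within ?D)"
      "((\<lambda>v. snd (snd v)) \<longlongrightarrow> p) (at w within ?D)"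
      using tendsto_fst[OF tendsto_ident_at[of w ?D]] tendsto_snd[OF tendsto_ident_at[of w ?D]]
        tendsto_fst[OF tendsto_snd[OF tendsto_ident_at[of w ?D]]] tendsto_snd[OF tendsto_snd[OF tendsto_ident_at[of w ?D]]]
      by (simp_all add: w_eq)
    have inD: "\<forall>\<^sub>F v in at w within ?D. v \<in> ?D" by (simp add: eventually_at_topological) blast
    have "((\<lambda>v. kobayashi A (?\<Psi> w) (?\<Psi> v)) \<longlongrightarrow> 0) (at w within ?D)"
    proof (rule tendstoI)
      fix e :: real assume e: "e > 0"
      have e3: "e/3 > 0" using e by simp
      obtain \<delta> where \<delta>: "\<delta> > 0"
        "\<And>a b. 0 \<le> a \<Longrightarrow> a \<le> b \<Longrightarrow> s0 - \<delta> \<le> a \<Longrightarrow> b \<le> s0 + \<delta> \<Longrightarrow> kobayashi A p (flow a b p) < e/3"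
        by (rule flow_small_move[OF s0 e3]) (rule that, auto)
      have 1: "\<forall>\<^sub>F v in at w within ?D. \<bar>fst v - s0\<bar> \<le> \<delta>"
        using tendstoD[OF proj(1) \<delta>(1)] by eventually_elim (simp add: dist_real_def)
      have "((\<lambda>v. flow s0 (max s0 (max (fst v) (fst (snd v)))) p) \<longlongrightarrow> flow s0 (max s0 (max s0 t0)) p) (at w within ?D)"
      proof (rule continuous_on_tendsto_compose[OF sol_continuous[OF flow_sol[OF s0 t0(2)]]])
        show "((\<lambda>v. max s0 (max (fst v) (fst (snd v)))) \<longlongrightarrow> max s0 (max s0 t0)) (at w within ?D)"
          by (intro tendsto_max tendsto_const proj)
        show "max s0 (max s0 t0) \<in> {s0..T}" using t0 by simp
        show "\<forall>\<^sub>F v in at w within ?D. max s0 (max (fst v) (fst (snd v))) \<in> {s0..T}"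
          using inD by eventually_elim (use t0 in auto)
      qed
      then have "((\<lambda>v. kobayashi A (?\<Psi> w) (flow s0 (max s0 (max (fst v) (fst (snd v)))) p)) \<longlongrightarrow> 0) (at w within ?D)"
        by (simp add: tendsto_iff_kobayashi w_eq)
      then have 2: "\<forall>\<^sub>F v in at w within ?D. kobayashi A (?\<Psi> w) (flow s0 (max s0 (max (fst v) (fst (snd v)))) p) < e/3"
        using e3 by (rule order_tendstoD)
      have "((\<lambda>v. kobayashi A p (snd (snd v))) \<longlongrightarrow> 0) (at w within ?D)"
        using proj(3) unfolding tendsto_iff_kobayashi .
      then have 3: "\<forall>\<^sub>F v in at w within ?D. kobayashi A p (snd (snd v)) < e/3"
        using e3 by (rule order_tendstoD)
      show "\<forall>\<^sub>F v in at w within ?D. dist (kobayashi A (?\<Psi> w) (?\<Psi> v)) 0 < e"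
        using 1 2 3 inD
      proof eventually_elim
        case (elim v)
        obtain s t z where v: "v = (s, t, z)" by (cases v)
        have st: "0 \<le> s" "s \<le> max s t" using elim(4) by (auto simp: v)
        let ?r = "max s t"
        have a: "kobayashi A (flow s ?r p) (flow s0 (max s0 ?r) p) < e/3"
          by (rule flow_change_start[OF st s0 \<delta>(2)]) (use elim(1) in \<open>auto simp: v\<close>)
        have b: "kobayashi A (flow s ?r z) (flow s ?r p) < e/3"
          using flow_contraction[OF st, of z p] elim(3) by (simp add: v K.commute)
        have "kobayashi A (?\<Psi> w) (?\<Psi> v) \<le> kobayashi A (?\<Psi> w) (flow s0 (max s0 ?r) p) +
            (kobayashi A (flow s0 (max s0 ?r) p) (flow s ?r p) + kobayashi A (flow s ?r p) (flow s ?r z))"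
          using K.triangle[of "?\<Psi> w" "flow s0 (max s0 ?r) p" "flow s ?r z"] K.triangle[of "flow s0 (max s0 ?r) p" "flow s ?r p" "flow s ?r z"]
          by (simp add: v)
        also have "\<dots> < e/3 + (e/3 + e/3)"
          using elim(2) a b by (intro add_strict_mono) (simp_all add: v K.commute)
        finally show ?case by simp
      qed
    qed
    then show "(?\<Psi> \<longlongrightarrow> ?\<Psi> w) (at w within ?D)" unfolding tendsto_iff_kobayashi .
  qed
  then have "compact (?\<Psi> ` ?D)"
    by (rule compact_continuous_image) (intro compact_Times K compact_Icc)
  then show thesis
  proof (rule that)
    fix s t z assume st: "0 \<le> s" "s \<le> t" "t \<le> T" "z \<in> K"
    then have "(s, t, z) \<in> ?D" and max: "max s t = t" by auto
    from imageI[OF this(1), of ?\<Psi>] show "flow s t z \<in> ?\<Psi> ` ?D" by (simp only: case_prod_conv max)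
  qed
qed

text \<open>A constant factor is harmless in the definition of an evolution family, so it suffices to compare
  the Hermitian norm with the Euclidean norm of a chart.\<close>

lemma sol_metric_dist_local:
  obtains W \<rho> where "open W" "q \<in> W" "\<rho> \<ge> (0 :: real)"
    "\<And>a b x C N. 0 \<le> a \<Longrightarrow> a \<le> b \<Longrightarrow> sol a b x \<Longrightarrow> x ` {a..b} \<subseteq> W \<Longrightarrow> C integrable_on {a..b} \<Longrightarrow>
      (\<forall>t\<in>{a..b}. 0 \<le> C t) \<Longrightarrow> negligible N \<Longrightarrow> (\<forall>t\<in>{a..b} - N. hnorm h (x t) (G (x t) t) \<le> C t) \<Longrightarrow>
      metric_dist A h (x a) (x b) \<le> \<rho> * integral {a..b} C"
proof -
  obtain c where c: "c \<in> A" "q \<in> chart_dom c" using chart_exists by blast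
  obtain r where r: "r > 0" "cball (chart_map c q) r \<subseteq> chart_img c" using chart_cball[OF c open_UNIV] by auto
  obtain m M where m: "m > 0" "M > 0" "\<And>x v. x \<in> cball (chart_map c q) r \<Longrightarrow> m * norm v \<le> chart_norm c x v"
    "\<And>x v. x \<in> cball (chart_map c q) r \<Longrightarrow> chart_norm c x v \<le> M * norm v"
    using chart_norm_bounds[OF c(1) compact_cball r(2)] by metis
  let ?W = "chart_dom c \<inter> chart_map c -` ball (chart_map c q) r"
  show thesis
  proof (rule that[of ?W "M / m"])
    show "open ?W" by (rule open_chart_preimage[OF c(1) open_ball])
    show "q \<in> ?W" "0 \<le> M / m" using c r m by auto
    fix a b x and C :: "real \<Rightarrow> real" and N
    assume ab: "0 \<le> a" "a \<le> b" and x: "sol a b x" "x ` {a..b} \<subseteq> ?W"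
      and C: "C integrable_on {a..b}" "\<forall>t\<in>{a..b}. 0 \<le> C t"
      and N: "negligible N" "\<forall>t\<in>{a..b} - N. hnorm h (x t) (G (x t) t) \<le> C t"
    have xW: "x t \<in> chart_dom c" "chart_map c (x t) \<in> cball (chart_map c q) r" if "t \<in> {a..b}" for t
    proof -
      have "x t \<in> ?W" using x(2) that by blast
      then show "x t \<in> chart_dom c" "chart_map c (x t) \<in> cball (chart_map c q) r" by auto
    qed
    have "((\<lambda>\<tau>. G (x \<tau>) \<tau> c) has_integral (chart_map c (x b) - chart_map c (x a))) {a..b}"
      by (rule sol_integral[OF x(1) c(1)]) (use ab xW in auto)
    then have int: "((\<lambda>\<tau>. if \<tau> \<in> N then 0 else G (x \<tau>) \<tau> c) has_integral (chart_map c (x b) - chart_map c (x a))) {a..b}"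
      by (rule has_integral_spike[OF N(1), rotated]) auto
    have "norm (integral {a..b} (\<lambda>\<tau>. if \<tau> \<in> N then 0 else G (x \<tau>) \<tau> c)) \<le> integral {a..b} (\<lambda>t. C t * (1 / m))"
    proof (rule integral_norm_bound_integral)
      show "(\<lambda>\<tau>. if \<tau> \<in> N then 0 else G (x \<tau>) \<tau> c) integrable_on {a..b}" using int by blast
      show "(\<lambda>t. C t * (1 / m)) integrable_on {a..b}" by (rule integrable_on_mult_left[OF C(1)])
      fix t assume t: "t \<in> {a..b}"
      show "norm (if t \<in> N then 0 else G (x t) t c) \<le> C t * (1 / m)"
      proof (cases "t \<in> N")
        case True
        then show ?thesis using C(2) t m(1) by simp
      next
        case False
        have "m * norm (G (x t) t c) \<le> chart_norm c (chart_map c (x t)) (G (x t) t c)" by (rule m(3)[OF xW(2)[OF t]])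
        also have "\<dots> = hnorm h (x t) (G (x t) t)"
          by (rule hnorm_G_in_chart[symmetric]) (use t ab c xW in auto)
        also have "\<dots> \<le> C t" using N(2) t False by blast
        finally show ?thesis using False m(1) by (simp add: field_simps)
      qed
    qed
    then have n: "norm (chart_map c (x b) - chart_map c (x a)) \<le> integral {a..b} C * (1 / m)"
      using integral_unique[OF int] by simp
    have "metric_dist A h (chart_inv c (chart_map c (x a))) (chart_inv c (chart_map c (x b))) \<le> M * norm (chart_map c (x b) - chart_map c (x a))"
      by (rule metric_dist_segment[OF c(1) _ _ r(2) m(4)]) (use xW ab m in auto)
    then have "metric_dist A h (x a) (x b) \<le> M * norm (chart_map c (x b) - chart_map c (x a))"
      using xW(1)[of a] xW(1)[of b] ab by (simp add: chart_inv_map[OF c(1)])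
    also have "\<dots> \<le> M * (integral {a..b} C * (1 / m))" using n m(2) by (intro mult_left_mono) auto
    finally show "metric_dist A h (x a) (x b) \<le> M / m * integral {a..b} C" by (simp add: mult_ac)
  qed
qed

text \<open>Finitely many neighbourhoods from \<open>sol_metric_dist_local\<close> cover
  \<open>L\<close>, and the sum of their constants bounds each of them. The resulting constant
  depends on \<open>L\<close> but on neither the curve nor its time interval.\<close>

lemma sol_metric_dist:
  assumes L: "compact L"
  obtains \<rho> where "\<rho> \<ge> (0 :: real)"
    "\<And>a b x C N. 0 \<le> a \<Longrightarrow> a \<le> b \<Longrightarrow> sol a b x \<Longrightarrow> x ` {a..b} \<subseteq> L \<Longrightarrow> C integrable_on {a..b} \<Longrightarrow>
      (\<forall>t\<in>{a..b}. 0 \<le> C t) \<Longrightarrow> negligible N \<Longrightarrow> (\<forall>t\<in>{a..b} - N. hnorm h (x t) (G (x t) t) \<le> C t) \<Longrightarrow>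
      metric_dist A h (x a) (x b) \<le> \<rho> * integral {a..b} C"
proof -
  define good where "good W \<rho> \<longleftrightarrow> (\<forall>a b x C N. 0 \<le> a \<longrightarrow> a \<le> b \<longrightarrow> sol a b x \<longrightarrow> x ` {a..b} \<subseteq> W \<longrightarrow> C integrable_on {a..b} \<longrightarrow>
      (\<forall>t\<in>{a..b}. 0 \<le> C t) \<longrightarrow> negligible N \<longrightarrow> (\<forall>t\<in>{a..b} - N. hnorm h (x t) (G (x t) t) \<le> C t) \<longrightarrow>
      metric_dist A h (x a) (x b) \<le> \<rho> * integral {a..b} C)" for W and \<rho> :: real
  have "\<exists>W \<rho>. open W \<and> q \<in> W \<and> \<rho> \<ge> 0 \<and> good W \<rho>" for q
    by (rule sol_metric_dist_local[of q]) (unfold good_def, blast)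
  then obtain W \<rho> where W: "\<And>q. open (W q)" "\<And>q. q \<in> W q" "\<And>q. \<rho> q \<ge> 0" "\<And>q. good (W q) (\<rho> q)" by metis
  obtain F where F: "finite F" "L \<subseteq> (\<Union>q\<in>F. W q)"
    using compactE_image[OF L, of UNIV W] W(1,2) by (metis UNIV_I UN_I subsetI)
  define R where "R = (\<Sum>q\<in>F. \<rho> q)"
  have R: "\<rho> q \<le> R" if "q \<in> F" for q unfolding R_def by (rule member_le_sum[OF that]) (use W(3) F in auto)
  have R0: "0 \<le> R" unfolding R_def by (rule sum_nonneg) (rule W(3))
  show thesis
  proof (rule that[OF R0])
    fix a b x and C :: "real \<Rightarrow> real" and N
    assume ab: "0 \<le> a" "a \<le> b" and x: "sol a b x" "x ` {a..b} \<subseteq> L"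
      and C: "C integrable_on {a..b}" "\<forall>t\<in>{a..b}. 0 \<le> C t"
      and N: "negligible N" "\<forall>t\<in>{a..b} - N. hnorm h (x t) (G (x t) t) \<le> C t"
    have Ci: "C integrable_on {s..t}" if "a \<le> s" "t \<le> b" for s t
      using integrable_on_subinterval[OF C(1), of s t] that by auto
    show "metric_dist A h (x a) (x b) \<le> R * integral {a..b} C"
    proof (rule interval_local_to_global[OF ab(2), where P = "\<lambda>s t. metric_dist A h (x s) (x t) \<le> R * integral {s..t} C"])
      fix r s t assume *: "a \<le> r" "r \<le> s" "s \<le> t" "t \<le> b" "metric_dist A h (x r) (x s) \<le> R * integral {r..s} C"
        "metric_dist A h (x s) (x t) \<le> R * integral {s..t} C"
      have "integral {r..t} C = integral {r..s} C + integral {s..t} C"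
        using * by (intro Henstock_Kurzweil_Integration.integral_combine[symmetric] Ci) auto
      then show "metric_dist A h (x r) (x t) \<le> R * integral {r..t} C"
        using *(5,6) metric_dist_triangle[of "x r" "x t" "x s"] by (simp add: distrib_left)
    next
      fix \<tau> assume "a \<le> \<tau>" "\<tau> \<le> b"
      then have \<tau>: "\<tau> \<in> {a..b}" by simp
      then have "x \<tau> \<in> L" using x(2) by blast
      then obtain q where q: "q \<in> F" "x \<tau> \<in> W q" using F(2) by blast
      obtain \<delta> where \<delta>: "\<delta> > 0" "\<And>t. t \<in> {a..b} \<Longrightarrow> \<bar>t - \<tau>\<bar> < \<delta> \<Longrightarrow> x t \<in> W q"
        by (rule continuous_path_nbhd[OF sol_continuous[OF x(1)] \<tau> W(1) q(2)]) (rule that, auto)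
      show "\<exists>\<delta>>0. \<forall>s t. a \<le> s \<longrightarrow> s \<le> \<tau> \<longrightarrow> \<tau> \<le> t \<longrightarrow> t \<le> b \<longrightarrow> t - s < \<delta> \<longrightarrow>
          metric_dist A h (x s) (x t) \<le> R * integral {s..t} C"
      proof (intro exI[of _ \<delta>] conjI allI impI \<delta>(1))
        fix s t assume st: "a \<le> s" "s \<le> \<tau>" "\<tau> \<le> t" "t \<le> b" "t - s < \<delta>"
        have sub: "x ` {s..t} \<subseteq> W q" using \<delta>(2) st by (auto simp: image_subset_iff)
        have "metric_dist A h (x s) (x t) \<le> \<rho> q * integral {s..t} C"
        proof (rule W(4)[of q, unfolded good_def, rule_format, OF _ _ _ sub _ _ N(1)])
          show "0 \<le> s" "s \<le> t" using st ab by auto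
          show "sol s t x" by (rule sol_subinterval[OF x(1)]) (use st in auto)
          show "C integrable_on {s..t}" using Ci st by auto
          show "0 \<le> C t'" if "t' \<in> {s..t}" for t' using C(2) that st by auto
          show "hnorm h (x t') (G (x t') t') \<le> C t'" if "t' \<in> {s..t} - N" for t' using N(2) that st by auto
        qed
        also have "\<dots> \<le> R * integral {s..t} C"
          using R[OF q(1)] Ci[of s t] C(2) st by (intro mult_right_mono integral_nonneg) auto
        finally show "metric_dist A h (x s) (x t) \<le> R * integral {s..t} C" .
      qed
    qed
  qed
qed

lemma Lp_set_integral:
  assumes C: "C \<in> Lp_nonneg d T" and st: "0 \<le> s" "t \<le> T"
  shows "(LINT \<xi>:{s..t}|lebesgue. C \<xi>) = integral {s..t} C"
proof (rule set_lebesgue_integral_eq_integral(2))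
  have "C integrable_on {s..t}" using integrable_on_subinterval[OF Lp_nonneg_integrable(1)[OF C d], of s t] st by auto
  then show "C absolutely_integrable_on {s..t}"
    by (rule nonnegative_absolutely_integrable_1) (use C st in \<open>auto simp: Lp_nonneg_def\<close>)
qed

text \<open>The field has to be bounded on the compact set swept out by all trajectories from
  \<open>K\<close> up to time \<open>T\<close>, not on \<open>K\<close> itself. This bound,
  multiplied by the constant of \<open>sol_metric_dist\<close>, serves for all \<open>s\<close>,
  \<open>t'\<close> and \<open>t\<close> at once.\<close>

lemma flow_evolution_family: "evolution_family A h d flow"
  unfolding evolution_family_def
proof (intro conjI allI impI)
  show "flow s s = id" if "0 \<le> s" for s using flow_refl[OF that] by auto
  show "flow s t = flow u t \<circ> flow s u" if "0 \<le> s \<and> s \<le> u \<and> u \<le> t" for s u t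
    using flow_semigroup[of s u t] that by auto
  show "holomorphic_self_map A (flow s t)" if "0 \<le> s \<and> s \<le> t" for s t
    by (rule holomorphic_self_mapI) (use flow_cdiff that in auto)
  fix T :: real and K :: "'m set" assume TK: "0 < T \<and> compact K"
  obtain L where L: "compact L" "\<And>s t z. 0 \<le> s \<Longrightarrow> s \<le> t \<Longrightarrow> t \<le> T \<Longrightarrow> z \<in> K \<Longrightarrow> flow s t z \<in> L"
    by (rule flow_image_compact[of K T]) (use TK in auto)
  obtain C N where C: "C \<in> Lp_nonneg d T" "negligible N"
    "\<And>t z. t \<in> {0..T} - N \<Longrightarrow> z \<in> L \<Longrightarrow> hnorm h z (G z t) \<le> C t"
    using field_bound[OF L(1)] TK by metis
  obtain \<rho> where \<rho>: "\<rho> \<ge> 0" "\<And>a b x C N. 0 \<le> a \<Longrightarrow> a \<le> b \<Longrightarrow> sol a b x \<Longrightarrow> x ` {a..b} \<subseteq> L \<Longrightarrow> C integrable_on {a..b} \<Longrightarrow>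
      (\<forall>t\<in>{a..b}. 0 \<le> C t) \<Longrightarrow> negligible N \<Longrightarrow> (\<forall>t\<in>{a..b} - N. hnorm h (x t) (G (x t) t) \<le> C t) \<Longrightarrow>
      metric_dist A h (x a) (x b) \<le> \<rho> * integral {a..b} C"
    by (rule sol_metric_dist[OF L(1)]) blast
  show "\<exists>C\<in>Lp_nonneg d T. \<forall>s t' t. 0 \<le> s \<and> s \<le> t' \<and> t' \<le> t \<and> t \<le> T \<longrightarrow>
     (SUP z\<in>K. ereal (metric_dist A h (flow s t z) (flow s t' z))) \<le> ereal (LINT \<xi>:{t'..t}|lebesgue. C \<xi>)"
  proof (intro bexI[of _ "\<lambda>t. \<rho> * C t"] allI impI SUP_least)
    show C': "(\<lambda>t. \<rho> * C t) \<in> Lp_nonneg d T" by (rule Lp_nonneg_cmult[OF C(1) \<rho>(1)])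
    fix s t' t z assume st: "0 \<le> s \<and> s \<le> t' \<and> t' \<le> t \<and> t \<le> T" and z: "z \<in> K"
    have Ci: "C integrable_on {t'..t}"
      using integrable_on_subinterval[OF Lp_nonneg_integrable(1)[OF C(1) d], of t' t] st by auto
    have "metric_dist A h (flow s t z) (flow s t' z) = metric_dist A h (flow s t' z) (flow s t z)"
      by (rule metric_dist_commute)
    also have "\<dots> \<le> \<rho> * integral {t'..t} C"
    proof (rule \<rho>(2)[of t' t "\<lambda>\<tau>. flow s \<tau> z" C N])
      show "sol t' t (\<lambda>\<tau>. flow s \<tau> z)" by (rule sol_subinterval[OF flow_sol[of s t]]) (use st in auto)
      show "(\<lambda>\<tau>. flow s \<tau> z) ` {t'..t} \<subseteq> L" using L(2) st z by auto
      show "\<forall>\<tau>\<in>{t'..t} - N. hnorm h (flow s \<tau> z) (G (flow s \<tau> z) \<tau>) \<le> C \<tau>"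
      proof
        fix \<tau> assume "\<tau> \<in> {t'..t} - N"
        then show "hnorm h (flow s \<tau> z) (G (flow s \<tau> z) \<tau>) \<le> C \<tau>"
          using C(3)[of \<tau> "flow s \<tau> z"] L(2)[of s \<tau> z] st z by auto
      qed
      show "\<forall>\<tau>\<in>{t'..t}. 0 \<le> C \<tau>" using C(1) st by (auto simp: Lp_nonneg_def)
    qed (use st Ci C(2) in auto)
    also have "\<dots> = integral {t'..t} (\<lambda>t. \<rho> * C t)" by simp
    also have "\<dots> = (LINT \<xi>:{t'..t}|lebesgue. \<rho> * C \<xi>)"
      by (rule Lp_set_integral[OF C', symmetric]) (use st in auto)
    finally show "ereal (metric_dist A h (flow s t z) (flow s t' z)) \<le> ereal (LINT \<xi>:{t'..t}|lebesgue. \<rho> * C \<xi>)" by simp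
  qed
qed

section \<open>Almost everywhere solutions are integral solutions\<close>

text \<open>Leaving the coordinate ball of radius \<open>r\<close> costs Hermitian distance at least
  \<open>m * r\<close>, and over short intervals the integral of \<open>C\<close> is smaller than
  that.\<close>

lemma metric_dist_AC_continuous:
  fixes C :: "real \<Rightarrow> real"
  assumes C: "C integrable_on {a..b}"
    and y: "\<And>s t. a \<le> s \<Longrightarrow> s \<le> t \<Longrightarrow> t \<le> b \<Longrightarrow> metric_dist A h (y s) (y t) \<le> integral {s..t} C"
  shows "continuous_on {a..b} y"
  unfolding continuous_on_def
proof
  fix \<tau> assume \<tau>: "\<tau> \<in> {a..b}"
  show "(y \<longlongrightarrow> y \<tau>) (at \<tau> within {a..b})"
  proof (rule topological_tendstoI)
    fix W assume W: "open W" "y \<tau> \<in> W"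
    obtain c where c: "c \<in> A" "y \<tau> \<in> chart_dom c" using chart_exists by blast
    obtain r where r: "r > 0" "cball (chart_map c (y \<tau>)) r \<subseteq> chart_img c" "chart_inv c ` cball (chart_map c (y \<tau>)) r \<subseteq> W"
      using chart_cball[OF c W] by blast
    obtain m M where m: "m > 0" "M > 0" "\<And>x v. x \<in> cball (chart_map c (y \<tau>)) r \<Longrightarrow> m * norm v \<le> chart_norm c x v"
      "\<And>x v. x \<in> cball (chart_map c (y \<tau>)) r \<Longrightarrow> chart_norm c x v \<le> M * norm v"
      using chart_norm_bounds[OF c(1) compact_cball r(2)] by metis
    let ?I = "\<lambda>t. integral {a..t} C"
    have "(?I \<longlongrightarrow> ?I \<tau>) (at \<tau> within {a..b})"
      using indefinite_integral_continuous_1[OF C] \<tau> unfolding continuous_on_def by blast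
    moreover have "m * r > 0" using m(1) r(1) by simp
    ultimately have "\<forall>\<^sub>F t in at \<tau> within {a..b}. dist (?I t) (?I \<tau>) < m * r" by (rule tendstoD)
    moreover have "\<forall>\<^sub>F t in at \<tau> within {a..b}. t \<in> {a..b}" by (simp add: eventually_at_topological) blast
    ultimately show "\<forall>\<^sub>F t in at \<tau> within {a..b}. y t \<in> W"
    proof eventually_elim
      case (elim t)
      have comb: "?I t' = ?I s + integral {s..t'} C" if "a \<le> s" "s \<le> t'" "t' \<le> b" for s t'
        using that integrable_on_subinterval[OF C, of a t']
        by (intro Henstock_Kurzweil_Integration.integral_combine[symmetric]) auto
      have "metric_dist A h (y \<tau>) (y t) < m * r"
      proof (cases "t \<le> \<tau>")
        case True
        have "metric_dist A h (y \<tau>) (y t) = metric_dist A h (y t) (y \<tau>)" by (rule metric_dist_commute)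
        also have "\<dots> \<le> ?I \<tau> - ?I t" using y[of t \<tau>] comb[of t \<tau>] True elim(2) \<tau> by simp
        finally show ?thesis using elim(1) unfolding dist_real_def by linarith
      next
        case False
        have "metric_dist A h (y \<tau>) (y t) \<le> ?I t - ?I \<tau>" using y[of \<tau> t] comb[of \<tau> t] False elim(2) \<tau> by simp
        then show ?thesis using elim(1) unfolding dist_real_def by linarith
      qed
      then have "y t \<in> chart_inv c ` ball (chart_map c (y \<tau>)) r"
        using metric_dist_lower_bound[OF c r(1,2) less_imp_le[OF m(1)] m(3), of "y t"] by fastforce
      then show ?case using r(3) ball_subset_cball by blast
    qed
  qed
qed

text \<open>In a chart, the difference between the curve and a primitive of the field along it has
  derivative 0 almost everywhere. The metric bound, turned into a bound in coordinates, controls its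
  increments by integrals of an integrable function; this excludes a singular part, so the
  difference is constant.\<close>

lemma sol_from_ae_velocity:
  assumes a: "0 \<le> a" and C: "C integrable_on {a..b}" "\<And>t. t \<in> {a..b} \<Longrightarrow> 0 \<le> C t"
    and y: "\<And>s t. a \<le> s \<Longrightarrow> s \<le> t \<Longrightarrow> t \<le> b \<Longrightarrow> metric_dist A h (y s) (y t) \<le> integral {s..t} C"
    and N: "negligible N" "\<And>t. t \<in> {a<..<b} - N \<Longrightarrow> has_velocity A y (G (y t) t) t UNIV"
  shows "sol a b y"
  unfolding sol_def
proof (intro conjI ballI allI impI)
  show yc: "continuous_on {a..b} y" by (rule metric_dist_AC_continuous[OF C(1) y])
  fix c s t assume c: "c \<in> A" and st: "a \<le> s" "s \<le> t" "t \<le> b" and dom: "y ` {s..t} \<subseteq> chart_dom c"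
  let ?g = "\<lambda>\<tau>. G (y \<tau>) \<tau> c"
  have dom': "y \<tau> \<in> chart_dom c" if "\<tau> \<in> {s..t}" for \<tau> using dom that by blast
  have yst: "continuous_on {s..t} y" by (rule continuous_on_subset[OF yc]) (use st in auto)
  have gai: "?g absolutely_integrable_on {s..t}"
    by (rule field_along_path_integrable[OF c yst dom]) (use a st in auto)
  have gi: "?g integrable_on {s'..t'}" and ngi: "(\<lambda>\<tau>. norm (?g \<tau>)) integrable_on {s'..t'}"
    if "s \<le> s'" "t' \<le> t" for s' t'
    using gai integrable_on_subinterval[of ?g "{s..t}" s' t'] integrable_on_subinterval[of "\<lambda>\<tau>. norm (?g \<tau>)" "{s..t}" s' t'] that
    by (auto simp: absolutely_integrable_on_def)
  have "chart_map c (y t) - chart_map c (y s) = integral {s..t} ?g"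
  proof (rule interval_local_to_global[OF st(2), where P = "\<lambda>s t. chart_map c (y t) - chart_map c (y s) = integral {s..t} ?g"])
    fix u v w assume *: "s \<le> u" "u \<le> v" "v \<le> w" "w \<le> t" "chart_map c (y v) - chart_map c (y u) = integral {u..v} ?g"
      "chart_map c (y w) - chart_map c (y v) = integral {v..w} ?g"
    have "integral {u..w} ?g = integral {u..v} ?g + integral {v..w} ?g"
      using * by (intro Henstock_Kurzweil_Integration.integral_combine[symmetric] gi) auto
    then show "chart_map c (y w) - chart_map c (y u) = integral {u..w} ?g" using *(5,6) by (simp add: algebra_simps)
  next
    fix \<tau> assume "s \<le> \<tau>" "\<tau> \<le> t"
    then have \<tau>: "\<tau> \<in> {s..t}" by simp
    let ?p = "chart_map c (y \<tau>)"
    obtain r where r: "r > 0" "cball ?p r \<subseteq> chart_img c" using chart_cball[OF c dom'[OF \<tau>] open_UNIV] by auto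
    obtain m M where m: "m > 0" "M > 0" "\<And>x v. x \<in> cball ?p r \<Longrightarrow> m * norm v \<le> chart_norm c x v"
      "\<And>x v. x \<in> cball ?p r \<Longrightarrow> chart_norm c x v \<le> M * norm v"
      using chart_norm_bounds[OF c compact_cball r(2)] by metis
    \<comment> \<open>Two points of the ball of radius \<open>r/4\<close> are at distance at most
      \<open>r/2\<close>, and the ball of that radius around the first one lies in the ball of
      radius \<open>r\<close>, where \<open>m\<close> is valid.\<close>
    have W: "open (chart_dom c \<inter> chart_map c -` ball ?p (r/4))" "y \<tau> \<in> chart_dom c \<inter> chart_map c -` ball ?p (r/4)"
      using open_chart_preimage[OF c open_ball] dom'[OF \<tau>] r(1) by auto
    obtain \<delta> where \<delta>: "\<delta> > 0" "\<And>\<sigma>. \<sigma> \<in> {s..t} \<Longrightarrow> \<bar>\<sigma> - \<tau>\<bar> < \<delta> \<Longrightarrow> y \<sigma> \<in> chart_dom c \<inter> chart_map c -` ball ?p (r/4)"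
      by (rule continuous_path_nbhd[OF yst \<tau> W]) (rule that, auto)
    show "\<exists>\<delta>>0. \<forall>u v. s \<le> u \<longrightarrow> u \<le> \<tau> \<longrightarrow> \<tau> \<le> v \<longrightarrow> v \<le> t \<longrightarrow> v - u < \<delta> \<longrightarrow>
        chart_map c (y v) - chart_map c (y u) = integral {u..v} ?g"
    proof (intro exI[of _ \<delta>] conjI allI impI \<delta>(1))
      fix u v assume uv: "s \<le> u" "u \<le> \<tau>" "\<tau> \<le> v" "v \<le> t" "v - u < \<delta>"
      then have uv': "u \<le> v" by simp
      have near: "y \<sigma> \<in> chart_dom c" "chart_map c (y \<sigma>) \<in> ball ?p (r/4)" if "\<sigma> \<in> {u..v}" for \<sigma>
        using \<delta>(2)[of \<sigma>] that uv by auto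
      have Ci: "C integrable_on {u'..v'}" if "u \<le> u'" "v' \<le> v" for u' v'
        using integrable_on_subinterval[OF C(1), of u' v'] that uv st by auto
      have chart_AC: "norm (chart_map c (y v') - chart_map c (y u')) \<le> integral {u'..v'} C / m"
        if uv'': "u \<le> u'" "u' \<le> v'" "v' \<le> v" for u' v'
      proof -
        let ?q = "chart_map c (y u')" and ?q' = "chart_map c (y v')"
        \<comment> \<open>With the coordinate distance itself as radius, \<open>y v'\<close> lies
          just outside the open ball around \<open>y u'\<close>, so the lower bound for the
          Hermitian distance yields \<open>m * R\<close>.\<close>
        define R where "R = dist ?q ?q'"
        have q: "?q \<in> ball ?p (r/4)" "?q' \<in> ball ?p (r/4)" "y u' \<in> chart_dom c" "y v' \<in> chart_dom c"
          using near[of u'] near[of v'] uv'' by auto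
        have "R \<le> dist ?q ?p + dist ?q' ?p" unfolding R_def by (rule dist_triangle2)
        then have Rr: "R \<le> r / 2" using q by (simp add: dist_commute)
        have sub: "cball ?q R \<subseteq> cball ?p r"
        proof
          fix z assume "z \<in> cball ?q R"
          then show "z \<in> cball ?p r" using dist_triangle[of ?p z ?q] Rr q(1) r(1) by simp
        qed
        have "m * R \<le> integral {u'..v'} C"
        proof (cases "R = 0")
          case True
          then show ?thesis using integral_nonneg[OF Ci] C(2) uv'' uv st by auto
        next
          case False
          then have R0: "R > 0" by (simp add: R_def)
          have "m * R \<le> metric_dist A h (y u') (y v')"
          proof (rule metric_dist_lower_bound[OF c q(3) R0 order_trans[OF sub r(2)] less_imp_le[OF m(1)]])
            show "m * norm w \<le> chart_norm c x w" if "x \<in> cball ?q R" for x w using m(3) sub that by blast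
            show "y v' \<notin> chart_inv c ` ball ?q R"
            proof
              assume "y v' \<in> chart_inv c ` ball ?q R"
              then obtain z where z: "z \<in> ball ?q R" "y v' = chart_inv c z" by blast
              have "z \<in> chart_img c" using z(1) sub r(2) ball_subset_cball by blast
              then have "?q' = z" using z(2) chart_map_inv[OF c] by simp
              then show False using z(1) by (simp add: R_def)
            qed
          qed
          also have "\<dots> \<le> integral {u'..v'} C" using y uv'' uv st by auto
          finally show ?thesis .
        qed
        then show ?thesis using m(1) by (simp add: R_def dist_norm norm_minus_commute field_simps)
      qed
      define F where "F \<sigma> = integral {u..\<sigma>} ?g" for \<sigma>
      have F: "(?g has_integral (F v' - F u')) {u'..v'}" if uv'': "u \<le> u'" "u' \<le> v'" "v' \<le> v" for u' v'
      proof -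
        have "F v' = F u' + integral {u'..v'} ?g" unfolding F_def
          using uv'' uv by (intro Henstock_Kurzweil_Integration.integral_combine[symmetric] gi) auto
        then have "F v' - F u' = integral {u'..v'} ?g" by simp
        moreover have "?g integrable_on {u'..v'}" by (rule gi) (use uv'' uv in auto)
        ultimately show ?thesis using integrable_integral by metis
      qed
      define H where "H \<sigma> = chart_map c (y \<sigma>) - F \<sigma>" for \<sigma>
      obtain N' where N': "negligible N'"
        "\<And>t' F. t' \<in> {u<..<v} - N' \<Longrightarrow> (\<And>c' d. u \<le> c' \<Longrightarrow> c' \<le> d \<Longrightarrow> d \<le> v \<Longrightarrow> (?g has_integral (F d - F c')) {c'..d}) \<Longrightarrow>
          (F has_vector_derivative ?g t') (at t')"
        by (rule lebesgue_differentiation[OF gi[OF uv(1,4)]]) (rule that, auto)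
      have "H v = H u"
      proof (rule zero_derivative_ae_imp_constant[OF uv', where m = "\<lambda>\<sigma>. C \<sigma> * (1 / m) + norm (?g \<sigma>)" and N = "N \<union> N' \<union> {u, v}"])
        show mi: "(\<lambda>\<sigma>. C \<sigma> * (1 / m) + norm (?g \<sigma>)) integrable_on {u..v}"
          by (intro integrable_add integrable_on_mult_left Ci ngi) (use uv in auto)
        show "0 \<le> C \<sigma> * (1 / m) + norm (?g \<sigma>)" if "\<sigma> \<in> {u..v}" for \<sigma>
          using C(2)[of \<sigma>] that uv st m(1) by (intro add_nonneg_nonneg) auto
        show "norm (H v' - H u') \<le> integral {u'..v'} (\<lambda>\<sigma>. C \<sigma> * (1 / m) + norm (?g \<sigma>))"
          if uv'': "u \<le> u'" "u' \<le> v'" "v' \<le> v" for u' v'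
        proof -
          have i: "(\<lambda>\<sigma>. C \<sigma> * (1 / m)) integrable_on {u'..v'}" "(\<lambda>\<sigma>. norm (?g \<sigma>)) integrable_on {u'..v'}" "?g integrable_on {u'..v'}"
            by (intro integrable_on_mult_left Ci ngi gi; use uv'' uv in simp)+
          have "norm (H v' - H u') = norm ((chart_map c (y v') - chart_map c (y u')) - (F v' - F u'))"
            by (simp add: H_def algebra_simps)
          also have "\<dots> \<le> norm (chart_map c (y v') - chart_map c (y u')) + norm (F v' - F u')"
            by (rule norm_triangle_ineq4)
          also have "\<dots> \<le> integral {u'..v'} C / m + integral {u'..v'} (\<lambda>\<sigma>. norm (?g \<sigma>))"
          proof (rule add_mono[OF chart_AC[OF uv'']])
            show "norm (F v' - F u') \<le> integral {u'..v'} (\<lambda>\<sigma>. norm (?g \<sigma>))"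
              using integral_norm_bound_integral[OF i(3,2)] integral_unique[OF F[OF uv'']] by simp
          qed
          also have "\<dots> = integral {u'..v'} (\<lambda>\<sigma>. C \<sigma> * (1 / m) + norm (?g \<sigma>))"
            using integral_add[OF i(1,2)] by simp
          finally show ?thesis .
        qed
        show "negligible (N \<union> N' \<union> {u, v})" using N(1) N'(1) by (intro negligible_Un) auto
        show "(H has_vector_derivative 0) (at \<sigma> within {u..v})" if \<sigma>: "\<sigma> \<in> {u..v} - (N \<union> N' \<union> {u, v})" for \<sigma>
        proof -
          have \<sigma>': "\<sigma> \<in> {u<..<v} - N'" "\<sigma> \<in> {a<..<b} - N" using \<sigma> uv st by auto
          have "(F has_vector_derivative ?g \<sigma>) (at \<sigma>)" by (rule N'(2)[OF \<sigma>'(1)]) (rule F)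
          moreover have "((\<lambda>\<sigma>. chart_map c (y \<sigma>)) has_vector_derivative ?g \<sigma>) (at \<sigma>)"
            using N(2)[OF \<sigma>'(2)] c near(1)[of \<sigma>] \<sigma> unfolding has_velocity_def by auto
          ultimately have "(H has_vector_derivative (?g \<sigma> - ?g \<sigma>)) (at \<sigma>)"
            unfolding H_def by (intro has_vector_derivative_diff)
          then show ?thesis by (simp add: has_vector_derivative_at_within)
        qed
      qed
      then show "chart_map c (y v) - chart_map c (y u) = integral {u..v} ?g"
        by (simp add: H_def F_def algebra_simps)
    qed
  qed
  then show "(?g has_integral (chart_map c (y t) - chart_map c (y s))) {s..t}"
    using integrable_integral[OF gi[of s t]] by simp
qed

text \<open>Every competitor solves the integral equation and therefore equals \<open>flow\<close>
  by uniqueness of solutions. The distance bound is applied to the singleton \<open>{z}\<close> with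
  the initial time \<open>s\<close> kept fixed.\<close>

lemma evolution_family_unique:
  assumes \<psi>: "evolution_family A h d \<psi>" "solves_loewner_ODE A G \<psi>" and st: "0 \<le> s" "s \<le> t"
  shows "\<psi> s t = flow s t"
proof
  fix z
  \<comment> \<open>The final time in the definition must be positive, and \<open>t\<close> may be
    0.\<close>
  let ?y = "\<lambda>\<tau>. \<psi> s \<tau> z" and ?T = "t + 1"
  have T: "0 < ?T" using st by simp
  have "\<forall>T K. 0 < T \<and> compact K \<longrightarrow>
       (\<exists>C\<in>Lp_nonneg d T. \<forall>s t' t. 0 \<le> s \<and> s \<le> t' \<and> t' \<le> t \<and> t \<le> T \<longrightarrow>
          (SUP z\<in>K. ereal (metric_dist A h (\<psi> s t z) (\<psi> s t' z))) \<le> ereal (LINT \<xi>:{t'..t}|lebesgue. C \<xi>))"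
    using \<psi>(1) unfolding evolution_family_def by (elim conjE)
  from this[rule_format, of ?T "{z}"] T
  obtain C where C: "C \<in> Lp_nonneg d ?T"
    "\<And>s t' t. 0 \<le> s \<and> s \<le> t' \<and> t' \<le> t \<and> t \<le> ?T \<Longrightarrow>
       (SUP z\<in>{z}. ereal (metric_dist A h (\<psi> s t z) (\<psi> s t' z))) \<le> ereal (LINT \<xi>:{t'..t}|lebesgue. C \<xi>)"
    by auto
  define N where "N = {\<tau> \<in> {s..}. \<not> has_velocity A ?y (G (?y \<tau>) \<tau>) \<tau> {s..}}"
  have "AE \<tau> in lebesgue_on {s..}. has_velocity A ?y (G (?y \<tau>) \<tau>) \<tau> {s..}"
    using \<psi>(2) st(1) unfolding solves_loewner_ODE_def by blast
  then have N: "negligible N" unfolding N_def by (subst (asm) AE_lebesgue_on_iff_negligible) auto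
  have "sol s t ?y"
  proof (rule sol_from_ae_velocity[OF st(1) _ _ _ N])
    show "C integrable_on {s..t}"
      using integrable_on_subinterval[OF Lp_nonneg_integrable(1)[OF C(1) d], of s t] st by auto
    show "0 \<le> C \<tau>" if "\<tau> \<in> {s..t}" for \<tau> using C(1) that st by (auto simp: Lp_nonneg_def)
    show "metric_dist A h (?y u) (?y v) \<le> integral {u..v} C" if uv: "s \<le> u" "u \<le> v" "v \<le> t" for u v
    proof -
      have "metric_dist A h (?y v) (?y u) \<le> (LINT \<xi>:{u..v}|lebesgue. C \<xi>)" using C(2)[of s u v] uv st by simp
      also have "\<dots> = integral {u..v} C" by (rule Lp_set_integral[OF C(1)]) (use uv st in auto)
      finally show ?thesis by (simp add: metric_dist_commute)
    qed
    show "has_velocity A ?y (G (?y \<tau>) \<tau>) \<tau> UNIV" if "\<tau> \<in> {s<..<t} - N" for \<tau>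
      using that has_velocity_UNIV_iff[of s \<tau>] by (auto simp: N_def)
  qed
  then have "flow s t (?y s) = ?y t" by (rule flow_eq[OF st])
  moreover have "\<forall>s\<ge>0. \<psi> s s = id" using \<psi>(1) unfolding evolution_family_def by (rule conjunct1)
  then have "\<psi> s s = id" using st(1) by blast
  ultimately show "\<psi> s t z = flow s t z" by simp
qed

end

theorem proposition3p1:
  fixes A :: "('m::{t2_space, second_countable_topology}, 'n::finite) chart set"
    and h :: "'m \<Rightarrow> ('m, 'n) tvec \<Rightarrow> ('m, 'n) tvec \<Rightarrow> complex"
    and d :: ennreal
    and G :: "'m \<Rightarrow> real \<Rightarrow> ('m, 'n) tvec"
  assumes "complex_manifold A"
    and "hermitian_metric A h"
    and "complete_hyperbolic A"
    and "C1_off_Diag A (kobayashi A)"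
    and "1 \<le> d"
    and "herglotz_vector_field A h d G"
  shows "\<exists>\<phi>. evolution_family A h d \<phi> \<and> solves_loewner_ODE A G \<phi> \<and>
    (\<forall>\<psi>. evolution_family A h d \<psi> \<and> solves_loewner_ODE A G \<psi> \<longrightarrow>
       (\<forall>s t. 0 \<le> s \<and> s \<le> t \<longrightarrow> \<psi> s t = \<phi> s t))"
proof -
  interpret herglotz_mfd A h d G by unfold_locales (fact assms)+
  show ?thesis
    using flow_evolution_family flow_solves_ODE evolution_family_unique by (intro exI[of _ flow]) blast
qed

end
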